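(* Let $H\in(\tfrac14,\tfrac12)$ and let $u=\{u(t,x);t\ge 0,x\in\mathbb{R}\}$ be the solution of the hyperbolic Anderson model $\partial_t^2u=\partial_x^2u+u\,\dot W$ on $\mathbb{R}_+\times\mathbb{R}$, with $u(0,x)=1$ and $\partial_t u(0,x)=0$ for all $x\in\mathbb{R}$, where $\dot W$ is Gaussian noise that is white in time and fractional in space with Hurst index $H$. Then for any $t>0$, the process $\{u(t,x)\}_{x\in\mathbb{R}}$ is strictly stationary and ergodic.
   Context: Let $\mathcal{F}\varphi(\xi)=\int_{\mathbb{R}}e^{-i\xi x}\varphi(x)\,dx$ and $c_H=\frac{\Gamma(2H+1)\sin(\pi H)}{2\pi}$. The noise $W=\{W(\varphi)\}$ is a zero-mean Gaussian process on a complete probability space $(\Omega,\mathcal{F},\mathbb{P})$, indexed by infinitely differentiable compactly supported functions on $\mathbb{R}_+\times\mathbb{R}$, with covariance $$\mathbb{E}[W(\varphi)W(\psi)]=c_H\int_0^\infty\int_{\mathbb{R}}\mathcal{F}\varphi(t,\cdot)(\xi)\overline{\mathcal{F}\psi(t,\cdot)(\xi)}\,|\xi|^{1-2H}d\xi\,dt=:\langle\varphi,\psi\rangle_{\mathcal{H}}.$$ $\mathcal{H}$ is the Hilbert space completion of these test functions under $\langle\cdot,\cdot\rangle_{\mathcal{H}}$, and $W$ extends to an isonormal Gaussian process over $\mathcal{H}$; $I_n$ denotes the $n$-th multiple Wiener integral with respect to $W$ (with $I_n(f)=I_n(\widetilde f)$, $\widetilde f$ the symmetrization of $f$). Let $G_t(x)=\frac12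 1_{\{|x|<t\}}$. The (mild) solution $u$ is the unique predictable process with $u(t,x)=1+\int_0^t\int_{\mathbb{R}}G_{t-s}(x-y)u(s,y)\,W(ds,dy)$ (Itô integral, equivalently Skorohod integral); explicitly, $u(t,x)=1+\sum_{n\ge1}I_n(f_n(\cdot,t,x))$ with $$f_n(t_1,\dots,t_n,x_1,\dots,x_n,t,x)=G_{t-t_n}(x-x_n)\cdots G_{t_2-t_1}(x_2-x_1)\,1_{\{0<t_1<\dots<t_n<t\}}.$$ Stationarity and ergodicity are with respect to spatial shifts $x\mapsto x+h$, $h\in\mathbb{R}$. *)

theory Defs
  imports "HOL-Probability.Probability"
begin

section \<open>Test functions\<close>

text \<open>\<^term>\<open>C_diff k f\<close>: \<open>f\<close> is \<open>k\<close> times continuously differentiable.  Continuity of all directional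
  derivatives is the usual notion on the finite-dimensional domains \<open>\<real>\<close> and \<open>\<real>\<^sup>2\<close> used here.\<close>

primrec C_diff :: "nat \<Rightarrow> ('a::real_normed_vector \<Rightarrow> real) \<Rightarrow> bool" where
  "C_diff 0 f \<longleftrightarrow> continuous_on UNIV f"
| "C_diff (Suc k) f \<longleftrightarrow> (\<forall>x. f differentiable (at x)) \<and>
     (\<forall>v. C_diff k (\<lambda>x. frechet_derivative f (at x) v))"

definition smooth_compact :: "('a::real_normed_vector \<Rightarrow> real) \<Rightarrow> bool" where
  "smooth_compact f \<longleftrightarrow> (\<forall>k. C_diff k f) \<and> compact (closure {x. f x \<noteq> 0})"

text \<open>Smooth compactly supported functions on \<open>\<real>\<^sub>+ \<times> \<real>\<close>, with \<open>\<real>\<^sub>+ = [0,\<infinity>)\<close> and smoothness up to the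
  boundary, i.e. restrictions of functions in \<open>C\<^sub>c\<^sup>\<infinity>(\<real>\<^sup>2)\<close>.  Being functions on the half-plane, they are
  represented by their extension by \<open>0\<close> to negative times.\<close>

definition test_fun :: "(real \<times> real \<Rightarrow> real) \<Rightarrow> bool" where
  "test_fun \<phi> \<longleftrightarrow> (\<exists>\<psi>. smooth_compact \<psi> \<and> \<phi> = (\<lambda>(t, x). if 0 \<le> t then \<psi> (t, x) else 0))"


section \<open>The inner product of the noise\<close>

definition fourier :: "(real \<Rightarrow> real) \<Rightarrow> real \<Rightarrow> complex" where
  "fourier g \<xi> = (\<integral>x. exp (- (\<i> * complex_of_real \<xi> * complex_of_real x)) * complex_of_real (g x) \<partial>lborel)"

definition c_const :: "real \<Rightarrow> real" where
  "c_const H = Gamma (2 * H + 1) * sin (pi * H) / (2 * pi)"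

definition H_inner :: "real \<Rightarrow> (real \<times> real \<Rightarrow> real) \<Rightarrow> (real \<times> real \<Rightarrow> real) \<Rightarrow> complex" where
  "H_inner H \<phi> \<psi> = complex_of_real (c_const H) *
     (\<integral>t\<in>{0..}. (\<integral>\<xi>. fourier (\<lambda>x. \<phi> (t, x)) \<xi> * cnj (fourier (\<lambda>x. \<psi> (t, x)) \<xi>)
                     * complex_of_real (\<bar>\<xi>\<bar> powr (1 - 2 * H)) \<partial>lborel) \<partial>lborel)"

text \<open>The squared norm, as a possibly infinite number.  It is meant for functions all of whose time
  slices \<open>f (t, \<cdot>)\<close> are Lebesgue integrable, so that the Fourier integral converges.\<close>

definition H_norm2 :: "real \<Rightarrow> (real \<times> real \<Rightarrow> real) \<Rightarrow> ennreal" where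
  "H_norm2 H f = ennreal (c_const H) *
     (\<integral>\<^sup>+t\<in>{0..}. (\<integral>\<^sup>+\<xi>. ennreal ((cmod (fourier (\<lambda>x. f (t, x)) \<xi>))\<^sup>2 * \<bar>\<xi>\<bar> powr (1 - 2 * H)) \<partial>lborel) \<partial>lborel)"


section \<open>The Gaussian noise\<close>

text \<open>Degenerate (constant) Gaussian variables are allowed.\<close>

definition gaussian_rv :: "'w measure \<Rightarrow> ('w \<Rightarrow> real) \<Rightarrow> bool" where
  "gaussian_rv M X \<longleftrightarrow> X \<in> borel_measurable M \<and>
     ((\<exists>\<mu>. AE \<omega> in M. X \<omega> = \<mu>) \<or>
      (\<exists>\<mu> \<sigma>. 0 < \<sigma> \<and> distributed M lborel X (\<lambda>x. ennreal (normal_density \<mu> \<sigma> x))))"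

definition gaussian_process :: "'w measure \<Rightarrow> 'i set \<Rightarrow> ('i \<Rightarrow> 'w \<Rightarrow> real) \<Rightarrow> bool" where
  "gaussian_process M T X \<longleftrightarrow>
     (\<forall>J c. finite J \<and> J \<subseteq> T \<longrightarrow> gaussian_rv M (\<lambda>\<omega>. \<Sum>i\<in>J. c i * X i \<omega>))"

definition fractional_noise ::
  "'w measure \<Rightarrow> real \<Rightarrow> ((real \<times> real \<Rightarrow> real) \<Rightarrow> 'w \<Rightarrow> real) \<Rightarrow> bool" where
  "fractional_noise M H W \<longleftrightarrow>
     prob_space M \<and> complete_measure M \<and>
     gaussian_process M {\<phi>. test_fun \<phi>} W \<and>
     (\<forall>\<phi>. test_fun \<phi> \<longrightarrow> (\<integral>\<omega>. W \<phi> \<omega> \<partial>M) = 0) \<and>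
     (\<forall>\<phi> \<psi>. test_fun \<phi> \<longrightarrow> test_fun \<psi> \<longrightarrow>
        complex_of_real (\<integral>\<omega>. W \<phi> \<omega> * W \<psi> \<omega> \<partial>M) = H_inner H \<phi> \<psi>)"

definition L2_tendsto :: "'w measure \<Rightarrow> (nat \<Rightarrow> 'w \<Rightarrow> real) \<Rightarrow> ('w \<Rightarrow> real) \<Rightarrow> bool" where
  "L2_tendsto M Z Z' \<longleftrightarrow>
     (\<forall>n. Z n \<in> borel_measurable M) \<and> Z' \<in> borel_measurable M \<and>
     (\<lambda>n. \<integral>\<^sup>+\<omega>. ennreal ((Z n \<omega> - Z' \<omega>)\<^sup>2) \<partial>M) \<longlonglongrightarrow> 0"

text \<open>The isonormal extension of the noise: \<open>Z\<close> is (a version of) \<open>W(f)\<close>, where the function \<open>f\<close> belongs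
  to the completion of the test functions, being the limit of some sequence of them.  The limit \<open>Z\<close>
  is determined almost surely, by the isometry property of \<open>W\<close>.\<close>

definition wiener_integral ::
  "'w measure \<Rightarrow> real \<Rightarrow> ((real \<times> real \<Rightarrow> real) \<Rightarrow> 'w \<Rightarrow> real) \<Rightarrow> (real \<times> real \<Rightarrow> real) \<Rightarrow> ('w \<Rightarrow> real) \<Rightarrow> bool" where
  "wiener_integral M H W f Z \<longleftrightarrow>
     (\<exists>\<phi>. (\<forall>n. test_fun (\<phi> n)) \<and>
          (\<lambda>n. H_norm2 H (\<lambda>z. \<phi> n z - f z)) \<longlonglongrightarrow> 0 \<and>
          L2_tendsto M (\<lambda>n. W (\<phi> n)) Z)"


section \<open>Predictability and the stochastic integral\<close>

text \<open>The filtration of the noise, augmented by the null sets: \<open>\<F>\<^sub>t\<close> is generated by the noise on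
  \<open>[0,t] \<times> \<real>\<close>.\<close>

definition noise_filtration ::
  "'w measure \<Rightarrow> ((real \<times> real \<Rightarrow> real) \<Rightarrow> 'w \<Rightarrow> real) \<Rightarrow> real \<Rightarrow> 'w measure" where
  "noise_filtration M W t = sigma (space M)
     ({W \<phi> -` B \<inter> space M | \<phi> B. test_fun \<phi> \<and> (\<forall>s x. t < s \<longrightarrow> \<phi> (s, x) = 0) \<and> B \<in> sets borel}
      \<union> null_sets M)"

definition predictable_sigma ::
  "'w measure \<Rightarrow> ((real \<times> real \<Rightarrow> real) \<Rightarrow> 'w \<Rightarrow> real) \<Rightarrow> (real \<times> 'w) measure" where
  "predictable_sigma M W = sigma ({0..} \<times> space M)
     ({{0} \<times> A | A. A \<in> sets (noise_filtration M W 0)}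
      \<union> {{a<..b} \<times> A | a b A. 0 \<le> a \<and> a \<le> b \<and> A \<in> sets (noise_filtration M W a)})"

definition predictable ::
  "'w measure \<Rightarrow> ((real \<times> real \<Rightarrow> real) \<Rightarrow> 'w \<Rightarrow> real) \<Rightarrow> (real \<Rightarrow> real \<Rightarrow> 'w \<Rightarrow> real) \<Rightarrow> bool" where
  "predictable M W X \<longleftrightarrow>
     (\<lambda>((s, \<omega>), y). X s y \<omega>) \<in> borel_measurable (predictable_sigma M W \<Otimes>\<^sub>M (borel :: real measure))"

text \<open>\<open>S\<close> is a simple process \<open>\<Sum>\<^sub>j Y\<^sub>j(\<omega>) 1\<^bsub>(a\<^sub>j,b\<^sub>j]\<^esub>(s) \<phi>\<^sub>j(y)\<close>, with bounded \<open>\<F>\<^bsub>a\<^sub>j\<^esub>\<close>-measurable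
  \<open>Y\<^sub>j\<close> and \<open>\<phi>\<^sub>j \<in> C\<^sub>c\<^sup>\<infinity>(\<real>)\<close>, and \<open>Z\<close> is its stochastic integral \<open>\<Sum>\<^sub>j Y\<^sub>j W(1\<^bsub>(a\<^sub>j,b\<^sub>j]\<^esub> \<phi>\<^sub>j)\<close>.\<close>

definition simple_integral ::
  "'w measure \<Rightarrow> real \<Rightarrow> ((real \<times> real \<Rightarrow> real) \<Rightarrow> 'w \<Rightarrow> real) \<Rightarrow> (real \<Rightarrow> real \<Rightarrow> 'w \<Rightarrow> real) \<Rightarrow> ('w \<Rightarrow> real) \<Rightarrow> bool" where
  "simple_integral M H W S Z \<longleftrightarrow>
     (\<exists>(m::nat) (a::nat \<Rightarrow> real) (b::nat \<Rightarrow> real) (\<phi>::nat \<Rightarrow> real \<Rightarrow> real) (Y::nat \<Rightarrow> 'w \<Rightarrow> real) (\<zeta>::nat \<Rightarrow> 'w \<Rightarrow> real).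
        (\<forall>j<m. 0 \<le> a j \<and> a j \<le> b j \<and> smooth_compact (\<phi> j) \<and>
               Y j \<in> borel_measurable (noise_filtration M W (a j)) \<and>
               (\<exists>C. \<forall>\<omega>\<in>space M. \<bar>Y j \<omega>\<bar> \<le> C) \<and>
               wiener_integral M H W (\<lambda>(s, y). indicator {a j<..b j} s * \<phi> j y) (\<zeta> j)) \<and>
        S = (\<lambda>s y \<omega>. \<Sum>j<m. Y j \<omega> * indicator {a j<..b j} s * \<phi> j y) \<and>
        Z = (\<lambda>\<omega>. \<Sum>j<m. Y j \<omega> * \<zeta> j \<omega>))"

text \<open>\<open>Z\<close> is (a version of) the Ito integral \<open>\<integral>\<^sub>0\<^sup>\<infinity> \<integral>\<^sub>\<real> X(s,y) W(ds,dy)\<close>: the extension of the integral of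
  simple processes by the Ito isometry, with norm \<open>E \<parallel>X\<parallel>\<^sup>2\<close>.  The slice integrability makes the pathwise
  Fourier transforms in this norm genuine ones.\<close>

definition ito_integral ::
  "'w measure \<Rightarrow> real \<Rightarrow> ((real \<times> real \<Rightarrow> real) \<Rightarrow> 'w \<Rightarrow> real) \<Rightarrow> (real \<Rightarrow> real \<Rightarrow> 'w \<Rightarrow> real) \<Rightarrow> ('w \<Rightarrow> real) \<Rightarrow> bool" where
  "ito_integral M H W X Z \<longleftrightarrow>
     predictable M W X \<and>
     (AE \<omega> in M. AE s in lborel. 0 \<le> s \<longrightarrow> integrable lborel (\<lambda>y. X s y \<omega>)) \<and>
     (\<exists>S I. (\<forall>n. simple_integral M H W (S n) (I n)) \<and>
            (\<lambda>n. \<integral>\<^sup>+\<omega>. H_norm2 H (\<lambda>(s, y). S n s y \<omega> - X s y \<omega>) \<partial>M) \<longlonglongrightarrow> 0 \<and>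
            L2_tendsto M I Z)"


section \<open>The hyperbolic Anderson model\<close>

definition wave_kernel :: "real \<Rightarrow> real \<Rightarrow> real" where
  "wave_kernel t x = (if \<bar>x\<bar> < t then 1 / 2 else 0)"

text \<open>The stochastic integral over \<open>[0,t]\<close> is the integral over \<open>\<real>\<^sub>+\<close> of the integrand cut off at \<open>t\<close>; the
  mild equation holds almost surely for each \<open>(t,x)\<close>.  It encodes the initial conditions
  \<open>u(0,x) = 1\<close>, \<open>\<partial>\<^sub>t u(0,x) = 0\<close>.\<close>

definition hyperbolic_anderson_solution ::
  "'w measure \<Rightarrow> real \<Rightarrow> ((real \<times> real \<Rightarrow> real) \<Rightarrow> 'w \<Rightarrow> real) \<Rightarrow> (real \<Rightarrow> real \<Rightarrow> 'w \<Rightarrow> real) \<Rightarrow> bool" where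
  "hyperbolic_anderson_solution M H W u \<longleftrightarrow>
     predictable M W u \<and>
     (\<forall>t\<ge>0. \<forall>x. \<exists>Z.
        ito_integral M H W (\<lambda>s y \<omega>. indicator {0..t} s * wave_kernel (t - s) (x - y) * u s y \<omega>) Z \<and>
        (AE \<omega> in M. u t x \<omega> = 1 + Z \<omega>))"


section \<open>Stationarity and ergodicity under shifts of the line\<close>

definition strictly_stationary :: "'w measure \<Rightarrow> (real \<Rightarrow> 'w \<Rightarrow> real) \<Rightarrow> bool" where
  "strictly_stationary M X \<longleftrightarrow>
     (\<forall>x. X x \<in> borel_measurable M) \<and>
     (\<forall>J h. finite J \<longrightarrow>
        distr M (Pi\<^sub>M J (\<lambda>_. borel)) (\<lambda>\<omega>. \<lambda>x\<in>J. X (x + h) \<omega>) =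
        distr M (Pi\<^sub>M J (\<lambda>_. borel)) (\<lambda>\<omega>. \<lambda>x\<in>J. X x \<omega>))"

definition path_law :: "'w measure \<Rightarrow> (real \<Rightarrow> 'w \<Rightarrow> real) \<Rightarrow> (real \<Rightarrow> real) measure" where
  "path_law M X = distr M (Pi\<^sub>M UNIV (\<lambda>_. borel)) (\<lambda>\<omega> x. X x \<omega>)"

text \<open>Invariance of an event is understood up to null sets, for each shift.  Exact invariance would make
  the notion void: a set in the product sigma-algebra depends on countably many coordinates only, so
  if it is exactly invariant under all shifts of \<open>\<real>\<close>, it is empty or the whole space.\<close>

definition ergodic_process :: "'w measure \<Rightarrow> (real \<Rightarrow> 'w \<Rightarrow> real) \<Rightarrow> bool" where
  "ergodic_process M X \<longleftrightarrow>
     (\<forall>A\<in>sets (Pi\<^sub>M UNIV (\<lambda>_. borel)).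
        (\<forall>h. AE w in path_law M X. (\<lambda>x. w (x + h)) \<in> A \<longleftrightarrow> w \<in> A) \<longrightarrow>
        measure (path_law M X) A = 0 \<or> measure (path_law M X) A = 1)"

end

theory Submission
  imports Defs
begin

text \<open>
  For a test function \<open>h\<close> put \<open>U\<^sub>h(t,x) = E[u(t,x) exp(i W(h))]\<close>.  Gaussian integration by parts turns the mild
  equation into the deterministic Volterra equation
  \<open>U\<^sub>h(t,x) = E[exp(i W(h))] + i \<integral>\<integral> G\<^bsub>t-s\<^esub>(x-y) k\<^sub>h(s,y) U\<^sub>h(s,y) dy ds\<close> with a bounded potential \<open>k\<^sub>h\<close>.  Its
  solution is unique and the equation commutes with spatial shifts, so \<open>U\<close> is invariant when \<open>h\<close> and \<open>x\<close> are
  shifted together.  No moment bound on \<open>u\<close> is assumed: the local integrability that Fubini and the iteration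
  need comes from the finiteness of the norm of the integrand, since on functions supported in an interval the
  weight \<open>|\<xi>|\<^bsup>1-2H\<^esup>\<close> dominates the \<open>L\<^sup>2\<close> norm (an increment of the function has twice its square norm).

  Trigonometric polynomials of the noise are dense in the square-integrable functionals, hence \<open>u(t,x+a)\<close> is
  the limit of the shifted polynomials whose originals approximate \<open>u(t,x)\<close>.  This passes to all events of the path, which
  gives stationarity.  Since the covariance of \<open>W(f)\<close> and a shifted \<open>W(h)\<close> vanishes at infinity
  (Riemann--Lebesgue), an invariant event has an indicator of variance \<open>0\<close>.
\<close>

section \<open>Test functions\<close>

text \<open>No transformation of the sample space realizes a spatial shift, and \<open>W\<close> is
  linear only up to null sets that depend on the arguments, so a random variable has no intrinsic
  shift. The shift acts on names of functionals instead, the lists \<open>trig\<close>, and the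
  relation \<open>approx T a F F'\<close> carries it to limits. The closure of this relation under
  \<open>L^2\<close> limits, bounded products, Lipschitz images and sigma-algebras does the work of
  a measure-preserving flow. The transform yields only the inner products of \<open>u t x\<close>
  with polynomials. For the shifted polynomials to converge to \<open>u t (x + a)\<close>, the
  second moment of \<open>u t x\<close> has to be independent of \<open>x\<close> as well; this
  follows because the distance from a polynomial to the solution is nonnegative at both points. The
  space \<open>T\<close> is a parameter because adaptedness enters through polynomials over test
  functions that vanish after a time \<open>a\<close>: their kernels vanish at all later times,
  where an integrand with a coefficient known at time \<open>a\<close> lives.\<close>

lemma C_diff_lincomb:
  "C_diff k f \<Longrightarrow> C_diff k g \<Longrightarrow> C_diff k (\<lambda>x. a * f x + b * g x)"
proof (induction k arbitrary: f g)
  case 0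
  then show ?case by (auto intro!: continuous_intros)
next
  case (Suc k)
  have D: "((\<lambda>x. a * f x + b * g x) has_derivative
      (\<lambda>v. a * frechet_derivative f (at x) v + b * frechet_derivative g (at x) v)) (at x)" for x
    using Suc.prems by (auto intro!: derivative_eq_intros simp: frechet_derivative_works)
  have "frechet_derivative (\<lambda>x. a * f x + b * g x) (at x) =
      (\<lambda>v. a * frechet_derivative f (at x) v + b * frechet_derivative g (at x) v)" for x
    using frechet_derivative_at[OF D] by simp
  moreover have "(\<lambda>x. a * f x + b * g x) differentiable (at x)" for x
    using D differentiable_def by blast
  ultimately show ?case using Suc by simp
qed

lemma C_diff_translate: "C_diff k f \<Longrightarrow> C_diff k (\<lambda>x. f (x - v))"
proof (induction k arbitrary: f)
  case 0
  then have "continuous_on UNIV (f \<circ> (\<lambda>x. x - v))"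
    by (intro continuous_on_compose continuous_intros) (auto intro: continuous_on_subset)
  then show ?case by (simp add: o_def)
next
  case (Suc k)
  have D: "((\<lambda>x. f (x - v)) has_derivative frechet_derivative f (at (x - v))) (at x)" for x
  proof -
    have "(f has_derivative frechet_derivative f (at (x - v))) (at (x - v))"
      using Suc.prems by (simp add: frechet_derivative_works)
    moreover have "((\<lambda>x. x - v) has_derivative (\<lambda>h. h)) (at x)"
      by (auto intro!: derivative_eq_intros)
    ultimately show ?thesis
      using diff_chain_at[of "\<lambda>x. x - v" "\<lambda>h. h" x f] by (simp add: o_def)
  qed
  have "frechet_derivative (\<lambda>x. f (x - v)) (at x) = frechet_derivative f (at (x - v))" for x
    using frechet_derivative_at[OF D] by simp
  moreover have "(\<lambda>x. f (x - v)) differentiable (at x)" for x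
    using D differentiable_def by blast
  moreover have "C_diff k (\<lambda>x. (\<lambda>x. frechet_derivative f (at x) w) (x - v))" for w
    using Suc.prems by (intro Suc.IH) simp
  ultimately show ?case by simp
qed

lemma closed_subset_compact:
  fixes S K :: "'a::t2_space set"
  assumes "closed S" "S \<subseteq> K" "compact K"
  shows "compact S"
  using compact_Int_closed[OF assms(3,1)] assms(2) by (simp add: Int_absorb1)

lemma smooth_compact_lincomb:
  fixes f g :: "'a::real_normed_vector \<Rightarrow> real"
  assumes "smooth_compact f" "smooth_compact g"
  shows "smooth_compact (\<lambda>x. a * f x + b * g x)"
proof -
  have "closure {x. a * f x + b * g x \<noteq> 0} \<subseteq> closure {x. f x \<noteq> 0} \<union> closure {x. g x \<noteq> 0}"
    unfolding closure_Un[symmetric] by (intro closure_mono) auto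
  moreover have "compact (closure {x. f x \<noteq> 0} \<union> closure {x. g x \<noteq> 0})"
    using assms by (auto simp: smooth_compact_def intro: compact_Un)
  ultimately have "compact (closure {x. a * f x + b * g x \<noteq> 0})"
    using closed_subset_compact[OF closed_closure] by blast
  with assms show ?thesis
    by (auto simp: smooth_compact_def intro: C_diff_lincomb)
qed

lemma smooth_compact_translate:
  fixes f :: "'a::real_normed_vector \<Rightarrow> real"
  assumes "smooth_compact f"
  shows "smooth_compact (\<lambda>x. f (x - v))"
proof -
  have "{x. f (x - v) \<noteq> 0} = (\<lambda>x. v + x) ` {x. f x \<noteq> 0}"
    by (auto simp: image_iff intro!: exI[of _ "_ - v"])
  then have "closure {x. f (x - v) \<noteq> 0} = (\<lambda>x. v + x) ` closure {x. f x \<noteq> 0}"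
    by (simp add: closure_translation)
  with assms show ?thesis
    by (auto simp: smooth_compact_def intro: C_diff_translate compact_translation)
qed

text \<open>Off the closed support \<open>f\<close> agrees near the point with the zero function, so
  the support does not grow. Iterated in the direction \<open>(0, 1)\<close>, this yields the decay
  of the Fourier transform in space.\<close>

lemma smooth_compact_derivative:
  fixes f :: "'a::real_normed_vector \<Rightarrow> real"
  assumes "smooth_compact f"
  shows "smooth_compact (\<lambda>x. frechet_derivative f (at x) v)"
proof -
  have "frechet_derivative f (at x) v = 0" if x: "x \<notin> closure {x. f x \<noteq> 0}" for x
  proof -
    have "(f has_derivative (\<lambda>_. 0)) (at x)"
    proof (rule has_derivative_transform_within_open)
      show "((\<lambda>_. 0) has_derivative (\<lambda>_. 0)) (at x)" by simp
      show "open (- closure {x. f x \<noteq> 0})" by auto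
      show "x \<in> - closure {x. f x \<noteq> 0}" using x by simp
      show "0 = f y" if "y \<in> - closure {x. f x \<noteq> 0}" for y
        using that closure_subset[of "{x. f x \<noteq> 0}"] by auto
    qed
    from frechet_derivative_at[OF this, symmetric] show ?thesis by simp
  qed
  then have "closure {x. frechet_derivative f (at x) v \<noteq> 0} \<subseteq> closure {x. f x \<noteq> 0}"
    by (intro closure_minimal) auto
  moreover have "compact (closure {x. f x \<noteq> 0})"
    using assms by (simp add: smooth_compact_def)
  ultimately have "compact (closure {x. frechet_derivative f (at x) v \<noteq> 0})"
    using closed_subset_compact[OF closed_closure] by blast
  moreover have "C_diff k (\<lambda>x. frechet_derivative f (at x) v)" for k
    using assms C_diff.simps(2) unfolding smooth_compact_def by blast
  ultimately show ?thesis by (simp add: smooth_compact_def)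
qed

lemma smooth_compact_continuous: "smooth_compact f \<Longrightarrow> continuous_on UNIV f"
  unfolding smooth_compact_def using C_diff.simps(1) by blast

lemma smooth_compact_bounds:
  fixes f :: "'a::real_normed_vector \<Rightarrow> real"
  assumes "smooth_compact f"
  obtains R where "0 < R" "\<And>x. \<bar>f x\<bar> \<le> R" "\<And>x. R < norm x \<Longrightarrow> f x = 0"
proof -
  let ?S = "closure {x. f x \<noteq> 0}"
  have S: "compact ?S" using assms by (simp add: smooth_compact_def)
  have "compact (f ` ?S)"
    using S smooth_compact_continuous[OF assms] by (intro compact_continuous_image) (auto intro: continuous_on_subset)
  then obtain A where A: "\<And>y. y \<in> f ` ?S \<Longrightarrow> norm y \<le> A"
    using compact_imp_bounded bounded_iff by metis
  obtain B where B: "\<And>y. y \<in> ?S \<Longrightarrow> norm y \<le> B"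
    using compact_imp_bounded[OF S] bounded_iff by metis
  have out: "f x = 0" if "x \<notin> ?S" for x
    using that closure_subset[of "{x. f x \<noteq> 0}"] by auto
  show thesis
  proof
    \<comment> \<open>One constant serves both as sup bound and as support radius; the
      \<open>1\<close> keeps it positive when \<open>f\<close> is zero.\<close>
    show "0 < max 1 (max A B)" by simp
    show "\<bar>f x\<bar> \<le> max 1 (max A B)" for x
      using A[of "f x"] out[of x] by (cases "x \<in> ?S") (auto simp: max_def)
    show "f x = 0" if "max 1 (max A B) < norm x" for x
      using B[of x] out[of x] that by (cases "x \<in> ?S") auto
  qed
qed

text \<open>The graph of \<open>h\<close> moves to the right by \<open>a\<close>. With this sign
  \<open>W (space_shift a h)\<close> belongs to \<open>u t (x + a)\<close>.\<close>

definition space_shift :: "real \<Rightarrow> (real \<times> real \<Rightarrow> real) \<Rightarrow> real \<times> real \<Rightarrow> real" where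
  "space_shift a h = (\<lambda>(s, y). h (s, y - a))"

lemma space_shift_apply [simp]: "space_shift a h (s, y) = h (s, y - a)"
  by (simp add: space_shift_def)

lemma test_fun_lincomb:
  assumes "test_fun \<phi>" "test_fun \<psi>"
  shows "test_fun (\<lambda>z. a * \<phi> z + b * \<psi> z)"
proof -
  from assms obtain f g where "smooth_compact f" "\<phi> = (\<lambda>(t, x). if 0 \<le> t then f (t, x) else 0)"
     "smooth_compact g" "\<psi> = (\<lambda>(t, x). if 0 \<le> t then g (t, x) else 0)"
    unfolding test_fun_def by blast
  then show ?thesis unfolding test_fun_def
    by (intro exI[of _ "\<lambda>z. a * f z + b * g z"]) (auto simp: smooth_compact_lincomb)
qed

lemma test_fun_zero: "test_fun (\<lambda>_. 0)"
proof -
  have "C_diff k (\<lambda>_ :: real \<times> real. 0 :: real)" for k by (induction k) auto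
  then have "smooth_compact (\<lambda>_ :: real \<times> real. 0 :: real)" by (simp add: smooth_compact_def)
  then show ?thesis unfolding test_fun_def by (intro exI[of _ "\<lambda>_. 0"]) auto
qed

lemma test_fun_shift:
  assumes "test_fun \<phi>"
  shows "test_fun (space_shift a \<phi>)"
proof -
  from assms obtain f where "smooth_compact f" "\<phi> = (\<lambda>(t, x). if 0 \<le> t then f (t, x) else 0)"
    unfolding test_fun_def by blast
  then show ?thesis unfolding test_fun_def
    using smooth_compact_translate[of f "(0, a)"]
    by (intro exI[of _ "\<lambda>z. f (z - (0, a))"]) (auto simp: space_shift_def)
qed

section \<open>Fourier transforms of test functions\<close>

lemma integrable_bounded_Icc:
  fixes g :: "real \<Rightarrow> 'b::{banach, second_countable_topology}"
  assumes [measurable]: "g \<in> borel_measurable borel"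
    and "\<And>x. norm (g x) \<le> C" and "\<And>x. R < \<bar>x\<bar> \<Longrightarrow> g x = 0"
  shows "integrable lborel g"
proof (rule Bochner_Integration.integrable_bound)
  show "integrable lborel (\<lambda>x. indicator {-R..R} x * C)"
    by (intro integrable_mult_left integrable_real_indicator) (simp_all add: emeasure_lborel_Icc_eq)
  have "norm (g x) \<le> norm (indicator {-R..R} x * C)" for x
    using assms(2)[of x] assms(3)[of x] by (cases "R < \<bar>x\<bar>") (auto simp: indicator_def)
  then show "AE x in lborel. norm (g x) \<le> norm (indicator {-R..R} x * C)" by simp
qed simp

lemma fourier_integrable:
  assumes "integrable lborel g"
  shows "integrable lborel (\<lambda>x. exp (- (\<i> * complex_of_real \<xi> * complex_of_real x)) * complex_of_real (g x))"
  using assms by (intro Bochner_Integration.integrable_bound[OF assms]) (auto simp: norm_mult)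

lemma norm_fourier_le: "cmod (fourier g \<xi>) \<le> (\<integral>x. \<bar>g x\<bar> \<partial>lborel)"
  unfolding fourier_def
  by (intro order_trans[OF integral_norm_bound]) (simp add: norm_mult)

lemma norm_fourier_le_bounded:
  assumes [measurable]: "g \<in> borel_measurable borel"
    and "0 \<le> R" "\<And>x. \<bar>g x\<bar> \<le> C" and "\<And>x. R < \<bar>x\<bar> \<Longrightarrow> g x = 0"
  shows "cmod (fourier g \<xi>) \<le> 2 * R * C"
proof -
  have "(\<integral>x. \<bar>g x\<bar> \<partial>lborel) \<le> (\<integral>x. indicator {-R..R} x * C \<partial>lborel)"
  proof (rule integral_mono)
    show "integrable lborel (\<lambda>x. \<bar>g x\<bar>)"
      using integrable_bounded_Icc[of g C R] assms by (intro integrable_abs) auto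
    show "integrable lborel (\<lambda>x. indicator {-R..R} x * C)"
      by (intro integrable_mult_left integrable_real_indicator) (simp_all add: emeasure_lborel_Icc_eq)
    show "\<bar>g x\<bar> \<le> indicator {-R..R} x * C" for x
      using assms(3)[of x] assms(4)[of x] by (auto simp: indicator_def)
  qed
  also have "\<dots> = 2 * R * C" using assms(2) by simp
  finally show ?thesis using norm_fourier_le order_trans by blast
qed

text \<open>Integration by parts: the derivative of the exponential times \<open>g\<close> is the
  difference of the two integrands, and its integral over an interval with endpoints outside the
  support is zero.\<close>

lemma fourier_derivative:
  assumes g: "\<And>x. (g has_real_derivative g' x) (at x)" and g': "continuous_on UNIV g'"
    and R: "\<And>x. R < \<bar>x\<bar> \<Longrightarrow> g x = 0" "\<And>x. R < \<bar>x\<bar> \<Longrightarrow> g' x = 0"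
  shows "fourier g' \<xi> = \<i> * complex_of_real \<xi> * fourier g \<xi>"
proof -
  let ?e = "\<lambda>x. exp (- (\<i> * complex_of_real \<xi> * complex_of_real x))"
  \<comment> \<open>The endpoints lie strictly outside the support, also when \<open>R\<close> is
    negative.\<close>
  let ?a = "- (\<bar>R\<bar> + 1)" and ?b = "\<bar>R\<bar> + 1"
  have cg: "continuous_on UNIV g"
    using g by (meson DERIV_isCont continuous_at_imp_continuous_on)
  have int: "integrable lborel h" if "continuous_on UNIV h" "\<And>x. R < \<bar>x\<bar> \<Longrightarrow> h x = 0" for h :: "real \<Rightarrow> real"
  proof -
    have "compact (h ` {-R..R})"
      using that(1) by (intro compact_continuous_image) (auto intro: continuous_on_subset)
    then obtain A where A: "\<And>y. y \<in> h ` {-R..R} \<Longrightarrow> norm y \<le> A"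
      using compact_imp_bounded bounded_iff by metis
    have "norm (h x) \<le> max 0 A" for x
    proof (cases "R < \<bar>x\<bar>")
      case False
      then have "h x \<in> h ` {-R..R}" by (intro imageI) auto
      from A[OF this] show ?thesis by simp
    qed (simp add: that(2))
    with borel_measurable_continuous_onI[OF that(1)] that(2) show ?thesis
      by (intro integrable_bounded_Icc[of h "max 0 A" R]) auto
  qed
  let ?F = "\<lambda>x. ?e x * complex_of_real (g x)"
  let ?f = "\<lambda>x. ?e x * complex_of_real (g' x) - \<i> * complex_of_real \<xi> * (?e x * complex_of_real (g x))"
  have "has_bochner_integral lborel (\<lambda>x. indicator {?a..?b} x *\<^sub>R ?f x) (?F ?b - ?F ?a)"
  proof (rule has_bochner_integral_FTC_Icc)
    show "?a \<le> ?b" by simp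
    show "(?F has_vector_derivative ?f x) (at x within {?a..?b})" for x
    proof -
      have g: "((\<lambda>x. complex_of_real (g x)) has_vector_derivative complex_of_real (g' x)) (at x within {?a..?b})"
        using g[of x] by (intro has_vector_derivative_of_real has_vector_derivative_at_within)
           (simp add: has_real_derivative_iff_has_vector_derivative)
      have e: "(?e has_vector_derivative (- (\<i> * complex_of_real \<xi>)) * ?e x) (at x within {?a..?b})"
      proof -
        have "((\<lambda>z. exp (- (\<i> * complex_of_real \<xi> * z))) has_field_derivative
              (- (\<i> * complex_of_real \<xi>)) * ?e x) (at (complex_of_real x))"
          by (auto intro!: derivative_eq_intros)
        from has_vector_derivative_real_field[OF this] show ?thesis by simp
      qed
      from has_vector_derivative_mult[OF e g] show ?thesis
        by (simp add: algebra_simps)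
    qed
    show "continuous_on {?a..?b} ?f"
      by (intro continuous_intros) (auto intro: continuous_on_subset[OF cg] continuous_on_subset[OF g'])
  qed
  moreover have "(\<lambda>x. indicator {?a..?b} x *\<^sub>R ?f x) = ?f"
    using R by (auto simp: indicator_def fun_eq_iff abs_le_iff)
  moreover have "?F ?b - ?F ?a = 0" using R by simp
  ultimately have "has_bochner_integral lborel ?f 0" by metis
  then have "integral\<^sup>L lborel ?f = 0" by (simp add: has_bochner_integral_iff)
  moreover have "integral\<^sup>L lborel ?f = fourier g' \<xi> - \<i> * complex_of_real \<xi> * fourier g \<xi>"
    unfolding fourier_def
    using fourier_integrable[OF int[OF cg R(1)], of \<xi>] fourier_integrable[OF int[OF g' R(2)], of \<xi>]
    by (subst Bochner_Integration.integral_diff) auto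
  ultimately show ?thesis by simp
qed

lemma smooth_compact_slice_derivative:
  assumes "smooth_compact \<psi>"
  shows "((\<lambda>x. \<psi> (t, x)) has_real_derivative frechet_derivative \<psi> (at (t, x)) (0, 1)) (at x)"
proof -
  have "C_diff (Suc 0) \<psi>" using assms smooth_compact_def by blast
  then have "(\<psi> has_derivative frechet_derivative \<psi> (at (t, x))) (at (t, x))"
    by (simp add: frechet_derivative_works)
  moreover have "((\<lambda>x. (t, x)) has_derivative (\<lambda>h. (0, h))) (at x)"
    by (auto intro!: derivative_eq_intros)
  ultimately have D: "((\<lambda>x. \<psi> (t, x)) has_derivative (\<lambda>h. frechet_derivative \<psi> (at (t, x)) (0, h))) (at x)"
    using diff_chain_at[of "\<lambda>x. (t, x)" "\<lambda>h. (0, h)" x \<psi>] by (simp add: o_def)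
  have "frechet_derivative \<psi> (at (t, x)) (0, h) = frechet_derivative \<psi> (at (t, x)) (0, 1) * h" for h
    using linear_scale[OF has_derivative_linear[OF D], of h 1]
    unfolding real_scaleR_def mult_1_right by (simp only: mult.commute)
  then have "(\<lambda>h. frechet_derivative \<psi> (at (t, x)) (0, h)) = (*) (frechet_derivative \<psi> (at (t, x)) (0, 1))"
    by (rule ext)
  with D show ?thesis unfolding has_field_derivative_def by metis
qed

lemma smooth_compact_fourier_derivative:
  assumes "smooth_compact \<psi>"
  shows "fourier (\<lambda>x. frechet_derivative \<psi> (at (t, x)) (0, 1)) \<xi> = \<i> * complex_of_real \<xi> * fourier (\<lambda>x. \<psi> (t, x)) \<xi>"
proof -
  let ?D = "\<lambda>z. frechet_derivative \<psi> (at z) (0, 1)"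
  have D: "smooth_compact ?D" using assms by (rule smooth_compact_derivative)
  obtain R where R: "\<And>x. R < norm x \<Longrightarrow> \<psi> x = 0" using smooth_compact_bounds[OF assms] by metis
  obtain R' where R': "\<And>x. R' < norm x \<Longrightarrow> ?D x = 0" using smooth_compact_bounds[OF D] by metis
  have n: "\<bar>x\<bar> \<le> norm (t, x)" for x :: real using norm_snd_le[of x t] by simp
  show ?thesis
  proof (rule fourier_derivative[where R = "max R R'"])
    show "continuous_on UNIV (\<lambda>x. ?D (t, x))"
      by (rule continuous_on_compose2[OF smooth_compact_continuous[OF D]]) (auto intro!: continuous_intros)
    show "((\<lambda>x. \<psi> (t, x)) has_real_derivative ?D (t, x)) (at x)" for x
      by (rule smooth_compact_slice_derivative[OF assms])
    show "\<psi> (t, x) = 0" if "max R R' < \<bar>x\<bar>" for x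
      using R[of "(t, x)"] n[of x] that by linarith
    show "?D (t, x) = 0" if "max R R' < \<bar>x\<bar>" for x
      using R'[of "(t, x)"] n[of x] that by linarith
  qed
qed

lemma smooth_compact_fourier_bound:
  assumes "smooth_compact (\<psi> :: real \<times> real \<Rightarrow> real)"
  obtains C where "0 \<le> C" "\<And>t \<xi>. cmod (fourier (\<lambda>x. \<psi> (t, x)) \<xi>) \<le> C"
proof -
  obtain R where R: "0 < R" "\<And>x. \<bar>\<psi> x\<bar> \<le> R" "\<And>x. R < norm x \<Longrightarrow> \<psi> x = 0"
    using smooth_compact_bounds[OF assms] by metis
  have [measurable]: "\<psi> \<in> borel_measurable borel"
    using smooth_compact_continuous[OF assms] by (rule borel_measurable_continuous_onI)
  have n: "\<bar>x\<bar> \<le> norm (t, x)" for x t :: real using norm_snd_le[of x t] by simp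
  show thesis
  proof
    show "cmod (fourier (\<lambda>x. \<psi> (t, x)) \<xi>) \<le> 2 * R * R" for t \<xi>
    proof (rule norm_fourier_le_bounded)
      show "(\<lambda>x. \<psi> (t, x)) \<in> borel_measurable borel"
        by (rule measurable_compose[of "Pair t" borel borel]) (auto simp flip: borel_prod simp: \<open>\<psi> \<in> _\<close>[unfolded borel_prod[symmetric]])
      show "\<psi> (t, x) = 0" if "R < \<bar>x\<bar>" for x
        using R(3)[of "(t, x)"] n[of x t] that by linarith
    qed (use R in auto)
  qed (use R in auto)
qed

text \<open>Each space derivative multiplies the transform by \<open>\<i> * \<xi>\<close>, so four
  of them bound \<open>\<xi>^4\<close> times the transform, uniformly in \<open>t\<close>. The
  exponent is chosen so that one factor \<open>1 + \<xi>^2\<close> absorbs the weight of the noise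
  while the other remains integrable.\<close>

lemma smooth_compact_fourier_decay:
  assumes "smooth_compact (\<psi> :: real \<times> real \<Rightarrow> real)"
  obtains C where "0 \<le> C" "\<And>t \<xi>. cmod (fourier (\<lambda>x. \<psi> (t, x)) \<xi>) \<le> C / (1 + \<xi>\<^sup>2)\<^sup>2"
proof -
  define D where "D \<psi> = (\<lambda>z. frechet_derivative \<psi> (at z) (0, 1))" for \<psi> :: "real \<times> real \<Rightarrow> real"
  have sD: "smooth_compact (D \<psi>)" if "smooth_compact \<psi>" for \<psi>
    using that smooth_compact_derivative unfolding D_def by blast
  have fD: "fourier (\<lambda>x. D \<psi> (t, x)) \<xi> = \<i> * complex_of_real \<xi> * fourier (\<lambda>x. \<psi> (t, x)) \<xi>"
    if "smooth_compact \<psi>" for \<psi> t \<xi>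
    using smooth_compact_fourier_derivative[OF that] unfolding D_def .
  have s4: "smooth_compact (D (D (D (D \<psi>))))" using assms sD by blast
  obtain C0 where C0: "0 \<le> C0" "\<And>t \<xi>. cmod (fourier (\<lambda>x. \<psi> (t, x)) \<xi>) \<le> C0"
    using smooth_compact_fourier_bound[OF assms] by metis
  obtain C4 where C4: "0 \<le> C4" "\<And>t \<xi>. cmod (fourier (\<lambda>x. D (D (D (D \<psi>))) (t, x)) \<xi>) \<le> C4"
    using smooth_compact_fourier_bound[OF s4] by metis
  have "cmod (fourier (\<lambda>x. \<psi> (t, x)) \<xi>) \<le> (2 * (C0 + C4)) / (1 + \<xi>\<^sup>2)\<^sup>2" for t \<xi>
  proof -
    let ?f = "cmod (fourier (\<lambda>x. \<psi> (t, x)) \<xi>)"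
    have "cmod (fourier (\<lambda>x. D (D (D (D \<psi>))) (t, x)) \<xi>) = \<xi>^4 * ?f"
      using assms by (simp add: fD sD norm_mult power4_eq_xxxx mult.assoc[symmetric] flip: abs_mult)
    then have 1: "\<xi>^4 * ?f \<le> C4" using C4 by metis
    have "(1 + \<xi>\<^sup>2)\<^sup>2 \<le> 2 * (1 + \<xi>^4)"
      using zero_le_power2[of "1 - \<xi>\<^sup>2"] by (simp add: power2_eq_square power4_eq_xxxx algebra_simps)
    then have "(1 + \<xi>\<^sup>2)\<^sup>2 * ?f \<le> 2 * (1 + \<xi>^4) * ?f" by (rule mult_right_mono) simp
    also have "\<dots> = 2 * (?f + \<xi>^4 * ?f)" by (simp add: algebra_simps)
    also have "\<dots> \<le> 2 * (C0 + C4)" using 1 C0(2)[of t \<xi>] by simp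
    finally show ?thesis using sum_power2_gt_zero_iff[of 1 \<xi>] by (subst pos_le_divide_eq) (simp_all add: mult.commute)
  qed
  then show thesis using that[of "2 * (C0 + C4)"] C0 C4 by simp
qed

text \<open>All bounds share one constant, the sum of the support radius and the decay constant of
  the smooth extension. They are uniform in time because the slices at negative times are
  zero.\<close>

lemma test_fun_bounds:
  assumes "test_fun h"
  obtains R where "0 < R" "\<And>z. \<bar>h z\<bar> \<le> R" "\<And>s y. \<not> (0 \<le> s \<and> s \<le> R \<and> \<bar>y\<bar> \<le> R) \<Longrightarrow> h (s, y) = 0"
    "\<And>s \<xi>. cmod (fourier (\<lambda>x. h (s, x)) \<xi>) \<le> R / (1 + \<xi>\<^sup>2)\<^sup>2"
proof -
  obtain f where f: "smooth_compact f" and h: "h = (\<lambda>(t, x). if 0 \<le> t then f (t, x) else 0)"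
    using assms unfolding test_fun_def by blast
  obtain R where R: "0 < R" "\<And>x. \<bar>f x\<bar> \<le> R" "\<And>x. R < norm x \<Longrightarrow> f x = 0"
    using smooth_compact_bounds[OF f] by metis
  obtain C where C: "0 \<le> C" "\<And>t \<xi>. cmod (fourier (\<lambda>x. f (t, x)) \<xi>) \<le> C / (1 + \<xi>\<^sup>2)\<^sup>2"
    using smooth_compact_fourier_decay[OF f] by metis
  have n: "\<bar>x\<bar> \<le> norm (t, x)" "\<bar>t\<bar> \<le> norm (t, x)" for x t :: real
    using norm_snd_le[of x t] norm_fst_le[of t x] by auto
  have z: "fourier (\<lambda>x. 0) \<xi> = 0" for \<xi> by (simp add: fourier_def)
  show thesis
  proof
    show "0 < R + C" using R C by simp
    show "\<bar>h z\<bar> \<le> R + C" for z using R(1) R(2)[of z] C(1) by (cases z) (auto simp: h)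
    show "h (s, y) = 0" if "\<not> (0 \<le> s \<and> s \<le> R + C \<and> \<bar>y\<bar> \<le> R + C)" for s y
    proof (cases "0 \<le> s")
      case True
      then have "R + C < \<bar>s\<bar> \<or> R + C < \<bar>y\<bar>" using that by auto
      then have "R < norm (s, y)" using n[where x=y and t=s] C(1) by linarith
      then show ?thesis using R by (simp add: h)
    qed (simp add: h)
    show "cmod (fourier (\<lambda>x. h (s, x)) \<xi>) \<le> (R + C) / (1 + \<xi>\<^sup>2)\<^sup>2" for s \<xi>
    proof (cases "0 \<le> s")
      case True
      then have "cmod (fourier (\<lambda>x. h (s, x)) \<xi>) \<le> C / (1 + \<xi>\<^sup>2)\<^sup>2" using C by (simp add: h)
      also have "\<dots> \<le> (R + C) / (1 + \<xi>\<^sup>2)\<^sup>2" using R by (intro divide_right_mono) auto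
      finally show ?thesis .
    qed (use R C in \<open>simp add: h z\<close>)
  qed
qed

lemma test_fun_borel [measurable_dest]:
  assumes "test_fun h" shows "h \<in> borel_measurable borel"
proof -
  obtain f where f: "smooth_compact f" and h: "h = (\<lambda>(t, x). if 0 \<le> t then f (t, x) else 0)"
    using assms unfolding test_fun_def by blast
  have [measurable]: "f \<in> borel_measurable borel"
    using smooth_compact_continuous[OF f] by (rule borel_measurable_continuous_onI)
  have "h = (\<lambda>z. if 0 \<le> fst z then f z else 0)" by (auto simp: h fun_eq_iff)
  moreover have "(\<lambda>z. if 0 \<le> fst z then f z else 0) \<in> borel_measurable borel"
  proof (intro measurable_If)
    show "{x \<in> space borel. 0 \<le> fst (x :: real \<times> real)} \<in> sets borel"
      unfolding borel_prod[symmetric] by measurable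
  qed auto
  ultimately show ?thesis by simp
qed

lemma fourier_measurable:
  assumes [measurable]: "(\<lambda>(w, x). f w x) \<in> borel_measurable (N \<Otimes>\<^sub>M borel)"
  shows "(\<lambda>(w, \<xi>). fourier (f w) \<xi>) \<in> borel_measurable (N \<Otimes>\<^sub>M borel)"
  unfolding fourier_def by measurable

lemma fourier_slice_measurable [measurable]:
  assumes "f \<in> borel_measurable (borel :: (real \<times> real) measure)"
  shows "(\<lambda>(s, \<xi>). fourier (\<lambda>x. f (s, x)) \<xi>) \<in> borel_measurable (borel \<Otimes>\<^sub>M borel)"
  using assms by (intro fourier_measurable) (simp add: borel_prod)

lemma fourier_borel [measurable (raw)]:
  assumes [measurable]: "g \<in> borel_measurable borel"
  shows "fourier g \<in> borel_measurable borel"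
  unfolding fourier_def by measurable

lemma powr_weight_le:
  assumes "0 < p" "p < 1" shows "\<bar>\<xi>::real\<bar> powr p \<le> 1 + \<xi>\<^sup>2"
proof (cases "\<bar>\<xi>\<bar> \<le> 1")
  case True
  then have "\<bar>\<xi>\<bar> powr p \<le> 1" using assms by (intro powr_le1) auto
  then show ?thesis by (simp add: add_increasing2)
next
  case False
  then have "\<bar>\<xi>\<bar> powr p \<le> \<bar>\<xi>\<bar> powr 2" using assms by (intro powr_mono) auto
  also have "\<dots> = \<xi>\<^sup>2" using False by (simp add: powr_numeral)
  finally show ?thesis by simp
qed

lemma integrable_inverse_one_plus_square: "integrable lborel (\<lambda>\<xi>::real. 1 / (1 + \<xi>\<^sup>2))"
proof -
  have "set_integrable lborel (einterval (-\<infinity>) \<infinity>) (\<lambda>x::real. inverse (1 + x^2))"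
    by (rule integrable_inverse_1_plus_square)
  then show ?thesis by (simp add: set_integrable_def einterval_def inverse_eq_divide)
qed

lemma lborel_integral_translate:
  fixes f :: "'a::euclidean_space \<Rightarrow> 'b::{banach, second_countable_topology}"
  assumes "f \<in> borel_measurable borel"
  shows "(\<integral>z. f (c + z) \<partial>lborel) = (\<integral>z. f z \<partial>lborel)"
proof -
  have "(\<integral>z. f z \<partial>lborel) = (\<integral>z. f z \<partial>distr lborel borel ((+) c))" by (simp add: lborel_distr_plus)
  also have "\<dots> = (\<integral>z. f (c + z) \<partial>lborel)" using assms by (subst integral_distr) auto
  finally show ?thesis by simp
qed

lemma integrable_bounded_box:
  fixes f :: "real \<times> real \<Rightarrow> 'b::{banach, second_countable_topology}"
  assumes [measurable]: "f \<in> borel_measurable borel"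
    and "\<And>z. norm (f z) \<le> C" and "\<And>s y. \<not> (\<bar>s\<bar> \<le> R \<and> \<bar>y\<bar> \<le> R) \<Longrightarrow> f (s, y) = 0"
  shows "integrable lborel f"
proof (rule Bochner_Integration.integrable_bound)
  show "integrable lborel (\<lambda>z::real\<times>real. indicator (cbox (-R,-R) (R,R)) z * C)"
    by (intro integrable_mult_left integrable_real_indicator) (simp_all add: emeasure_lborel_cbox_finite[unfolded infinity_ennreal_def])
  have "norm (f z) \<le> norm (indicator (cbox (-R,-R) (R,R)) z * C)" for z
    using assms(2)[of z] assms(3)[of "fst z" "snd z"]
    by (cases z) (auto simp: indicator_def cbox_Pair_eq abs_le_iff)
  then show "AE z in lborel. norm (f z) \<le> norm (indicator (cbox (-R,-R) (R,R)) z * C)" by simp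
qed simp

lemma lborel_integral_prod:
  fixes f :: "real \<times> real \<Rightarrow> 'b::{banach, second_countable_topology}"
  assumes "integrable lborel f"
  shows "(\<integral>z. f z \<partial>lborel) = (\<integral>s. (\<integral>y. f (s, y) \<partial>lborel) \<partial>lborel)"
    and "AE s in lborel. integrable lborel (\<lambda>y. f (s, y))"
    and "integrable lborel (\<lambda>s. \<integral>y. f (s, y) \<partial>lborel)"
  using assms lborel_pair.integral_fst'[of f] lborel_pair.AE_integrable_fst'[of f]
    lborel_pair.integrable_fst'[of f] unfolding lborel_prod by auto

lemma borel_slice [measurable (raw)]:
  assumes "f \<in> borel_measurable (borel :: (real \<times> real) measure)"
  shows "(\<lambda>y. f (s, y)) \<in> borel_measurable borel"
  using assms by (intro measurable_compose[of "Pair s" borel borel f]) (auto simp flip: borel_prod)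

section \<open>Continuity of the transform, the multiplication formula, and the Riemann--Lebesgue
  lemma\<close>

lemma fourier_continuous:
  assumes "integrable lborel g"
  shows "continuous_on UNIV (fourier g)"
proof (rule continuous_on_sequentiallyI)
  fix u :: "nat \<Rightarrow> real" and a assume u: "u \<longlonglongrightarrow> a"
  show "(\<lambda>n. fourier g (u n)) \<longlonglongrightarrow> fourier g a"
    unfolding fourier_def
  proof (rule integral_dominated_convergence[where w = "\<lambda>x. \<bar>g x\<bar>"])
    show "AE x in lborel. (\<lambda>n. exp (- (\<i> * complex_of_real (u n) * complex_of_real x)) * complex_of_real (g x))
        \<longlonglongrightarrow> exp (- (\<i> * complex_of_real a * complex_of_real x)) * complex_of_real (g x)"
      using u by (intro AE_I2 tendsto_intros)
  qed (use assms in \<open>auto simp: norm_mult\<close>)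
qed

lemma one_plus_square_pos [simp]: "0 < 1 + (x::real)\<^sup>2"
  using sum_power2_gt_zero_iff[of 1 x] by simp

lemma integrable_decay:
  fixes g :: "real \<Rightarrow> complex"
  assumes "g \<in> borel_measurable borel" "\<And>\<xi>. cmod (g \<xi>) \<le> R / (1 + \<xi>\<^sup>2)"
  shows "integrable lborel g"
proof (rule Bochner_Integration.integrable_bound)
  show "integrable lborel (\<lambda>\<xi>::real. R * (1 / (1 + \<xi>\<^sup>2)))"
    using integrable_inverse_one_plus_square by (rule integrable_mult_right)
  have "norm (g \<xi>) \<le> norm (R * (1 / (1 + \<xi>\<^sup>2)))" for \<xi>
  proof -
    have "R / (1 + \<xi>\<^sup>2) \<le> \<bar>R\<bar> / (1 + \<xi>\<^sup>2)" by (intro divide_right_mono) auto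
    with assms(2)[of \<xi>] show ?thesis by simp
  qed
  then show "AE \<xi> in lborel. norm (g \<xi>) \<le> norm (R * (1 / (1 + \<xi>\<^sup>2)))" by simp
qed (use assms in simp)

text \<open>The multiplication formula of the Fourier transform, by Fubini. The second factor is
  complex because it will be a conjugate transform multiplied by the weight or by a Gaussian
  cutoff.\<close>

lemma fourier_pairing:
  fixes g :: "real \<Rightarrow> complex"
  assumes f: "integrable lborel f" and g: "integrable lborel g"
  shows "(\<integral>\<xi>. fourier f \<xi> * g \<xi> \<partial>lborel)
     = (\<integral>y. complex_of_real (f y) * (\<integral>\<xi>. exp (- (\<i> * complex_of_real \<xi> * complex_of_real y)) * g \<xi> \<partial>lborel) \<partial>lborel)"
    and "integrable lborel (\<lambda>y. complex_of_real (f y) * (\<integral>\<xi>. exp (- (\<i> * complex_of_real \<xi> * complex_of_real y)) * g \<xi> \<partial>lborel))"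
proof -
  let ?e = "\<lambda>y \<xi>. exp (- (\<i> * complex_of_real \<xi> * complex_of_real y))"
  let ?G = "\<lambda>y \<xi>. ?e y \<xi> * complex_of_real (f y) * g \<xi>"
  have [measurable]: "f \<in> borel_measurable borel" "g \<in> borel_measurable borel" using f g by auto
  have int: "integrable (lborel \<Otimes>\<^sub>M lborel) (\<lambda>(y, \<xi>). ?G y \<xi>)"
  proof (rule lborel_pair.Fubini_integrable)
    show "(\<lambda>(y, \<xi>). ?G y \<xi>) \<in> borel_measurable (lborel \<Otimes>\<^sub>M lborel)" by measurable
    have "(\<integral>\<xi>. norm (?G y \<xi>) \<partial>lborel) = \<bar>f y\<bar> * (\<integral>\<xi>. norm (g \<xi>) \<partial>lborel)" for y
      by (simp add: norm_mult)
    then show "integrable lborel (\<lambda>y. \<integral>\<xi>. norm (case (y, \<xi>) of (y, \<xi>) \<Rightarrow> ?G y \<xi>) \<partial>lborel)"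
      using f by simp
    show "AE y in lborel. integrable lborel (\<lambda>\<xi>. case (y, \<xi>) of (y, \<xi>) \<Rightarrow> ?G y \<xi>)"
      by (intro AE_I2 Bochner_Integration.integrable_bound[OF integrable_mult_right[OF g, of "complex_of_real (f _)"]])
         (auto simp: norm_mult)
  qed
  have e: "(\<integral>\<xi>. ?G y \<xi> \<partial>lborel) = complex_of_real (f y) * (\<integral>\<xi>. ?e y \<xi> * g \<xi> \<partial>lborel)" for y
    by (subst Bochner_Integration.integral_mult_right_zero[symmetric]) (simp add: mult_ac)
  have "(\<integral>\<xi>. fourier f \<xi> * g \<xi> \<partial>lborel) = (\<integral>\<xi>. (\<integral>y. ?G y \<xi> \<partial>lborel) \<partial>lborel)"
  proof (rule Bochner_Integration.integral_cong[OF refl])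
    fix \<xi>
    show "fourier f \<xi> * g \<xi> = (\<integral>y. ?G y \<xi> \<partial>lborel)"
      unfolding fourier_def[of f] by (rule integral_mult_left_zero[symmetric])
  qed
  also have "\<dots> = (\<integral>y. (\<integral>\<xi>. ?G y \<xi> \<partial>lborel) \<partial>lborel)"
    by (rule lborel_pair.Fubini_integral[OF int])
  finally show "(\<integral>\<xi>. fourier f \<xi> * g \<xi> \<partial>lborel) = (\<integral>y. complex_of_real (f y) * (\<integral>\<xi>. ?e y \<xi> * g \<xi> \<partial>lborel) \<partial>lborel)"
    unfolding e .
  show "integrable lborel (\<lambda>y. complex_of_real (f y) * (\<integral>\<xi>. ?e y \<xi> * g \<xi> \<partial>lborel))"
    using lborel_pair.integrable_fst[OF int] unfolding e .
qed

text \<open>The half-period argument: translating \<xi> by \<open>pi / z\<close> reverses the sign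
  of the exponential, so twice the integral is at most the \<open>L^1\<close> distance of
  \<open>g\<close> from its translate. As \<open>z = y - n\<close> diverges, the translation tends
  to 0.\<close>

lemma Riemann_Lebesgue_shift:
  fixes g :: "real \<Rightarrow> complex"
  assumes g: "continuous_on UNIV g" and C: "\<And>\<xi>. cmod (g \<xi>) \<le> C / (1 + \<xi>\<^sup>2)"
  shows "(\<lambda>n. \<integral>\<xi>. exp (- (\<i> * complex_of_real \<xi> * complex_of_real (y - real n))) * g \<xi> \<partial>lborel) \<longlonglongrightarrow> 0"
proof -
  have [measurable]: "g \<in> borel_measurable borel" using g by (rule borel_measurable_continuous_onI)
  have C0: "0 \<le> C" using order_trans[OF norm_ge_zero C[of 0]] by simp
  have gi: "integrable lborel (\<lambda>\<xi>. g (c + \<xi>))" for c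
  proof -
    have "integrable lborel g" using C by (intro integrable_decay) auto
    then have "integrable (distr lborel borel ((+) c)) g" by (simp add: lborel_distr_plus)
    then show ?thesis by (subst (asm) integrable_distr_eq) auto
  qed
  \<comment> \<open>After this many terms \<open>|z n|\<close> is at least
    \<open>pi + 1 + n\<close>; hence \<open>z n\<close> is nonzero and the half-period
    \<open>d n\<close> is at most 1. The offset is removed in the last line.\<close>
  define N where "N = nat \<lceil>\<bar>y\<bar> + pi + 1\<rceil>"
  define z where "z n = y - real (n + N)" for n
  have zb: "pi + 1 + real n \<le> \<bar>z n\<bar>" for n
  proof -
    have "\<bar>y\<bar> + pi + 1 \<le> real N" unfolding N_def by linarith
    then show ?thesis unfolding z_def by (auto simp: abs_real_def split: if_splits)
  qed
  have z0: "z n \<noteq> 0" for n using zb[of n] pi_gt_zero by force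
  define d where "d n = pi / z n" for n
  have d1: "\<bar>d n\<bar> \<le> 1" for n
    using zb[of n] pi_gt_zero z0[of n] unfolding d_def by (simp add: abs_divide divide_le_eq)
  have d0: "d \<longlonglongrightarrow> 0"
  proof (rule Lim_null_comparison)
    have "norm (d n) \<le> pi / (1 + real n)" for n
    proof -
      have "1 + real n \<le> \<bar>z n\<bar>" using zb[of n] pi_gt_zero by linarith
      then show ?thesis unfolding d_def by (simp add: abs_divide frac_le)
    qed
    then show "\<forall>\<^sub>F n in sequentially. norm (d n) \<le> pi / (1 + real n)" by simp
    show "(\<lambda>n. pi / (1 + real n)) \<longlonglongrightarrow> 0" by real_asymp
  qed
  let ?e = "\<lambda>z \<xi>. exp (- (\<i> * complex_of_real \<xi> * complex_of_real z))"
  let ?J = "\<lambda>z. \<integral>\<xi>. ?e z \<xi> * g \<xi> \<partial>lborel"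
  have int: "integrable lborel (\<lambda>\<xi>. ?e z \<xi> * g (c + \<xi>))" for z c
    using gi[of c] by (rule Bochner_Integration.integrable_bound) (auto simp: norm_mult)
  have bound: "2 * cmod (?J (z n)) \<le> (\<integral>\<xi>. cmod (g \<xi> - g (d n + \<xi>)) \<partial>lborel)" for n
  proof -
    have e: "?e (z n) (d n + \<xi>) = - ?e (z n) \<xi>" for \<xi>
    proof -
      have "- (\<i> * complex_of_real (d n + \<xi>) * complex_of_real (z n)) = - (\<i> * complex_of_real \<xi> * complex_of_real (z n)) - \<i> * complex_of_real pi"
        using z0[of n] unfolding d_def by (simp add: field_simps)
      then show ?thesis by (simp only: exp_diff) (simp add: exp_pi_i')
    qed
    have "?J (z n) = (\<integral>\<xi>. ?e (z n) (d n + \<xi>) * g (d n + \<xi>) \<partial>lborel)"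
      by (rule lborel_integral_translate[symmetric]) measurable
    also have "\<dots> = - (\<integral>\<xi>. ?e (z n) \<xi> * g (d n + \<xi>) \<partial>lborel)"
      unfolding e mult_minus_left by (rule integral_minus)
    finally have "2 * ?J (z n) = (\<integral>\<xi>. ?e (z n) \<xi> * g (0 + \<xi>) - ?e (z n) \<xi> * g (d n + \<xi>) \<partial>lborel)"
      using int[of "z n" 0] int[of "z n" "d n"] by (subst Bochner_Integration.integral_diff) auto
    also have "\<dots> = (\<integral>\<xi>. ?e (z n) \<xi> * (g \<xi> - g (d n + \<xi>)) \<partial>lborel)" by (simp add: right_diff_distrib)
    finally have "cmod (2 * ?J (z n)) = cmod (\<integral>\<xi>. ?e (z n) \<xi> * (g \<xi> - g (d n + \<xi>)) \<partial>lborel)"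
      by (rule arg_cong)
    then have "2 * cmod (?J (z n)) = cmod (\<integral>\<xi>. ?e (z n) \<xi> * (g \<xi> - g (d n + \<xi>)) \<partial>lborel)"
      unfolding norm_mult norm_numeral .
    also have "\<dots> \<le> (\<integral>\<xi>. cmod (?e (z n) \<xi> * (g \<xi> - g (d n + \<xi>))) \<partial>lborel)" by (rule integral_norm_bound)
    finally show ?thesis by (simp add: norm_mult)
  qed
  \<comment> \<open>The majorant has one \<open>C\<close> from \<open>g \<xi>\<close> and three from
    the translate, because a translation by at most 1 changes \<open>1 + \<xi>^2\<close> by a factor
    of at most 3.\<close>
  have "(\<lambda>n. \<integral>\<xi>. cmod (g \<xi> - g (d n + \<xi>)) \<partial>lborel) \<longlonglongrightarrow> (\<integral>\<xi>. 0 \<partial>(lborel::real measure))"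
  proof (rule integral_dominated_convergence[where w = "\<lambda>\<xi>. 4 * C * (1 / (1 + \<xi>\<^sup>2))"])
    show "integrable lborel (\<lambda>\<xi>::real. 4 * C * (1 / (1 + \<xi>\<^sup>2)))"
      using integrable_inverse_one_plus_square by (rule integrable_mult_right)
    show "AE \<xi> in lborel. (\<lambda>n. cmod (g \<xi> - g (d n + \<xi>))) \<longlonglongrightarrow> 0"
    proof (intro AE_I2)
      fix \<xi>
      have "(\<lambda>n. d n + \<xi>) \<longlonglongrightarrow> 0 + \<xi>" using d0 by (intro tendsto_intros)
      then have "(\<lambda>n. g (d n + \<xi>)) \<longlonglongrightarrow> g \<xi>"
        using continuous_on_tendsto_compose[OF g] by auto
      then have "(\<lambda>n. g \<xi> - g (d n + \<xi>)) \<longlonglongrightarrow> g \<xi> - g \<xi>" by (intro tendsto_intros)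
      then show "(\<lambda>n. cmod (g \<xi> - g (d n + \<xi>))) \<longlonglongrightarrow> 0" using tendsto_norm_zero by force
    qed
    show "AE \<xi> in lborel. norm (cmod (g \<xi> - g (d n + \<xi>))) \<le> 4 * C * (1 / (1 + \<xi>\<^sup>2))" for n
    proof (intro AE_I2)
      fix \<xi>
      have p: "0 < 1 + x\<^sup>2" for x :: real using sum_power2_gt_zero_iff[of 1 x] by simp
      have "1 + \<xi>\<^sup>2 \<le> 3 * (1 + (d n + \<xi>)\<^sup>2)"
      proof -
        \<comment> \<open>With the squares abstracted to variables the claim becomes linear:
          \<open>X\<close>, \<open>A\<close>, \<open>B\<close>, \<open>D\<close> stand for the
          squares of \<xi>, \<open>d n + \<xi>\<close>, \<open>\<xi> + 2 * d n\<close> and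
          \<open>d n\<close>.\<close>
        have key: "2 * A = X + B - 2 * D \<Longrightarrow> D \<le> 1 \<Longrightarrow> 0 \<le> B \<Longrightarrow> 0 \<le> A \<Longrightarrow> 1 + X \<le> 3 * (1 + A)"
          for A B D X :: real by argo
        have "2 * (d n + \<xi>)\<^sup>2 = \<xi>\<^sup>2 + (\<xi> + 2 * d n)\<^sup>2 - 2 * (d n)\<^sup>2"
          by (simp add: power2_eq_square algebra_simps)
        then show ?thesis by (rule key) (use d1[of n] in \<open>simp_all add: abs_square_le_1\<close>)
      qed
      then have "1 / (1 + (d n + \<xi>)\<^sup>2) \<le> 3 / (1 + \<xi>\<^sup>2)"
        using p[of \<xi>] p[of "d n + \<xi>"] by (simp add: divide_simps mult.commute)
      from mult_left_mono[OF this C0] have "cmod (g (d n + \<xi>)) \<le> 3 * C / (1 + \<xi>\<^sup>2)"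
        using C[of "d n + \<xi>"] by (simp add: mult.commute)
      moreover have "C / (1 + \<xi>\<^sup>2) + 3 * C / (1 + \<xi>\<^sup>2) = 4 * C * (1 / (1 + \<xi>\<^sup>2))"
        by (simp add: add_divide_distrib[symmetric])
      ultimately show "norm (cmod (g \<xi> - g (d n + \<xi>))) \<le> 4 * C * (1 / (1 + \<xi>\<^sup>2))"
        using C[of \<xi>] norm_triangle_ineq4[of "g \<xi>" "g (d n + \<xi>)"] unfolding real_norm_def abs_norm_cancel
        by linarith
    qed
  qed auto
  then have "(\<lambda>n. (\<integral>\<xi>. cmod (g \<xi> - g (d n + \<xi>)) \<partial>lborel) / 2) \<longlonglongrightarrow> 0"
    by (intro tendsto_divide_zero) simp
  moreover have J: "norm (?J (z n)) \<le> (\<integral>\<xi>. cmod (g \<xi> - g (d n + \<xi>)) \<partial>lborel) / 2" for n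
    using bound[of n] by linarith
  have "\<forall>\<^sub>F n in sequentially. norm (?J (z n)) \<le> (\<integral>\<xi>. cmod (g \<xi> - g (d n + \<xi>)) \<partial>lborel) / 2"
    by (intro always_eventually allI J)
  ultimately have "(\<lambda>n. ?J (z n)) \<longlonglongrightarrow> 0" by (rule Lim_null_comparison[rotated])
  then show ?thesis unfolding z_def by (rule LIMSEQ_offset)
qed

section \<open>The covariance as an integral in physical space\<close>

text \<open>The covariance turns into integration against this bounded function, see \<open>Re_H_inner\<close> below.\<close>

definition noise_kernel :: "real \<Rightarrow> (real \<times> real \<Rightarrow> real) \<Rightarrow> real \<times> real \<Rightarrow> real" where
  "noise_kernel H h = (\<lambda>(s, y). c_const H * Re (\<integral>\<xi>. exp (- (\<i> * complex_of_real \<xi> * complex_of_real y)) *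
     (cnj (fourier (\<lambda>x. h (s, x)) \<xi>) * complex_of_real (\<bar>\<xi>\<bar> powr (1 - 2 * H))) \<partial>lborel))"

text \<open>The inner product in one-sided form: smoothness is asked of \<open>h\<close> alone, and
  \<open>f\<close> may be any integrable function. This admits the discontinuous paths of the
  stochastic integrands.\<close>

definition noise_pairing :: "real \<Rightarrow> (real \<times> real \<Rightarrow> real) \<Rightarrow> (real \<times> real \<Rightarrow> real) \<Rightarrow> real" where
  "noise_pairing H f h = (\<integral>z. f z * noise_kernel H h z \<partial>lborel)"

lemma fourier_zero [simp]: "fourier (\<lambda>x. 0) \<xi> = 0"
  by (simp add: fourier_def)

lemma noise_kernel_eq_0: "(\<And>y. h (s, y) = 0) \<Longrightarrow> noise_kernel H h (s, y) = 0"
  by (simp add: noise_kernel_def)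

lemma borel_measurable_cnj [measurable (raw)]:
  assumes "f \<in> borel_measurable M" shows "(\<lambda>x. cnj (f x)) \<in> borel_measurable M"
proof -
  have "cnj \<in> borel_measurable borel" by (intro borel_measurable_continuous_onI continuous_intros)
  then show ?thesis using assms by (rule measurable_compose[rotated])
qed

lemma lborel_integral_measurable:
  fixes f :: "'a \<Rightarrow> real \<Rightarrow> 'b::{banach, second_countable_topology}"
  assumes "(\<lambda>(w, x). f w x) \<in> borel_measurable (N \<Otimes>\<^sub>M borel)"
  shows "(\<lambda>w. \<integral>x. f w x \<partial>lborel) \<in> borel_measurable N"
proof -
  have "sets (N \<Otimes>\<^sub>M borel) = sets (N \<Otimes>\<^sub>M lborel)" by (intro sets_pair_measure_cong) simp_all
  with assms have "(\<lambda>(w, x). f w x) \<in> borel_measurable (N \<Otimes>\<^sub>M lborel)"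
    using measurable_cong_sets by blast
  then show ?thesis by (rule lborel.borel_measurable_lebesgue_integral)
qed

text \<open>In this range the exponent \<open>1 - 2 * H\<close> lies strictly between 0 and 1, so
  the weight is continuous at the origin and dominated by \<open>1 + \<xi>^2\<close>.\<close>

locale hurst =
  fixes H :: real
  assumes H_pos: "0 < H" and H_less: "H < 1 / 2"
begin

abbreviation weight :: "real \<Rightarrow> real" where "weight \<xi> \<equiv> \<bar>\<xi>\<bar> powr (1 - 2 * H)"

lemma c_const_pos: "0 < c_const H"
  unfolding c_const_def using H_pos H_less
  by (intro divide_pos_pos mult_pos_pos Gamma_real_pos sin_gt_zero) (auto simp: field_simps)

lemma weight_le: "weight \<xi> \<le> 1 + \<xi>\<^sup>2"
  using H_pos H_less by (intro powr_weight_le) auto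

lemma continuous_weight: "continuous_on UNIV weight"
  using H_less by (intro continuous_on_powr' continuous_intros) auto

lemma weighted_decay:
  assumes "cmod z \<le> R / (1 + \<xi>\<^sup>2)\<^sup>2"
  shows "cmod (cnj z * complex_of_real (weight \<xi>)) \<le> R / (1 + \<xi>\<^sup>2)"
proof -
  have "cmod z * weight \<xi> \<le> R / (1 + \<xi>\<^sup>2)\<^sup>2 * (1 + \<xi>\<^sup>2)"
    using assms order_trans[OF norm_ge_zero assms] by (intro mult_mono weight_le) auto
  also have "\<dots> = R / (1 + \<xi>\<^sup>2)" by (simp add: power2_eq_square)
  finally show ?thesis by (simp add: norm_mult)
qed

lemma noise_kernel_measurable [measurable]:
  assumes "test_fun h"
  shows "noise_kernel H h \<in> borel_measurable borel"
proof -
  have [measurable]: "(\<lambda>(s, \<xi>). fourier (\<lambda>x. h (s, x)) \<xi>) \<in> borel_measurable (borel \<Otimes>\<^sub>M borel)"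
    using test_fun_borel[OF assms] by (rule fourier_slice_measurable)
  have "(\<lambda>((s, y), \<xi>). fourier (\<lambda>x. h (s, x)) \<xi>) \<in> borel_measurable ((borel \<Otimes>\<^sub>M borel) \<Otimes>\<^sub>M borel)"
    using measurable_compose[of "\<lambda>((s, y), \<xi>). (s, \<xi>)" "(borel \<Otimes>\<^sub>M borel) \<Otimes>\<^sub>M borel" "borel \<Otimes>\<^sub>M borel"
        "\<lambda>(s, \<xi>). fourier (\<lambda>x. h (s, x)) \<xi>"] by (simp add: case_prod_unfold)
  then show ?thesis unfolding noise_kernel_def borel_prod[symmetric] case_prod_unfold
    by (intro borel_measurable_times borel_measurable_const borel_measurable_Re lborel_integral_measurable)
       measurable
qed

text \<open>The bound \<open>K\<close> is what allows pairing with merely integrable functions and,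
  later, the iteration of the Volterra equation. It is the integral of the weighted decay estimate
  times the constant of the noise.\<close>

lemma test_fun_noise_kernel:
  assumes "test_fun h"
  obtains R K where "0 < R" "0 \<le> K" "\<And>z. \<bar>h z\<bar> \<le> R" "\<And>s y. \<not> (0 \<le> s \<and> s \<le> R \<and> \<bar>y\<bar> \<le> R) \<Longrightarrow> h (s, y) = 0"
    "\<And>s \<xi>. cmod (fourier (\<lambda>x. h (s, x)) \<xi>) \<le> R / (1 + \<xi>\<^sup>2)\<^sup>2"
    "\<And>z. \<bar>noise_kernel H h z\<bar> \<le> K" "\<And>s y. s < 0 \<or> R < s \<Longrightarrow> noise_kernel H h (s, y) = 0"
proof -
  obtain R where R: "0 < R" "\<And>z. \<bar>h z\<bar> \<le> R" "\<And>s y. \<not> (0 \<le> s \<and> s \<le> R \<and> \<bar>y\<bar> \<le> R) \<Longrightarrow> h (s, y) = 0"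
    "\<And>s \<xi>. cmod (fourier (\<lambda>x. h (s, x)) \<xi>) \<le> R / (1 + \<xi>\<^sup>2)\<^sup>2"
    using test_fun_bounds[OF assms] by metis
  define K where "K = c_const H * (\<integral>\<xi>. R * (1 / (1 + \<xi>\<^sup>2)) \<partial>(lborel :: real measure))"
  show thesis
  proof (rule that[of R K])
    show "0 \<le> K" unfolding K_def using c_const_pos R by (intro mult_nonneg_nonneg Bochner_Integration.integral_nonneg) auto
    show "\<bar>noise_kernel H h z\<bar> \<le> K" for z
    proof (cases z)
      case (Pair s y)
      have m: "(\<lambda>x. h (s, x)) \<in> borel_measurable borel" using test_fun_borel[OF assms] by measurable
      let ?g = "\<lambda>\<xi>. exp (- (\<i> * complex_of_real \<xi> * complex_of_real y)) *
         (cnj (fourier (\<lambda>x. h (s, x)) \<xi>) * complex_of_real (weight \<xi>))"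
      have b: "cmod (?g \<xi>) \<le> R * (1 / (1 + \<xi>\<^sup>2))" for \<xi>
        using weighted_decay[OF R(4)] by (simp add: norm_mult)
      have "\<bar>Re (\<integral>\<xi>. ?g \<xi> \<partial>lborel)\<bar> \<le> cmod (\<integral>\<xi>. ?g \<xi> \<partial>lborel)" by (rule abs_Re_le_cmod)
      also have "\<dots> \<le> (\<integral>\<xi>. cmod (?g \<xi>) \<partial>lborel)" by (rule integral_norm_bound)
      also have "\<dots> \<le> (\<integral>\<xi>. R * (1 / (1 + \<xi>\<^sup>2)) \<partial>lborel)"
      proof (rule integral_mono)
        show "integrable lborel (\<lambda>\<xi>::real. R * (1 / (1 + \<xi>\<^sup>2)))"
          using integrable_inverse_one_plus_square by (rule integrable_mult_right)
        show "integrable lborel (\<lambda>\<xi>. cmod (?g \<xi>))"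
          using b m by (intro integrable_norm integrable_decay[where R = R]) auto
      qed (rule b)
      finally show ?thesis
        unfolding Pair noise_kernel_def K_def using c_const_pos by (simp add: abs_mult)
    qed
    show "noise_kernel H h (s, y) = 0" if "s < 0 \<or> R < s" for s y
      by (intro noise_kernel_eq_0 R(3)) (use that in auto)
  qed (use R in auto)
qed

lemma weighted_fourier_integrable:
  assumes "test_fun h"
  shows "integrable lborel (\<lambda>\<xi>. cnj (fourier (\<lambda>x. h (s, x)) \<xi>) * complex_of_real (weight \<xi>))"
proof -
  obtain R where R: "\<And>s \<xi>. cmod (fourier (\<lambda>x. h (s, x)) \<xi>) \<le> R / (1 + \<xi>\<^sup>2)\<^sup>2"
    using test_fun_bounds[OF assms] by metis
  have m: "(\<lambda>x. h (s, x)) \<in> borel_measurable borel" using test_fun_borel[OF assms] by measurable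
  show ?thesis using m by (intro integrable_decay[where R = R] weighted_decay R) auto
qed

text \<open>At a fixed time the multiplication formula moves the transform from \<open>f\<close> to
  the weighted transform of \<open>h\<close>; since \<open>f\<close> is real, the real part then
  falls on the kernel alone.\<close>

lemma slice_pairing:
  assumes h: "test_fun h" and f: "integrable lborel f"
  shows "c_const H * Re (\<integral>\<xi>. fourier f \<xi> * cnj (fourier (\<lambda>x. h (s, x)) \<xi>) * complex_of_real (weight \<xi>) \<partial>lborel)
       = (\<integral>y. f y * noise_kernel H h (s, y) \<partial>lborel)"
  using integral_Re[OF fourier_pairing(2)[OF f weighted_fourier_integrable[OF h, of s]], symmetric]
  by (simp add: fourier_pairing(1)[OF f weighted_fourier_integrable[OF h, of s]] noise_kernel_def mult.assoc
      flip: integral_mult_right_zero) (simp add: mult_ac)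

lemma noise_kernel_mult_integrable:
  assumes h: "test_fun h" and f: "integrable lborel f"
  shows "integrable lborel (\<lambda>z. f z * noise_kernel H h z)"
proof -
  obtain K where K: "\<And>z. \<bar>noise_kernel H h z\<bar> \<le> K" "0 \<le> K" using test_fun_noise_kernel[OF h] by metis
  have [measurable]: "f \<in> borel_measurable borel" using f by auto
  have [measurable]: "noise_kernel H h \<in> borel_measurable borel" by (rule noise_kernel_measurable[OF h])
  show ?thesis
  proof (rule Bochner_Integration.integrable_bound[OF integrable_mult_right[OF f, of K]])
    show "AE z in lborel. norm (f z * noise_kernel H h z) \<le> norm (K * f z)"
    proof (rule AE_I2)
      fix z
      show "norm (f z * noise_kernel H h z) \<le> norm (K * f z)"
        using mult_left_mono[OF K(1)[of z], of "\<bar>f z\<bar>"] K(2) by (simp add: abs_mult mult.commute)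
    qed
  qed simp
qed

lemma test_fun_integrable: "test_fun f \<Longrightarrow> integrable lborel f"
proof -
  assume f: "test_fun f"
  obtain R where R: "\<And>z. \<bar>f z\<bar> \<le> R" "\<And>s y. \<not> (0 \<le> s \<and> s \<le> R \<and> \<bar>y\<bar> \<le> R) \<Longrightarrow> f (s, y) = 0"
    using test_fun_bounds[OF f] by metis
  show "integrable lborel f"
    using R test_fun_borel[OF f] by (intro integrable_bounded_box[of f R R]) auto
qed

lemma test_fun_slice_integrable:
  assumes "test_fun f" shows "integrable lborel (\<lambda>y. f (s, y))"
proof -
  obtain R where R: "\<And>z. \<bar>f z\<bar> \<le> R" "\<And>s y. \<not> (0 \<le> s \<and> s \<le> R \<and> \<bar>y\<bar> \<le> R) \<Longrightarrow> f (s, y) = 0"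
    using test_fun_bounds[OF assms] by metis
  have m: "(\<lambda>x. f (s, x)) \<in> borel_measurable borel" using test_fun_borel[OF assms] by measurable
  show ?thesis using R m by (intro integrable_bounded_Icc[of _ R R]) auto
qed

lemma noise_pairing_lincomb:
  assumes "test_fun h" "integrable lborel f" "integrable lborel g"
  shows "noise_pairing H (\<lambda>z. a * f z + b * g z) h = a * noise_pairing H f h + b * noise_pairing H g h"
  unfolding noise_pairing_def
  using noise_kernel_mult_integrable[OF assms(1,2)] noise_kernel_mult_integrable[OF assms(1,3)]
  by (subst Bochner_Integration.integral_mult_right_zero[symmetric])+
    (subst Bochner_Integration.integral_add[symmetric], auto simp: algebra_simps)

text \<open>Real parts suffice, since in \<open>fractional_noise\<close> the values of
  \<open>H_inner\<close> on test functions are real covariances. The rest is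
  \<open>slice_pairing\<close> integrated over time.\<close>

lemma Re_H_inner:
  assumes f: "test_fun f" and h: "test_fun h"
  shows "Re (H_inner H f h) = noise_pairing H f h"
proof -
  let ?G = "\<lambda>t. \<integral>\<xi>. fourier (\<lambda>x. f (t, x)) \<xi> * cnj (fourier (\<lambda>x. h (t, x)) \<xi>) * complex_of_real (weight \<xi>) \<partial>lborel"
  obtain R where R: "0 < R" "\<And>s y. \<not> (0 \<le> s \<and> s \<le> R \<and> \<bar>y\<bar> \<le> R) \<Longrightarrow> h (s, y) = 0"
     "\<And>s \<xi>. cmod (fourier (\<lambda>x. h (s, x)) \<xi>) \<le> R / (1 + \<xi>\<^sup>2)\<^sup>2"
    using test_fun_bounds[OF h] by metis
  obtain C where C: "0 < C" "\<And>s \<xi>. cmod (fourier (\<lambda>x. f (s, x)) \<xi>) \<le> C / (1 + \<xi>\<^sup>2)\<^sup>2"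
    using test_fun_bounds[OF f] by metis
  have [measurable]: "(\<lambda>(s, \<xi>). fourier (\<lambda>x. h (s, x)) \<xi>) \<in> borel_measurable (borel \<Otimes>\<^sub>M borel)"
    "(\<lambda>(s, \<xi>). fourier (\<lambda>x. f (s, x)) \<xi>) \<in> borel_measurable (borel \<Otimes>\<^sub>M borel)"
    using test_fun_borel[OF h] test_fun_borel[OF f] by (auto intro: fourier_slice_measurable)
  \<comment> \<open>Integrability in time is what permits taking the real part under the outer
    integral. One transform is bounded by \<open>C\<close>, the other carries the weight and is
    bounded by \<open>R / (1 + \<xi>^2)\<close>.\<close>
  have "integrable lborel (\<lambda>t. indicator {0..} t *\<^sub>R ?G t)"
  proof (rule integrable_bounded_Icc)
    show "(\<lambda>t. indicator {0..} t *\<^sub>R ?G t) \<in> borel_measurable borel"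
      by (intro borel_measurable_scaleR lborel_integral_measurable) measurable
    have b: "norm (?G t) \<le> (\<integral>\<xi>. (C * R) * (1 / (1 + \<xi>\<^sup>2)) \<partial>(lborel :: real measure))" for t
    proof (rule order_trans[OF integral_norm_bound integral_mono'])
      show "integrable lborel (\<lambda>\<xi>::real. (C * R) * (1 / (1 + \<xi>\<^sup>2)))"
        using integrable_inverse_one_plus_square by (rule integrable_mult_right)
      show "norm (fourier (\<lambda>x. f (t, x)) \<xi> * cnj (fourier (\<lambda>x. h (t, x)) \<xi>) * complex_of_real (weight \<xi>))
          \<le> (C * R) * (1 / (1 + \<xi>\<^sup>2))" for \<xi>
      proof -
        have "1 \<le> (1 + \<xi>\<^sup>2)\<^sup>2" by (simp add: one_le_power)
        then have "C / (1 + \<xi>\<^sup>2)\<^sup>2 \<le> C" using C(1) by (simp add: divide_le_eq mult_le_cancel_left1)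
        with C(2)[of t \<xi>] have "cmod (fourier (\<lambda>x. f (t, x)) \<xi>) \<le> C" by linarith
        then have "cmod (fourier (\<lambda>x. f (t, x)) \<xi>) * cmod (cnj (fourier (\<lambda>x. h (t, x)) \<xi>) * complex_of_real (weight \<xi>))
            \<le> C * (R / (1 + \<xi>\<^sup>2))"
          using C(1) by (intro mult_mono weighted_decay R(3)) auto
        then show ?thesis by (simp add: norm_mult mult.assoc)
      qed
    qed (use C R in auto)
    then show "norm (indicator {0..} t *\<^sub>R ?G t) \<le> (\<integral>\<xi>. (C * R) * (1 / (1 + \<xi>\<^sup>2)) \<partial>(lborel :: real measure))" for t
      using order_trans[OF norm_ge_zero b[of t]] b[of t] by (auto simp: indicator_def)
    show "indicator {0..} t *\<^sub>R ?G t = 0" if "R < \<bar>t\<bar>" for t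
    proof (cases "0 \<le> t")
      case True
      then have "h (t, x) = 0" for x using that by (intro R(2)) auto
      then show ?thesis by simp
    qed simp
  qed
  then have "Re (\<integral>t. indicator {0..} t *\<^sub>R ?G t \<partial>lborel) = (\<integral>t. Re (indicator {0..} t *\<^sub>R ?G t) \<partial>lborel)"
    by (rule integral_Re[symmetric])
  then have "Re (H_inner H f h) = (\<integral>t. c_const H * (indicator {0..} t * Re (?G t)) \<partial>lborel)"
    unfolding H_inner_def set_lebesgue_integral_def by simp
  also have "\<dots> = (\<integral>t. (\<integral>y. f (t, y) * noise_kernel H h (t, y) \<partial>lborel) \<partial>lborel)"
  proof (rule Bochner_Integration.integral_cong[OF refl])
    fix t
    show "c_const H * (indicator {0..} t * Re (?G t)) = (\<integral>y. f (t, y) * noise_kernel H h (t, y) \<partial>lborel)"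
    proof (cases "0 \<le> t")
      case True
      then show ?thesis using slice_pairing[OF h test_fun_slice_integrable[OF f], of t t] by simp
    next
      case False
      then have "noise_kernel H h (t, y) = 0" for y by (intro noise_kernel_eq_0 R(2)) auto
      with False show ?thesis by simp
    qed
  qed
  also have "\<dots> = noise_pairing H f h"
    unfolding noise_pairing_def
    by (rule lborel_integral_prod(1)[symmetric, OF noise_kernel_mult_integrable[OF h test_fun_integrable[OF f]]])
  finally show ?thesis .
qed

end

section \<open>Norm bounds, translation invariance and decay of the covariance\<close>

lemma weighted_amgm:
  fixes x y :: real
  assumes "0 < \<kappa>"
  shows "x * y \<le> \<kappa> / 2 * x\<^sup>2 + 1 / (2 * \<kappa>) * y\<^sup>2"
proof -
  have "0 \<le> (\<kappa> * x - y)\<^sup>2 / (2 * \<kappa>)" using assms by simp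
  also have "\<dots> = \<kappa> / 2 * x\<^sup>2 + 1 / (2 * \<kappa>) * y\<^sup>2 - x * y"
    using assms by (simp add: power2_eq_square field_simps)
  finally show ?thesis by simp
qed

lemma fourier_shift: "g \<in> borel_measurable borel \<Longrightarrow>
    fourier (\<lambda>x. g (x - a)) \<xi> = exp (- (\<i> * complex_of_real \<xi> * complex_of_real a)) * fourier g \<xi>"
proof -
  assume [measurable]: "g \<in> borel_measurable borel"
  have "fourier (\<lambda>x. g (x - a)) \<xi> = (\<integral>x. exp (- (\<i> * complex_of_real \<xi> * complex_of_real (a + x))) * complex_of_real (g (a + x - a)) \<partial>lborel)"
    unfolding fourier_def by (rule lborel_integral_translate[symmetric]) measurable
  also have "\<dots> = (\<integral>x. exp (- (\<i> * complex_of_real \<xi> * complex_of_real a)) * (exp (- (\<i> * complex_of_real \<xi> * complex_of_real x)) * complex_of_real (g x)) \<partial>lborel)"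
  proof (rule Bochner_Integration.integral_cong[OF refl])
    fix x
    have "exp (- (\<i> * complex_of_real \<xi> * complex_of_real (a + x))) =
        exp (- (\<i> * complex_of_real \<xi> * complex_of_real a)) * exp (- (\<i> * complex_of_real \<xi> * complex_of_real x))"
      by (subst exp_add[symmetric]) (simp add: algebra_simps)
    then show "exp (- (\<i> * complex_of_real \<xi> * complex_of_real (a + x))) * complex_of_real (g (a + x - a)) =
        exp (- (\<i> * complex_of_real \<xi> * complex_of_real a)) * (exp (- (\<i> * complex_of_real \<xi> * complex_of_real x)) * complex_of_real (g x))"
      by (simp only: mult.assoc add_diff_cancel_left')
  qed
  also have "\<dots> = exp (- (\<i> * complex_of_real \<xi> * complex_of_real a)) * fourier g \<xi>"
    unfolding fourier_def by (rule integral_mult_right_zero)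
  finally show ?thesis .
qed

lemma measurable_pair_lborel:
  "f \<in> measurable (N \<Otimes>\<^sub>M borel) L \<Longrightarrow> f \<in> measurable (N \<Otimes>\<^sub>M lborel) L"
  by (subst measurable_cong_sets[where M' = "N \<Otimes>\<^sub>M borel" and N' = L])
     (simp_all cong: sets_pair_measure_cong)

context hurst
begin

lemma H_norm2_slice_measurable:
  assumes [measurable]: "(\<lambda>((w, s), x). f w (s, x)) \<in> borel_measurable ((N \<Otimes>\<^sub>M borel) \<Otimes>\<^sub>M borel)"
  shows "(\<lambda>(w, s). \<integral>\<^sup>+\<xi>. ennreal ((cmod (fourier (\<lambda>x. f w (s, x)) \<xi>))\<^sup>2 * weight \<xi>) \<partial>lborel)
     \<in> borel_measurable (N \<Otimes>\<^sub>M borel)"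
proof -
  have "(\<lambda>(p, x). (\<lambda>(w, s). \<lambda>x. f w (s, x)) p x) \<in> borel_measurable ((N \<Otimes>\<^sub>M borel) \<Otimes>\<^sub>M borel)"
    using assms by (simp add: case_prod_unfold)
  from fourier_measurable[OF this]
  have m: "(\<lambda>(p, \<xi>). fourier (\<lambda>x. f (fst p) (snd p, x)) \<xi>) \<in> borel_measurable ((N \<Otimes>\<^sub>M borel) \<Otimes>\<^sub>M borel)"
    by (simp add: case_prod_unfold)
  have m': "(\<lambda>(p, \<xi>). fourier (\<lambda>x. f (fst p) (snd p, x)) \<xi>) \<in> borel_measurable ((N \<Otimes>\<^sub>M borel) \<Otimes>\<^sub>M lborel)"
    using m by (rule measurable_pair_lborel)
  have "(\<lambda>p. \<integral>\<^sup>+\<xi>. ennreal ((cmod (fourier (\<lambda>x. f (fst p) (snd p, x)) \<xi>))\<^sup>2 * weight \<xi>) \<partial>lborel) \<in> borel_measurable (N \<Otimes>\<^sub>M borel)"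
    using m' by (intro lborel.borel_measurable_nn_integral) (simp add: case_prod_unfold)
  then show ?thesis by (simp add: case_prod_unfold)
qed

lemma H_norm2_measurable:
  assumes "(\<lambda>((w, s), x). f w (s, x)) \<in> borel_measurable ((N \<Otimes>\<^sub>M borel) \<Otimes>\<^sub>M borel)"
  shows "(\<lambda>w. H_norm2 H (f w)) \<in> borel_measurable N"
proof -
  have "(\<lambda>(w, s). (\<integral>\<^sup>+\<xi>. ennreal ((cmod (fourier (\<lambda>x. f w (s, x)) \<xi>))\<^sup>2 * weight \<xi>) \<partial>lborel) * indicator {0..} s)
     \<in> borel_measurable (N \<Otimes>\<^sub>M borel)"
    using H_norm2_slice_measurable[OF assms] by (simp add: case_prod_unfold)
  then have "(\<lambda>(w, s). (\<integral>\<^sup>+\<xi>. ennreal ((cmod (fourier (\<lambda>x. f w (s, x)) \<xi>))\<^sup>2 * weight \<xi>) \<partial>lborel) * indicator {0..} s)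
     \<in> borel_measurable (N \<Otimes>\<^sub>M lborel)"
    by (rule measurable_pair_lborel)
  then show ?thesis unfolding H_norm2_def
    by (intro borel_measurable_times_ennreal lborel.borel_measurable_nn_integral) auto
qed

lemma nn_slice_measurable:
  assumes "f \<in> borel_measurable (borel :: (real \<times> real) measure)"
  shows "(\<lambda>s. \<integral>\<^sup>+\<xi>. ennreal ((cmod (fourier (\<lambda>x. f (s, x)) \<xi>))\<^sup>2 * weight \<xi>) \<partial>lborel) \<in> borel_measurable borel"
proof -
  have m: "(\<lambda>(s, \<xi>). fourier (\<lambda>x. f (s, x)) \<xi>) \<in> borel_measurable (borel \<Otimes>\<^sub>M lborel)"
    using fourier_slice_measurable[OF assms]
    by (rule measurable_pair_lborel)
  then show ?thesis by (intro lborel.borel_measurable_nn_integral) (simp add: case_prod_unfold)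
qed

lemma H_norm2_test_fun_finite:
  assumes h: "test_fun h" shows "H_norm2 H h < \<infinity>"
proof -
  obtain R where R: "0 < R" "\<And>s y. \<not> (0 \<le> s \<and> s \<le> R \<and> \<bar>y\<bar> \<le> R) \<Longrightarrow> h (s, y) = 0"
     "\<And>s \<xi>. cmod (fourier (\<lambda>x. h (s, x)) \<xi>) \<le> R / (1 + \<xi>\<^sup>2)\<^sup>2"
    using test_fun_bounds[OF h] by metis
  define K where "K = (\<integral>\<^sup>+\<xi>. ennreal (R\<^sup>2 * (1 / (1 + \<xi>\<^sup>2))) \<partial>lborel)"
  have K: "K < \<infinity>"
  proof -
    have "integrable lborel (\<lambda>\<xi>::real. R\<^sup>2 * (1 / (1 + \<xi>\<^sup>2)))"
      using integrable_inverse_one_plus_square by (rule integrable_mult_right)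
    then have "K = ennreal (\<integral>\<xi>. R\<^sup>2 * (1 / (1 + \<xi>\<^sup>2)) \<partial>lborel)"
      unfolding K_def by (intro nn_integral_eq_integral) auto
    then show ?thesis by simp
  qed
  have b: "(\<integral>\<^sup>+\<xi>. ennreal ((cmod (fourier (\<lambda>x. h (s, x)) \<xi>))\<^sup>2 * weight \<xi>) \<partial>lborel) * indicator {0..} s
      \<le> K * indicator {0..R} s" for s
  proof (cases "0 \<le> s \<and> s \<le> R")
    case True
    have "(cmod (fourier (\<lambda>x. h (s, x)) \<xi>))\<^sup>2 * weight \<xi> \<le> R\<^sup>2 * (1 / (1 + \<xi>\<^sup>2))" for \<xi>
    proof -
      have "1 \<le> (1 + \<xi>\<^sup>2)\<^sup>2" by (simp add: one_le_power)
      then have "R / (1 + \<xi>\<^sup>2)\<^sup>2 \<le> R" using R(1) by (simp add: divide_le_eq mult_le_cancel_left1)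
      with R(3)[of s \<xi>] have "cmod (fourier (\<lambda>x. h (s, x)) \<xi>) \<le> R" by linarith
      then have "cmod (fourier (\<lambda>x. h (s, x)) \<xi>) * cmod (cnj (fourier (\<lambda>x. h (s, x)) \<xi>) * complex_of_real (weight \<xi>))
          \<le> R * (R / (1 + \<xi>\<^sup>2))"
        using R(1) by (intro mult_mono weighted_decay R(3)) auto
      then show ?thesis by (simp add: norm_mult power2_eq_square mult.assoc)
    qed
    then show ?thesis using True unfolding K_def by (auto intro!: nn_integral_mono ennreal_leI)
  next
    case False
    show ?thesis
    proof (cases "0 \<le> s")
      case True
      then have "h (s, x) = 0" for x using False by (intro R(2)) auto
      then show ?thesis by simp
    qed simp
  qed
  have "(\<integral>\<^sup>+s\<in>{0..}. (\<integral>\<^sup>+\<xi>. ennreal ((cmod (fourier (\<lambda>x. h (s, x)) \<xi>))\<^sup>2 * weight \<xi>) \<partial>lborel) \<partial>lborel)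
      \<le> (\<integral>\<^sup>+s. K * indicator {0..R} s \<partial>lborel)"
    by (intro nn_integral_mono b)
  also have "\<dots> = K * ennreal R" using R by (subst nn_integral_cmult_indicator) auto
  also have "\<dots> < \<infinity>" using K by (simp add: ennreal_mult_less_top)
  finally show ?thesis unfolding H_norm2_def by (simp add: ennreal_mult_less_top)
qed

text \<open>The free parameter \<open>\<kappa>\<close> replaces the Cauchy--Schwarz inequality.\<close>

lemma noise_pairing_bound:
  assumes h: "test_fun h" and f: "integrable lborel f" and \<kappa>: "0 < \<kappa>"
  shows "ennreal \<bar>noise_pairing H f h\<bar> \<le> ennreal (\<kappa> / 2) * H_norm2 H f + ennreal (1 / (2 * \<kappa>)) * H_norm2 H h"
proof -
  have [measurable]: "f \<in> borel_measurable borel" using f by auto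
  have [measurable]: "h \<in> borel_measurable borel" using h by (rule test_fun_borel)
  let ?A = "\<lambda>f s. \<integral>\<^sup>+\<xi>. ennreal ((cmod (fourier (\<lambda>x. f (s, x)) \<xi>))\<^sup>2 * weight \<xi>) \<partial>lborel"
  have [measurable]: "?A f \<in> borel_measurable borel" "?A h \<in> borel_measurable borel"
    by (auto intro: nn_slice_measurable)
  let ?G = "\<lambda>s. \<integral>y. f (s, y) * noise_kernel H h (s, y) \<partial>lborel"
  note prod = lborel_integral_prod[OF noise_kernel_mult_integrable[OF h f]]
  have slice: "ennreal \<bar>?G s\<bar> \<le> ennreal (c_const H) * (ennreal (\<kappa> / 2) * ?A f s + ennreal (1 / (2 * \<kappa>)) * ?A h s) * indicator {0..} s"
    if int: "integrable lborel (\<lambda>y. f (s, y))" for s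
  proof (cases "0 \<le> s")
    case False
    then have "h (s, y) = 0" for y using h by (auto simp: test_fun_def)
    then have "?G s = 0" by (simp add: noise_kernel_eq_0)
    then show ?thesis by simp
  next
    case True
    let ?F = "\<lambda>\<xi>. fourier (\<lambda>x. f (s, x)) \<xi>" and ?K = "\<lambda>\<xi>. fourier (\<lambda>x. h (s, x)) \<xi>"
    let ?I = "\<lambda>\<xi>. ?F \<xi> * cnj (?K \<xi>) * complex_of_real (weight \<xi>)"
    have "integrable lborel ?I"
    proof (rule Bochner_Integration.integrable_bound)
      show "integrable lborel (\<lambda>\<xi>. complex_of_real (\<integral>x. \<bar>f (s, x)\<bar> \<partial>lborel) * (cnj (?K \<xi>) * complex_of_real (weight \<xi>)))"
        by (intro integrable_mult_right weighted_fourier_integrable[OF h])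
      show "AE \<xi> in lborel. norm (?I \<xi>) \<le> norm (complex_of_real (\<integral>x. \<bar>f (s, x)\<bar> \<partial>lborel) * (cnj (?K \<xi>) * complex_of_real (weight \<xi>)))"
        by (auto simp: norm_mult mult.assoc intro!: mult_right_mono norm_fourier_le)
    qed measurable
    then have "ennreal (cmod (\<integral>\<xi>. ?I \<xi> \<partial>lborel)) \<le> (\<integral>\<^sup>+\<xi>. ennreal (norm (?I \<xi>)) \<partial>lborel)"
      by (rule integral_norm_bound_ennreal)
    also have "\<dots> \<le> (\<integral>\<^sup>+\<xi>. ennreal (\<kappa> / 2) * ennreal ((cmod (?F \<xi>))\<^sup>2 * weight \<xi>) + ennreal (1 / (2 * \<kappa>)) * ennreal ((cmod (?K \<xi>))\<^sup>2 * weight \<xi>) \<partial>lborel)"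
    proof (rule nn_integral_mono)
      fix \<xi>
      have "norm (?I \<xi>) \<le> \<kappa> / 2 * ((cmod (?F \<xi>))\<^sup>2 * weight \<xi>) + 1 / (2 * \<kappa>) * ((cmod (?K \<xi>))\<^sup>2 * weight \<xi>)"
        using mult_right_mono[OF weighted_amgm[OF \<kappa>, of "cmod (?F \<xi>)" "cmod (?K \<xi>)"], of "weight \<xi>"]
        by (simp add: norm_mult algebra_simps)
      then show "ennreal (norm (?I \<xi>)) \<le> ennreal (\<kappa> / 2) * ennreal ((cmod (?F \<xi>))\<^sup>2 * weight \<xi>) + ennreal (1 / (2 * \<kappa>)) * ennreal ((cmod (?K \<xi>))\<^sup>2 * weight \<xi>)"
        using \<kappa> by (subst (1 2) ennreal_mult'[symmetric]) (simp_all add: ennreal_leI flip: ennreal_plus)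
    qed
    also have "\<dots> = ennreal (\<kappa> / 2) * ?A f s + ennreal (1 / (2 * \<kappa>)) * ?A h s"
      by (subst nn_integral_add) (simp_all add: nn_integral_cmult)
    finally have I: "ennreal (cmod (\<integral>\<xi>. ?I \<xi> \<partial>lborel)) \<le> ennreal (\<kappa> / 2) * ?A f s + ennreal (1 / (2 * \<kappa>)) * ?A h s" .
    have "\<bar>?G s\<bar> = c_const H * \<bar>Re (\<integral>\<xi>. ?I \<xi> \<partial>lborel)\<bar>"
      using slice_pairing[OF h int, of s, symmetric] c_const_pos by (simp add: abs_mult)
    also have "\<dots> \<le> c_const H * cmod (\<integral>\<xi>. ?I \<xi> \<partial>lborel)"
      using c_const_pos by (intro mult_left_mono abs_Re_le_cmod) auto
    finally have "ennreal \<bar>?G s\<bar> \<le> ennreal (c_const H) * ennreal (cmod (\<integral>\<xi>. ?I \<xi> \<partial>lborel))"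
      using c_const_pos by (simp add: ennreal_leI flip: ennreal_mult)
    also have "\<dots> \<le> ennreal (c_const H) * (ennreal (\<kappa> / 2) * ?A f s + ennreal (1 / (2 * \<kappa>)) * ?A h s)"
      by (intro mult_left_mono I) auto
    finally show ?thesis using True by simp
  qed
  have "ennreal \<bar>noise_pairing H f h\<bar> = ennreal (norm (\<integral>s. ?G s \<partial>lborel))"
    unfolding noise_pairing_def prod(1) by simp
  also have "\<dots> \<le> (\<integral>\<^sup>+s. ennreal (norm (?G s)) \<partial>lborel)"
    by (rule integral_norm_bound_ennreal[OF prod(3)])
  also have "\<dots> \<le> (\<integral>\<^sup>+s. ennreal (c_const H) * (ennreal (\<kappa> / 2) * ?A f s + ennreal (1 / (2 * \<kappa>)) * ?A h s) * indicator {0..} s \<partial>lborel)"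
    using lborel_integral_prod(2)[OF f] by (intro nn_integral_mono_AE) (auto elim!: eventually_mono dest!: slice)
  also have "\<dots> = (\<integral>\<^sup>+s. ennreal (\<kappa> / 2) * (ennreal (c_const H) * (?A f s * indicator {0..} s)) + ennreal (1 / (2 * \<kappa>)) * (ennreal (c_const H) * (?A h s * indicator {0..} s)) \<partial>lborel)"
    by (intro nn_integral_cong) (simp add: algebra_simps)
  also have "\<dots> = ennreal (\<kappa> / 2) * H_norm2 H f + ennreal (1 / (2 * \<kappa>)) * H_norm2 H h"
    unfolding H_norm2_def
    by (subst nn_integral_add) (simp_all add: nn_integral_cmult)
  finally show ?thesis .
qed

text \<open>A translation multiplies the transform by a phase, and the conjugate of this phase turns
  \<open>y\<close> into \<open>y - a\<close> in the outer exponential.\<close>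

lemma noise_kernel_shift:
  assumes "test_fun h" shows "noise_kernel H (space_shift a h) (s, y) = noise_kernel H h (s, y - a)"
proof -
  have [measurable]: "h \<in> borel_measurable borel" using assms by (rule test_fun_borel)
  have "fourier (\<lambda>x. h (s, x - a)) \<xi> = exp (- (\<i> * complex_of_real \<xi> * complex_of_real a)) * fourier (\<lambda>x. h (s, x)) \<xi>" for \<xi>
    by (rule fourier_shift) measurable
  moreover have "exp (- (\<i> * complex_of_real \<xi> * complex_of_real y)) * (cnj (exp (- (\<i> * complex_of_real \<xi> * complex_of_real a)) * F) * w)
     = exp (- (\<i> * complex_of_real \<xi> * complex_of_real (y - a))) * (cnj F * w)" for \<xi> F w
  proof -
    have "cnj (exp (- (\<i> * complex_of_real \<xi> * complex_of_real a))) = exp (\<i> * complex_of_real \<xi> * complex_of_real a)"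
      by (simp add: exp_cnj)
    moreover have "exp (- (\<i> * complex_of_real \<xi> * complex_of_real (y - a))) =
        exp (- (\<i> * complex_of_real \<xi> * complex_of_real y)) * exp (\<i> * complex_of_real \<xi> * complex_of_real a)"
      by (subst exp_add[symmetric]) (simp add: algebra_simps)
    ultimately show ?thesis by (simp only: complex_cnj_mult mult.assoc)
  qed
  ultimately show ?thesis unfolding noise_kernel_def by (simp only: prod.case space_shift_apply)
qed

lemma noise_pairing_shift:
  assumes f: "test_fun f" and h: "test_fun h"
  shows "noise_pairing H (space_shift a f) (space_shift a h) = noise_pairing H f h"
proof -
  have [measurable]: "f \<in> borel_measurable borel" "noise_kernel H h \<in> borel_measurable borel"
    "space_shift a f \<in> borel_measurable borel" "noise_kernel H (space_shift a h) \<in> borel_measurable borel"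
    using f h test_fun_borel noise_kernel_measurable test_fun_shift by blast+
  have "noise_pairing H (space_shift a f) (space_shift a h)
      = (\<integral>z. space_shift a f ((0, a) + z) * noise_kernel H (space_shift a h) ((0, a) + z) \<partial>lborel)"
    unfolding noise_pairing_def by (rule lborel_integral_translate[symmetric]) measurable
  also have "\<dots> = noise_pairing H f h"
    unfolding noise_pairing_def by (intro Bochner_Integration.integral_cong) (auto simp: noise_kernel_shift[OF h])
  finally show ?thesis .
qed

text \<open>Riemann--Lebesgue applies because the weighted transform is continuous, including at the
  origin where the weight vanishes.\<close>

lemma noise_kernel_shift_tendsto:
  assumes h: "test_fun h" shows "(\<lambda>n. noise_kernel H h (s, y - real n)) \<longlonglongrightarrow> 0"
proof -
  obtain R where R: "\<And>s \<xi>. cmod (fourier (\<lambda>x. h (s, x)) \<xi>) \<le> R / (1 + \<xi>\<^sup>2)\<^sup>2"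
    using test_fun_bounds[OF h] by metis
  let ?g = "\<lambda>\<xi>. cnj (fourier (\<lambda>x. h (s, x)) \<xi>) * complex_of_real (weight \<xi>)"
  have "continuous_on UNIV ?g"
    using continuous_weight fourier_continuous[OF test_fun_slice_integrable[OF h, of s]]
    by (intro continuous_on_mult continuous_on_cnj continuous_on_of_real)
  then have "(\<lambda>n. \<integral>\<xi>. exp (- (\<i> * complex_of_real \<xi> * complex_of_real (y - real n))) * ?g \<xi> \<partial>lborel) \<longlonglongrightarrow> 0"
    using R by (intro Riemann_Lebesgue_shift[where C = R] weighted_decay) auto
  from tendsto_mult[OF tendsto_const[of "c_const H"] tendsto_Re[OF this]] show ?thesis
    by (simp add: noise_kernel_def)
qed

text \<open>The source of all decorrelation below: the shifted kernels tend to 0 pointwise and have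
  the common bound \<open>K\<close>, so \<open>K * |f|\<close> is a majorant.\<close>

lemma noise_pairing_mixing:
  assumes f: "test_fun f" and h: "test_fun h"
  shows "(\<lambda>n. noise_pairing H f (space_shift (real n) h)) \<longlonglongrightarrow> 0"
proof -
  obtain K where K: "\<And>z. \<bar>noise_kernel H h z\<bar> \<le> K" "0 \<le> K" using test_fun_noise_kernel[OF h] by metis
  have [measurable]: "f \<in> borel_measurable borel" "\<And>a. noise_kernel H (space_shift a h) \<in> borel_measurable borel"
    using f h test_fun_borel noise_kernel_measurable test_fun_shift by blast+
  have "(\<lambda>n. noise_pairing H f (space_shift (real n) h)) \<longlonglongrightarrow> (\<integral>z. 0 \<partial>(lborel :: (real \<times> real) measure))"
    unfolding noise_pairing_def
  proof (rule integral_dominated_convergence[where w = "\<lambda>z. K * \<bar>f z\<bar>"])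
    show "integrable lborel (\<lambda>z. K * \<bar>f z\<bar>)"
      using test_fun_integrable[OF f] by (intro integrable_mult_right integrable_abs)
    show "AE z in lborel. (\<lambda>n. f z * noise_kernel H (space_shift (real n) h) z) \<longlonglongrightarrow> 0"
    proof (rule AE_I2)
      fix z :: "real \<times> real"
      obtain s y where z: "z = (s, y)" by (cases z)
      show "(\<lambda>n. f z * noise_kernel H (space_shift (real n) h) z) \<longlonglongrightarrow> 0"
        unfolding z noise_kernel_shift[OF h]
        by (intro tendsto_mult_right_zero noise_kernel_shift_tendsto h)
    qed
    show "AE z in lborel. norm (f z * noise_kernel H (space_shift (real n) h) z) \<le> K * \<bar>f z\<bar>" for n
    proof (rule AE_I2)
      fix z :: "real \<times> real"
      obtain s y where z: "z = (s, y)" by (cases z)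
      show "norm (f z * noise_kernel H (space_shift (real n) h) z) \<le> K * \<bar>f z\<bar>"
        unfolding z noise_kernel_shift[OF h]
        using mult_left_mono[OF K(1)[of "(s, y - real n)"], of "\<bar>f (s, y)\<bar>"] by (simp add: abs_mult mult.commute)
    qed
  qed measurable
  then show ?thesis by simp
qed

end

section \<open>Gaussian calculus for the noise\<close>

text \<open>The squared norm is kept in \<open>ennreal\<close>, as in \<open>L2_tendsto\<close>, so
  that estimates and limits carry no integrability side conditions.\<close>

definition l2 :: "'w measure \<Rightarrow> ('w \<Rightarrow> real) \<Rightarrow> ennreal" where
  "l2 M X = (\<integral>\<^sup>+\<omega>. ennreal ((X \<omega>)\<^sup>2) \<partial>M)"

lemma l2_cong_AE: "AE \<omega> in M. X \<omega> = Y \<omega> \<Longrightarrow> l2 M X = l2 M Y"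
  unfolding l2_def by (intro nn_integral_cong_AE) auto

lemma integrable_square_iff_l2:
  assumes "X \<in> borel_measurable M"
  shows "integrable M (\<lambda>\<omega>. (X \<omega>)\<^sup>2) \<longleftrightarrow> l2 M X < \<infinity>"
  using assms by (auto simp: integrable_iff_bounded l2_def)

lemma l2_eq_integral: "integrable M (\<lambda>\<omega>. (X \<omega>)\<^sup>2) \<Longrightarrow> l2 M X = ennreal (\<integral>\<omega>. (X \<omega>)\<^sup>2 \<partial>M)"
  unfolding l2_def by (intro nn_integral_eq_integral) auto

text \<open>\<open>(x + y)^2 \<le> 2 * x^2 + 2 * y^2\<close> stands in for Minkowski's inequality;
  the constants are immaterial for limits.\<close>

lemma l2_add_le:
  assumes [measurable]: "X \<in> borel_measurable M" "Y \<in> borel_measurable M"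
  shows "l2 M (\<lambda>\<omega>. X \<omega> + Y \<omega>) \<le> 2 * l2 M X + 2 * l2 M Y"
proof -
  have "l2 M (\<lambda>\<omega>. X \<omega> + Y \<omega>) \<le> (\<integral>\<^sup>+\<omega>. 2 * ennreal ((X \<omega>)\<^sup>2) + 2 * ennreal ((Y \<omega>)\<^sup>2) \<partial>M)"
    unfolding l2_def
  proof (rule nn_integral_mono)
    fix \<omega>
    have "(X \<omega> + Y \<omega>)\<^sup>2 \<le> 2 * (X \<omega>)\<^sup>2 + 2 * (Y \<omega>)\<^sup>2"
      using zero_le_power2[of "X \<omega> - Y \<omega>"] by (simp add: power2_eq_square algebra_simps)
    then show "ennreal ((X \<omega> + Y \<omega>)\<^sup>2) \<le> 2 * ennreal ((X \<omega>)\<^sup>2) + 2 * ennreal ((Y \<omega>)\<^sup>2)"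
      using ennreal_leI[of "(X \<omega> + Y \<omega>)\<^sup>2" "2 * (X \<omega>)\<^sup>2 + 2 * (Y \<omega>)\<^sup>2"]
      by (simp add: ennreal_plus ennreal_mult')
  qed
  also have "\<dots> = 2 * l2 M X + 2 * l2 M Y"
    unfolding l2_def by (subst nn_integral_add) (simp_all add: nn_integral_cmult)
  finally show ?thesis .
qed

lemma l2_minus_commute: "l2 M (\<lambda>\<omega>. X \<omega> - Y \<omega>) = l2 M (\<lambda>\<omega>. Y \<omega> - X \<omega>)"
  unfolding l2_def by (simp add: power2_commute)

lemma l2_triangle:
  assumes [measurable]: "X \<in> borel_measurable M" "Y \<in> borel_measurable M" "Z \<in> borel_measurable M"
  shows "l2 M (\<lambda>\<omega>. X \<omega> - Z \<omega>) \<le> 2 * l2 M (\<lambda>\<omega>. X \<omega> - Y \<omega>) + 2 * l2 M (\<lambda>\<omega>. Y \<omega> - Z \<omega>)"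
  using l2_add_le[of "\<lambda>\<omega>. X \<omega> - Y \<omega>" M "\<lambda>\<omega>. Y \<omega> - Z \<omega>"] by simp

lemma integrable_mult_square:
  fixes X Y :: "'w \<Rightarrow> real"
  assumes [measurable]: "X \<in> borel_measurable M" "Y \<in> borel_measurable M"
    and "integrable M (\<lambda>\<omega>. (X \<omega>)\<^sup>2)" "integrable M (\<lambda>\<omega>. (Y \<omega>)\<^sup>2)"
  shows "integrable M (\<lambda>\<omega>. X \<omega> * Y \<omega>)"
proof (rule Bochner_Integration.integrable_bound)
  show "integrable M (\<lambda>\<omega>. (X \<omega>)\<^sup>2 + (Y \<omega>)\<^sup>2)" using assms by auto
  have "\<bar>X \<omega> * Y \<omega>\<bar> \<le> (X \<omega>)\<^sup>2 + (Y \<omega>)\<^sup>2" for \<omega>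
  proof -
    have "\<bar>X \<omega>\<bar> * \<bar>Y \<omega>\<bar> * 2 \<le> \<bar>X \<omega>\<bar>\<^sup>2 + \<bar>Y \<omega>\<bar>\<^sup>2"
      using zero_le_power2[of "\<bar>X \<omega>\<bar> - \<bar>Y \<omega>\<bar>"] by (simp add: power2_eq_square algebra_simps)
    moreover have "0 \<le> \<bar>X \<omega>\<bar> * \<bar>Y \<omega>\<bar>" by simp
    ultimately show ?thesis unfolding abs_mult power2_abs by linarith
  qed
  then show "AE \<omega> in M. norm (X \<omega> * Y \<omega>) \<le> norm ((X \<omega>)\<^sup>2 + (Y \<omega>)\<^sup>2)" by simp
qed simp

context prob_space
begin

lemma integrable_of_square:
  fixes X :: "'a \<Rightarrow> real"
  assumes [measurable]: "X \<in> borel_measurable M" and "integrable M (\<lambda>\<omega>. (X \<omega>)\<^sup>2)"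
  shows "integrable M X"
  using integrable_mult_square[of X M "\<lambda>_. 1"] assms by simp

text \<open>After the modulus is taken inside, the estimate is the nonnegativity of the variance of
  \<open>|X|\<close>.\<close>

lemma expectation_mult_bounded_le:
  fixes X :: "'a \<Rightarrow> real" and g :: "'a \<Rightarrow> complex"
  assumes [measurable]: "X \<in> borel_measurable M" "g \<in> borel_measurable M" and X: "integrable M (\<lambda>\<omega>. (X \<omega>)\<^sup>2)"
    and g: "\<And>\<omega>. cmod (g \<omega>) \<le> 1"
  shows "cmod (\<integral>\<omega>. X \<omega> * g \<omega> \<partial>M) \<le> sqrt (\<integral>\<omega>. (X \<omega>)\<^sup>2 \<partial>M)"
proof -
  have iX: "integrable M X" by (rule integrable_of_square[OF assms(1) X])
  have "cmod (\<integral>\<omega>. X \<omega> * g \<omega> \<partial>M) \<le> (\<integral>\<omega>. cmod (X \<omega> * g \<omega>) \<partial>M)" by (rule integral_norm_bound)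
  also have "\<dots> \<le> (\<integral>\<omega>. \<bar>X \<omega>\<bar> \<partial>M)"
    using iX g by (intro integral_mono' integrable_abs) (auto simp: norm_mult mult_left_le)
  also have "\<dots> \<le> sqrt (\<integral>\<omega>. (X \<omega>)\<^sup>2 \<partial>M)"
  proof (rule real_le_rsqrt)
    have "0 \<le> variance (\<lambda>\<omega>. \<bar>X \<omega>\<bar>)" by (rule variance_positive)
    also have "\<dots> = (\<integral>\<omega>. (X \<omega>)\<^sup>2 \<partial>M) - (\<integral>\<omega>. \<bar>X \<omega>\<bar> \<partial>M)\<^sup>2"
      using iX X by (subst variance_eq) auto
    finally show "(\<integral>\<omega>. \<bar>X \<omega>\<bar> \<partial>M)\<^sup>2 \<le> (\<integral>\<omega>. (X \<omega>)\<^sup>2 \<partial>M)" by simp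
  qed
  finally show ?thesis .
qed

lemma integrable_mult_bounded:
  fixes X :: "'a \<Rightarrow> real" and g :: "'a \<Rightarrow> complex"
  assumes X: "integrable M X" and [measurable]: "g \<in> borel_measurable M"
    and g: "\<And>\<omega>. cmod (g \<omega>) \<le> 1"
  shows "integrable M (\<lambda>\<omega>. X \<omega> * g \<omega>)"
  using X g by (intro Bochner_Integration.integrable_bound[OF X]) (auto simp: norm_mult mult_left_le)

lemma L2_tendsto_square_integrable:
  assumes Z: "L2_tendsto M Z Z'" and sq: "\<And>n. integrable M (\<lambda>\<omega>. (Z n \<omega>)\<^sup>2)"
  shows "integrable M (\<lambda>\<omega>. (Z' \<omega>)\<^sup>2)"
proof -
  have [measurable]: "\<And>n. Z n \<in> borel_measurable M" "Z' \<in> borel_measurable M"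
    using Z by (auto simp: L2_tendsto_def)
  have "(\<lambda>n. l2 M (\<lambda>\<omega>. Z n \<omega> - Z' \<omega>)) \<longlonglongrightarrow> 0" using Z by (simp add: L2_tendsto_def l2_def)
  from order_tendstoD(2)[OF this, of 1] obtain n where n: "l2 M (\<lambda>\<omega>. Z n \<omega> - Z' \<omega>) < 1"
    by (auto simp: eventually_sequentially)
  have "l2 M Z' = l2 M (\<lambda>\<omega>. Z' \<omega> - Z n \<omega> + Z n \<omega>)" by simp
  also have "\<dots> \<le> 2 * l2 M (\<lambda>\<omega>. Z' \<omega> - Z n \<omega>) + 2 * l2 M (Z n)" by (rule l2_add_le) measurable
  also have "\<dots> < \<infinity>"
    using n sq[of n] unfolding l2_minus_commute[of M Z'] integrable_square_iff_l2[OF \<open>\<And>n. Z n \<in> _\<close>]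
    by (auto simp: ennreal_mult_less_top less_trans)
  finally show ?thesis by (simp add: integrable_square_iff_l2)
qed

text \<open>Used with \<open>g\<close> the exponential \<open>cis (W h)\<close>: identities tested
  against the noise survive \<open>L^2\<close> limits of the tested variable.\<close>

lemma L2_tendsto_expectation_mult:
  fixes g :: "'a \<Rightarrow> complex"
  assumes Z: "L2_tendsto M Z Z'" and sq: "\<And>n. integrable M (\<lambda>\<omega>. (Z n \<omega>)\<^sup>2)"
    and [measurable]: "g \<in> borel_measurable M" and g: "\<And>\<omega>. cmod (g \<omega>) \<le> 1"
  shows "(\<lambda>n. \<integral>\<omega>. Z n \<omega> * g \<omega> \<partial>M) \<longlonglongrightarrow> (\<integral>\<omega>. Z' \<omega> * g \<omega> \<partial>M)"
proof -
  have [measurable]: "\<And>n. Z n \<in> borel_measurable M" "Z' \<in> borel_measurable M"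
    using Z by (auto simp: L2_tendsto_def)
  have sq': "integrable M (\<lambda>\<omega>. (Z' \<omega>)\<^sup>2)" by (rule L2_tendsto_square_integrable[OF Z sq])
  have D: "integrable M (\<lambda>\<omega>. (Z n \<omega> - Z' \<omega>)\<^sup>2)" for n
    using sq[of n] sq' integrable_mult_square[OF _ _ sq sq', of n]
    by (simp add: power2_diff mult.assoc)
  have "(\<lambda>n. ennreal (\<integral>\<omega>. (Z n \<omega> - Z' \<omega>)\<^sup>2 \<partial>M)) \<longlonglongrightarrow> ennreal 0"
    using Z l2_eq_integral[OF D] by (simp add: L2_tendsto_def l2_def)
  then have "(\<lambda>n. \<integral>\<omega>. (Z n \<omega> - Z' \<omega>)\<^sup>2 \<partial>M) \<longlonglongrightarrow> 0"
    by (subst (asm) tendsto_ennreal_iff) auto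
  then have "(\<lambda>n. sqrt (\<integral>\<omega>. (Z n \<omega> - Z' \<omega>)\<^sup>2 \<partial>M)) \<longlonglongrightarrow> 0"
    using tendsto_real_sqrt by fastforce
  moreover have "cmod ((\<integral>\<omega>. Z n \<omega> * g \<omega> \<partial>M) - (\<integral>\<omega>. Z' \<omega> * g \<omega> \<partial>M)) \<le> sqrt (\<integral>\<omega>. (Z n \<omega> - Z' \<omega>)\<^sup>2 \<partial>M)" for n
  proof -
    have "(\<integral>\<omega>. Z n \<omega> * g \<omega> \<partial>M) - (\<integral>\<omega>. Z' \<omega> * g \<omega> \<partial>M) = (\<integral>\<omega>. complex_of_real (Z n \<omega> - Z' \<omega>) * g \<omega> \<partial>M)"
      using integrable_mult_bounded[OF integrable_of_square[OF _ sq[of n]], of g] integrable_mult_bounded[OF integrable_of_square[OF _ sq'], of g] g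
      by (subst Bochner_Integration.integral_diff[symmetric]) (auto simp: algebra_simps)
    also have "cmod \<dots> \<le> sqrt (\<integral>\<omega>. (Z n \<omega> - Z' \<omega>)\<^sup>2 \<partial>M)"
      using D g by (intro expectation_mult_bounded_le) auto
    finally show ?thesis .
  qed
  ultimately have "(\<lambda>n. (\<integral>\<omega>. Z n \<omega> * g \<omega> \<partial>M) - (\<integral>\<omega>. Z' \<omega> * g \<omega> \<partial>M)) \<longlonglongrightarrow> 0"
    by (rule Lim_null_comparison[OF always_eventually[OF allI], rotated])
  then show ?thesis by (rule LIM_zero_cancel)
qed

text \<open>In the degenerate case centering forces the constant to be 0. Otherwise the variable is
  rescaled to the standard normal law.\<close>

lemma centered_gaussian:
  assumes g: "gaussian_rv M X" and m: "(\<integral>\<omega>. X \<omega> \<partial>M) = 0"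
  shows "integrable M (\<lambda>\<omega>. (X \<omega>)\<^sup>2)"
    and "(\<integral>\<omega>. cis (X \<omega>) \<partial>M) = exp (- (\<integral>\<omega>. (X \<omega>)\<^sup>2 \<partial>M) / 2)"
proof -
  have [measurable]: "X \<in> borel_measurable M" using g by (simp add: gaussian_rv_def)
  have "integrable M (\<lambda>\<omega>. (X \<omega>)\<^sup>2) \<and> (\<integral>\<omega>. cis (X \<omega>) \<partial>M) = exp (- (\<integral>\<omega>. (X \<omega>)\<^sup>2 \<partial>M) / 2)"
  proof (cases "\<exists>\<mu>. AE \<omega> in M. X \<omega> = \<mu>")
    case True
    then obtain \<mu> where \<mu>: "AE \<omega> in M. X \<omega> = \<mu>" by blast
    then have "(\<integral>\<omega>. X \<omega> \<partial>M) = (\<integral>\<omega>. \<mu> \<partial>M)" by (intro integral_cong_AE) auto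
    then have "\<mu> = 0" using m by (simp add: prob_space)
    then have X0: "AE \<omega> in M. X \<omega> = 0" using \<mu> by simp
    then have a: "AE \<omega> in M. (X \<omega>)\<^sup>2 = 0" "AE \<omega> in M. cis (X \<omega>) = 1" by auto
    have "integrable M (\<lambda>\<omega>. (X \<omega>)\<^sup>2)"
      by (subst integrable_cong_AE[OF _ _ a(1)]) auto
    moreover have "(\<integral>\<omega>. (X \<omega>)\<^sup>2 \<partial>M) = 0" using a(1) by (simp add: integral_eq_zero_AE)
    moreover have "(\<integral>\<omega>. cis (X \<omega>) \<partial>M) = (\<integral>\<omega>. 1 \<partial>M)"
      by (rule integral_cong_AE) (use a in \<open>auto intro!: borel_measurable_continuous_on[OF continuous_on_cis] continuous_on_id\<close>)
    ultimately show ?thesis by (simp add: prob_space)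
  next
    case False
    then obtain \<mu> \<sigma> where \<sigma>: "0 < \<sigma>" and d: "distributed M lborel X (\<lambda>x. ennreal (normal_density \<mu> \<sigma> x))"
      using g by (auto simp: gaussian_rv_def)
    have \<mu>: "\<mu> = 0" using normal_distributed_expectation[OF \<sigma> d] m by simp
    have v: "(\<integral>\<omega>. (X \<omega>)\<^sup>2 \<partial>M) = \<sigma>\<^sup>2"
      using normal_distributed_variance[OF \<sigma> d] m by simp
    \<comment> \<open>A nonintegrable function has integral 0 by default, whereas the variance
      formula gives the positive number \<open>\<sigma>^2\<close>.\<close>
    have i: "integrable M (\<lambda>\<omega>. (X \<omega>)\<^sup>2)"
    proof (rule ccontr)
      assume "\<not> integrable M (\<lambda>\<omega>. (X \<omega>)\<^sup>2)"
      then have "(\<integral>\<omega>. (X \<omega>)\<^sup>2 \<partial>M) = 0" by (rule not_integrable_integral_eq)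
      with v \<sigma> show False by simp
    qed
    \<comment> \<open>The characteristic function of \<open>X / \<sigma>\<close> at \<sigma> is that
      of \<open>X\<close> at 1.\<close>
    have "distributed M lborel (\<lambda>x. (X x - \<mu>) / \<sigma>) std_normal_density"
      using d normal_standard_normal_convert[OF \<sigma>] by blast
    then have "distr M lborel (\<lambda>x. X x / \<sigma>) = std_normal_distribution"
      unfolding \<mu> by (simp add: distributed_def)
    then have "char (distr M lborel (\<lambda>x. X x / \<sigma>)) \<sigma> = complex_of_real (exp (- (\<sigma>\<^sup>2) / 2))"
      by (simp add: char_std_normal_distribution)
    moreover have "char (distr M lborel (\<lambda>x. X x / \<sigma>)) \<sigma> = (\<integral>\<omega>. iexp (\<sigma> * (X \<omega> / \<sigma>)) \<partial>M)"
      unfolding char_def by (subst integral_distr) auto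
    ultimately show ?thesis using i v \<sigma> by (simp add: cis_conv_exp)
  qed
  then show "integrable M (\<lambda>\<omega>. (X \<omega>)\<^sup>2)"
    "(\<integral>\<omega>. cis (X \<omega>) \<partial>M) = exp (- (\<integral>\<omega>. (X \<omega>)\<^sup>2 \<partial>M) / 2)" by auto
qed

end

section \<open>Almost sure linearity of the noise and Gaussian integration by parts\<close>

locale noise = hurst H for H :: real +
  fixes M :: "'w measure" and W :: "(real \<times> real \<Rightarrow> real) \<Rightarrow> 'w \<Rightarrow> real"
  assumes noise: "fractional_noise M H W"
begin

sublocale prob_space M
  using noise by (simp add: fractional_noise_def)

sublocale complete_measure M
  using noise by (simp add: fractional_noise_def)

abbreviation q :: "(real \<times> real \<Rightarrow> real) \<Rightarrow> (real \<times> real \<Rightarrow> real) \<Rightarrow> real" where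
  "q \<equiv> noise_pairing H"

lemma W_gaussian: "test_fun \<phi> \<Longrightarrow> gaussian_rv M (W \<phi>)"
proof -
  assume t: "test_fun \<phi>"
  have "gaussian_process M {\<phi>. test_fun \<phi>} W" using noise by (simp add: fractional_noise_def)
  from this[unfolded gaussian_process_def, rule_format, of "{\<phi>}" "\<lambda>_. 1"] show ?thesis using t by simp
qed

lemma W_measurable [measurable_dest]: "test_fun \<phi> \<Longrightarrow> W \<phi> \<in> borel_measurable M"
  using W_gaussian by (simp add: gaussian_rv_def)

lemma W_centered: "test_fun \<phi> \<Longrightarrow> expectation (W \<phi>) = 0"
  using noise by (simp add: fractional_noise_def)

lemma W_square_integrable: "test_fun \<phi> \<Longrightarrow> integrable M (\<lambda>\<omega>. (W \<phi> \<omega>)\<^sup>2)"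
  using centered_gaussian(1)[OF W_gaussian W_centered] .

lemma W_covariance: "test_fun \<phi> \<Longrightarrow> test_fun \<psi> \<Longrightarrow> expectation (\<lambda>\<omega>. W \<phi> \<omega> * W \<psi> \<omega>) = q \<phi> \<psi>"
proof -
  assume t: "test_fun \<phi>" "test_fun \<psi>"
  then have "complex_of_real (expectation (\<lambda>\<omega>. W \<phi> \<omega> * W \<psi> \<omega>)) = H_inner H \<phi> \<psi>"
    using noise by (simp add: fractional_noise_def)
  from arg_cong[OF this, of Re] show ?thesis using Re_H_inner[OF t] by simp
qed

text \<open>The pairing treats its two arguments differently, so symmetry is read off from the
  covariance of the noise.\<close>

lemma q_sym: "test_fun \<phi> \<Longrightarrow> test_fun \<psi> \<Longrightarrow> q \<phi> \<psi> = q \<psi> \<phi>"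
  using W_covariance[of \<phi> \<psi>] W_covariance[of \<psi> \<phi>] by (simp add: mult.commute)

lemma q_lincomb_left: "test_fun \<phi> \<Longrightarrow> test_fun \<psi> \<Longrightarrow> test_fun \<eta> \<Longrightarrow>
    q (\<lambda>z. a * \<phi> z + b * \<psi> z) \<eta> = a * q \<phi> \<eta> + b * q \<psi> \<eta>"
  by (rule noise_pairing_lincomb) (auto intro: test_fun_integrable)

lemma q_lincomb_right: "test_fun \<phi> \<Longrightarrow> test_fun \<psi> \<Longrightarrow> test_fun \<eta> \<Longrightarrow>
    q \<eta> (\<lambda>z. a * \<phi> z + b * \<psi> z) = a * q \<eta> \<phi> + b * q \<eta> \<psi>"
  using q_lincomb_left[of \<phi> \<psi> \<eta> a b] q_sym[of \<eta> "\<lambda>z. a * \<phi> z + b * \<psi> z"] q_sym[of \<eta> \<phi>] q_sym[of \<eta> \<psi>]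
  by (simp add: test_fun_lincomb)

lemma W_mult_integrable: "test_fun \<phi> \<Longrightarrow> test_fun \<psi> \<Longrightarrow> integrable M (\<lambda>\<omega>. W \<phi> \<omega> * W \<psi> \<omega>)"
  by (intro integrable_mult_square W_measurable W_square_integrable)

text \<open>Linearity is not among the axioms of the noise. It follows from the bilinearity of the
  covariance, which makes the expected square of the difference vanish; the exceptional null set
  depends on the functions and the coefficients.\<close>

lemma W_lincomb:
  assumes t: "test_fun \<phi>" "test_fun \<psi>"
  shows "AE \<omega> in M. W (\<lambda>z. a * \<phi> z + b * \<psi> z) \<omega> = a * W \<phi> \<omega> + b * W \<psi> \<omega>"
proof -
  let ?\<eta> = "\<lambda>z. a * \<phi> z + b * \<psi> z"
  have t': "test_fun ?\<eta>" using t by (rule test_fun_lincomb)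
  let ?X = "W ?\<eta>" and ?Y = "W \<phi>" and ?Z = "W \<psi>"
  note i = W_mult_integrable
  have e: "(?X \<omega> - (a * ?Y \<omega> + b * ?Z \<omega>))\<^sup>2 = ?X \<omega> * ?X \<omega> + a * a * (?Y \<omega> * ?Y \<omega>) + b * b * (?Z \<omega> * ?Z \<omega>)
      + 2 * a * b * (?Y \<omega> * ?Z \<omega>) - 2 * a * (?X \<omega> * ?Y \<omega>) - 2 * b * (?X \<omega> * ?Z \<omega>)" for \<omega>
    by (simp add: power2_eq_square algebra_simps)
  have int: "integrable M (\<lambda>\<omega>. (?X \<omega> - (a * ?Y \<omega> + b * ?Z \<omega>))\<^sup>2)"
    unfolding e
    by (intro Bochner_Integration.integrable_add Bochner_Integration.integrable_diff integrable_mult_right i t t')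
  have "expectation (\<lambda>\<omega>. (?X \<omega> - (a * ?Y \<omega> + b * ?Z \<omega>))\<^sup>2)
      = q ?\<eta> ?\<eta> + a * a * q \<phi> \<phi> + b * b * q \<psi> \<psi> + 2 * a * b * q \<phi> \<psi> - 2 * a * q ?\<eta> \<phi> - 2 * b * q ?\<eta> \<psi>"
    unfolding e
    by (subst Bochner_Integration.integral_add Bochner_Integration.integral_diff,
       (intro Bochner_Integration.integrable_add Bochner_Integration.integrable_diff integrable_mult_right i t t')+)+
      (simp add: W_covariance t t')
  also have "\<dots> = 0"
    unfolding q_lincomb_left[OF t t'] q_lincomb_right[OF t t(1)] q_lincomb_right[OF t t(2)]
      q_lincomb_left[OF t t(1)] q_lincomb_left[OF t t(2)] q_sym[OF t(2,1)]
    by (simp add: algebra_simps)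
  finally have "AE \<omega> in M. (?X \<omega> - (a * ?Y \<omega> + b * ?Z \<omega>))\<^sup>2 = 0"
    using integral_nonneg_eq_0_iff_AE[OF int] by simp
  then show ?thesis by simp
qed

lemma W_cis: "test_fun \<phi> \<Longrightarrow> expectation (\<lambda>\<omega>. cis (W \<phi> \<omega>)) = exp (- q \<phi> \<phi> / 2)"
  using centered_gaussian(2)[OF W_gaussian W_centered, of \<phi>] W_covariance[of \<phi> \<phi>]
  by (simp add: power2_eq_square)

lemma cis_measurable [measurable (raw)]:
  "f \<in> borel_measurable N \<Longrightarrow> (\<lambda>x. cis (f x)) \<in> borel_measurable N"
  by (intro borel_measurable_continuous_on[OF continuous_on_cis]) (auto intro: continuous_on_id)

text \<open>Gaussian integration by parts, obtained by differentiating the characteristic functional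
  at \<open>s * \<phi> + k\<close> with respect to \<open>s\<close> at 0.\<close>

lemma W_mult_cis:
  assumes t: "test_fun \<phi>" "test_fun k"
  shows "expectation (\<lambda>\<omega>. W \<phi> \<omega> * cis (W k \<omega>)) = \<i> * q \<phi> k * exp (- q k k / 2)"
proof -
  let ?X = "W \<phi>" and ?Y = "W k"
  have [measurable]: "?X \<in> borel_measurable M" "?Y \<in> borel_measurable M" using t W_measurable by auto
  define e where "e n = 1 / real (Suc n)" for n
  have e: "e \<longlonglongrightarrow> 0" "\<And>n. 0 < e n" unfolding e_def using LIMSEQ_inverse_real_of_nat
    by (auto simp: inverse_eq_divide)
  have iX: "integrable M ?X" by (rule integrable_of_square) (use t W_square_integrable in auto)
  \<comment> \<open>The difference quotients of the exponential are bounded by \<open>|X|\<close>,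
    which justifies dominated convergence.\<close>
  have lim1: "(\<lambda>n. expectation (\<lambda>\<omega>. complex_of_real (1 / e n) * (cis (e n * ?X \<omega>) - 1) * cis (?Y \<omega>)))
      \<longlonglongrightarrow> expectation (\<lambda>\<omega>. \<i> * complex_of_real (?X \<omega>) * cis (?Y \<omega>))"
  proof (rule integral_dominated_convergence[where w = "\<lambda>\<omega>. \<bar>?X \<omega>\<bar>"])
    show "AE \<omega> in M. (\<lambda>n. complex_of_real (1 / e n) * (cis (e n * ?X \<omega>) - 1) * cis (?Y \<omega>))
        \<longlonglongrightarrow> \<i> * complex_of_real (?X \<omega>) * cis (?Y \<omega>)"
    proof (intro AE_I2 tendsto_mult_right)
      fix \<omega>
      let ?x = "?X \<omega>"
      have b: "norm (complex_of_real (1 / e n) * (cis (e n * ?x) - 1) - \<i> * complex_of_real ?x) \<le> e n * (?x\<^sup>2 / 2)" for n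
      proof -
        have "cmod (cis (e n * ?x) - (1 + \<i> * complex_of_real (e n * ?x))) \<le> \<bar>e n * ?x\<bar>\<^sup>2 / 2"
          using iexp_approx1[of "e n * ?x" 1] by (simp add: cis_conv_exp numeral_2_eq_2)
        then have c: "cmod (complex_of_real (1 / e n)) * cmod (cis (e n * ?x) - (1 + \<i> * complex_of_real (e n * ?x)))
             \<le> 1 / e n * (\<bar>e n * ?x\<bar>\<^sup>2 / 2)"
          using e(2)[of n] by (intro mult_mono) (auto simp: norm_divide)
        have "complex_of_real (1 / e n) * (cis (e n * ?x) - 1) - \<i> * complex_of_real ?x
            = complex_of_real (1 / e n) * (cis (e n * ?x) - (1 + \<i> * complex_of_real (e n * ?x)))"
          using e(2)[of n] by (simp add: field_simps)
        with c show ?thesis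
          using e(2)[of n] unfolding norm_mult[symmetric] by (simp add: power2_eq_square mult_ac)
      qed
      have "(\<lambda>n. e n * (?x\<^sup>2 / 2)) \<longlonglongrightarrow> 0" using e(1) by (rule tendsto_mult_left_zero)
      then have "(\<lambda>n. complex_of_real (1 / e n) * (cis (e n * ?x) - 1) - \<i> * complex_of_real ?x) \<longlonglongrightarrow> 0"
        by (rule Lim_null_comparison[OF always_eventually[OF allI], rotated]) (rule b)
      then show "(\<lambda>n. complex_of_real (1 / e n) * (cis (e n * ?x) - 1)) \<longlonglongrightarrow> \<i> * complex_of_real ?x"
        by (rule LIM_zero_cancel)
    qed
    show "AE \<omega> in M. norm (complex_of_real (1 / e n) * (cis (e n * ?X \<omega>) - 1) * cis (?Y \<omega>)) \<le> \<bar>?X \<omega>\<bar>" for n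
    proof (rule AE_I2)
      fix \<omega>
      have "cmod (cis (e n * ?X \<omega>) - 1) \<le> \<bar>e n * ?X \<omega>\<bar>"
        using iexp_approx1[of "e n * ?X \<omega>" 0] by (simp add: cis_conv_exp)
      then show "norm (complex_of_real (1 / e n) * (cis (e n * ?X \<omega>) - 1) * cis (?Y \<omega>)) \<le> \<bar>?X \<omega>\<bar>"
        using e(2)[of n] by (simp add: norm_mult norm_divide divide_le_eq abs_mult mult.commute)
    qed
  qed (use iX in auto)
  \<comment> \<open>This is the value of the characteristic functional at
    \<open>s * \<phi> + k\<close>, with the quadratic form expanded.\<close>
  define f where "f s = exp (- (s * s * q \<phi> \<phi> + 2 * s * q \<phi> k + q k k) / 2)" for s
  have ev: "expectation (\<lambda>\<omega>. complex_of_real (1 / e n) * (cis (e n * ?X \<omega>) - 1) * cis (?Y \<omega>))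
      = complex_of_real ((f (e n) - f 0) / e n)" for n
  proof -
    let ?k = "\<lambda>z. e n * \<phi> z + 1 * k z"
    have tk: "test_fun ?k" by (rule test_fun_lincomb[OF t])
    have qk: "q ?k ?k = e n * e n * q \<phi> \<phi> + 2 * e n * q \<phi> k + q k k"
      unfolding q_lincomb_left[OF t tk] q_lincomb_right[OF t t(1)] q_lincomb_right[OF t t(2)] q_sym[OF t(2,1)]
      by (simp add: algebra_simps)
    have ic: "integrable M (\<lambda>\<omega>. cis (W h \<omega>))" if "test_fun h" for h
      by (rule integrable_const_bound[of _ 1]) (use that W_measurable in auto)
    have "expectation (\<lambda>\<omega>. complex_of_real (1 / e n) * (cis (e n * ?X \<omega>) - 1) * cis (?Y \<omega>))
       = expectation (\<lambda>\<omega>. complex_of_real (1 / e n) * (cis (W ?k \<omega>) - cis (?Y \<omega>)))"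
    proof (rule integral_cong_AE)
      show "AE \<omega> in M. complex_of_real (1 / e n) * (cis (e n * ?X \<omega>) - 1) * cis (?Y \<omega>)
         = complex_of_real (1 / e n) * (cis (W ?k \<omega>) - cis (?Y \<omega>))"
        using W_lincomb[OF t, of "e n" 1] by eventually_elim (simp add: cis_mult[symmetric] algebra_simps)
    qed (use W_measurable[OF tk] in auto)
    also have "\<dots> = complex_of_real (1 / e n) * (exp (- q ?k ?k / 2) - exp (- q k k / 2))"
      by (subst integral_mult_right_zero, subst Bochner_Integration.integral_diff[OF ic[OF tk] ic[OF t(2)]])
        (simp only: W_cis[OF tk] W_cis[OF t(2)] of_real_diff)
    finally show ?thesis unfolding qk f_def by simp
  qed
  have "(f has_real_derivative (- q \<phi> k * exp (- q k k / 2))) (at 0)"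
    unfolding f_def by (auto intro!: derivative_eq_intros)
  then have "((\<lambda>h. (f h - f 0) / h) \<longlongrightarrow> - q \<phi> k * exp (- q k k / 2)) (at 0)"
    by (simp add: DERIV_def)
  moreover have "filterlim e (at 0) sequentially"
    using e(1) less_imp_neq[OF e(2), symmetric] by (simp add: filterlim_at)
  ultimately have "(\<lambda>n. (f (e n) - f 0) / e n) \<longlonglongrightarrow> - q \<phi> k * exp (- q k k / 2)"
    by (rule filterlim_compose)
  then have "(\<lambda>n. complex_of_real ((f (e n) - f 0) / e n)) \<longlonglongrightarrow> complex_of_real (- q \<phi> k * exp (- q k k / 2))"
    by (rule tendsto_of_real)
  with lim1 have "expectation (\<lambda>\<omega>. \<i> * complex_of_real (?X \<omega>) * cis (?Y \<omega>)) = complex_of_real (- q \<phi> k * exp (- q k k / 2))"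
    unfolding ev by (rule LIMSEQ_unique)
  then have "\<i> * expectation (\<lambda>\<omega>. ?X \<omega> * cis (?Y \<omega>)) = complex_of_real (- q \<phi> k * exp (- q k k / 2))"
    by (simp add: mult.assoc)
  then have "\<i> * (\<i> * expectation (\<lambda>\<omega>. ?X \<omega> * cis (?Y \<omega>))) = \<i> * complex_of_real (- q \<phi> k * exp (- q k k / 2))"
    by (rule arg_cong)
  then show ?thesis by (simp add: mult.assoc[symmetric])
qed

lemma wiener_integral_square_integrable:
  assumes "wiener_integral M H W f Z"
  shows "Z \<in> borel_measurable M" "integrable M (\<lambda>\<omega>. (Z \<omega>)\<^sup>2)"
proof -
  obtain \<phi> where \<phi>: "\<And>n. test_fun (\<phi> n)" "L2_tendsto M (\<lambda>n. W (\<phi> n)) Z"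
    using assms unfolding wiener_integral_def by blast
  show "Z \<in> borel_measurable M" using \<phi>(2) by (simp add: L2_tendsto_def)
  show "integrable M (\<lambda>\<omega>. (Z \<omega>)\<^sup>2)"
    by (rule L2_tendsto_square_integrable[OF \<phi>(2) W_square_integrable[OF \<phi>(1)]])
qed

text \<open>The \<kappa>-family plays the part of the Cauchy--Schwarz inequality: a large \<kappa>
  makes the constant term small, and then a large \<open>n\<close> makes the first term
  small.\<close>

lemma null_of_weighted_bounds:
  fixes x :: "nat \<Rightarrow> real" and e :: "nat \<Rightarrow> ennreal"
  assumes b: "\<And>\<kappa> n. 0 < \<kappa> \<Longrightarrow> ennreal \<bar>x n\<bar> \<le> ennreal (\<kappa> / 2) * e n + ennreal (1 / (2 * \<kappa>)) * B"
    and e: "e \<longlonglongrightarrow> 0" and B: "B < \<infinity>"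
  shows "x \<longlonglongrightarrow> 0"
proof (rule LIMSEQ_I)
  fix r :: real assume r: "0 < r"
  define b where "b = enn2real B"
  have Bb: "B = ennreal b" "0 \<le> b" using B by (auto simp: b_def)
  \<comment> \<open>With this choice \<open>b / (2 * \<kappa>) \<le> r / 2\<close>; adding 1 to
    \<open>b\<close> keeps \<kappa> positive when \<open>B\<close> is zero.\<close>
  define \<kappa> where "\<kappa> = (b + 1) / r"
  have \<kappa>: "0 < \<kappa>" using r Bb by (simp add: \<kappa>_def)
  have "1 / (2 * \<kappa>) * b \<le> r / 2" using r Bb \<kappa> unfolding \<kappa>_def by (simp add: field_simps)
  then have 1: "ennreal (1 / (2 * \<kappa>)) * B \<le> ennreal (r / 2)"
    unfolding Bb(1) using \<kappa> Bb(2) by (subst ennreal_mult[symmetric]) (auto intro: ennreal_leI)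
  have "(\<lambda>n. ennreal (\<kappa> / 2) * e n) \<longlonglongrightarrow> ennreal (\<kappa> / 2) * 0"
    using e by (intro ennreal_tendsto_cmult) auto
  then have "\<forall>\<^sub>F n in sequentially. ennreal (\<kappa> / 2) * e n < ennreal (r / 4)"
    using r by (intro order_tendstoD(2)) auto
  then obtain N where N: "\<And>n. N \<le> n \<Longrightarrow> ennreal (\<kappa> / 2) * e n < ennreal (r / 4)"
    by (auto simp: eventually_sequentially)
  have "norm (x n - 0) < r" if "N \<le> n" for n
  proof -
    have "ennreal \<bar>x n\<bar> \<le> ennreal (r / 4) + ennreal (r / 2)"
      using order_trans[OF b[OF \<kappa>, of n] add_mono[OF less_imp_le[OF N[OF that]] 1]] .
    also have "\<dots> < ennreal r" using r by (simp add: ennreal_less_iff flip: ennreal_plus)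
    finally show ?thesis using r by (simp add: ennreal_less_iff)
  qed
  then show "\<exists>N. \<forall>n\<ge>N. norm (x n - 0) < r" by blast
qed

text \<open>Integration by parts passes from test functions to \<open>f\<close>: \<open>L^2\<close>
  convergence controls the left side, and \<open>noise_pairing_bound\<close> turns convergence in
  the norm of the noise into convergence of the pairings on the right.\<close>

lemma wiener_integral_cis:
  assumes Z: "wiener_integral M H W f Z" and f: "integrable lborel f" and k: "test_fun k"
  shows "expectation (\<lambda>\<omega>. Z \<omega> * cis (W k \<omega>)) = \<i> * q f k * exp (- q k k / 2)"
proof -
  obtain \<phi> where \<phi>: "\<And>n. test_fun (\<phi> n)" "(\<lambda>n. H_norm2 H (\<lambda>z. \<phi> n z - f z)) \<longlonglongrightarrow> 0" "L2_tendsto M (\<lambda>n. W (\<phi> n)) Z"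
    using Z unfolding wiener_integral_def by blast
  have [measurable]: "W k \<in> borel_measurable M" by (rule W_measurable[OF k])
  have "(\<lambda>n. expectation (\<lambda>\<omega>. W (\<phi> n) \<omega> * cis (W k \<omega>))) \<longlonglongrightarrow> expectation (\<lambda>\<omega>. Z \<omega> * cis (W k \<omega>))"
    by (rule L2_tendsto_expectation_mult[OF \<phi>(3) W_square_integrable[OF \<phi>(1)]]) auto
  then have lim: "(\<lambda>n. \<i> * q (\<phi> n) k * exp (- q k k / 2)) \<longlonglongrightarrow> expectation (\<lambda>\<omega>. Z \<omega> * cis (W k \<omega>))"
    unfolding W_mult_cis[OF \<phi>(1) k] .
  have i: "integrable lborel (\<lambda>z. \<phi> n z - f z)" for n
    using test_fun_integrable[OF \<phi>(1)] f by (rule Bochner_Integration.integrable_diff)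
  have "q (\<lambda>z. \<phi> n z - f z) k = q (\<phi> n) k - q f k" for n
    using noise_pairing_lincomb[OF k test_fun_integrable[OF \<phi>(1)] f, of 1 n "-1"] by simp
  moreover have "(\<lambda>n. q (\<lambda>z. \<phi> n z - f z) k) \<longlonglongrightarrow> 0"
    using noise_pairing_bound[OF k i] \<phi>(2) H_norm2_test_fun_finite[OF k] by (rule null_of_weighted_bounds)
  ultimately have "(\<lambda>n. q (\<phi> n) k) \<longlonglongrightarrow> q f k" by (simp add: LIM_zero_cancel)
  then have "(\<lambda>n. \<i> * q (\<phi> n) k * exp (- q k k / 2)) \<longlonglongrightarrow> \<i> * q f k * exp (- q k k / 2)"
    by (intro tendsto_intros)
  with lim show ?thesis by (rule LIMSEQ_unique)
qed

end

section \<open>Trigonometric polynomials of the noise\<close>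

lemma space_shift_lincomb [simp]: "space_shift a (\<lambda>z. r * h z + s * k z) = (\<lambda>z. r * space_shift a h z + s * space_shift a k z)"
  by (auto simp: space_shift_def)

lemma space_shift_0 [simp]: "space_shift 0 h = h"
  by (auto simp: space_shift_def)

lemma l2_dominated:
  assumes [measurable]: "\<And>n. X n \<in> borel_measurable M" and Y: "integrable M (\<lambda>\<omega>. (Y \<omega>)\<^sup>2)"
    and b: "\<And>n \<omega>. \<omega> \<in> space M \<Longrightarrow> \<bar>X n \<omega>\<bar> \<le> \<bar>Y \<omega>\<bar>" and l: "\<And>\<omega>. \<omega> \<in> space M \<Longrightarrow> (\<lambda>n. X n \<omega>) \<longlonglongrightarrow> 0"
  shows "(\<lambda>n. l2 M (X n)) \<longlonglongrightarrow> 0"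
proof -
  have b2: "(X n \<omega>)\<^sup>2 \<le> (Y \<omega>)\<^sup>2" if "\<omega> \<in> space M" for n \<omega>
    using b[OF that] by (simp add: abs_le_square_iff)
  have i: "integrable M (\<lambda>\<omega>. (X n \<omega>)\<^sup>2)" for n
    using Y by (rule Bochner_Integration.integrable_bound) (use b2 in auto)
  have "(\<lambda>n. \<integral>\<omega>. (X n \<omega>)\<^sup>2 \<partial>M) \<longlonglongrightarrow> (\<integral>\<omega>. 0 \<partial>M)"
  proof (rule integral_dominated_convergence[OF _ _ Y])
    show "AE \<omega> in M. (\<lambda>n. (X n \<omega>)\<^sup>2) \<longlonglongrightarrow> 0"
    proof (rule AE_I2)
      fix \<omega> assume "\<omega> \<in> space M"
      from tendsto_power[OF l[OF this], of 2] show "(\<lambda>n. (X n \<omega>)\<^sup>2) \<longlonglongrightarrow> 0" by simp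
    qed
  qed (use b2 in auto)
  then have "(\<lambda>n. ennreal (\<integral>\<omega>. (X n \<omega>)\<^sup>2 \<partial>M)) \<longlonglongrightarrow> ennreal 0"
    by (intro tendsto_ennrealI) simp
  then show ?thesis using l2_eq_integral[OF i] by simp
qed

lemma l2_le_bound:
  assumes "prob_space M" "0 \<le> c" "AE \<omega> in M. \<bar>X \<omega>\<bar> \<le> c"
  shows "l2 M X \<le> ennreal (c\<^sup>2)"
proof -
  interpret prob_space M by fact
  have "l2 M X \<le> (\<integral>\<^sup>+\<omega>. ennreal (c\<^sup>2) \<partial>M)"
    unfolding l2_def using assms(3)
    by (intro nn_integral_mono_AE) (auto elim!: eventually_mono intro!: ennreal_leI simp: abs_le_square_iff[symmetric] assms(2))
  then show ?thesis by (simp add: emeasure_space_1)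
qed

lemma l2_mult_le:
  assumes "\<And>\<omega>. \<bar>Y \<omega>\<bar> \<le> c * \<bar>X \<omega>\<bar>" and [measurable]: "X \<in> borel_measurable M"
  shows "l2 M Y \<le> ennreal (c\<^sup>2) * l2 M X"
proof -
  have "l2 M Y \<le> (\<integral>\<^sup>+\<omega>. ennreal (c\<^sup>2) * ennreal ((X \<omega>)\<^sup>2) \<partial>M)"
    unfolding l2_def
  proof (rule nn_integral_mono)
    fix \<omega>
    have "(Y \<omega>)\<^sup>2 \<le> (c * \<bar>X \<omega>\<bar>)\<^sup>2" using assms(1)[of \<omega>] by (metis abs_ge_zero power2_abs power_mono)
    then show "ennreal ((Y \<omega>)\<^sup>2) \<le> ennreal (c\<^sup>2) * ennreal ((X \<omega>)\<^sup>2)"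
      by (simp add: ennreal_leI power_mult_distrib flip: ennreal_mult')
  qed
  then show ?thesis unfolding l2_def by (simp add: nn_integral_cmult)
qed

lemma ennreal_tendsto_0_le:
  fixes x y :: "nat \<Rightarrow> ennreal"
  assumes "y \<longlonglongrightarrow> 0" "\<And>n. x n \<le> y n" shows "x \<longlonglongrightarrow> 0"
  using assms(1) by (rule tendsto_sandwich[rotated 2, OF tendsto_const]) (use assms(2) in auto)

lemma ennreal_tendsto_0_cmult:
  fixes x :: "nat \<Rightarrow> ennreal"
  assumes "x \<longlonglongrightarrow> 0" "c < \<infinity>" shows "(\<lambda>n. c * x n) \<longlonglongrightarrow> 0"
  using ennreal_tendsto_cmult[OF _ assms(1), of c] assms(2) by simp

lemma ennreal_tendsto_0_add:
  fixes x y :: "nat \<Rightarrow> ennreal"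
  assumes "x \<longlonglongrightarrow> 0" "y \<longlonglongrightarrow> 0" shows "(\<lambda>n. x n + y n) \<longlonglongrightarrow> 0"
  using tendsto_add[OF assms] by simp

text \<open>An entry \<open>(c, h)\<close> stands for the real part of \<open>c * cis (W h)\<close>,
  so that one complex coefficient covers cosine and sine. A list can be shifted and multiplied
  exactly, while its evaluation respects products only almost surely.\<close>

type_synonym trig = "(complex \<times> (real \<times> real \<Rightarrow> real)) list"

definition trig_shift :: "real \<Rightarrow> trig \<Rightarrow> trig" where
  "trig_shift a L = map (\<lambda>(c, h). (c, space_shift a h)) L"

definition trig_scale :: "real \<Rightarrow> trig \<Rightarrow> trig" where
  "trig_scale r L = map (\<lambda>(c, h). (complex_of_real r * c, h)) L"

text \<open>The product formula \<open>2 * Re u * Re v = Re (u * v) + Re (u * cnj v)\<close>,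
  applied entry by entry. The factors \<open>1\<close> and \<open>-1\<close> are written out so that
  the entries have the shape of \<open>W_lincomb\<close>.\<close>

definition trig_mult :: "trig \<Rightarrow> trig \<Rightarrow> trig" where
  "trig_mult L L' = concat (map (\<lambda>(c, h). concat (map (\<lambda>(d, k).
     [(c * d / 2, \<lambda>z. 1 * h z + 1 * k z), (c * cnj d / 2, \<lambda>z. 1 * h z + (-1) * k z)]) L')) L)"

definition trig_bound :: "trig \<Rightarrow> real" where
  "trig_bound L = (\<Sum>(c, h)\<leftarrow>L. cmod c)"

lemma trig_shift_simps [simp]:
  "trig_shift a [] = []" "trig_shift a ((c, h) # L) = (c, space_shift a h) # trig_shift a L"
  "trig_shift a (L @ L') = trig_shift a L @ trig_shift a L'"
  by (simp_all add: trig_shift_def)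

lemma trig_shift_0 [simp]: "trig_shift 0 L = L"
  by (simp add: trig_shift_def map_idI)

lemma trig_shift_scale: "trig_shift a (trig_scale r L) = trig_scale r (trig_shift a L)"
  by (auto simp: trig_shift_def trig_scale_def)

lemma trig_shift_mult: "trig_shift a (trig_mult L L') = trig_mult (trig_shift a L) (trig_shift a L')"
  by (auto simp: trig_shift_def trig_mult_def map_concat o_def case_prod_unfold space_shift_def)

lemma trig_bound_shift [simp]: "trig_bound (trig_shift a L) = trig_bound L"
  by (auto simp: trig_bound_def trig_shift_def o_def case_prod_unfold)

lemma trig_bound_nonneg: "0 \<le> trig_bound L"
  unfolding trig_bound_def by (intro sum_list_nonneg) auto

text \<open>There are two instances: all test functions, and those that vanish after a given time,
  which generate the filtration.\<close>

definition test_space :: "(real \<times> real \<Rightarrow> real) set \<Rightarrow> bool" where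
  "test_space T \<longleftrightarrow> (\<forall>h\<in>T. test_fun h) \<and> (\<lambda>_. 0) \<in> T \<and>
     (\<forall>h\<in>T. \<forall>k\<in>T. \<forall>r s. (\<lambda>z. r * h z + s * k z) \<in> T)"

definition trig_over :: "(real \<times> real \<Rightarrow> real) set \<Rightarrow> trig \<Rightarrow> bool" where
  "trig_over T L \<longleftrightarrow> (\<forall>x\<in>set L. snd x \<in> T)"

lemma trig_over_simps [simp]: "trig_over T []" "trig_over T ((c, h) # L) \<longleftrightarrow> h \<in> T \<and> trig_over T L"
   "trig_over T (L @ L') \<longleftrightarrow> trig_over T L \<and> trig_over T L'" "trig_over T (trig_scale r L) \<longleftrightarrow> trig_over T L"
  by (auto simp: trig_over_def trig_scale_def)

lemma trig_over_mult:
  assumes T: "test_space T" and L: "trig_over T L" "trig_over T L'"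
  shows "trig_over T (trig_mult L L')"
proof -
  have c: "h \<in> T \<Longrightarrow> k \<in> T \<Longrightarrow> (\<lambda>z. r * h z + s * k z) \<in> T" for h k r s
    using T by (auto simp: test_space_def)
  have "h \<in> T \<Longrightarrow> k \<in> T \<Longrightarrow> (\<lambda>z. h z + k z) \<in> T" "h \<in> T \<Longrightarrow> k \<in> T \<Longrightarrow> (\<lambda>z. h z - k z) \<in> T" for h k
    using c[of h k 1 1] c[of h k 1 "-1"] by auto
  then show ?thesis using L by (fastforce simp: trig_over_def trig_mult_def)
qed

lemma trig_over_test_fun: "test_space T \<Longrightarrow> trig_over T L \<Longrightarrow> trig_over {h. test_fun h} L"
  by (auto simp: trig_over_def test_space_def)

lemma trig_over_test_fun_shift: "trig_over {h. test_fun h} L \<Longrightarrow> trig_over {h. test_fun h} (trig_shift a L)"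
  by (force simp: trig_over_def trig_shift_def intro: test_fun_shift)

section \<open>Evaluation of trigonometric polynomials, and the functionals they approximate\<close>

context noise
begin

definition trig :: "trig \<Rightarrow> 'w \<Rightarrow> real" where
  "trig L \<omega> = (\<Sum>(c, h)\<leftarrow>L. Re (c * cis (W h \<omega>)))"

lemma trig_simps [simp]: "trig [] \<omega> = 0" "trig ((c, h) # L) \<omega> = Re (c * cis (W h \<omega>)) + trig L \<omega>"
  "trig (L @ L') \<omega> = trig L \<omega> + trig L' \<omega>"
  by (simp_all add: trig_def)

lemma trig_scale [simp]: "trig (trig_scale r L) \<omega> = r * trig L \<omega>"
  by (induction L) (auto simp: trig_scale_def trig_def algebra_simps)

lemma trig_measurable: "trig_over {h. test_fun h} L \<Longrightarrow> trig L \<in> borel_measurable M"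
proof (induction L)
  case Nil
  have "trig [] = (\<lambda>_. 0)" by (rule ext) simp
  then show ?case by simp
next
  case (Cons x L)
  obtain c h where x: "x = (c, h)" by (cases x)
  have [measurable]: "W h \<in> borel_measurable M" "trig L \<in> borel_measurable M"
    using Cons x by (auto intro: W_measurable)
  have "trig (x # L) = (\<lambda>\<omega>. Re (c * cis (W h \<omega>)) + trig L \<omega>)" by (rule ext) (simp add: x)
  then show ?case by simp
qed

lemma trig_bounded: "\<bar>trig L \<omega>\<bar> \<le> trig_bound L"
proof (induction L)
  case (Cons x L)
  obtain c h where x: "x = (c, h)" by (cases x)
  have "\<bar>Re (c * cis (W h \<omega>))\<bar> \<le> cmod c" using abs_Re_le_cmod[of "c * cis (W h \<omega>)"] by (simp add: norm_mult)
  with Cons show ?case by (auto simp: x trig_bound_def simp del: times_complex.sel)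
qed (simp add: trig_bound_def)

text \<open>The null set of \<open>W_lincomb\<close> depends on the pair of test functions. Only
  finitely many pairs occur, so all null sets are removed at once, and a computation at a fixed
  \<omega> remains.\<close>

lemma trig_mult_AE:
  assumes "trig_over {h. test_fun h} L" "trig_over {h. test_fun h} L'"
  shows "AE \<omega> in M. trig (trig_mult L L') \<omega> = trig L \<omega> * trig L' \<omega>"
proof -
  have "AE \<omega> in M. \<forall>h\<in>snd ` set L. \<forall>k\<in>snd ` set L'. W (\<lambda>z. 1 * h z + 1 * k z) \<omega> = 1 * W h \<omega> + 1 * W k \<omega>
     \<and> W (\<lambda>z. 1 * h z + (-1) * k z) \<omega> = 1 * W h \<omega> + (-1) * W k \<omega>"
    using assms by (intro AE_finite_allI AE_conjI W_lincomb) (auto simp: trig_over_def)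
  then show ?thesis
  proof eventually_elim
    case (elim \<omega>)
    have pr: "Re (c * cis x) * Re (d * cis y) = Re (c * d / 2 * cis (x + y)) + Re (c * cnj d / 2 * cis (x - y))" for c d x y
    proof -
      have re: "2 * (Re u * Re v) = Re (u * v) + Re (u * cnj v)" for u v by simp
      have half: "Re (w / 2 * z) = Re (w * z) / 2" for w z by (simp add: diff_divide_distrib)
      have "c * cis x * (d * cis y) = c * d * cis (x + y)" by (simp only: cis_mult[symmetric] mult_ac)
      moreover have "c * cis x * cnj (d * cis y) = c * cnj d * cis (x - y)"
        using cis_mult[of x "- y"] by (simp only: complex_cnj_mult cis_cnj diff_conv_add_uminus mult_ac)
      ultimately have "2 * (Re (c * cis x) * Re (d * cis y)) = Re (c * d * cis (x + y)) + Re (c * cnj d * cis (x - y))"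
        unfolding re by (simp only:)
      then show ?thesis unfolding half by linarith
    qed
    have one: "trig (concat (map (\<lambda>(d, k). [(c * d / 2, \<lambda>z. 1 * h z + 1 * k z), (c * cnj d / 2, \<lambda>z. 1 * h z + (-1) * k z)]) K)) \<omega>
        = Re (c * cis (W h \<omega>)) * trig K \<omega>" if "h \<in> snd ` set L" "set K \<subseteq> set L'" for c h K
      using that(2)
    proof (induction K)
      case (Cons y K)
      obtain d k where y: "y = (d, k)" by (cases y)
      have e: "W (\<lambda>z. 1 * h z + 1 * k z) \<omega> = W h \<omega> + W k \<omega>" "W (\<lambda>z. 1 * h z + (-1) * k z) \<omega> = W h \<omega> - W k \<omega>"
        using elim that(1) Cons.prems y by (force simp: image_iff)+
      have "Re (c * d / 2 * cis (W h \<omega> + W k \<omega>)) + (Re (c * cnj d / 2 * cis (W h \<omega> - W k \<omega>)) + Re (c * cis (W h \<omega>)) * trig K \<omega>)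
          = Re (c * cis (W h \<omega>)) * (Re (d * cis (W k \<omega>)) + trig K \<omega>)"
        unfolding distrib_left pr by (simp only: add.assoc)
      then show ?case
        using Cons unfolding y list.map concat.simps trig_simps prod.case append.simps e
        by (simp only: set_simps insert_subset)
    qed simp
    \<comment> \<open>The induction runs over sublists \<open>K\<close>, since the exceptional set
      was fixed for the full list \<open>L\<close>.\<close>
    have "trig (trig_mult K L') \<omega> = trig K \<omega> * trig L' \<omega>" if "set K \<subseteq> set L" for K
      using that
    proof (induction K)
      case (Cons x K)
      obtain c h where x: "x = (c, h)" by (cases x)
      have "h \<in> snd ` set L" using Cons.prems x by force
      from one[OF this order_refl, of c] Cons show ?case
        by (simp add: trig_mult_def x distrib_right del: times_complex.sel)
    qed (simp add: trig_mult_def)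
    then show ?case by simp
  qed
qed

lemma W_zero_AE: "AE \<omega> in M. W (\<lambda>_. 0) \<omega> = 0"
  using W_lincomb[OF test_fun_zero test_fun_zero, of 0 0] by simp

text \<open>The list \<open>L'\<close> is chosen before \<open>a\<close>. This is possible because
  sums and products of lists commute with the shift, and constants are represented by the zero test
  function, which every shift fixes and on which \<open>W\<close> vanishes almost surely.\<close>

lemma trig_polynomial:
  assumes T: "test_space T" and L: "trig_over T L" and p: "real_polynomial_function (p :: real \<Rightarrow> real)"
  shows "\<exists>L'. trig_over T L' \<and> (\<forall>a. AE \<omega> in M. trig (trig_shift a L') \<omega> = p (trig (trig_shift a L) \<omega>))"
  using p
proof (induction p)
  case (linear f)
  have fl: "f x = f 1 * x" for x using linear_scale[OF bounded_linear.linear[OF linear], of x 1] by (simp add: mult.commute)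
  show ?case using L
    by (intro exI[of _ "trig_scale (f 1) L"]) (simp add: trig_shift_scale fl[of "trig (trig_shift a L) \<omega>" for a \<omega>])
next
  case (const c)
  have "AE \<omega> in M. trig (trig_shift a [(complex_of_real c, \<lambda>_. 0)]) \<omega> = c" for a
    using W_zero_AE by eventually_elim (simp add: space_shift_def case_prod_unfold)
  then show ?case using T by (intro exI[of _ "[(complex_of_real c, \<lambda>_. 0)]"]) (auto simp: test_space_def simp del: trig_shift_simps trig_simps)
next
  case (add f g)
  then obtain L1 L2 where 1: "trig_over T L1" "\<And>a. AE \<omega> in M. trig (trig_shift a L1) \<omega> = f (trig (trig_shift a L) \<omega>)"
     and 2: "trig_over T L2" "\<And>a. AE \<omega> in M. trig (trig_shift a L2) \<omega> = g (trig (trig_shift a L) \<omega>)" by blast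
  have "AE \<omega> in M. trig (trig_shift a (L1 @ L2)) \<omega> = f (trig (trig_shift a L) \<omega>) + g (trig (trig_shift a L) \<omega>)" for a
    using 1(2)[of a] 2(2)[of a] by eventually_elim simp
  then show ?case using 1(1) 2(1) by (intro exI[of _ "L1 @ L2"]) auto
next
  case (mult f g)
  then obtain L1 L2 where 1: "trig_over T L1" "\<And>a. AE \<omega> in M. trig (trig_shift a L1) \<omega> = f (trig (trig_shift a L) \<omega>)"
     and 2: "trig_over T L2" "\<And>a. AE \<omega> in M. trig (trig_shift a L2) \<omega> = g (trig (trig_shift a L) \<omega>)" by blast
  have "AE \<omega> in M. trig (trig_shift a (trig_mult L1 L2)) \<omega> = f (trig (trig_shift a L) \<omega>) * g (trig (trig_shift a L) \<omega>)" for a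
    using 1(2)[of a] 2(2)[of a]
      trig_mult_AE[OF trig_over_test_fun_shift[OF trig_over_test_fun[OF T 1(1)], of a] trig_over_test_fun_shift[OF trig_over_test_fun[OF T 2(1)], of a]]
    unfolding trig_shift_mult by eventually_elim simp
  then show ?case using trig_over_mult[OF T 1(1) 2(1)] by (intro exI[of _ "trig_mult L1 L2"]) auto
qed

text \<open>\<open>F\<close> and \<open>F'\<close> are simultaneous \<open>L\<^sup>2\<close> limits of trigonometric polynomials of the noise and of
  the same polynomials of the shifted noise: \<open>F'\<close> is the shift by \<open>a\<close> of the functional \<open>F\<close>.
  For \<open>a = 0\<close> and \<open>F' = F\<close> it says that \<open>F\<close> is approximable by polynomials over \<open>T\<close>.\<close>

definition approx :: "(real \<times> real \<Rightarrow> real) set \<Rightarrow> real \<Rightarrow> ('w \<Rightarrow> real) \<Rightarrow> ('w \<Rightarrow> real) \<Rightarrow> bool" where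
  "approx T a F F' \<longleftrightarrow> F \<in> borel_measurable M \<and> F' \<in> borel_measurable M \<and>
     (\<forall>e>0. \<exists>L. trig_over T L \<and> l2 M (\<lambda>\<omega>. trig L \<omega> - F \<omega>) < e \<and> l2 M (\<lambda>\<omega>. trig (trig_shift a L) \<omega> - F' \<omega>) < e)"

lemma approx_seq:
  assumes "approx T a F F'"
  obtains L where "\<And>n. trig_over T (L n)" "(\<lambda>n. l2 M (\<lambda>\<omega>. trig (L n) \<omega> - F \<omega>)) \<longlonglongrightarrow> 0"
    "(\<lambda>n. l2 M (\<lambda>\<omega>. trig (trig_shift a (L n)) \<omega> - F' \<omega>)) \<longlonglongrightarrow> 0"
proof -
  have "\<forall>n. \<exists>L. trig_over T L \<and> l2 M (\<lambda>\<omega>. trig L \<omega> - F \<omega>) < ennreal (1 / real (Suc n)) \<and> l2 M (\<lambda>\<omega>. trig (trig_shift a L) \<omega> - F' \<omega>) < ennreal (1 / real (Suc n))"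
    using assms unfolding approx_def by (auto simp: ennreal_zero_less_divide)
  then obtain L where L: "\<And>n. trig_over T (L n)" "\<And>n. l2 M (\<lambda>\<omega>. trig (L n) \<omega> - F \<omega>) < ennreal (1 / real (Suc n))"
     "\<And>n. l2 M (\<lambda>\<omega>. trig (trig_shift a (L n)) \<omega> - F' \<omega>) < ennreal (1 / real (Suc n))" by metis
  have z: "(\<lambda>n. ennreal (1 / real (Suc n))) \<longlonglongrightarrow> 0"
    using tendsto_ennrealI[OF LIMSEQ_inverse_real_of_nat] by (simp add: inverse_eq_divide)
  show thesis
    using ennreal_tendsto_0_le[OF z less_imp_le[OF L(2)]] ennreal_tendsto_0_le[OF z less_imp_le[OF L(3)]] L(1)
    by (intro that[of L])
qed

lemma approx_trig:
  assumes "test_space T" "trig_over T L" shows "approx T a (trig L) (trig (trig_shift a L))"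
  using trig_measurable[OF trig_over_test_fun[OF assms]] trig_measurable[OF trig_over_test_fun_shift[OF trig_over_test_fun[OF assms]], of a] assms(2)
  unfolding approx_def by (auto simp: l2_def)

text \<open>A diagonal choice: one index good on both sides, followed by one list good on both sides
  for that index.\<close>

lemma approx_limit:
  assumes T: "test_space T" and A: "\<And>n. approx T a (F n) (F' n)"
    and [measurable]: "G \<in> borel_measurable M" "G' \<in> borel_measurable M"
    and l: "(\<lambda>n. l2 M (\<lambda>\<omega>. F n \<omega> - G \<omega>)) \<longlonglongrightarrow> 0" "(\<lambda>n. l2 M (\<lambda>\<omega>. F' n \<omega> - G' \<omega>)) \<longlonglongrightarrow> 0"
  shows "approx T a G G'"
proof -
  have [measurable]: "\<And>n. F n \<in> borel_measurable M" "\<And>n. F' n \<in> borel_measurable M"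
    using A by (auto simp: approx_def)
  have "\<exists>L. trig_over T L \<and> l2 M (\<lambda>\<omega>. trig L \<omega> - G \<omega>) < e \<and> l2 M (\<lambda>\<omega>. trig (trig_shift a L) \<omega> - G' \<omega>) < e"
    if e: "0 < e" for e :: ennreal
  proof -
    \<comment> \<open>A quarter on each of the two terms is enough, because
      \<open>l2_triangle\<close> doubles both.\<close>
    have e4: "0 < e / 4" using e by (simp add: ennreal_zero_less_divide)
    have "\<forall>\<^sub>F n in sequentially. l2 M (\<lambda>\<omega>. F n \<omega> - G \<omega>) < e / 4 \<and> l2 M (\<lambda>\<omega>. F' n \<omega> - G' \<omega>) < e / 4"
      using order_tendstoD(2)[OF l(1) e4] order_tendstoD(2)[OF l(2) e4] by eventually_elim simp
    then obtain n where n: "l2 M (\<lambda>\<omega>. F n \<omega> - G \<omega>) < e / 4" "l2 M (\<lambda>\<omega>. F' n \<omega> - G' \<omega>) < e / 4"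
      by (auto simp: eventually_sequentially)
    obtain L where L: "trig_over T L" "l2 M (\<lambda>\<omega>. trig L \<omega> - F n \<omega>) < e / 4" "l2 M (\<lambda>\<omega>. trig (trig_shift a L) \<omega> - F' n \<omega>) < e / 4"
      using A[of n] e4 unfolding approx_def by blast
    have [measurable]: "trig L \<in> borel_measurable M" "trig (trig_shift a L) \<in> borel_measurable M"
      using trig_over_test_fun[OF T L(1)] by (auto intro: trig_measurable trig_over_test_fun_shift)
    \<comment> \<open>The tolerance is an extended number; when it is infinite, finiteness of the
      two terms is all that is needed.\<close>
    have sum: "2 * x + 2 * y < e" if "x < e / 4" "y < e / 4" for x y
    proof -
      have "x < top" "y < top" using that by (auto intro: less_le_trans[OF _ top_greatest])
      then obtain u v where uv: "x = ennreal u" "0 \<le> u" "y = ennreal v" "0 \<le> v"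
        by (metis ennreal_cases less_irrefl)
      show ?thesis
      proof (cases e)
        case (real r)
        then have "u < r / 4" "v < r / 4" using that uv by (simp_all add: ennreal_divide_numeral ennreal_less_iff)
        then have "ennreal (2 * u + 2 * v) < ennreal r" using uv by (intro ennreal_lessI) auto
        then show ?thesis using uv real by (simp add: ennreal_plus ennreal_mult')
      next
        case top
        have "ennreal (2 * u + 2 * v) < \<top>" by simp
        then show ?thesis unfolding top using uv by (simp add: ennreal_plus ennreal_mult')
      qed
    qed
    show ?thesis
      using L(1) le_less_trans[OF l2_triangle sum[OF L(2) n(1)]] le_less_trans[OF l2_triangle sum[OF L(3) n(2)]]
      by (intro exI[of _ L]) auto
  qed
  then show ?thesis by (auto simp: approx_def)
qed

lemma approx_cong_AE:
  assumes A: "approx T a F F'" and [measurable]: "G \<in> borel_measurable M" "G' \<in> borel_measurable M"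
    and "AE \<omega> in M. F \<omega> = G \<omega>" "AE \<omega> in M. F' \<omega> = G' \<omega>"
  shows "approx T a G G'"
proof -
  have "l2 M (\<lambda>\<omega>. X \<omega> - F \<omega>) = l2 M (\<lambda>\<omega>. X \<omega> - G \<omega>)" "l2 M (\<lambda>\<omega>. X \<omega> - F' \<omega>) = l2 M (\<lambda>\<omega>. X \<omega> - G' \<omega>)" for X
    using assms(4,5) by (auto intro!: l2_cong_AE)
  then show ?thesis using A assms(2,3) by (simp add: approx_def)
qed

lemma approx_cong:
  assumes A: "approx T a F F'"
    and "\<And>\<omega>. \<omega> \<in> space M \<Longrightarrow> F \<omega> = G \<omega>" "\<And>\<omega>. \<omega> \<in> space M \<Longrightarrow> F' \<omega> = G' \<omega>"
  shows "approx T a G G'"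
proof (rule approx_cong_AE[OF A])
  have F: "F \<in> borel_measurable M" "F' \<in> borel_measurable M" using A by (simp_all add: approx_def)
  show "G \<in> borel_measurable M" by (rule iffD1[OF measurable_cong[of M F G borel, OF assms(2)] F(1)])
  show "G' \<in> borel_measurable M" by (rule iffD1[OF measurable_cong[of M F' G' borel, OF assms(3)] F(2)])
  show "AE \<omega> in M. F \<omega> = G \<omega>" using assms(2) by (rule AE_I2)
  show "AE \<omega> in M. F' \<omega> = G' \<omega>" using assms(3) by (rule AE_I2)
qed

lemma approx_lincomb:
  assumes T: "test_space T" and A: "approx T a F F'" "approx T a G G'"
  shows "approx T a (\<lambda>\<omega>. r * F \<omega> + s * G \<omega>) (\<lambda>\<omega>. r * F' \<omega> + s * G' \<omega>)"
proof -
  obtain L where L: "\<And>n. trig_over T (L n)" "(\<lambda>n. l2 M (\<lambda>\<omega>. trig (L n) \<omega> - F \<omega>)) \<longlonglongrightarrow> 0"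
    "(\<lambda>n. l2 M (\<lambda>\<omega>. trig (trig_shift a (L n)) \<omega> - F' \<omega>)) \<longlonglongrightarrow> 0" by (rule approx_seq[OF A(1)]) (rule that)
  obtain K where K: "\<And>n. trig_over T (K n)" "(\<lambda>n. l2 M (\<lambda>\<omega>. trig (K n) \<omega> - G \<omega>)) \<longlonglongrightarrow> 0"
    "(\<lambda>n. l2 M (\<lambda>\<omega>. trig (trig_shift a (K n)) \<omega> - G' \<omega>)) \<longlonglongrightarrow> 0" by (rule approx_seq[OF A(2)]) (rule that)
  define N where "N n = trig_scale r (L n) @ trig_scale s (K n)" for n
  have N: "trig_over T (N n)" for n using L(1) K(1) by (simp add: N_def)
  have [measurable]: "F \<in> borel_measurable M" "F' \<in> borel_measurable M" "G \<in> borel_measurable M" "G' \<in> borel_measurable M"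
    using A by (auto simp: approx_def)
  have lim: "(\<lambda>n. l2 M (\<lambda>\<omega>. (r * X n \<omega> + s * Y n \<omega>) - (r * F \<omega> + s * G \<omega>))) \<longlonglongrightarrow> 0"
    if "(\<lambda>n. l2 M (\<lambda>\<omega>. X n \<omega> - F \<omega>)) \<longlonglongrightarrow> 0" "(\<lambda>n. l2 M (\<lambda>\<omega>. Y n \<omega> - G \<omega>)) \<longlonglongrightarrow> 0"
      "\<And>n. X n \<in> borel_measurable M" "\<And>n. Y n \<in> borel_measurable M"
      "F \<in> borel_measurable M" "G \<in> borel_measurable M" for X Y F G
  proof (rule ennreal_tendsto_0_le)
    note [measurable] = that(3-6)
    show "(\<lambda>n. 2 * (ennreal (\<bar>r\<bar>\<^sup>2) * l2 M (\<lambda>\<omega>. X n \<omega> - F \<omega>)) + 2 * (ennreal (\<bar>s\<bar>\<^sup>2) * l2 M (\<lambda>\<omega>. Y n \<omega> - G \<omega>))) \<longlonglongrightarrow> 0"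
      using that(1,2) by (intro ennreal_tendsto_0_add ennreal_tendsto_0_cmult) auto
    fix n
    have "l2 M (\<lambda>\<omega>. (r * X n \<omega> + s * Y n \<omega>) - (r * F \<omega> + s * G \<omega>)) = l2 M (\<lambda>\<omega>. r * (X n \<omega> - F \<omega>) + s * (Y n \<omega> - G \<omega>))"
      by (simp add: algebra_simps)
    also have "\<dots> \<le> 2 * l2 M (\<lambda>\<omega>. r * (X n \<omega> - F \<omega>)) + 2 * l2 M (\<lambda>\<omega>. s * (Y n \<omega> - G \<omega>))"
      by (rule l2_add_le) measurable
    also have "\<dots> \<le> 2 * (ennreal (\<bar>r\<bar>\<^sup>2) * l2 M (\<lambda>\<omega>. X n \<omega> - F \<omega>)) + 2 * (ennreal (\<bar>s\<bar>\<^sup>2) * l2 M (\<lambda>\<omega>. Y n \<omega> - G \<omega>))"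
      by (intro add_mono mult_left_mono l2_mult_le) (auto simp: abs_mult)
    finally show "l2 M (\<lambda>\<omega>. (r * X n \<omega> + s * Y n \<omega>) - (r * F \<omega> + s * G \<omega>)) \<le> 2 * (ennreal (\<bar>r\<bar>\<^sup>2) * l2 M (\<lambda>\<omega>. X n \<omega> - F \<omega>)) + 2 * (ennreal (\<bar>s\<bar>\<^sup>2) * l2 M (\<lambda>\<omega>. Y n \<omega> - G \<omega>))" .
  qed
  have m: "trig (trig_shift b (L n)) \<in> borel_measurable M" "trig (trig_shift b (K n)) \<in> borel_measurable M" for b n
    using trig_over_test_fun[OF T] L(1) K(1) by (auto intro!: trig_measurable trig_over_test_fun_shift)
  show ?thesis
  proof (rule approx_limit[OF T approx_trig[OF T N]])
    show "(\<lambda>n. l2 M (\<lambda>\<omega>. trig (N n) \<omega> - (r * F \<omega> + s * G \<omega>))) \<longlonglongrightarrow> 0"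
      using lim[OF L(2) K(2)] m[of 0] by (simp add: N_def)
    show "(\<lambda>n. l2 M (\<lambda>\<omega>. trig (trig_shift a (N n)) \<omega> - (r * F' \<omega> + s * G' \<omega>))) \<longlonglongrightarrow> 0"
      using lim[OF L(3) K(3)] m[of a] by (simp add: N_def trig_shift_scale)
  qed measurable
qed

lemma l2_bounded_mult:
  assumes "\<And>\<omega>. \<bar>B \<omega>\<bar> \<le> c" "(\<lambda>n. l2 M (\<lambda>\<omega>. X n \<omega> - F \<omega>)) \<longlonglongrightarrow> 0"
    and [measurable]: "\<And>n. X n \<in> borel_measurable M" "F \<in> borel_measurable M"
  shows "(\<lambda>n. l2 M (\<lambda>\<omega>. X n \<omega> * B \<omega> - F \<omega> * B \<omega>)) \<longlonglongrightarrow> 0"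
proof (rule ennreal_tendsto_0_le)
  show "(\<lambda>n. ennreal (c\<^sup>2) * l2 M (\<lambda>\<omega>. X n \<omega> - F \<omega>)) \<longlonglongrightarrow> 0"
    using assms(2) by (intro ennreal_tendsto_0_cmult) auto
  show "l2 M (\<lambda>\<omega>. X n \<omega> * B \<omega> - F \<omega> * B \<omega>) \<le> ennreal (c\<^sup>2) * l2 M (\<lambda>\<omega>. X n \<omega> - F \<omega>)" for n
    using assms(1) by (intro l2_mult_le) (auto simp: abs_mult mult.commute[of c] simp flip: left_diff_distrib intro!: mult_left_mono)
qed

text \<open>A product of two \<open>L^2\<close>-convergent sequences need not converge in
  \<open>L^2\<close>, so the limits are taken in turn. With the bounded polynomial
  \<open>L n\<close> held fixed, the other factor passes to \<open>G\<close>; then the bound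
  \<open>c\<close> lets \<open>L n\<close> pass to \<open>F\<close>.\<close>

lemma approx_mult:
  assumes T: "test_space T" and A: "approx T a F F'" "approx T a G G'"
    and b: "\<And>\<omega>. \<bar>G \<omega>\<bar> \<le> c" "\<And>\<omega>. \<bar>G' \<omega>\<bar> \<le> c"
  shows "approx T a (\<lambda>\<omega>. F \<omega> * G \<omega>) (\<lambda>\<omega>. F' \<omega> * G' \<omega>)"
proof -
  obtain L where L: "\<And>n. trig_over T (L n)" "(\<lambda>n. l2 M (\<lambda>\<omega>. trig (L n) \<omega> - F \<omega>)) \<longlonglongrightarrow> 0"
    "(\<lambda>n. l2 M (\<lambda>\<omega>. trig (trig_shift a (L n)) \<omega> - F' \<omega>)) \<longlonglongrightarrow> 0" by (rule approx_seq[OF A(1)]) (rule that)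
  obtain K where K: "\<And>n. trig_over T (K n)" "(\<lambda>n. l2 M (\<lambda>\<omega>. trig (K n) \<omega> - G \<omega>)) \<longlonglongrightarrow> 0"
    "(\<lambda>n. l2 M (\<lambda>\<omega>. trig (trig_shift a (K n)) \<omega> - G' \<omega>)) \<longlonglongrightarrow> 0" by (rule approx_seq[OF A(2)]) (rule that)
  have [measurable]: "F \<in> borel_measurable M" "F' \<in> borel_measurable M" "G \<in> borel_measurable M" "G' \<in> borel_measurable M"
    using A by (auto simp: approx_def)
  have m: "trig (trig_shift b (L n)) \<in> borel_measurable M" "trig (trig_shift b (K n)) \<in> borel_measurable M" for b n
    using trig_over_test_fun[OF T] L(1) K(1) by (auto intro!: trig_measurable trig_over_test_fun_shift)
  have m0 [measurable]: "trig (L n) \<in> borel_measurable M" "trig (K n) \<in> borel_measurable M" for n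
    using m[of 0] by auto
  note [measurable] = m
  have prod: "approx T a (\<lambda>\<omega>. trig (K m) \<omega> * trig (L n) \<omega>) (\<lambda>\<omega>. trig (trig_shift a (K m)) \<omega> * trig (trig_shift a (L n)) \<omega>)" for m n
    using trig_mult_AE[of "K m" "L n"] trig_mult_AE[of "trig_shift a (K m)" "trig_shift a (L n)"]
      trig_over_test_fun[OF T] L(1) K(1)
    by (intro approx_cong_AE[OF approx_trig[OF T trig_over_mult[OF T K(1)[of m] L(1)[of n]]]])
      (auto simp: trig_shift_mult trig_over_test_fun_shift)
  have GL: "approx T a (\<lambda>\<omega>. G \<omega> * trig (L n) \<omega>) (\<lambda>\<omega>. G' \<omega> * trig (trig_shift a (L n)) \<omega>)" for n
  proof (rule approx_limit[OF T prod[of _ n]])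
    show "(\<lambda>m. l2 M (\<lambda>\<omega>. trig (K m) \<omega> * trig (L n) \<omega> - G \<omega> * trig (L n) \<omega>)) \<longlonglongrightarrow> 0"
      by (rule l2_bounded_mult[OF trig_bounded K(2)]) measurable
    show "(\<lambda>m. l2 M (\<lambda>\<omega>. trig (trig_shift a (K m)) \<omega> * trig (trig_shift a (L n)) \<omega> - G' \<omega> * trig (trig_shift a (L n)) \<omega>)) \<longlonglongrightarrow> 0"
      by (rule l2_bounded_mult[OF trig_bounded K(3)]) measurable
  qed measurable
  have LG: "approx T a (\<lambda>\<omega>. trig (L n) \<omega> * G \<omega>) (\<lambda>\<omega>. trig (trig_shift a (L n)) \<omega> * G' \<omega>)" for n
    using GL[of n] by (simp only: mult.commute)
  show ?thesis
  proof (rule approx_limit[OF T LG])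
    show "(\<lambda>n. l2 M (\<lambda>\<omega>. trig (L n) \<omega> * G \<omega> - F \<omega> * G \<omega>)) \<longlonglongrightarrow> 0"
      by (rule l2_bounded_mult[OF b(1) L(2)]) measurable
    show "(\<lambda>n. l2 M (\<lambda>\<omega>. trig (trig_shift a (L n)) \<omega> * G' \<omega> - F' \<omega> * G' \<omega>)) \<longlonglongrightarrow> 0"
      by (rule l2_bounded_mult[OF b(2) L(3)]) measurable
  qed measurable
qed

text \<open>On a polynomial the argument of \<open>f\<close> stays in a compact interval, where
  Weierstrass replaces \<open>f\<close> by a polynomial. The Lipschitz constant then handles the
  passage to the limit \<open>F\<close>, which may be unbounded.\<close>

lemma approx_lipschitz:
  fixes f :: "real \<Rightarrow> real"
  assumes T: "test_space T" and A: "approx T a F F'" and f: "\<And>x y. \<bar>f x - f y\<bar> \<le> C * \<bar>x - y\<bar>"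
  shows "approx T a (\<lambda>\<omega>. f (F \<omega>)) (\<lambda>\<omega>. f (F' \<omega>))"
proof -
  obtain L where L: "\<And>n. trig_over T (L n)" "(\<lambda>n. l2 M (\<lambda>\<omega>. trig (L n) \<omega> - F \<omega>)) \<longlonglongrightarrow> 0"
    "(\<lambda>n. l2 M (\<lambda>\<omega>. trig (trig_shift a (L n)) \<omega> - F' \<omega>)) \<longlonglongrightarrow> 0" by (rule approx_seq[OF A]) (rule that)
  have C0: "0 \<le> C" using f[of 0 1] by simp
  have cf: "continuous_on S f" for S
  proof -
    have "C-lipschitz_on S f" using f C0 by (intro lipschitz_onI) (auto simp: dist_real_def)
    then show ?thesis by (rule lipschitz_on_continuous_on)
  qed
  have [measurable]: "f \<in> borel_measurable borel" using cf by (rule borel_measurable_continuous_onI)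
  have [measurable]: "F \<in> borel_measurable M" "F' \<in> borel_measurable M"
    using A by (auto simp: approx_def)
  have m: "trig (trig_shift b (L n)) \<in> borel_measurable M" for b n
    using trig_over_test_fun[OF T] L(1) by (auto intro!: trig_measurable trig_over_test_fun_shift)
  have m0 [measurable]: "trig (L n) \<in> borel_measurable M" for n
    using m[of 0] by auto
  note [measurable] = m
  have 1: "approx T a (\<lambda>\<omega>. f (trig (L n) \<omega>)) (\<lambda>\<omega>. f (trig (trig_shift a (L n)) \<omega>))" for n
  proof -
    \<comment> \<open>The interval is the same for a list and all its shifts, since
      \<open>trig_bound\<close> depends on the coefficients only; one \<open>p m\<close> therefore
      serves both sides.\<close>
    have "\<exists>p. real_polynomial_function p \<and> (\<forall>x\<in>cball 0 (trig_bound (L n)). \<bar>f x - p x\<bar> < 1 / real (Suc m))" for m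
    proof -
      obtain g where "real_polynomial_function g" "\<And>x. x \<in> cball 0 (trig_bound (L n)) \<Longrightarrow> \<bar>f x - g x\<bar> < 1 / real (Suc m)"
        by (rule Stone_Weierstrass_real_polynomial_function[OF compact_cball cf, of "1 / real (Suc m)" 0 "trig_bound (L n)"]) auto
      then show ?thesis by blast
    qed
    then obtain p where p: "\<And>m. real_polynomial_function (p m) \<and> (\<forall>x\<in>cball 0 (trig_bound (L n)). \<bar>f x - p m x\<bar> < 1 / real (Suc m))"
      by metis
    have "\<exists>L'. trig_over T L' \<and> (\<forall>a. AE \<omega> in M. trig (trig_shift a L') \<omega> = p m (trig (trig_shift a (L n)) \<omega>))" for m
      using p[of m] by (intro trig_polynomial[OF T L(1)]) simp
    then obtain K where K: "\<And>m. trig_over T (K m)" "\<And>m a. AE \<omega> in M. trig (trig_shift a (K m)) \<omega> = p m (trig (trig_shift a (L n)) \<omega>)"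
      by metis
    have b: "l2 M (\<lambda>\<omega>. trig (trig_shift b (K m)) \<omega> - f (trig (trig_shift b (L n)) \<omega>)) \<le> ennreal ((1 / real (Suc m))\<^sup>2)" for b m
    proof (rule l2_le_bound)
      show "AE \<omega> in M. \<bar>trig (trig_shift b (K m)) \<omega> - f (trig (trig_shift b (L n)) \<omega>)\<bar> \<le> 1 / real (Suc m)"
        using K(2)[of b m]
      proof eventually_elim
        case (elim \<omega>)
        have "trig (trig_shift b (L n)) \<omega> \<in> cball 0 (trig_bound (L n))"
          using trig_bounded[of "trig_shift b (L n)" \<omega>] by simp
        with p[of m] have "\<bar>f (trig (trig_shift b (L n)) \<omega>) - p m (trig (trig_shift b (L n)) \<omega>)\<bar> < 1 / real (Suc m)" by blast
          then show ?case unfolding elim by linarith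
      qed
    qed (auto intro: prob_space_axioms)
    have "(\<lambda>m. (1 / real (Suc m))\<^sup>2) \<longlonglongrightarrow> 0\<^sup>2"
      using LIMSEQ_inverse_real_of_nat by (intro tendsto_power) (simp add: inverse_eq_divide)
    from tendsto_ennrealI[OF this] have z: "(\<lambda>m. ennreal ((1 / real (Suc m))\<^sup>2)) \<longlonglongrightarrow> 0" by simp
    show ?thesis
      using ennreal_tendsto_0_le[OF z b[of 0]] ennreal_tendsto_0_le[OF z b[of a]]
      by (intro approx_limit[OF T approx_trig[OF T K(1)]]) auto
  qed
  have "(\<lambda>n. l2 M (\<lambda>\<omega>. f (X n \<omega>) - f (F \<omega>))) \<longlonglongrightarrow> 0"
    if "(\<lambda>n. l2 M (\<lambda>\<omega>. X n \<omega> - F \<omega>)) \<longlonglongrightarrow> 0" "\<And>n. X n \<in> borel_measurable M" "F \<in> borel_measurable M" for X F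
  proof (rule ennreal_tendsto_0_le)
    show "(\<lambda>n. ennreal (C\<^sup>2) * l2 M (\<lambda>\<omega>. X n \<omega> - F \<omega>)) \<longlonglongrightarrow> 0"
      using that(1) by (intro ennreal_tendsto_0_cmult) auto
    show "l2 M (\<lambda>\<omega>. f (X n \<omega>) - f (F \<omega>)) \<le> ennreal (C\<^sup>2) * l2 M (\<lambda>\<omega>. X n \<omega> - F \<omega>)" for n
      using f that(2,3) by (intro l2_mult_le) auto
  qed
  from this[OF L(2)] this[OF L(3)] show ?thesis
    by (intro approx_limit[OF T 1]) auto
qed

end

text \<open>The null sets are included as in \<open>noise_filtration\<close>, which is the instance
  for the test functions that vanish after time \<open>t\<close>.\<close>

definition noise_sigma :: "'w measure \<Rightarrow> ((real \<times> real \<Rightarrow> real) \<Rightarrow> 'w \<Rightarrow> real) \<Rightarrow> (real \<times> real \<Rightarrow> real) set \<Rightarrow> 'w measure" where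
  "noise_sigma M W T = sigma (space M) ({W \<phi> -` B \<inter> space M | \<phi> B. \<phi> \<in> T \<and> B \<in> sets borel} \<union> null_sets M)"

section \<open>Events and square-integrable functionals of the noise\<close>

context noise
begin

text \<open>The indicator of a half-line is the pointwise limit of ramps with slope
  \<open>n\<close>, which are Lipschitz; all differences are bounded by 1.\<close>

lemma approx_atMost:
  assumes T: "test_space T" and A: "approx T a F F'"
  shows "approx T a (\<lambda>\<omega>. indicator {..c} (F \<omega>)) (\<lambda>\<omega>. indicator {..c} (F' \<omega>))"
proof -
  define f where "f n x = max 0 (min 1 (1 - real n * (x - c)))" for n and x :: real
  have [measurable]: "F \<in> borel_measurable M" "F' \<in> borel_measurable M"
    using A by (auto simp: approx_def)
  have [measurable]: "f n \<in> borel_measurable borel" for n unfolding f_def by measurable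
  have lip: "\<bar>f n x - f n y\<bar> \<le> real n * \<bar>x - y\<bar>" for n x y
  proof -
    have "\<bar>max 0 (min 1 u) - max 0 (min 1 v)\<bar> \<le> \<bar>u - v\<bar>" for u v :: real by (auto simp: max_def min_def)
    from this[of "1 - real n * (x - c)" "1 - real n * (y - c)"]
    have "\<bar>f n x - f n y\<bar> \<le> \<bar>real n * (y - x)\<bar>" unfolding f_def by (simp add: algebra_simps)
    then show ?thesis by (simp add: abs_mult abs_minus_commute)
  qed
  have lim: "(\<lambda>n. f n x - indicator {..c} x) \<longlonglongrightarrow> 0" for x
  proof (cases "x \<le> c")
    case True
    then have "f n x = 1" for n by (simp add: f_def mult_le_0_iff)
    then show ?thesis using True by simp
  next
    case False
    obtain N where N: "1 / (x - c) < real N" using reals_Archimedean2 by blast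
    have "f n x - indicator {..c} x = 0" if "N \<le> n" for n
    proof -
      have "1 / (x - c) \<le> real n" using N that by linarith
      then have "1 \<le> real n * (x - c)" using False by (simp add: divide_le_eq)
      then show ?thesis using False by (simp add: f_def)
    qed
    then show ?thesis by (intro tendsto_eventually) (auto simp: eventually_sequentially)
  qed
  have b: "\<bar>f n x - indicator {..c} x\<bar> \<le> \<bar>1\<bar>" for n x
    by (auto simp: f_def indicator_def)
  show ?thesis
  proof (rule approx_limit[OF T approx_lipschitz[OF T A lip]])
    show "(\<lambda>n. l2 M (\<lambda>\<omega>. f n (F \<omega>) - indicator {..c} (F \<omega>))) \<longlonglongrightarrow> 0"
      by (rule l2_dominated[where Y = "\<lambda>_. 1"]) (use b lim in auto)
    show "(\<lambda>n. l2 M (\<lambda>\<omega>. f n (F' \<omega>) - indicator {..c} (F' \<omega>))) \<longlonglongrightarrow> 0"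
      by (rule l2_dominated[where Y = "\<lambda>_. 1"]) (use b lim in auto)
  qed measurable
qed

lemma approx_const:
  assumes T: "test_space T" shows "approx T a (\<lambda>_. c) (\<lambda>_. c)"
proof -
  have z: "trig [] = (\<lambda>_. 0)" by (rule ext) simp
  have "approx T a (\<lambda>_. 0) (\<lambda>_. 0)" using approx_trig[OF T, of "[]" a] by (simp add: z)
  from approx_lipschitz[OF T this, of "\<lambda>_. c" 0] show ?thesis by simp
qed

text \<open>Bounded products give finite unions through \<open>1_A + 1_B - 1_A * 1_B\<close>, and
  limits give countable unions, so the events with the property form a sigma-algebra. Complements
  are relative to \<open>\<Omega>\<close>, hence the condition on the ranges of \<open>f\<close> and
  \<open>f'\<close>.\<close>

lemma approx_sigma_sets:
  assumes T: "test_space T" and ff: "\<And>\<omega>. \<omega> \<in> space M \<Longrightarrow> f \<omega> \<in> \<Omega>" "\<And>\<omega>. \<omega> \<in> space M \<Longrightarrow> f' \<omega> \<in> \<Omega>"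
    and G: "\<And>A. A \<in> G \<Longrightarrow> approx T a (\<lambda>\<omega>. indicator A (f \<omega>)) (\<lambda>\<omega>. indicator A (f' \<omega>))"
    and A: "A \<in> sigma_sets \<Omega> G"
  shows "approx T a (\<lambda>\<omega>. indicator A (f \<omega>)) (\<lambda>\<omega>. indicator A (f' \<omega>))"
  using A
proof induction
  case (Basic A)
  then show ?case by (rule G)
next
  case Empty
  show ?case using approx_const[OF T, of a 0] by simp
next
  case (Compl A)
  show ?case
    by (rule approx_cong[OF approx_lincomb[OF T approx_const[OF T, of a 1] Compl.IH, of 1 "-1"]])
       (use ff in \<open>auto simp: indicator_def\<close>)
next
  case (Union A)
  have fin: "approx T a (\<lambda>\<omega>. indicator (\<Union>i<n. A i) (f \<omega>)) (\<lambda>\<omega>. indicator (\<Union>i<n. A i) (f' \<omega>))" for n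
  proof (induction n)
    case 0
    show ?case using approx_const[OF T, of a 0] by simp
  next
    case (Suc n)
    have "approx T a (\<lambda>\<omega>. indicator (\<Union>i<n. A i) (f \<omega>) * indicator (A n) (f \<omega>))
        (\<lambda>\<omega>. indicator (\<Union>i<n. A i) (f' \<omega>) * indicator (A n) (f' \<omega>))"
      by (rule approx_mult[OF T Suc Union.IH[of n], of 1]) (auto simp: indicator_def)
    from approx_lincomb[OF T approx_lincomb[OF T Suc Union.IH[of n], of 1 1] this, of 1 "-1"]
    show ?case by (rule approx_cong) (auto simp: indicator_def lessThan_Suc)
  qed
  have lim: "(\<lambda>n. indicator (\<Union>i<n. A i) x - (indicator (\<Union>i. A i) x :: real)) \<longlonglongrightarrow> 0" for x
  proof (cases "x \<in> (\<Union>i. A i)")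
    case True
    then obtain i where i: "x \<in> A i" by blast
    have "indicator (\<Union>i<n. A i) x - (indicator (\<Union>i. A i) x :: real) = 0" if "Suc i \<le> n" for n
      using i that by (auto simp: indicator_def)
    then show ?thesis by (intro tendsto_eventually) (auto simp: eventually_sequentially)
  qed (simp add: indicator_def)
  have b: "\<bar>indicator (\<Union>i<n. A i) x - (indicator (\<Union>i. A i) x :: real)\<bar> \<le> \<bar>1\<bar>" for n x
    by (auto simp: indicator_def)
  have m: "(\<lambda>\<omega>. indicator (\<Union>i<n. A i) (g \<omega>) :: real) \<in> borel_measurable M" if "g = f \<or> g = f'" for n g
    using fin[of n] that by (auto simp: approx_def)
  have m': "(\<lambda>\<omega>. indicator (\<Union>i. A i) (g \<omega>) :: real) \<in> borel_measurable M" if "g = f \<or> g = f'" for g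
    by (rule borel_measurable_LIMSEQ_real[where u = "\<lambda>n \<omega>. indicator (\<Union>i<n. A i) (g \<omega>)"])
       (auto intro: m[OF that] LIM_zero_cancel[OF lim])
  show ?case
  proof (rule approx_limit[OF T fin])
    show "(\<lambda>n. l2 M (\<lambda>\<omega>. indicator (\<Union>i<n. A i) (f \<omega>) - indicator (\<Union>i. A i) (f \<omega>))) \<longlonglongrightarrow> 0"
      by (rule l2_dominated[where Y = "\<lambda>_. 1"]) (use b lim m m' in auto)
    show "(\<lambda>n. l2 M (\<lambda>\<omega>. indicator (\<Union>i<n. A i) (f' \<omega>) - indicator (\<Union>i. A i) (f' \<omega>))) \<longlonglongrightarrow> 0"
      by (rule l2_dominated[where Y = "\<lambda>_. 1"]) (use b lim m m' in auto)
  qed (use m' in auto)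
qed

lemma approx_borel:
  assumes T: "test_space T" and A: "approx T a F F'" and B: "B \<in> sets borel"
  shows "approx T a (\<lambda>\<omega>. indicator B (F \<omega>)) (\<lambda>\<omega>. indicator B (F' \<omega>))"
proof (rule approx_sigma_sets[OF T, of F UNIV F' "range (\<lambda>c. {..c})"])
  show "B \<in> sigma_sets UNIV (range (\<lambda>c. {..c}))"
    using B by (simp add: borel_eq_atMost)
qed (auto intro: approx_atMost[OF T A])

lemma test_space_test_fun: "test_space T \<Longrightarrow> h \<in> T \<Longrightarrow> test_fun h"
  by (auto simp: test_space_def)

lemma test_space_lincomb: "test_space T \<Longrightarrow> h \<in> T \<Longrightarrow> k \<in> T \<Longrightarrow> (\<lambda>z. r * h z + s * k z) \<in> T"
  by (auto simp: test_space_def)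

text \<open>The unbounded variable \<open>W h\<close> is the limit of
  \<open>n * sin (W h / n)\<close>, which is dominated by \<open>|W h|\<close>.\<close>

lemma approx_W:
  assumes T: "test_space T" and h: "h \<in> T"
  shows "approx T a (W h) (W (space_shift a h))"
proof -
  have th: "test_fun h" "test_fun (space_shift a h)" using test_space_test_fun[OF T h] by (auto intro: test_fun_shift)
  \<comment> \<open>The coefficient \<open>- \<i> * n\<close> selects the sine from the real part;
    the summand \<open>0 * h\<close> only fits the shape of \<open>W_lincomb\<close>.\<close>
  define L where "L n = [(- \<i> * complex_of_real (real (Suc n)), \<lambda>z. 1 / real (Suc n) * h z + 0 * h z)]" for n
  have L: "trig_over T (L n)" for n unfolding L_def trig_over_simps
    using test_space_lincomb[OF T h h, of "1 / real (Suc n)" 0] trig_over_simps(1) by blast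
  define X where "X n x = real (Suc n) * sin (x / real (Suc n))" for n x
  have tpL: "AE \<omega> in M. trig (trig_shift b (L n)) \<omega> = X n (W (space_shift b h) \<omega>)" for b n
    using W_lincomb[OF test_fun_shift[OF th(1), of b] test_fun_shift[OF th(1), of b], of "1 / real (Suc n)" 0]
    unfolding L_def trig_shift_simps trig_simps space_shift_lincomb
    by eventually_elim (simp add: X_def del: of_nat_Suc)
  have bX: "\<bar>X n x\<bar> \<le> \<bar>x\<bar>" for n x
    using mult_left_mono[OF abs_sin_x_le_abs_x[of "x / real (Suc n)"], of "real (Suc n)"]
    by (simp add: X_def abs_mult del: of_nat_Suc)
  have limX: "(\<lambda>n. X n x - x) \<longlonglongrightarrow> 0" for x
  proof -
    have "(\<lambda>n. real n * sin (x / real n)) \<longlonglongrightarrow> x" by real_asymp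
    then have "(\<lambda>n. X n x) \<longlonglongrightarrow> x" unfolding X_def by (rule LIMSEQ_Suc)
    then show ?thesis by (rule LIM_zero)
  qed
  have [measurable]: "X n \<in> borel_measurable borel" for n unfolding X_def by measurable
  have lim: "(\<lambda>n. l2 M (\<lambda>\<omega>. trig (trig_shift b (L n)) \<omega> - W (space_shift b h) \<omega>)) \<longlonglongrightarrow> 0" for b
  proof -
    have tb: "test_fun (space_shift b h)" using th(1) by (rule test_fun_shift)
    have [measurable]: "W (space_shift b h) \<in> borel_measurable M" by (rule W_measurable[OF tb])
    have "l2 M (\<lambda>\<omega>. trig (trig_shift b (L n)) \<omega> - W (space_shift b h) \<omega>) = l2 M (\<lambda>\<omega>. X n (W (space_shift b h) \<omega>) - W (space_shift b h) \<omega>)" for n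
      using tpL[of b n] by (intro l2_cong_AE) auto
    moreover have "(\<lambda>n. l2 M (\<lambda>\<omega>. X n (W (space_shift b h) \<omega>) - W (space_shift b h) \<omega>)) \<longlonglongrightarrow> 0"
    proof (rule l2_dominated)
      show "integrable M (\<lambda>\<omega>. (2 * W (space_shift b h) \<omega>)\<^sup>2)"
        using W_square_integrable[OF tb] by (simp add: power_mult_distrib)
      show "\<bar>X n (W (space_shift b h) \<omega>) - W (space_shift b h) \<omega>\<bar> \<le> \<bar>2 * W (space_shift b h) \<omega>\<bar>" for n \<omega>
        using bX[of n "W (space_shift b h) \<omega>"] by linarith
    qed (use limX in auto)
    ultimately show ?thesis by simp
  qed
  show ?thesis
    using lim[of 0] lim[of a] th W_measurable by (intro approx_limit[OF T approx_trig[OF T L]]) auto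
qed

lemma sets_noise_sigma:
  "sets (noise_sigma M W T) = sigma_sets (space M) ({W \<phi> -` B \<inter> space M | \<phi> B. \<phi> \<in> T \<and> B \<in> sets borel} \<union> null_sets M)"
  unfolding noise_sigma_def by (rule sets_measure_of) (auto simp: null_sets_def dest: sets.sets_into_space)

lemma space_noise_sigma [simp]: "space (noise_sigma M W T) = space M"
  unfolding noise_sigma_def by (rule space_measure_of) (auto simp: null_sets_def dest: sets.sets_into_space)

lemma approx_noise_sigma:
  assumes T: "test_space T" and A: "A \<in> sets (noise_sigma M W T)"
  shows "approx T 0 (indicator A) (indicator A)"
proof (rule approx_sigma_sets[OF T, of "\<lambda>\<omega>. \<omega>" "space M" "\<lambda>\<omega>. \<omega>"])
  show "A \<in> sigma_sets (space M) ({W \<phi> -` B \<inter> space M | \<phi> B. \<phi> \<in> T \<and> B \<in> sets borel} \<union> null_sets M)"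
    using A by (simp add: sets_noise_sigma)
  fix A assume "A \<in> {W \<phi> -` B \<inter> space M | \<phi> B. \<phi> \<in> T \<and> B \<in> sets borel} \<union> null_sets M"
  then consider \<phi> B where "A = W \<phi> -` B \<inter> space M" "\<phi> \<in> T" "B \<in> sets borel" | "A \<in> null_sets M" by blast
  then show "approx T 0 (\<lambda>\<omega>. indicator A \<omega>) (\<lambda>\<omega>. indicator A \<omega>)"
  proof cases
    case 1
    show ?thesis
      by (rule approx_cong[OF approx_borel[OF T approx_W[OF T 1(2), of 0] 1(3)]]) (auto simp: 1 indicator_def)
  next
    case 2
    have "AE \<omega> in M. 0 = (indicator A \<omega> :: real)"
      by (intro AE_I'[OF 2]) (auto simp: indicator_def)
    with 2 show ?thesis by (intro approx_cong_AE[OF approx_const[OF T, of 0 0]]) (auto simp: null_sets_def)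
  qed
qed auto

lemma approx_sum:
  assumes T: "test_space T" and "finite I" "\<And>i. i \<in> I \<Longrightarrow> approx T a (F i) (F' i)"
  shows "approx T a (\<lambda>\<omega>. \<Sum>i\<in>I. r i * F i \<omega>) (\<lambda>\<omega>. \<Sum>i\<in>I. r i * F' i \<omega>)"
  using assms(2,3)
proof (induction I)
  case empty
  show ?case using approx_const[OF T, of a 0] by simp
next
  case (insert i I)
  from approx_lincomb[OF T insert.prems[of i] insert.IH, of "r i" 1] insert show ?case by simp
qed

text \<open>Density of the polynomials in \<open>L^2\<close> of the noise, through simple functions
  that converge pointwise and are dominated by a multiple of \<open>|Y|\<close>.\<close>

lemma approx_noise_sigma_measurable:
  assumes T: "test_space T" and Y: "Y \<in> borel_measurable (noise_sigma M W T)"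
    and YM: "Y \<in> borel_measurable M" and sq: "integrable M (\<lambda>\<omega>. (Y \<omega>)\<^sup>2)"
  shows "approx T 0 Y Y"
proof -
  obtain s where s: "\<And>i. simple_function (noise_sigma M W T) (s i)"
    "\<And>x. x \<in> space M \<Longrightarrow> (\<lambda>i. s i x) \<longlonglongrightarrow> Y x" "\<And>i x. x \<in> space M \<Longrightarrow> dist (s i x) 0 \<le> 2 * dist (Y x) 0"
    using borel_measurable_implies_sequence_metric[OF Y, of 0] unfolding space_noise_sigma by metis
  have A: "approx T 0 (s i) (s i)" for i
  proof -
    have fin: "finite (s i ` space M)" using s(1)[of i] by (simp add: simple_function_def)
    have "s i -` {y} \<inter> space M \<in> sets (noise_sigma M W T)" if "y \<in> s i ` space M" for y
      using simple_functionD(2)[OF s(1)[of i], of "{y}"] by simp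
    from approx_sum[OF T fin approx_noise_sigma[OF T this], of "\<lambda>y. y"]
    have "approx T 0 (\<lambda>\<omega>. \<Sum>y\<in>s i ` space M. y * indicator (s i -` {y} \<inter> space M) \<omega>) (\<lambda>\<omega>. \<Sum>y\<in>s i ` space M. y * indicator (s i -` {y} \<inter> space M) \<omega>)" .
    then show ?thesis
    proof (rule approx_cong)
      fix \<omega> assume "\<omega> \<in> space M"
      then have "(\<Sum>y\<in>s i ` space M. y * indicator (s i -` {y} \<inter> space M) \<omega>) = (\<Sum>y\<in>s i ` space M. if s i \<omega> = y then y else 0)"
        by (intro sum.cong) (auto simp: indicator_def)
      also have "\<dots> = s i \<omega>" using fin \<open>\<omega> \<in> space M\<close> by simp
      finally show "(\<Sum>y\<in>s i ` space M. y * indicator (s i -` {y} \<inter> space M) \<omega>) = s i \<omega>" .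
      then show "(\<Sum>y\<in>s i ` space M. y * indicator (s i -` {y} \<inter> space M) \<omega>) = s i \<omega>" .
    qed
  qed
  then have [measurable]: "\<And>i. s i \<in> borel_measurable M" by (auto simp: approx_def)
  have "(\<lambda>n. l2 M (\<lambda>\<omega>. s n \<omega> - Y \<omega>)) \<longlonglongrightarrow> 0"
  proof (rule l2_dominated)
    \<comment> \<open>The simple functions satisfy \<open>|s n| \<le> 2 * |Y|\<close>, so the
      differences are at most \<open>3 * |Y|\<close>.\<close>
    show "integrable M (\<lambda>\<omega>. (3 * Y \<omega>)\<^sup>2)" using sq by (simp add: power_mult_distrib)
    show "(\<lambda>n. s n \<omega> - Y \<omega>) \<longlonglongrightarrow> 0" if "\<omega> \<in> space M" for \<omega> using s(2)[OF that] by (rule LIM_zero)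
    show "\<bar>s n \<omega> - Y \<omega>\<bar> \<le> \<bar>3 * Y \<omega>\<bar>" if "\<omega> \<in> space M" for n \<omega>
      using s(3)[OF that, of n] by (simp add: dist_real_def)
  qed (use YM in measurable)
  then show ?thesis using YM by (intro approx_limit[OF T A]) auto
qed

end

section \<open>Fractional seminorm and square norm\<close>

text \<open>The Fourier transform of \<open>gauss_cutoff n\<close>: an approximate identity of total
  mass \<open>2 * pi\<close>, concentrated at scale \<open>1 / (n + 1)\<close>.\<close>

definition gauss_kernel :: "nat \<Rightarrow> real \<Rightarrow> real" where
  "gauss_kernel n z = 2 * pi * real (Suc n) * std_normal_density (real (Suc n) * z)"

definition gauss_cutoff :: "nat \<Rightarrow> real \<Rightarrow> real" where
  "gauss_cutoff n \<xi> = exp (- (\<xi> / real (Suc n))\<^sup>2 / 2)"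

lemma gauss_cutoff_bounds: "0 < gauss_cutoff n \<xi>" "gauss_cutoff n \<xi> \<le> 1"
  by (auto simp: gauss_cutoff_def)

lemma gauss_cutoff_measurable [measurable]: "gauss_cutoff n \<in> borel_measurable borel"
  unfolding gauss_cutoff_def by measurable

lemma gauss_cutoff_normal: "gauss_cutoff n (real (Suc n) * x) = sqrt (2 * pi) * std_normal_density x"
  by (simp add: gauss_cutoff_def std_normal_density_def del: of_nat_Suc)

lemma gauss_cutoff_integrable: "integrable lborel (gauss_cutoff n)"
proof -
  have "integrable lborel (\<lambda>x. gauss_cutoff n (0 + real (Suc n) * x))"
    using integrable_normal_density[of 1 0] by (simp add: gauss_cutoff_normal del: of_nat_Suc)
  then show ?thesis by (subst (asm) lborel_integrable_real_affine_iff) auto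
qed

text \<open>Rescaling reduces the claim to the characteristic function of the standard normal law;
  the two factors \<open>sqrt (2 * pi)\<close> of normalization combine to
  \<open>2 * pi\<close>.\<close>

lemma fourier_gauss_cutoff:
  "(\<integral>\<xi>. exp (- (\<i> * complex_of_real \<xi> * complex_of_real z)) * complex_of_real (gauss_cutoff n \<xi>) \<partial>lborel)
     = complex_of_real (gauss_kernel n z)"
proof -
  let ?N = "real (Suc n)"
  have N: "?N \<noteq> 0" by simp
  have "(\<integral>\<xi>. exp (- (\<i> * complex_of_real \<xi> * complex_of_real z)) * complex_of_real (gauss_cutoff n \<xi>) \<partial>lborel)
      = \<bar>?N\<bar> *\<^sub>R (\<integral>x. exp (- (\<i> * complex_of_real (0 + ?N * x) * complex_of_real z)) * complex_of_real (gauss_cutoff n (0 + ?N * x)) \<partial>lborel)"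
    by (rule lborel_integral_real_affine[OF N])
  also have "(\<integral>x. exp (- (\<i> * complex_of_real (0 + ?N * x) * complex_of_real z)) * complex_of_real (gauss_cutoff n (0 + ?N * x)) \<partial>lborel)
      = (\<integral>x. complex_of_real (sqrt (2 * pi)) * (std_normal_density x *\<^sub>R iexp (- (?N * z) * x)) \<partial>lborel)"
    unfolding add_0 gauss_cutoff_normal
    by (intro Bochner_Integration.integral_cong)
       (simp_all add: scaleR_conv_of_real mult_ac del: of_nat_Suc)
  also have "\<dots> = complex_of_real (sqrt (2 * pi)) * char std_normal_distribution (- (?N * z))"
    unfolding char_def integral_mult_right_zero by (subst integral_density) simp_all
  also have "\<dots> = complex_of_real (sqrt (2 * pi) * exp (- (?N * z)\<^sup>2 / 2))"
    by (simp add: char_std_normal_distribution del: of_nat_Suc)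
  also have "sqrt (2 * pi) * exp (- (?N * z)\<^sup>2 / 2) = 2 * pi * std_normal_density (?N * z)"
  proof -
    have "sqrt (2 * pi) * sqrt (2 * pi) = 2 * pi" by simp
    then have "2 * pi * (1 / sqrt (2 * pi)) = sqrt (2 * pi)" by (simp add: real_div_sqrt)
    then show ?thesis unfolding std_normal_density_def by (metis mult.assoc)
  qed
  finally show ?thesis
    by (simp add: gauss_kernel_def scaleR_conv_of_real mult_ac del: of_nat_Suc)
qed

definition gauss_mollify :: "nat \<Rightarrow> (real \<Rightarrow> real) \<Rightarrow> real \<Rightarrow> real" where
  "gauss_mollify n g x = (\<integral>y. g y * gauss_kernel n (y - x) \<partial>lborel)"

text \<open>A regularized Parseval identity. The transforms of integrable functions are merely
  bounded, and the cutoff supplies the integrability that the multiplication formula needs.\<close>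

lemma fourier_bilinear_gauss:
  assumes f: "integrable lborel f" and g: "integrable lborel g"
  shows "(\<integral>\<xi>. fourier f \<xi> * (cnj (fourier g \<xi>) * complex_of_real (gauss_cutoff n \<xi>)) \<partial>lborel)
     = complex_of_real (\<integral>x. f x * gauss_mollify n g x \<partial>lborel)" (is "?L = _")
    and "integrable lborel (\<lambda>\<xi>. fourier f \<xi> * (cnj (fourier g \<xi>) * complex_of_real (gauss_cutoff n \<xi>)))"
proof -
  have [measurable]: "f \<in> borel_measurable borel" "g \<in> borel_measurable borel" using f g by auto
  have bd: "integrable lborel (\<lambda>\<xi>. h \<xi> * complex_of_real (gauss_cutoff n \<xi>))"
    if [measurable]: "h \<in> borel_measurable borel" and "\<And>\<xi>. cmod (h \<xi>) \<le> C" for h C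
  proof (rule Bochner_Integration.integrable_bound)
    show "integrable lborel (\<lambda>\<xi>. C * gauss_cutoff n \<xi>)"
      using gauss_cutoff_integrable by (rule integrable_mult_right)
    have "norm (h \<xi> * complex_of_real (gauss_cutoff n \<xi>)) \<le> norm (C * gauss_cutoff n \<xi>)" for \<xi>
    proof -
      have "0 \<le> C" using that(2) norm_ge_zero order_trans by blast
      then show ?thesis using that(2)[of \<xi>] gauss_cutoff_bounds[of n \<xi>]
        by (simp add: norm_mult abs_mult mult_right_mono)
    qed
    then show "AE \<xi> in lborel. norm (h \<xi> * complex_of_real (gauss_cutoff n \<xi>)) \<le> norm (C * gauss_cutoff n \<xi>)" by simp
  qed measurable
  have i1: "integrable lborel (\<lambda>\<xi>. cnj (fourier g \<xi>) * complex_of_real (gauss_cutoff n \<xi>))"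
    by (rule bd[where C = "\<integral>x. \<bar>g x\<bar> \<partial>lborel"]) (auto simp: norm_fourier_le)
  have inner: "(\<integral>\<xi>. exp (- (\<i> * complex_of_real \<xi> * complex_of_real x)) * (cnj (fourier g \<xi>) * complex_of_real (gauss_cutoff n \<xi>)) \<partial>lborel)
      = complex_of_real (gauss_mollify n g x)" for x
  proof -
    let ?w = "\<lambda>\<xi>. exp (\<i> * complex_of_real \<xi> * complex_of_real x) * complex_of_real (gauss_cutoff n \<xi>)"
    have w: "integrable lborel ?w" by (rule bd[where C = 1]) auto
    have "(\<integral>\<xi>. exp (- (\<i> * complex_of_real \<xi> * complex_of_real x)) * (cnj (fourier g \<xi>) * complex_of_real (gauss_cutoff n \<xi>)) \<partial>lborel)
        = (\<integral>\<xi>. cnj (fourier g \<xi> * ?w \<xi>) \<partial>lborel)"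
      by (intro Bochner_Integration.integral_cong) (simp_all add: exp_cnj mult_ac)
    also have "\<dots> = cnj (\<integral>\<xi>. fourier g \<xi> * ?w \<xi> \<partial>lborel)" by (rule Bochner_Integration.integral_cnj)
    also have "(\<integral>\<xi>. fourier g \<xi> * ?w \<xi> \<partial>lborel)
        = (\<integral>y. complex_of_real (g y) * (\<integral>\<xi>. exp (- (\<i> * complex_of_real \<xi> * complex_of_real y)) * ?w \<xi> \<partial>lborel) \<partial>lborel)"
      by (rule fourier_pairing(1)[OF g w])
    also have "\<dots> = (\<integral>y. complex_of_real (g y * gauss_kernel n (y - x)) \<partial>lborel)"
    proof (rule Bochner_Integration.integral_cong[OF refl])
      fix y
      have "exp (- (\<i> * complex_of_real \<xi> * complex_of_real y)) * ?w \<xi> = exp (- (\<i> * complex_of_real \<xi> * complex_of_real (y - x))) * complex_of_real (gauss_cutoff n \<xi>)" for \<xi>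
      proof -
        have "exp (- (\<i> * complex_of_real \<xi> * complex_of_real y)) * exp (\<i> * complex_of_real \<xi> * complex_of_real x) = exp (- (\<i> * complex_of_real \<xi> * complex_of_real (y - x)))"
          by (subst exp_add[symmetric]) (simp add: algebra_simps)
        then show ?thesis by (simp only: mult.assoc[symmetric])
      qed
      then show "complex_of_real (g y) * (\<integral>\<xi>. exp (- (\<i> * complex_of_real \<xi> * complex_of_real y)) * ?w \<xi> \<partial>lborel) = complex_of_real (g y * gauss_kernel n (y - x))"
        by (simp only: fourier_gauss_cutoff of_real_mult)
    qed
    also have "cnj \<dots> = complex_of_real (gauss_mollify n g x)"
      unfolding gauss_mollify_def integral_complex_of_real complex_cnj_complex_of_real ..
    finally show ?thesis .
  qed
  show "?L = complex_of_real (\<integral>x. f x * gauss_mollify n g x \<partial>lborel)"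
    unfolding fourier_pairing(1)[OF f i1] inner by (simp flip: of_real_mult)
  have "integrable lborel (\<lambda>\<xi>. (fourier f \<xi> * cnj (fourier g \<xi>)) * complex_of_real (gauss_cutoff n \<xi>))"
    by (rule bd[where C = "(\<integral>x. \<bar>f x\<bar> \<partial>lborel) * (\<integral>x. \<bar>g x\<bar> \<partial>lborel)"])
       (auto simp: norm_mult intro!: mult_mono norm_fourier_le)
  then show "integrable lborel (\<lambda>\<xi>. fourier f \<xi> * (cnj (fourier g \<xi>) * complex_of_real (gauss_cutoff n \<xi>)))"
    by (simp only: mult.assoc)
qed

section \<open>Mollification and Parseval's inequality for integrable functions\<close>

lemma gauss_mollify_eq:
  "gauss_mollify n g x = 2 * pi * (\<integral>v. g (x + v / real (Suc n)) * std_normal_density v \<partial>lborel)"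
proof -
  let ?N = "real (Suc n)"
  have "gauss_mollify n g x = \<bar>1 / ?N\<bar> *\<^sub>R (\<integral>v. g (x + 1 / ?N * v) * gauss_kernel n (x + 1 / ?N * v - x) \<partial>lborel)"
    unfolding gauss_mollify_def by (rule lborel_integral_real_affine) simp
  also have "\<dots> = \<bar>1 / ?N\<bar> *\<^sub>R (\<integral>v. (2 * pi * ?N) * (g (x + v / ?N) * std_normal_density v) \<partial>lborel)"
    by (simp add: gauss_kernel_def mult_ac del: of_nat_Suc)
  also have "\<dots> = 2 * pi * (\<integral>v. g (x + v / ?N) * std_normal_density v \<partial>lborel)"
    by (simp del: of_nat_Suc)
  finally show ?thesis .
qed

lemma gauss_mollify_bound:
  assumes [measurable]: "g \<in> borel_measurable borel" and "\<And>x. \<bar>g x\<bar> \<le> B"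
  shows "\<bar>gauss_mollify n g x\<bar> \<le> 2 * pi * B"
proof -
  have "\<bar>\<integral>v. g (x + v / real (Suc n)) * std_normal_density v \<partial>lborel\<bar> \<le> (\<integral>v. B * std_normal_density v \<partial>lborel)"
  proof (rule order_trans[OF integral_abs_bound integral_mono'])
    show "integrable lborel (\<lambda>v. B * std_normal_density v)"
      by (intro integrable_mult_right integrable_normal_density) simp
    show "\<bar>g (x + v / real (Suc n)) * std_normal_density v\<bar> \<le> B * std_normal_density v" for v
      using assms(2) by (auto simp: abs_mult intro!: mult_right_mono)
    have "0 \<le> B" using assms(2) abs_ge_zero order_trans by blast
    then show "0 \<le> B * std_normal_density v" for v by simp
  qed
  also have "\<dots> = B" by (simp add: integral_normal_density)
  finally show ?thesis unfolding gauss_mollify_eq by (simp add: abs_mult)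
qed

lemma gauss_mollify_tendsto:
  assumes g: "continuous_on UNIV g" and B: "\<And>x. \<bar>g x\<bar> \<le> B"
  shows "(\<lambda>n. gauss_mollify n g x) \<longlonglongrightarrow> 2 * pi * g x"
proof -
  have [measurable]: "g \<in> borel_measurable borel" using g by (rule borel_measurable_continuous_onI)
  have "(\<lambda>n. \<integral>v. g (x + v / real (Suc n)) * std_normal_density v \<partial>lborel) \<longlonglongrightarrow> (\<integral>v. g x * std_normal_density v \<partial>lborel)"
  proof (rule integral_dominated_convergence[where w = "\<lambda>v. B * std_normal_density v"])
    show "integrable lborel (\<lambda>v. B * std_normal_density v)"
      by (intro integrable_mult_right integrable_normal_density) simp
    show "AE v in lborel. (\<lambda>n. g (x + v / real (Suc n)) * std_normal_density v) \<longlonglongrightarrow> g x * std_normal_density v"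
    proof (intro AE_I2 tendsto_mult_right)
      fix v
      have "(\<lambda>n. x + v * (1 / real (Suc n))) \<longlonglongrightarrow> x + v * 0"
        using LIMSEQ_inverse_real_of_nat by (intro tendsto_intros) (simp add: inverse_eq_divide)
      then have "(\<lambda>n. x + v / real (Suc n)) \<longlonglongrightarrow> x" by simp
      from continuous_on_tendsto_compose[OF g this] show "(\<lambda>n. g (x + v / real (Suc n))) \<longlonglongrightarrow> g x" by simp
    qed
    show "AE v in lborel. norm (g (x + v / real (Suc n)) * std_normal_density v) \<le> B * std_normal_density v" for n
      using B by (intro AE_I2) (auto simp: abs_mult intro!: mult_right_mono)
  qed measurable
  from tendsto_mult[OF tendsto_const[of "2 * pi"] this] show ?thesis
    unfolding gauss_mollify_eq by (simp add: integral_normal_density)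
qed

text \<open>The inequality \<open>2 * Re (z * cnj w) \<le> |z|^2 + |w|^2\<close> for the two
  transforms is integrated against the cutoff, and the cutoff is then sent to 1. The function
  \<open>d\<close> occurs only in a product with a bounded function, so its integrability
  suffices.\<close>

lemma parseval_test:
  assumes d: "integrable lborel d" and C: "(\<integral>\<^sup>+\<xi>. ennreal ((cmod (fourier d \<xi>))\<^sup>2) \<partial>lborel) \<le> ennreal C" "0 \<le> C"
    and g: "continuous_on UNIV g" "\<And>x. \<bar>g x\<bar> \<le> B" "\<And>x. R < \<bar>x\<bar> \<Longrightarrow> g x = 0"
  shows "4 * pi * (\<integral>x. d x * g x \<partial>lborel) \<le> C + 2 * pi * (\<integral>x. (g x)\<^sup>2 \<partial>lborel)"
proof -
  have [measurable]: "g \<in> borel_measurable borel" using g(1) by (rule borel_measurable_continuous_onI)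
  have [measurable]: "d \<in> borel_measurable borel" using d by auto
  have gi: "integrable lborel g" using g by (intro integrable_bounded_Icc[of g B R]) auto
  have B0: "0 \<le> B" using g(2) abs_ge_zero order_trans by blast
  have lim: "(\<lambda>n. \<integral>x. f x * gauss_mollify n g x \<partial>lborel) \<longlonglongrightarrow> (\<integral>x. f x * (2 * pi * g x) \<partial>lborel)"
    if f: "integrable lborel f" for f
  proof (rule integral_dominated_convergence[where w = "\<lambda>x. 2 * pi * B * \<bar>f x\<bar>"])
    have [measurable]: "f \<in> borel_measurable borel" using f by auto
    show "(\<lambda>x. f x * (2 * pi * g x)) \<in> borel_measurable lborel" by measurable
    have "(\<lambda>x. gauss_mollify n g x) \<in> borel_measurable borel" for n
      unfolding gauss_mollify_def gauss_kernel_def by (rule lborel_integral_measurable) measurable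
    then show "(\<lambda>x. f x * gauss_mollify n g x) \<in> borel_measurable lborel" for n by measurable
    show "integrable lborel (\<lambda>x. 2 * pi * B * \<bar>f x\<bar>)" using f by (intro integrable_mult_right integrable_abs)
    show "AE x in lborel. (\<lambda>n. f x * gauss_mollify n g x) \<longlonglongrightarrow> f x * (2 * pi * g x)"
      by (intro AE_I2 tendsto_mult_left gauss_mollify_tendsto[OF g(1,2)])
    have "norm (f x * gauss_mollify n g x) \<le> 2 * pi * B * \<bar>f x\<bar>" for n x
      using mult_left_mono[OF gauss_mollify_bound[of g B n x], of "\<bar>f x\<bar>"] g(2) by (simp add: abs_mult mult_ac)
    then show "AE x in lborel. norm (f x * gauss_mollify n g x) \<le> 2 * pi * B * \<bar>f x\<bar>" for n by simp
  qed
  have Fd: "integrable lborel (\<lambda>\<xi>. (cmod (fourier d \<xi>))\<^sup>2)"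
    using le_less_trans[OF C(1)] by (intro integrableI_nonneg) auto
  have FdC: "(\<integral>\<xi>. (cmod (fourier d \<xi>))\<^sup>2 \<partial>lborel) \<le> C"
    using C nn_integral_eq_integral[OF Fd] by simp
  have key: "2 * (\<integral>x. d x * gauss_mollify n g x \<partial>lborel) \<le> C + (\<integral>x. g x * gauss_mollify n g x \<partial>lborel)" for n
  proof -
    let ?D = "\<lambda>\<xi>. fourier d \<xi> * (cnj (fourier g \<xi>) * complex_of_real (gauss_cutoff n \<xi>))"
    let ?G = "\<lambda>\<xi>. fourier g \<xi> * (cnj (fourier g \<xi>) * complex_of_real (gauss_cutoff n \<xi>))"
    have "2 * Re (?D \<xi>) \<le> (cmod (fourier d \<xi>))\<^sup>2 + Re (?G \<xi>)" for \<xi>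
    proof -
      let ?c = "gauss_cutoff n \<xi>"
      have c: "0 < ?c" "?c \<le> 1" by (rule gauss_cutoff_bounds)+
      have "Re (?D \<xi>) = Re (fourier d \<xi> * cnj (fourier g \<xi>)) * ?c" by (simp add: mult.assoc[symmetric] del: times_complex.sel) simp
      also have "\<dots> \<le> (cmod (fourier d \<xi>) * cmod (fourier g \<xi>)) * ?c"
        using c complex_Re_le_cmod[of "fourier d \<xi> * cnj (fourier g \<xi>)"] by (intro mult_right_mono) (auto simp: norm_mult)
      finally have 1: "Re (?D \<xi>) \<le> cmod (fourier d \<xi>) * cmod (fourier g \<xi>) * ?c" .
      have 2: "Re (?G \<xi>) = (cmod (fourier g \<xi>))\<^sup>2 * ?c"
        by (simp add: mult.assoc[symmetric] complex_norm_square[symmetric] del: times_complex.sel of_real_power flip: of_real_power of_real_mult)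
      have "2 * (cmod (fourier d \<xi>) * cmod (fourier g \<xi>)) \<le> (cmod (fourier d \<xi>))\<^sup>2 + (cmod (fourier g \<xi>))\<^sup>2"
        using zero_le_power2[of "cmod (fourier d \<xi>) - cmod (fourier g \<xi>)"] by (simp add: power2_diff)
      then have "2 * (cmod (fourier d \<xi>) * cmod (fourier g \<xi>)) * ?c \<le> ((cmod (fourier d \<xi>))\<^sup>2 + (cmod (fourier g \<xi>))\<^sup>2) * ?c"
        using c by (intro mult_right_mono) auto
      \<comment> \<open>The cutoff is dropped only from the term with \<open>d\<close>. In the term
        with \<open>g\<close> it stays, and turns that term into the integral of \<open>g\<close>
        against its mollification.\<close>
      moreover have "(cmod (fourier d \<xi>))\<^sup>2 * ?c \<le> (cmod (fourier d \<xi>))\<^sup>2" using c by (intro mult_left_le) auto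
      ultimately show ?thesis using 1 2 by (simp add: distrib_right)
    qed
    then have "(\<integral>\<xi>. 2 * Re (?D \<xi>) \<partial>lborel) \<le> (\<integral>\<xi>. (cmod (fourier d \<xi>))\<^sup>2 + Re (?G \<xi>) \<partial>lborel)"
      using Fd integrable_Re[OF fourier_bilinear_gauss(2)[OF d gi, of n]] integrable_Re[OF fourier_bilinear_gauss(2)[OF gi gi, of n]]
      by (intro integral_mono integrable_mult_right Bochner_Integration.integrable_add)
    also have "(\<integral>\<xi>. 2 * Re (?D \<xi>) \<partial>lborel) = 2 * (\<integral>x. d x * gauss_mollify n g x \<partial>lborel)"
      using integral_Re[OF fourier_bilinear_gauss(2)[OF d gi, of n]] fourier_bilinear_gauss(1)[OF d gi, of n]
      unfolding integral_mult_right_zero by simp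
    also have "(\<integral>\<xi>. (cmod (fourier d \<xi>))\<^sup>2 + Re (?G \<xi>) \<partial>lborel) = (\<integral>\<xi>. (cmod (fourier d \<xi>))\<^sup>2 \<partial>lborel) + (\<integral>x. g x * gauss_mollify n g x \<partial>lborel)"
      using Fd integrable_Re[OF fourier_bilinear_gauss(2)[OF gi gi, of n]]
      by (subst Bochner_Integration.integral_add)
        (simp_all add: integral_Re[OF fourier_bilinear_gauss(2)[OF gi gi, of n]] fourier_bilinear_gauss(1)[OF gi gi, of n] del: times_complex.sel)
    finally show ?thesis using FdC by linarith
  qed
  have "2 * (\<integral>x. d x * (2 * pi * g x) \<partial>lborel) \<le> C + (\<integral>x. g x * (2 * pi * g x) \<partial>lborel)"
    by (rule LIMSEQ_le[OF tendsto_mult[OF tendsto_const lim[OF d]] tendsto_add[OF tendsto_const lim[OF gi]]]) (use key in auto)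
  also have "(\<integral>x. d x * (2 * pi * g x) \<partial>lborel) = 2 * pi * (\<integral>x. d x * g x \<partial>lborel)"
    unfolding integral_mult_right_zero[symmetric] by (simp add: mult_ac)
  also have "(\<integral>x. g x * (2 * pi * g x) \<partial>lborel) = 2 * pi * (\<integral>x. (g x)\<^sup>2 \<partial>lborel)"
    unfolding integral_mult_right_zero[symmetric] by (simp add: mult_ac power2_eq_square)
  finally show ?thesis by simp
qed

text \<open>Measurable functions are almost everywhere limits of continuous ones; clipping the
  values and multiplying by a continuous cutoff keeps the bound and the support under
  control.\<close>

lemma bounded_continuous_approximation:
  fixes b :: "real \<Rightarrow> real"
  assumes b: "b \<in> borel_measurable borel" "\<And>x. \<bar>b x\<bar> \<le> m" "\<And>x. m < \<bar>x\<bar> \<Longrightarrow> b x = 0"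
  obtains g where "\<And>n. continuous_on UNIV (g n)" "\<And>n x. \<bar>g n x\<bar> \<le> m" "\<And>n x. m + 1 < \<bar>x\<bar> \<Longrightarrow> g n x = 0"
    "AE x in lborel. (\<lambda>n. g n x) \<longlonglongrightarrow> b x"
proof -
  have m0: "0 \<le> m" using b(2) abs_ge_zero order_trans by blast
  have "b \<in> borel_measurable lebesgue" using b(1) by (intro measurable_completion) simp
  then have "b measurable_on UNIV" by (rule lebesgue_measurable_imp_measurable_on) simp
  then obtain N h where N: "negligible N" and h: "\<And>n. continuous_on UNIV (h n)" "\<And>x. x \<notin> N \<Longrightarrow> (\<lambda>n. h n x) \<longlonglongrightarrow> b x"
    unfolding measurable_on_def by auto
  \<comment> \<open>The second factor is 1 on \<open>[-m, m]\<close> and vanishes beyond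
    \<open>m + 1\<close>.\<close>
  define g where "g n x = max (- m) (min m (h n x)) * max 0 (min 1 (m + 1 - \<bar>x\<bar>))" for n x
  have "AE x in lebesgue. x \<notin> N"
    using N by (intro AE_not_in) (simp add: negligible_iff_null_sets)
  then have "AE x in lborel. x \<notin> N" by (simp add: AE_completion_iff)
  then have lim: "AE x in lborel. (\<lambda>n. g n x) \<longlonglongrightarrow> b x"
  proof eventually_elim
    case (elim x)
    have "(\<lambda>n. g n x) \<longlonglongrightarrow> max (- m) (min m (b x)) * max 0 (min 1 (m + 1 - \<bar>x\<bar>))"
      unfolding g_def by (intro tendsto_mult_right tendsto_max tendsto_min tendsto_const h elim)
    also have "max (- m) (min m (b x)) * max 0 (min 1 (m + 1 - \<bar>x\<bar>)) = b x"
      using b(2)[of x] b(3)[of x] m0 by (cases "m < \<bar>x\<bar>") (auto simp: max_def min_def abs_le_iff)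
    finally show ?case .
  qed
  show thesis
  proof (rule that[OF _ _ _ lim])
    show "continuous_on UNIV (g n)" for n
      unfolding g_def by (intro continuous_intros h)
    show "\<bar>g n x\<bar> \<le> m" for n x
    proof -
      have "\<bar>g n x\<bar> \<le> m * 1" unfolding g_def abs_mult using m0 by (intro mult_mono) auto
      then show ?thesis by simp
    qed
    show "g n x = 0" if "m + 1 < \<bar>x\<bar>" for n x using that by (simp add: g_def)
  qed
qed

text \<open>Square integrability of \<open>d\<close> is not known beforehand. The test function in
  \<open>parseval_test\<close> is therefore a truncation \<open>b\<close> of \<open>d\<close>
  itself: since \<open>d * b = b^2\<close>, the inequality becomes \<open>2 * pi\<close> times the
  integral of \<open>b^2\<close> being at most \<open>C\<close>. The truncations increase to
  \<open>d\<close>.\<close>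

lemma parseval_le:
  assumes d: "integrable lborel d"
  shows "(\<integral>\<^sup>+x. ennreal ((d x)\<^sup>2) \<partial>lborel) \<le> ennreal (1 / (2 * pi)) * (\<integral>\<^sup>+\<xi>. ennreal ((cmod (fourier d \<xi>))\<^sup>2) \<partial>lborel)"
proof (cases "(\<integral>\<^sup>+\<xi>. ennreal ((cmod (fourier d \<xi>))\<^sup>2) \<partial>lborel) = \<infinity>")
  case True
  then show ?thesis by (simp add: ennreal_mult_top)
next
  case False
  then obtain C where C: "(\<integral>\<^sup>+\<xi>. ennreal ((cmod (fourier d \<xi>))\<^sup>2) \<partial>lborel) = ennreal C" "0 \<le> C"
    by (cases "\<integral>\<^sup>+\<xi>. ennreal ((cmod (fourier d \<xi>))\<^sup>2) \<partial>lborel") auto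
  have [measurable]: "d \<in> borel_measurable borel" using d by auto
  \<comment> \<open>Truncation in value and in argument makes \<open>b m\<close> bounded with
    bounded support, and its square increases with \<open>m\<close>.\<close>
  define b where "b m x = (if \<bar>d x\<bar> \<le> real m \<and> \<bar>x\<bar> \<le> real m then d x else 0)" for m x
  have [measurable]: "b m \<in> borel_measurable borel" for m unfolding b_def by measurable
  have bm: "\<bar>b m x\<bar> \<le> real m" "real m < \<bar>x\<bar> \<Longrightarrow> b m x = 0" for m x by (auto simp: b_def)
  have bi: "integrable lborel (\<lambda>x. (b m x)\<^sup>2)" for m
    using bm by (intro integrable_bounded_Icc[of _ "(real m)\<^sup>2" "real m"]) (auto simp: power2_le_iff_abs_le)
  have ub: "(\<integral>x. (b m x)\<^sup>2 \<partial>lborel) \<le> C / (2 * pi)" for m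
  proof -
    obtain g where g: "\<And>n. continuous_on UNIV (g n)" "\<And>n x. \<bar>g n x\<bar> \<le> real m" "\<And>n x. real m + 1 < \<bar>x\<bar> \<Longrightarrow> g n x = 0"
      "AE x in lborel. (\<lambda>n. g n x) \<longlonglongrightarrow> b m x"
      by (rule bounded_continuous_approximation[of "b m" "real m"]) (use bm in auto)
    have [measurable]: "g n \<in> borel_measurable borel" for n using g(1) by (rule borel_measurable_continuous_onI)
    have l1: "(\<lambda>n. \<integral>x. d x * g n x \<partial>lborel) \<longlonglongrightarrow> (\<integral>x. d x * b m x \<partial>lborel)"
    proof (rule integral_dominated_convergence[where w = "\<lambda>x. real m * \<bar>d x\<bar>"])
      show "AE x in lborel. (\<lambda>n. d x * g n x) \<longlonglongrightarrow> d x * b m x"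
        using g(4) by eventually_elim (intro tendsto_mult_left)
      show "AE x in lborel. norm (d x * g n x) \<le> real m * \<bar>d x\<bar>" for n
        using g(2) by (intro AE_I2) (auto simp: abs_mult mult.commute[of "real m"] intro!: mult_left_mono)
    qed (use d in auto)
    have l2: "(\<lambda>n. \<integral>x. (g n x)\<^sup>2 \<partial>lborel) \<longlonglongrightarrow> (\<integral>x. (b m x)\<^sup>2 \<partial>lborel)"
    proof (rule integral_dominated_convergence[where w = "\<lambda>x. (real m)\<^sup>2 * indicator {-(real m + 1)..real m + 1} x"])
      show "AE x in lborel. (\<lambda>n. (g n x)\<^sup>2) \<longlonglongrightarrow> (b m x)\<^sup>2"
        using g(4) by eventually_elim (intro tendsto_power)
      show "AE x in lborel. norm ((g n x)\<^sup>2) \<le> (real m)\<^sup>2 * indicator {-(real m + 1)..real m + 1} x" for n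
      proof (rule AE_I2)
        fix x show "norm ((g n x)\<^sup>2) \<le> (real m)\<^sup>2 * indicator {-(real m + 1)..real m + 1} x"
          using g(2)[of n x] g(3)[where n=n and x=x] by (cases "real m + 1 < \<bar>x\<bar>") (auto simp: power2_le_iff_abs_le indicator_def abs_le_iff)
      qed
      show "integrable lborel (\<lambda>x. (real m)\<^sup>2 * indicator {-(real m + 1)..real m + 1} x)"
        by (intro integrable_mult_right integrable_real_indicator) (auto simp: emeasure_lborel_Icc_eq)
    qed measurable
    have "4 * pi * (\<integral>x. d x * b m x \<partial>lborel) \<le> C + 2 * pi * (\<integral>x. (b m x)\<^sup>2 \<partial>lborel)"
      by (rule LIMSEQ_le[OF tendsto_mult[OF tendsto_const l1] tendsto_add[OF tendsto_const tendsto_mult[OF tendsto_const l2]]])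
        (use parseval_test[OF d eq_refl[OF C(1)] C(2) g(1-3)] in auto)
    moreover have "d x * b m x = (b m x)\<^sup>2" for x by (simp add: b_def power2_eq_square)
    ultimately show ?thesis by (simp add: field_simps)
  qed
  have "(\<integral>\<^sup>+x. ennreal ((d x)\<^sup>2) \<partial>lborel) \<le> (\<integral>\<^sup>+x. (SUP m. ennreal ((b m x)\<^sup>2)) \<partial>lborel)"
  proof (rule nn_integral_mono)
    fix x
    obtain m :: nat where "max \<bar>d x\<bar> \<bar>x\<bar> \<le> real m" using real_arch_simple by blast
    then have "b m x = d x" by (simp add: b_def)
    then show "ennreal ((d x)\<^sup>2) \<le> (SUP m. ennreal ((b m x)\<^sup>2))" by (intro SUP_upper2[of m]) auto
  qed
  also have "\<dots> = (SUP m. \<integral>\<^sup>+x. ennreal ((b m x)\<^sup>2) \<partial>lborel)"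
  proof (rule nn_integral_monotone_convergence_SUP)
    show "incseq (\<lambda>m x. ennreal ((b m x)\<^sup>2))"
    proof (intro incseq_SucI le_funI ennreal_leI)
      fix m x show "(b m x)\<^sup>2 \<le> (b (Suc m) x)\<^sup>2" by (simp add: b_def)
    qed
  qed measurable
  also have "\<dots> \<le> ennreal (C / (2 * pi))"
    using ub by (intro SUP_least) (simp add: nn_integral_eq_integral[OF bi] ennreal_leI)
  also have "\<dots> = ennreal (1 / (2 * pi)) * ennreal C" using C by (simp flip: ennreal_mult)
  finally show ?thesis unfolding C(1) .
qed

context hurst
begin

text \<open>The first factor is Parseval's constant; the second bounds the squared multiplier of the
  increment by \<open>3 * R\<close> relative to the weight.\<close>

definition poincare_const :: "real \<Rightarrow> real" where
  "poincare_const R = 1 / (2 * pi) * (4 * (3 * R) powr (1 - 2 * H))"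

text \<open>Parseval for the increment \<open>f(x) - f(x - 3R)\<close>, whose two terms have disjoint supports.\<close>

lemma poincare:
  assumes f: "integrable lborel f" and R: "0 < R" "\<And>x. R < \<bar>x\<bar> \<Longrightarrow> f x = 0"
  shows "(\<integral>\<^sup>+x. ennreal ((f x)\<^sup>2) \<partial>lborel) \<le>
     ennreal (poincare_const R) * (\<integral>\<^sup>+\<xi>. ennreal ((cmod (fourier f \<xi>))\<^sup>2 * weight \<xi>) \<partial>lborel)"
proof -
  let ?p = "1 - 2 * H"
  have [measurable]: "f \<in> borel_measurable borel" using f by auto
  let ?d = "\<lambda>x. f x - f (x - 3 * R)"
  have f3: "integrable lborel (\<lambda>x. f (x - 3 * R))"
    using lborel_integrable_real_affine[OF f, of 1 "- 3 * R"] by simp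
  have d: "integrable lborel ?d" using f f3 by (rule Bochner_Integration.integrable_diff)
  have Fd: "fourier ?d \<xi> = (1 - exp (- (\<i> * complex_of_real \<xi> * complex_of_real (3 * R)))) * fourier f \<xi>" for \<xi>
  proof -
    have "fourier ?d \<xi> = fourier f \<xi> - fourier (\<lambda>x. f (x - 3 * R)) \<xi>"
      unfolding fourier_def using fourier_integrable[OF f, of \<xi>] fourier_integrable[OF f3, of \<xi>]
      by (subst Bochner_Integration.integral_diff[symmetric]) (auto simp: algebra_simps)
    then show ?thesis by (simp add: fourier_shift left_diff_distrib)
  qed
  \<comment> \<open>For a small angle the squared multiplier is at most the squared angle, hence at
    most its power \<open>1 - 2 * H\<close>; for an angle of at least 1 it is at most 4. The factor
    4 covers both cases.\<close>
  have inc: "(cmod (1 - exp (- (\<i> * complex_of_real \<xi> * complex_of_real (3 * R)))))\<^sup>2 \<le> 4 * (3 * R) powr ?p * weight \<xi>" for \<xi>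
  proof -
    let ?\<theta> = "- (\<xi> * (3 * R))"
    have e: "exp (- (\<i> * complex_of_real \<xi> * complex_of_real (3 * R))) = iexp ?\<theta>" by (simp add: mult_ac)
    have 1: "cmod (1 - iexp ?\<theta>) \<le> \<bar>?\<theta>\<bar>" using iexp_approx1[of ?\<theta> 0] by (simp add: norm_minus_commute)
    have 2: "cmod (1 - iexp ?\<theta>) \<le> 2" using norm_triangle_ineq4[of 1 "iexp ?\<theta>"] by simp
    have "(cmod (1 - iexp ?\<theta>))\<^sup>2 \<le> 4 * \<bar>?\<theta>\<bar> powr ?p"
    proof (cases "\<bar>?\<theta>\<bar> < 1")
      case True
      have "(cmod (1 - iexp ?\<theta>))\<^sup>2 \<le> \<bar>?\<theta>\<bar>\<^sup>2" using 1 by (intro power_mono) auto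
      also have "\<bar>?\<theta>\<bar>\<^sup>2 \<le> \<bar>?\<theta>\<bar> powr ?p"
      proof (cases "?\<theta> = 0")
        case False
        then have "\<bar>?\<theta>\<bar>\<^sup>2 = \<bar>?\<theta>\<bar> powr 2" by (simp add: powr_numeral)
        also have "\<dots> \<le> \<bar>?\<theta>\<bar> powr ?p" using True H_pos by (intro powr_mono') auto
        finally show ?thesis .
      next
        case True
        then have "\<bar>?\<theta>\<bar>\<^sup>2 = 0" by (simp only: abs_zero) simp
        then show ?thesis by (simp only: powr_ge_zero)
      qed
      also have "\<dots> \<le> 4 * \<bar>?\<theta>\<bar> powr ?p" by simp
      finally show ?thesis .
    next
      case False
      have "(cmod (1 - iexp ?\<theta>))\<^sup>2 \<le> 2\<^sup>2" using 2 by (intro power_mono) auto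
      also have "\<dots> \<le> 4 * \<bar>?\<theta>\<bar> powr ?p" using False H_less ge_one_powr_ge_zero[of "\<bar>?\<theta>\<bar>" ?p] by simp
      finally show ?thesis .
    qed
    also have "\<bar>?\<theta>\<bar> powr ?p = (3 * R) powr ?p * weight \<xi>"
      using R(1) by (simp add: abs_mult powr_mult mult.commute)
    finally show ?thesis unfolding e by (simp add: mult.assoc)
  qed
  have "(\<integral>\<^sup>+x. ennreal ((f x)\<^sup>2) \<partial>lborel) \<le> (\<integral>\<^sup>+x. ennreal ((?d x)\<^sup>2) \<partial>lborel)"
  proof (rule nn_integral_mono)
    fix x
    show "ennreal ((f x)\<^sup>2) \<le> ennreal ((?d x)\<^sup>2)"
    proof (cases "R < \<bar>x\<bar>")
      case False
      then have "R < \<bar>x - 3 * R\<bar>" using R(1) by (auto simp: abs_real_def split: if_splits)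
      then show ?thesis using R(2) by simp
    qed (simp add: R(2))
  qed
  also have "\<dots> \<le> ennreal (1 / (2 * pi)) * (\<integral>\<^sup>+\<xi>. ennreal ((cmod (fourier ?d \<xi>))\<^sup>2) \<partial>lborel)"
    by (rule parseval_le[OF d])
  finally have 1: "(\<integral>\<^sup>+x. ennreal ((f x)\<^sup>2) \<partial>lborel) \<le> ennreal (1 / (2 * pi)) * (\<integral>\<^sup>+\<xi>. ennreal ((cmod (fourier ?d \<xi>))\<^sup>2) \<partial>lborel)" .
  have "(\<integral>\<^sup>+\<xi>. ennreal ((cmod (fourier ?d \<xi>))\<^sup>2) \<partial>lborel)
      \<le> (\<integral>\<^sup>+\<xi>. ennreal (4 * (3 * R) powr ?p) * ennreal ((cmod (fourier f \<xi>))\<^sup>2 * weight \<xi>) \<partial>lborel)"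
  proof (rule nn_integral_mono)
    fix \<xi>
    have "(cmod (fourier ?d \<xi>))\<^sup>2 \<le> (4 * (3 * R) powr ?p * weight \<xi>) * (cmod (fourier f \<xi>))\<^sup>2"
      unfolding Fd norm_mult power_mult_distrib by (intro mult_right_mono inc) auto
    then show "ennreal ((cmod (fourier ?d \<xi>))\<^sup>2) \<le> ennreal (4 * (3 * R) powr ?p) * ennreal ((cmod (fourier f \<xi>))\<^sup>2 * weight \<xi>)"
      by (subst ennreal_mult[symmetric]) (auto intro!: ennreal_leI simp: mult_ac)
  qed
  also have "\<dots> = ennreal (4 * (3 * R) powr ?p) * (\<integral>\<^sup>+\<xi>. ennreal ((cmod (fourier f \<xi>))\<^sup>2 * weight \<xi>) \<partial>lborel)"
    by (rule nn_integral_cmult) measurable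
  finally have 2: "(\<integral>\<^sup>+\<xi>. ennreal ((cmod (fourier ?d \<xi>))\<^sup>2) \<partial>lborel) \<le> \<dots>" .
  have c: "ennreal (poincare_const R) = ennreal (1 / (2 * pi)) * ennreal (4 * (3 * R) powr ?p)"
    unfolding poincare_const_def by (rule ennreal_mult) auto
  show ?thesis
    unfolding c mult.assoc by (rule order_trans[OF 1 mult_left_mono[OF 2]]) simp
qed

end

section \<open>The stochastic integral tested against the noise\<close>

context noise
begin

section \<open>The filtration and predictable processes\<close>

definition adapted_tests :: "real \<Rightarrow> (real \<times> real \<Rightarrow> real) set" where
  "adapted_tests t = {\<phi>. test_fun \<phi> \<and> (\<forall>s x. t < s \<longrightarrow> \<phi> (s, x) = 0)}"

abbreviation tests :: "(real \<times> real \<Rightarrow> real) set" where "tests \<equiv> {\<phi>. test_fun \<phi>}"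

lemma test_space_tests: "test_space tests"
  by (simp add: test_space_def test_fun_zero test_fun_lincomb)

lemma test_space_adapted: "test_space (adapted_tests t)"
  by (auto simp: test_space_def adapted_tests_def test_fun_zero test_fun_lincomb)

lemma noise_filtration_eq: "noise_filtration M W t = noise_sigma M W (adapted_tests t)"
  unfolding noise_filtration_def noise_sigma_def adapted_tests_def by (simp add: conj_assoc)

lemma sets_noise_sigma_subset:
  assumes "T \<subseteq> tests" shows "sets (noise_sigma M W T) \<subseteq> sets M"
proof -
  have "{W \<phi> -` B \<inter> space M | \<phi> B. \<phi> \<in> T \<and> B \<in> sets borel} \<union> null_sets M \<subseteq> sets M"
    using assms W_measurable by (auto simp: null_sets_def intro: measurable_sets)
  then show ?thesis unfolding sets_noise_sigma by (rule sets.sigma_sets_subset)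
qed

lemma sets_noise_sigma_mono: "T \<subseteq> T' \<Longrightarrow> sets (noise_sigma M W T) \<subseteq> sets (noise_sigma M W T')"
  unfolding sets_noise_sigma by (intro sigma_sets_mono') auto

lemma adapted_tests_subset: "adapted_tests t \<subseteq> tests"
  by (auto simp: adapted_tests_def)

lemma sets_noise_filtration:
  "sets (noise_filtration M W t) \<subseteq> sets (noise_sigma M W tests)" "sets (noise_filtration M W t) \<subseteq> sets M"
  unfolding noise_filtration_eq
  using sets_noise_sigma_mono sets_noise_sigma_subset adapted_tests_subset by auto

lemma sets_noise_filtration_space: "A \<in> sets (noise_filtration M W t) \<Longrightarrow> A \<subseteq> space M"
  using sets_noise_filtration(2) sets.sets_into_space by blast

text \<open>The generators are rectangles whose second side belongs to some sigma-algebra of the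
  filtration, so measurability can be checked on the two coordinates separately.\<close>

lemma measurable_into_predictable:
  assumes f: "\<And>x. x \<in> space N \<Longrightarrow> 0 \<le> f x" and g: "\<And>x. x \<in> space N \<Longrightarrow> g x \<in> space M"
    and [measurable]: "f \<in> borel_measurable N"
    and gm: "\<And>t A. A \<in> sets (noise_filtration M W t) \<Longrightarrow> {x \<in> space N. g x \<in> A} \<in> sets N"
  shows "(\<lambda>x. (f x, g x)) \<in> measurable N (predictable_sigma M W)"
  unfolding predictable_sigma_def
proof (rule measurable_measure_of)
  show "{{0} \<times> A | A. A \<in> sets (noise_filtration M W 0)}
      \<union> {{a<..b} \<times> A | a b A. 0 \<le> a \<and> a \<le> b \<and> A \<in> sets (noise_filtration M W a)} \<subseteq> Pow ({0..} \<times> space M)"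
    using sets_noise_filtration_space by fastforce
  show "(\<lambda>x. (f x, g x)) \<in> space N \<rightarrow> {0..} \<times> space M" using f g by auto
  fix B assume "B \<in> {{0} \<times> A | A. A \<in> sets (noise_filtration M W 0)}
      \<union> {{a<..b} \<times> A | a b A. 0 \<le> a \<and> a \<le> b \<and> A \<in> sets (noise_filtration M W a)}"
  then consider A where "B = {0} \<times> A" "A \<in> sets (noise_filtration M W 0)"
    | a b A where "B = {a<..b} \<times> A" "A \<in> sets (noise_filtration M W a)" by blast
  then show "(\<lambda>x. (f x, g x)) -` B \<inter> space N \<in> sets N"
  proof cases
    case 1
    have "(\<lambda>x. (f x, g x)) -` B \<inter> space N = {x \<in> space N. f x = 0} \<inter> {x \<in> space N. g x \<in> A}"
      unfolding 1 by auto
    then show ?thesis using gm[OF 1(2)] by simp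
  next
    case 2
    have "(\<lambda>x. (f x, g x)) -` B \<inter> space N = {x \<in> space N. a < f x \<and> f x \<le> b} \<inter> {x \<in> space N. g x \<in> A}"
      unfolding 2 by auto
    then show ?thesis using gm[OF 2(2)] by simp
  qed
qed

text \<open>This makes \<open>u t x\<close> a functional of the noise, to which the density of the
  polynomials applies.\<close>

lemma predictable_slice:
  assumes X: "predictable M W X" and s: "0 \<le> s"
  shows "X s y \<in> borel_measurable (noise_sigma M W tests)"
proof -
  have "(\<lambda>\<omega>. (s, \<omega>)) \<in> measurable (noise_sigma M W tests) (predictable_sigma M W)"
  proof (rule measurable_into_predictable)
    show "{x \<in> space (noise_sigma M W tests). x \<in> A} \<in> sets (noise_sigma M W tests)" if "A \<in> sets (noise_filtration M W t)" for t A
    proof -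
      have "{x \<in> space (noise_sigma M W tests). x \<in> A} = A" using sets_noise_filtration_space[OF that] by auto
      then show ?thesis using that sets_noise_filtration(1) by auto
    qed
  qed (use s in auto)
  then have "(\<lambda>\<omega>. ((s, \<omega>), y)) \<in> measurable (noise_sigma M W tests) (predictable_sigma M W \<Otimes>\<^sub>M borel)"
    by (intro measurable_Pair) auto
  from measurable_compose[OF this X[unfolded predictable_def]] show ?thesis by simp
qed

text \<open>Predictable sets live over nonnegative times, so \<open>max 0\<close> folds the negative
  times back; the integrands to which this is applied vanish there.\<close>

lemma predictable_joint:
  assumes X: "predictable M W X"
  shows "(\<lambda>(\<omega>, z). X (max 0 (fst z)) (snd z) \<omega>) \<in> borel_measurable (M \<Otimes>\<^sub>M (borel :: (real \<times> real) measure))"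
proof -
  let ?N = "M \<Otimes>\<^sub>M (borel \<Otimes>\<^sub>M borel :: (real \<times> real) measure)"
  have "(\<lambda>p. (max 0 (fst (snd p)), fst p)) \<in> measurable ?N (predictable_sigma M W)"
  proof (rule measurable_into_predictable)
    show "{x \<in> space ?N. fst x \<in> A} \<in> sets ?N" if "A \<in> sets (noise_filtration M W t)" for t A
    proof -
      have "A \<in> sets M" using that sets_noise_filtration(2) by auto
      then have "fst -` A \<inter> space ?N \<in> sets ?N" by (rule measurable_sets[OF measurable_fst])
      then show ?thesis by (simp add: vimage_def Int_def conj_commute)
    qed
  qed (auto simp: space_pair_measure)
  then have "(\<lambda>p. ((max 0 (fst (snd p)), fst p), snd (snd p))) \<in> measurable ?N (predictable_sigma M W \<Otimes>\<^sub>M borel)"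
    by (intro measurable_Pair) auto
  from measurable_compose[OF this X[unfolded predictable_def]] show ?thesis
    unfolding borel_prod[symmetric] by (simp add: case_prod_unfold)
qed

section \<open>Integration by parts for simple processes\<close>

lemma expectation_product_bound:
  fixes g :: "'w \<Rightarrow> complex"
  assumes [measurable]: "X \<in> borel_measurable M" "Y \<in> borel_measurable M" "g \<in> borel_measurable M"
    and g: "\<And>\<omega>. cmod (g \<omega>) \<le> 1" and \<kappa>: "0 < \<kappa>"
  shows "ennreal \<bar>cmod (\<integral>\<omega>. X \<omega> * (Y \<omega> * g \<omega>) \<partial>M)\<bar> \<le> ennreal (\<kappa> / 2) * l2 M X + ennreal (1 / (2 * \<kappa>)) * l2 M Y"
\<comment> \<open>If the product is not integrable, its integral is 0 by default and the bound is
  trivial.\<close>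
proof (cases "integrable M (\<lambda>\<omega>. X \<omega> * (Y \<omega> * g \<omega>))")
  case True
  have "ennreal (cmod (\<integral>\<omega>. X \<omega> * (Y \<omega> * g \<omega>) \<partial>M)) \<le> (\<integral>\<^sup>+\<omega>. ennreal (cmod (X \<omega> * (Y \<omega> * g \<omega>))) \<partial>M)"
    by (rule integral_norm_bound_ennreal[OF True])
  also have "\<dots> \<le> (\<integral>\<^sup>+\<omega>. ennreal (\<kappa> / 2) * ennreal ((X \<omega>)\<^sup>2) + ennreal (1 / (2 * \<kappa>)) * ennreal ((Y \<omega>)\<^sup>2) \<partial>M)"
  proof (rule nn_integral_mono)
    fix \<omega>
    have "cmod (X \<omega> * (Y \<omega> * g \<omega>)) \<le> \<bar>X \<omega>\<bar> * \<bar>Y \<omega>\<bar>"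
      using g[of \<omega>] by (auto simp: norm_mult mult.assoc[symmetric] intro!: mult_left_le)
    also have "\<dots> \<le> \<kappa> / 2 * (X \<omega>)\<^sup>2 + 1 / (2 * \<kappa>) * (Y \<omega>)\<^sup>2" using weighted_amgm[OF \<kappa>, of "\<bar>X \<omega>\<bar>" "\<bar>Y \<omega>\<bar>"] by simp
    finally show "ennreal (cmod (X \<omega> * (Y \<omega> * g \<omega>))) \<le> ennreal (\<kappa> / 2) * ennreal ((X \<omega>)\<^sup>2) + ennreal (1 / (2 * \<kappa>)) * ennreal ((Y \<omega>)\<^sup>2)"
      using \<kappa> by (subst (1 2) ennreal_mult'[symmetric]) (simp_all add: ennreal_leI flip: ennreal_plus)
  qed
  also have "\<dots> = ennreal (\<kappa> / 2) * l2 M X + ennreal (1 / (2 * \<kappa>)) * l2 M Y"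
    unfolding l2_def by (subst nn_integral_add) (simp_all add: nn_integral_cmult)
  finally show ?thesis by simp
qed (simp add: not_integrable_integral_eq)

lemma cis_integrable_mult:
  assumes "integrable M (Z :: 'w \<Rightarrow> real)" "W h \<in> borel_measurable M"
  shows "integrable M (\<lambda>\<omega>. Z \<omega> * cis (W h \<omega>))"
  using assms by (intro integrable_mult_bounded) auto

text \<open>Adaptedness enters here. An exponential of \<open>W k\<close> merges with
  \<open>cis (W h)\<close> into the exponential of \<open>h + r * k\<close>, and the part
  \<open>r * k\<close> does not contribute to the pairing with \<open>f\<close>. The polynomial thus
  behaves as a constant in the integration by parts.\<close>

lemma wiener_integral_trig_cis:
  assumes Z: "wiener_integral M H W f Z" and f: "integrable lborel f" "\<And>s y. s \<le> a \<Longrightarrow> f (s, y) = 0"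
    and L: "trig_over (adapted_tests a) L" and h: "test_fun h"
  shows "(\<integral>\<omega>. trig L \<omega> * (Z \<omega> * cis (W h \<omega>)) \<partial>M) = \<i> * q f h * (\<integral>\<omega>. trig L \<omega> * cis (W h \<omega>) \<partial>M)"
  using L
proof (induction L)
  case Nil
  show ?case by simp
next
  case (Cons x L)
  obtain c k where x: "x = (c, k)" by (cases x)
  have k: "k \<in> adapted_tests a" "test_fun k" and L: "trig_over (adapted_tests a) L"
    using Cons.prems x by (auto simp: adapted_tests_def)
  have [measurable]: "Z \<in> borel_measurable M" "W h \<in> borel_measurable M" "W k \<in> borel_measurable M"
    using wiener_integral_square_integrable[OF Z] W_measurable h k by auto
  have [measurable]: "trig L \<in> borel_measurable M"
    by (rule trig_measurable[OF trig_over_test_fun[OF test_space_adapted L]])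
  have iZ: "integrable M Z" by (rule integrable_of_square) (use wiener_integral_square_integrable[OF Z] in auto)
  have one: "(\<integral>\<omega>. Z \<omega> * (cis (r * W k \<omega>) * cis (W h \<omega>)) \<partial>M) = \<i> * q f h * (\<integral>\<omega>. cis (r * W k \<omega>) * cis (W h \<omega>) \<partial>M)" for r
  proof -
    let ?k = "\<lambda>z. r * k z + 1 * h z"
    have tk: "test_fun ?k" by (rule test_fun_lincomb[OF k(2) h])
    have [measurable]: "W ?k \<in> borel_measurable M" by (rule W_measurable[OF tk])
    have ae: "AE \<omega> in M. cis (r * W k \<omega>) * cis (W h \<omega>) = cis (W ?k \<omega>)"
      using W_lincomb[OF k(2) h, of r 1] by eventually_elim (simp add: cis_mult)
    \<comment> \<open>At times up to \<open>a\<close> the function \<open>f\<close> vanishes; after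
      \<open>a\<close> the slice of \<open>k\<close> vanishes, so the kernels of
      \<open>h + r * k\<close> and \<open>h\<close> agree.\<close>
    have "q f ?k = q f h"
    proof -
      have "f z * noise_kernel H ?k z = f z * noise_kernel H h z" for z
      proof (cases z)
        case (Pair s y)
        show ?thesis
        proof (cases "s \<le> a")
          case False
          then have "\<And>x. k (s, x) = 0" using k by (auto simp: adapted_tests_def)
          then show ?thesis unfolding Pair by (simp add: noise_kernel_def)
        qed (simp add: Pair f(2))
      qed
      then show ?thesis unfolding noise_pairing_def by (simp only:)
    qed
    then have "(\<integral>\<omega>. Z \<omega> * cis (W ?k \<omega>) \<partial>M) = \<i> * q f h * (\<integral>\<omega>. cis (W ?k \<omega>) \<partial>M)"
      unfolding wiener_integral_cis[OF Z f(1) tk] W_cis[OF tk] by simp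
    moreover have "(\<integral>\<omega>. Z \<omega> * (cis (r * W k \<omega>) * cis (W h \<omega>)) \<partial>M) = (\<integral>\<omega>. Z \<omega> * cis (W ?k \<omega>) \<partial>M)"
    proof (rule integral_cong_AE)
      show "AE \<omega> in M. Z \<omega> * (cis (r * W k \<omega>) * cis (W h \<omega>)) = Z \<omega> * cis (W ?k \<omega>)"
        using ae by eventually_elim (simp only:)
    qed measurable
    moreover have "(\<integral>\<omega>. cis (r * W k \<omega>) * cis (W h \<omega>) \<partial>M) = (\<integral>\<omega>. cis (W ?k \<omega>) \<partial>M)"
      by (rule integral_cong_AE[OF _ _ ae]) measurable
    ultimately show ?thesis by simp
  qed
  \<comment> \<open>A real part is half the sum of two exponentials; the signs are the values
    \<open>r = 1\<close> and \<open>r = -1\<close> of \<open>one\<close>.\<close>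
  have re: "complex_of_real (Re (c * cis x)) = c / 2 * cis (1 * x) + cnj c / 2 * cis (- 1 * x)" for x
  proof -
    have "complex_of_real (Re w) = (w + cnj w) / 2" for w by (simp add: complex_add_cnj)
    from this[of "c * cis x"] show ?thesis by (simp add: cis_cnj add_divide_distrib)
  qed
  have i: "integrable M (\<lambda>\<omega>. g \<omega> * (Z \<omega> * cis (W h \<omega>)))" "integrable M (\<lambda>\<omega>. g \<omega> * cis (W h \<omega>))"
    if [measurable]: "g \<in> borel_measurable M" and b: "\<And>\<omega>. cmod (g \<omega>) \<le> B" for g and B
  proof -
    show "integrable M (\<lambda>\<omega>. g \<omega> * cis (W h \<omega>))"
      by (rule integrable_const_bound[of _ B]) (use b in \<open>auto simp: norm_mult\<close>)
    show "integrable M (\<lambda>\<omega>. g \<omega> * (Z \<omega> * cis (W h \<omega>)))"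
    proof (rule Bochner_Integration.integrable_bound[OF integrable_mult_right[OF iZ, of B]])
      have "norm (g \<omega> * (Z \<omega> * cis (W h \<omega>))) \<le> norm (B * Z \<omega>)" for \<omega>
        using mult_right_mono[OF order_trans[OF b[of \<omega>] abs_ge_self], of "\<bar>Z \<omega>\<bar>"] by (simp add: norm_mult abs_mult)
      then show "AE \<omega> in M. norm (g \<omega> * (Z \<omega> * cis (W h \<omega>))) \<le> norm (B * Z \<omega>)" by simp
    qed measurable
  qed
  have head: "(\<integral>\<omega>. complex_of_real (Re (c * cis (W k \<omega>))) * (Z \<omega> * cis (W h \<omega>)) \<partial>M)
      = \<i> * q f h * (\<integral>\<omega>. complex_of_real (Re (c * cis (W k \<omega>))) * cis (W h \<omega>) \<partial>M)"
  proof -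
    have "(\<integral>\<omega>. complex_of_real (Re (c * cis (W k \<omega>))) * (Z \<omega> * cis (W h \<omega>)) \<partial>M)
       = (\<integral>\<omega>. c / 2 * (cis (1 * W k \<omega>) * (Z \<omega> * cis (W h \<omega>))) + cnj c / 2 * (cis (- 1 * W k \<omega>) * (Z \<omega> * cis (W h \<omega>))) \<partial>M)"
      unfolding re by (simp add: algebra_simps)
    also have "\<dots> = c / 2 * (\<integral>\<omega>. cis (1 * W k \<omega>) * (Z \<omega> * cis (W h \<omega>)) \<partial>M) + cnj c / 2 * (\<integral>\<omega>. cis (- 1 * W k \<omega>) * (Z \<omega> * cis (W h \<omega>)) \<partial>M)"
      by (subst Bochner_Integration.integral_add) (auto intro!: integrable_mult_right i[of _ 1])
    also have "\<dots> = \<i> * q f h * (c / 2 * (\<integral>\<omega>. cis (1 * W k \<omega>) * cis (W h \<omega>) \<partial>M) + cnj c / 2 * (\<integral>\<omega>. cis (- 1 * W k \<omega>) * cis (W h \<omega>) \<partial>M))"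
      using one[of 1] one[of "-1"] by (simp add: mult.left_commute[of "cis _" "complex_of_real (Z _)"] algebra_simps)
    also have "\<dots> = \<i> * q f h * (\<integral>\<omega>. c / 2 * (cis (1 * W k \<omega>) * cis (W h \<omega>)) + cnj c / 2 * (cis (- 1 * W k \<omega>) * cis (W h \<omega>)) \<partial>M)"
      by (subst Bochner_Integration.integral_add) (auto intro!: integrable_mult_right i[of _ 1])
    also have "\<dots> = \<i> * q f h * (\<integral>\<omega>. complex_of_real (Re (c * cis (W k \<omega>))) * cis (W h \<omega>) \<partial>M)"
      unfolding re by (simp add: algebra_simps)
    finally show ?thesis .
  qed
  have ms: "(\<lambda>\<omega>. complex_of_real (Re (c * cis (W k \<omega>)))) \<in> borel_measurable M"
    "(\<lambda>\<omega>. complex_of_real (trig L \<omega>)) \<in> borel_measurable M" by measurable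
  have b1: "cmod (complex_of_real (Re (c * cis (W k \<omega>)))) \<le> cmod c" for \<omega>
    using abs_Re_le_cmod[of "c * cis (W k \<omega>)"] by (simp add: norm_mult del: times_complex.sel)
  have b2: "cmod (complex_of_real (trig L \<omega>)) \<le> trig_bound L" for \<omega> using trig_bounded by simp
  have "(\<integral>\<omega>. trig (x # L) \<omega> * (Z \<omega> * cis (W h \<omega>)) \<partial>M)
     = (\<integral>\<omega>. complex_of_real (Re (c * cis (W k \<omega>))) * (Z \<omega> * cis (W h \<omega>)) + complex_of_real (trig L \<omega>) * (Z \<omega> * cis (W h \<omega>)) \<partial>M)"
    unfolding x trig_simps of_real_add by (simp only: distrib_right)
  also have "\<dots> = \<i> * q f h * (\<integral>\<omega>. complex_of_real (Re (c * cis (W k \<omega>))) * cis (W h \<omega>) \<partial>M) + \<i> * q f h * (\<integral>\<omega>. trig L \<omega> * cis (W h \<omega>) \<partial>M)"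
    unfolding head[symmetric] Cons.IH[OF L, symmetric]
    by (rule Bochner_Integration.integral_add[OF i(1)[OF ms(1) b1] i(1)[OF ms(2) b2]])
  also have "\<dots> = \<i> * q f h * (\<integral>\<omega>. complex_of_real (Re (c * cis (W k \<omega>))) * cis (W h \<omega>) + complex_of_real (trig L \<omega>) * cis (W h \<omega>) \<partial>M)"
    unfolding distrib_left[symmetric]
    by (simp only: Bochner_Integration.integral_add[OF i(2)[OF ms(1) b1] i(2)[OF ms(2) b2]])
  also have "\<dots> = \<i> * q f h * (\<integral>\<omega>. trig (x # L) \<omega> * cis (W h \<omega>) \<partial>M)"
    unfolding x trig_simps of_real_add by (simp only: distrib_right)
  finally show ?case .
qed

lemma noise_filtration_measurable:
  fixes Y :: "'w \<Rightarrow> real"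
  assumes Y: "Y \<in> borel_measurable (noise_filtration M W a)"
  shows "Y \<in> borel_measurable M"
proof (rule measurableI)
  fix A :: "real set" assume "A \<in> sets borel"
  from measurable_sets[OF Y this] have "Y -` A \<inter> space M \<in> sets (noise_filtration M W a)"
    by (simp add: noise_filtration_eq)
  then show "Y -` A \<inter> space M \<in> sets M" using sets_noise_filtration(2) by blast
qed simp

text \<open>The coefficient \<open>Y\<close> is an \<open>L^2\<close> limit of polynomials over the
  adapted test functions. Multiplication by the square-integrable \<open>Z\<close> and a bounded
  exponential is continuous along such a limit.\<close>

lemma adapted_product_cis:
  fixes Y :: "'w \<Rightarrow> real"
  assumes Y: "Y \<in> borel_measurable (noise_filtration M W a)" "\<And>\<omega>. \<omega> \<in> space M \<Longrightarrow> \<bar>Y \<omega>\<bar> \<le> C"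
    and Z: "wiener_integral M H W f Z" and f: "integrable lborel f" "\<And>s y. s \<le> a \<Longrightarrow> f (s, y) = 0"
    and h: "test_fun h"
  shows "(\<integral>\<omega>. Y \<omega> * (Z \<omega> * cis (W h \<omega>)) \<partial>M) = \<i> * q f h * (\<integral>\<omega>. Y \<omega> * cis (W h \<omega>) \<partial>M)"
proof -
  let ?T = "adapted_tests a"
  have [measurable]: "Z \<in> borel_measurable M" "W h \<in> borel_measurable M"
    using wiener_integral_square_integrable[OF Z] W_measurable h by auto
  have Z2: "integrable M (\<lambda>\<omega>. (Z \<omega>)\<^sup>2)" by (rule wiener_integral_square_integrable[OF Z])
  have iZ: "integrable M Z" by (rule integrable_of_square[OF _ Z2]) measurable
  have [measurable]: "Y \<in> borel_measurable M"
    using Y(1) by (rule noise_filtration_measurable)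
  have C0: "0 \<le> C" using Y(2) not_empty abs_ge_zero order_trans by blast
  have Y2: "integrable M (\<lambda>\<omega>. (Y \<omega>)\<^sup>2)"
    by (rule integrable_const_bound[of _ "C\<^sup>2"]) (use Y(2) C0 in \<open>auto simp: power2_le_iff_abs_le\<close>)
  have "approx ?T 0 Y Y"
    using Y(1) Y2 by (intro approx_noise_sigma_measurable test_space_adapted) (auto simp: noise_filtration_eq)
  then obtain L where L: "\<And>n. trig_over ?T (L n)" "(\<lambda>n. l2 M (\<lambda>\<omega>. trig (L n) \<omega> - Y \<omega>)) \<longlonglongrightarrow> 0"
    by (rule approx_seq) (rule that)
  have [measurable]: "trig (L n) \<in> borel_measurable M" for n
    by (rule trig_measurable[OF trig_over_test_fun[OF test_space_adapted L(1)]])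
  \<comment> \<open>Used with \<open>V = Z\<close> for the left side and with \<open>V = 1\<close>
    for the right side.\<close>
  have lim: "(\<lambda>n. \<integral>\<omega>. trig (L n) \<omega> * (V \<omega> * cis (W h \<omega>)) \<partial>M) \<longlonglongrightarrow> (\<integral>\<omega>. Y \<omega> * (V \<omega> * cis (W h \<omega>)) \<partial>M)"
    if [measurable]: "V \<in> borel_measurable M" and V2: "integrable M (\<lambda>\<omega>. (V \<omega>)\<^sup>2)" for V :: "'w \<Rightarrow> real"
  proof -
    have iV: "integrable M V" by (rule integrable_of_square[OF _ V2]) measurable
    have int: "integrable M (\<lambda>\<omega>. complex_of_real (g \<omega>) * (complex_of_real (V \<omega>) * cis (W h \<omega>)))"
      if [measurable]: "g \<in> borel_measurable M" and b: "\<And>\<omega>. \<omega> \<in> space M \<Longrightarrow> \<bar>g \<omega>\<bar> \<le> B" for g :: "'w \<Rightarrow> real" and B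
    proof (rule Bochner_Integration.integrable_bound[OF integrable_mult_right[OF iV, of B]])
      show "AE \<omega> in M. norm (complex_of_real (g \<omega>) * (complex_of_real (V \<omega>) * cis (W h \<omega>))) \<le> norm (B * V \<omega>)"
      proof (rule AE_I2)
        fix \<omega> assume "\<omega> \<in> space M"
        from mult_right_mono[OF order_trans[OF b[OF this] abs_ge_self], of "\<bar>V \<omega>\<bar>"]
        show "norm (complex_of_real (g \<omega>) * (complex_of_real (V \<omega>) * cis (W h \<omega>))) \<le> norm (B * V \<omega>)"
          by (simp add: norm_mult abs_mult)
      qed
    qed measurable
    have "(\<lambda>n. cmod (\<integral>\<omega>. complex_of_real (trig (L n) \<omega> - Y \<omega>) * (V \<omega> * cis (W h \<omega>)) \<partial>M)) \<longlonglongrightarrow> 0"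
    proof (rule null_of_weighted_bounds)
      show "ennreal \<bar>cmod (\<integral>\<omega>. complex_of_real (trig (L n) \<omega> - Y \<omega>) * (V \<omega> * cis (W h \<omega>)) \<partial>M)\<bar>
         \<le> ennreal (\<kappa> / 2) * l2 M (\<lambda>\<omega>. trig (L n) \<omega> - Y \<omega>) + ennreal (1 / (2 * \<kappa>)) * l2 M V" if "0 < \<kappa>" for \<kappa> n
        by (rule expectation_product_bound) (use that in auto)
      show "l2 M V < \<infinity>" using V2 integrable_square_iff_l2[of V M] by simp
    qed (rule L(2))
    then have "(\<lambda>n. \<integral>\<omega>. complex_of_real (trig (L n) \<omega> - Y \<omega>) * (V \<omega> * cis (W h \<omega>)) \<partial>M) \<longlonglongrightarrow> 0"
      by (rule tendsto_norm_zero_cancel)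
    moreover have "(\<integral>\<omega>. complex_of_real (trig (L n) \<omega> - Y \<omega>) * (V \<omega> * cis (W h \<omega>)) \<partial>M)
        = (\<integral>\<omega>. trig (L n) \<omega> * (V \<omega> * cis (W h \<omega>)) \<partial>M) - (\<integral>\<omega>. Y \<omega> * (V \<omega> * cis (W h \<omega>)) \<partial>M)" for n
      unfolding of_real_diff left_diff_distrib
      by (rule Bochner_Integration.integral_diff[OF int[OF _ trig_bounded] int[OF _ Y(2)]]) measurable
    ultimately show ?thesis by (simp add: LIM_zero_cancel)
  qed
  have 1: "(\<lambda>n. \<integral>\<omega>. trig (L n) \<omega> * (Z \<omega> * cis (W h \<omega>)) \<partial>M) \<longlonglongrightarrow> (\<integral>\<omega>. Y \<omega> * (Z \<omega> * cis (W h \<omega>)) \<partial>M)"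
    by (rule lim[OF _ Z2]) measurable
  have "(\<lambda>n. \<integral>\<omega>. trig (L n) \<omega> * cis (W h \<omega>) \<partial>M) \<longlonglongrightarrow> (\<integral>\<omega>. Y \<omega> * cis (W h \<omega>) \<partial>M)"
    using lim[of "\<lambda>_. 1"] by simp
  then have "(\<lambda>n. \<i> * q f h * (\<integral>\<omega>. trig (L n) \<omega> * cis (W h \<omega>) \<partial>M)) \<longlonglongrightarrow> \<i> * q f h * (\<integral>\<omega>. Y \<omega> * cis (W h \<omega>) \<partial>M)"
    by (rule tendsto_mult_left)
  then have "(\<lambda>n. \<integral>\<omega>. trig (L n) \<omega> * (Z \<omega> * cis (W h \<omega>)) \<partial>M) \<longlonglongrightarrow> \<i> * q f h * (\<integral>\<omega>. Y \<omega> * cis (W h \<omega>) \<partial>M)"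
    by (simp only: wiener_integral_trig_cis[OF Z f L(1) h])
  with 1 show ?thesis by (rule LIMSEQ_unique)
qed

text \<open>Under the test \<open>cis (W h)\<close>, the integral of a simple process becomes the
  expected pairing of its paths with \<open>h\<close>. The time intervals are open on the left, so
  the integrand with coefficient \<open>Y j\<close> vanishes up to time \<open>a j\<close>, as
  \<open>adapted_product_cis\<close> requires.\<close>

lemma simple_integral_props:
  assumes "simple_integral M H W S I"
  obtains B R where "0 \<le> B" "\<And>\<omega> z. \<omega> \<in> space M \<Longrightarrow> \<bar>S (fst z) (snd z) \<omega>\<bar> \<le> B"
    "\<And>\<omega> s y. \<not> (0 \<le> s \<and> s \<le> R \<and> \<bar>y\<bar> \<le> R) \<Longrightarrow> S s y \<omega> = 0"
    "(\<lambda>(\<omega>, z). S (fst z) (snd z) \<omega>) \<in> borel_measurable (M \<Otimes>\<^sub>M (borel :: (real \<times> real) measure))"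
    "I \<in> borel_measurable M" "integrable M (\<lambda>\<omega>. (I \<omega>)\<^sup>2)"
    "\<And>h. test_fun h \<Longrightarrow> (\<integral>\<omega>. I \<omega> * cis (W h \<omega>) \<partial>M) = \<i> * (\<integral>\<omega>. q (\<lambda>z. S (fst z) (snd z) \<omega>) h * cis (W h \<omega>) \<partial>M)"
proof -
  obtain m :: nat and a b \<phi> Y \<zeta> where
    D: "\<And>j. j < m \<Longrightarrow> 0 \<le> a j \<and> a j \<le> b j \<and> smooth_compact (\<phi> j) \<and>
               Y j \<in> borel_measurable (noise_filtration M W (a j)) \<and>
               (\<exists>C. \<forall>\<omega>\<in>space M. \<bar>Y j \<omega>\<bar> \<le> C) \<and>
               wiener_integral M H W (\<lambda>(s, y). indicator {a j<..b j} s * \<phi> j y) (\<zeta> j)"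
    and S: "S = (\<lambda>s y \<omega>. \<Sum>j<m. Y j \<omega> * indicator {a j<..b j} s * \<phi> j y)"
    and I: "I = (\<lambda>\<omega>. \<Sum>j<m. Y j \<omega> * \<zeta> j \<omega>)"
    using assms unfolding simple_integral_def by blast
  define f where "f j = (\<lambda>z. indicator {a j<..b j} (fst z) * \<phi> j (snd z) :: real)" for j
  have wf: "wiener_integral M H W (f j) (\<zeta> j)" if "j < m" for j
    using D[OF that] unfolding f_def case_prod_unfold by blast
  have "\<forall>j. \<exists>C. j < m \<longrightarrow> (\<forall>\<omega>\<in>space M. \<bar>Y j \<omega>\<bar> \<le> C)" using D by blast
  then obtain C where C: "\<And>j \<omega>. j < m \<Longrightarrow> \<omega> \<in> space M \<Longrightarrow> \<bar>Y j \<omega>\<bar> \<le> C j" by metis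
  have C0: "0 \<le> C j" if "j < m" for j using C[OF that] not_empty abs_ge_zero order_trans by blast
  have "\<forall>j. \<exists>r. j < m \<longrightarrow> 0 < r \<and> (\<forall>x. \<bar>\<phi> j x\<bar> \<le> r) \<and> (\<forall>x. r < norm x \<longrightarrow> \<phi> j x = 0)"
    using D smooth_compact_bounds by metis
  then obtain r where r: "\<And>j. j < m \<Longrightarrow> 0 < r j \<and> (\<forall>x. \<bar>\<phi> j x\<bar> \<le> r j) \<and> (\<forall>x. r j < norm x \<longrightarrow> \<phi> j x = 0)" by metis
  have [measurable]: "\<phi> j \<in> borel_measurable borel" if "j < m" for j
    using D[OF that] smooth_compact_continuous by (intro borel_measurable_continuous_onI) blast
  have Ym: "Y j \<in> borel_measurable M" if "j < m" for j
    by (rule noise_filtration_measurable[of _ "a j"]) (use D[OF that] in blast)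
  have fb: "\<bar>f j z\<bar> \<le> r j" if "j < m" for j z
    using r[OF that] by (auto simp: f_def indicator_def less_imp_le)
  \<comment> \<open>All summands are nonnegative, so the sum dominates every \<open>b j\<close> and
    every \<open>r j\<close>.\<close>
  define R where "R = (\<Sum>j<m. b j + r j)"
  have Rj: "b j \<le> R" "r j \<le> R" if "j < m" for j
  proof -
    have "0 \<le> b i + r i" if "i < m" for i
      using D[OF that] r[OF that] by auto
    then have "b j + r j \<le> R" unfolding R_def
      by (intro member_le_sum[of j "{..<m}" "\<lambda>j. b j + r j"]) (use that in auto)
    moreover have "0 \<le> b j" "0 \<le> r j" using D[OF that] r[OF that] by auto
    ultimately show "b j \<le> R" "r j \<le> R" by auto
  qed
  have f0: "f j (s, y) = 0" if "j < m" "\<not> (0 \<le> s \<and> s \<le> R \<and> \<bar>y\<bar> \<le> R)" for j s y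
  proof (cases "s \<in> {a j<..b j}")
    case True
    then have "0 \<le> s" "s \<le> R" using D[OF that(1)] Rj[OF that(1)] by auto
    then have "r j < norm y" using that Rj[OF that(1)] by auto
    then show ?thesis using r[OF that(1)] by (simp add: f_def)
  qed (simp add: f_def)
  have [measurable]: "f j \<in> borel_measurable borel" if "j < m" for j
    using that unfolding f_def borel_prod[symmetric] by measurable
  have fi: "integrable lborel (f j)" if "j < m" for j
    using fb[OF that] f0[OF that] that by (intro integrable_bounded_box[of _ "r j" R]) auto
  have Sf: "S (fst z) (snd z) \<omega> = (\<Sum>j<m. Y j \<omega> * f j z)" for z \<omega>
    unfolding S f_def by (simp add: mult.assoc)
  have Z2: "\<zeta> j \<in> borel_measurable M" "integrable M (\<lambda>\<omega>. (\<zeta> j \<omega>)\<^sup>2)" if "j < m" for j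
    using wiener_integral_square_integrable[OF wf[OF that]] by auto
  note [measurable] = Ym Z2(1)
  have iZ: "integrable M (\<zeta> j)" if "j < m" for j using integrable_of_square[OF Z2[OF that]] .
  have iY: "integrable M (\<lambda>\<omega>. complex_of_real (Y j \<omega>) * (g \<omega> :: complex))" if "j < m" "integrable M g" for j g
  proof (rule Bochner_Integration.integrable_bound[OF integrable_mult_right[OF that(2), of "complex_of_real (C j)"]])
    show "(\<lambda>\<omega>. complex_of_real (Y j \<omega>) * g \<omega>) \<in> borel_measurable M" using that by measurable
    show "AE \<omega> in M. norm (complex_of_real (Y j \<omega>) * g \<omega>) \<le> norm (complex_of_real (C j) * g \<omega>)"
      using C[OF that(1)] C0[OF that(1)] by (auto simp: norm_mult intro!: mult_right_mono)
  qed
  show thesis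
  proof (rule that[of "\<Sum>j<m. C j * r j" R])
    show "0 \<le> (\<Sum>j<m. C j * r j)" using C0 r by (intro sum_nonneg mult_nonneg_nonneg) (auto intro: less_imp_le)
    show "\<bar>S (fst z) (snd z) \<omega>\<bar> \<le> (\<Sum>j<m. C j * r j)" if "\<omega> \<in> space M" for \<omega> z
      unfolding Sf
    proof (rule order_trans[OF sum_abs sum_mono])
      fix j assume "j \<in> {..<m}"
      then have "j < m" by simp
      then show "\<bar>Y j \<omega> * f j z\<bar> \<le> C j * r j"
        unfolding abs_mult using that by (intro mult_mono C C0 fb) auto
    qed
    show "S s y \<omega> = 0" if "\<not> (0 \<le> s \<and> s \<le> R \<and> \<bar>y\<bar> \<le> R)" for \<omega> s y
      using Sf[of "(s, y)" \<omega>] f0[OF _ that] by simp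
    show "(\<lambda>(\<omega>, z). S (fst z) (snd z) \<omega>) \<in> borel_measurable (M \<Otimes>\<^sub>M (borel :: (real \<times> real) measure))"
      unfolding Sf by measurable
    show "I \<in> borel_measurable M" unfolding I by measurable
    show "integrable M (\<lambda>\<omega>. (I \<omega>)\<^sup>2)"
    proof -
      have "l2 M (\<lambda>\<omega>. \<Sum>j<k. Y j \<omega> * \<zeta> j \<omega>) < \<infinity>" if "k \<le> m" for k
        using that
      proof (induction k)
        case 0
        show ?case by (simp add: l2_def)
      next
        case (Suc k)
        have k: "k < m" using Suc by simp
        have [measurable]: "(\<lambda>\<omega>. \<Sum>j<k. Y j \<omega> * \<zeta> j \<omega>) \<in> borel_measurable M"
          using Suc.prems by (intro borel_measurable_sum) auto
        have "integrable M (\<lambda>\<omega>. (Y k \<omega> * \<zeta> k \<omega>)\<^sup>2)"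
        proof (rule Bochner_Integration.integrable_bound[OF integrable_mult_right[OF Z2(2)[OF k], of "(C k)\<^sup>2"]])
          show "AE \<omega> in M. norm ((Y k \<omega> * \<zeta> k \<omega>)\<^sup>2) \<le> norm ((C k)\<^sup>2 * (\<zeta> k \<omega>)\<^sup>2)"
            using C[OF k] C0[OF k] by (intro AE_I2) (auto simp: power_mult_distrib power2_le_iff_abs_le intro!: mult_right_mono)
        qed (use k in measurable)
        then have "l2 M (\<lambda>\<omega>. Y k \<omega> * \<zeta> k \<omega>) < \<infinity>" using k by (subst integrable_square_iff_l2[symmetric]) auto
        moreover have "l2 M (\<lambda>\<omega>. (\<Sum>j<k. Y j \<omega> * \<zeta> j \<omega>) + Y k \<omega> * \<zeta> k \<omega>) \<le> 2 * l2 M (\<lambda>\<omega>. \<Sum>j<k. Y j \<omega> * \<zeta> j \<omega>) + 2 * l2 M (\<lambda>\<omega>. Y k \<omega> * \<zeta> k \<omega>)"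
          using k by (intro l2_add_le) auto
        ultimately show ?case using Suc by (simp add: ennreal_mult_less_top le_less_trans)
      qed
      from this[of m] have "l2 M I < \<infinity>" unfolding I by simp
      then show ?thesis using \<open>I \<in> borel_measurable M\<close> by (simp add: integrable_square_iff_l2)
    qed
    fix h assume h: "test_fun h"
    have [measurable]: "W h \<in> borel_measurable M" by (rule W_measurable[OF h])
    have "(\<integral>\<omega>. I \<omega> * cis (W h \<omega>) \<partial>M) = (\<integral>\<omega>. (\<Sum>j<m. complex_of_real (Y j \<omega>) * (\<zeta> j \<omega> * cis (W h \<omega>))) \<partial>M)"
      unfolding I by (simp add: sum_distrib_right mult.assoc)
    also have "\<dots> = (\<Sum>j<m. \<integral>\<omega>. complex_of_real (Y j \<omega>) * (\<zeta> j \<omega> * cis (W h \<omega>)) \<partial>M)"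
      by (intro Bochner_Integration.integral_sum iY cis_integrable_mult iZ) auto
    also have "\<dots> = (\<Sum>j<m. \<i> * q (f j) h * (\<integral>\<omega>. Y j \<omega> * cis (W h \<omega>) \<partial>M))"
    proof (rule sum.cong[OF refl])
      fix j assume "j \<in> {..<m}"
      then have j: "j < m" by simp
      show "(\<integral>\<omega>. complex_of_real (Y j \<omega>) * (\<zeta> j \<omega> * cis (W h \<omega>)) \<partial>M) = \<i> * q (f j) h * (\<integral>\<omega>. Y j \<omega> * cis (W h \<omega>) \<partial>M)"
        by (rule adapted_product_cis[OF _ C[OF j] wf[OF j] fi[OF j] _ h]) (use D[OF j] in \<open>auto simp: f_def\<close>)
    qed
    also have "\<dots> = \<i> * (\<Sum>j<m. (\<integral>\<omega>. complex_of_real (q (f j) h) * (Y j \<omega> * cis (W h \<omega>)) \<partial>M))"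
      by (simp add: sum_distrib_left mult.assoc)
    also have "(\<Sum>j<m. (\<integral>\<omega>. complex_of_real (q (f j) h) * (Y j \<omega> * cis (W h \<omega>)) \<partial>M)) = (\<integral>\<omega>. (\<Sum>j<m. complex_of_real (q (f j) h) * (Y j \<omega> * cis (W h \<omega>))) \<partial>M)"
      by (intro Bochner_Integration.integral_sum[symmetric] integrable_mult_right iY integrable_const_bound[of _ 1]) auto
    also have "\<dots> = (\<integral>\<omega>. q (\<lambda>z. S (fst z) (snd z) \<omega>) h * cis (W h \<omega>) \<partial>M)"
    proof (rule Bochner_Integration.integral_cong[OF refl])
      fix \<omega>
      have "q (\<lambda>z. S (fst z) (snd z) \<omega>) h = (\<integral>z. (\<Sum>j<m. Y j \<omega> * (f j z * noise_kernel H h z)) \<partial>lborel)"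
        unfolding noise_pairing_def Sf by (simp add: sum_distrib_right mult.assoc)
      also have "\<dots> = (\<Sum>j<m. Y j \<omega> * q (f j) h)"
        unfolding noise_pairing_def
        by (subst Bochner_Integration.integral_sum) (auto intro!: integrable_mult_right noise_kernel_mult_integrable h fi)
      finally show "(\<Sum>j<m. complex_of_real (q (f j) h) * (Y j \<omega> * cis (W h \<omega>))) = q (\<lambda>z. S (fst z) (snd z) \<omega>) h * cis (W h \<omega>)"
        by (simp add: sum_distrib_left sum_distrib_right mult_ac)
    qed
    finally show "(\<integral>\<omega>. I \<omega> * cis (W h \<omega>) \<partial>M) = \<i> * (\<integral>\<omega>. q (\<lambda>z. S (fst z) (snd z) \<omega>) h * cis (W h \<omega>) \<partial>M)" .
  qed
qed

end

section \<open>Joint integrability from the norm of the noise, and the Ito integral\<close>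

lemma lborel_nn_integral_prod:
  assumes [measurable]: "f \<in> borel_measurable (borel :: (real \<times> real) measure)"
  shows "(\<integral>\<^sup>+z. f z \<partial>lborel) = (\<integral>\<^sup>+s. (\<integral>\<^sup>+y. f (s, y) \<partial>lborel) \<partial>lborel)"
  using lborel.nn_integral_fst[of f lborel] assms unfolding lborel_prod by simp

text \<open>Without integrability the left side is 0, the default value of the integral.\<close>

lemma nn_integral_norm_bound: "ennreal (norm (integral\<^sup>L N f)) \<le> (\<integral>\<^sup>+x. ennreal (norm (f x)) \<partial>N)"
proof (cases "integrable N f")
  case True
  then show ?thesis by (rule integral_norm_bound_ennreal)
qed (simp add: not_integrable_integral_eq)

context hurst
begin

text \<open>\<open>poincare\<close> on almost every time slice, integrated over time; the division
  by \<open>c_const H\<close> cancels the constant inside \<open>H_norm2\<close>.\<close>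

lemma L2_le_H_norm2:
  assumes [measurable]: "f \<in> borel_measurable borel" and R: "0 < R"
    and supp: "\<And>s y. \<not> (0 \<le> s \<and> s \<le> R \<and> \<bar>y\<bar> \<le> R) \<Longrightarrow> f (s, y) = 0"
    and int: "AE s in lborel. 0 \<le> s \<longrightarrow> integrable lborel (\<lambda>y. f (s, y))"
  shows "(\<integral>\<^sup>+z. ennreal ((f z)\<^sup>2) \<partial>lborel) \<le> ennreal (poincare_const R / c_const H) * H_norm2 H f"
proof -
  let ?A = "\<lambda>s. \<integral>\<^sup>+\<xi>. ennreal ((cmod (fourier (\<lambda>x. f (s, x)) \<xi>))\<^sup>2 * weight \<xi>) \<partial>lborel"
  have [measurable]: "?A \<in> borel_measurable borel" by (rule nn_slice_measurable) measurable
  have P: "0 \<le> poincare_const R" by (simp add: poincare_const_def)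
  have "(\<integral>\<^sup>+z. ennreal ((f z)\<^sup>2) \<partial>lborel) = (\<integral>\<^sup>+s. (\<integral>\<^sup>+y. ennreal ((f (s, y))\<^sup>2) \<partial>lborel) \<partial>lborel)"
    by (rule lborel_nn_integral_prod) measurable
  also have "\<dots> \<le> (\<integral>\<^sup>+s. ennreal (poincare_const R) * (?A s * indicator {0..} s) \<partial>lborel)"
  proof (rule nn_integral_mono_AE)
    show "AE s in lborel. (\<integral>\<^sup>+y. ennreal ((f (s, y))\<^sup>2) \<partial>lborel) \<le> ennreal (poincare_const R) * (?A s * indicator {0..} s)"
      using int
    proof eventually_elim
      case (elim s)
      show ?case
      proof (cases "0 \<le> s")
        case True
        have "(\<integral>\<^sup>+y. ennreal ((f (s, y))\<^sup>2) \<partial>lborel) \<le> ennreal (poincare_const R) * ?A s"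
          by (rule poincare) (use elim True R supp in auto)
        then show ?thesis using True by simp
      next
        case False
        then have "f (s, y) = 0" for y using supp by auto
        then show ?thesis by simp
      qed
    qed
  qed
  also have "\<dots> = ennreal (poincare_const R) * (\<integral>\<^sup>+s. ?A s * indicator {0..} s \<partial>lborel)"
    by (rule nn_integral_cmult) measurable
  also have "ennreal (poincare_const R) = ennreal (poincare_const R / c_const H) * ennreal (c_const H)"
    using P c_const_pos by (subst ennreal_mult[symmetric]) auto
  finally show ?thesis unfolding H_norm2_def by (simp add: mult.assoc)
qed

end

context noise
begin

sublocale P: pair_sigma_finite M "lborel :: (real \<times> real) measure" ..

text \<open>On the box \<open>|G| \<le> G^2 + 1\<close>, and the box has finite measure.\<close>

lemma joint_integrable:
  fixes G :: "'w \<times> (real \<times> real) \<Rightarrow> real"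
  assumes m: "G \<in> borel_measurable (M \<Otimes>\<^sub>M (borel :: (real \<times> real) measure))"
    and supp: "\<And>\<omega> s y. \<not> (0 \<le> s \<and> s \<le> R \<and> \<bar>y\<bar> \<le> R) \<Longrightarrow> G (\<omega>, (s, y)) = 0"
    and sq: "(\<integral>\<^sup>+\<omega>. (\<integral>\<^sup>+z. ennreal ((G (\<omega>, z))\<^sup>2) \<partial>lborel) \<partial>M) < \<infinity>"
  shows "integrable (M \<Otimes>\<^sub>M lborel) G"
proof -
  have [measurable]: "G \<in> borel_measurable (M \<Otimes>\<^sub>M (lborel :: (real \<times> real) measure))" using m by (rule measurable_pair_lborel)
  let ?B = "cbox (- R, - R) (R, R) :: (real \<times> real) set"
  have [measurable]: "snd \<in> measurable (M \<Otimes>\<^sub>M (lborel :: (real \<times> real) measure)) borel"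
    using measurable_snd[of M "lborel :: (real \<times> real) measure"] by simp
  have B: "?B \<in> sets borel" by simp
  note [measurable] = B
  have ind: "(\<lambda>p. indicator ?B (snd p) :: ennreal) \<in> borel_measurable (M \<Otimes>\<^sub>M lborel)" by measurable
  have "(\<integral>\<^sup>+p. ennreal (norm (G p)) \<partial>(M \<Otimes>\<^sub>M lborel)) \<le> (\<integral>\<^sup>+p. ennreal ((G p)\<^sup>2) + indicator ?B (snd p) \<partial>(M \<Otimes>\<^sub>M lborel))"
  proof (rule nn_integral_mono)
    fix p :: "'w \<times> (real \<times> real)"
    obtain \<omega> s y where p: "p = (\<omega>, (s, y))" by (metis prod.exhaust)
    show "ennreal (norm (G p)) \<le> ennreal ((G p)\<^sup>2) + indicator ?B (snd p)"
    proof (cases "(s, y) \<in> ?B")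
      case True
      have "\<bar>G p\<bar> \<le> (G p)\<^sup>2 + 1"
        using zero_le_power2[of "\<bar>G p\<bar> - 1 / 2"] unfolding power2_diff power2_abs by (simp add: power2_eq_square)
      from ennreal_leI[OF this] have "ennreal (norm (G p)) \<le> ennreal ((G p)\<^sup>2 + 1)" by (simp only: real_norm_def)
      also have "\<dots> = ennreal ((G p)\<^sup>2) + 1" by (simp add: ennreal_plus)
      finally show ?thesis using True by (simp add: p)
    next
      case False
      then have "\<not> (0 \<le> s \<and> s \<le> R \<and> \<bar>y\<bar> \<le> R)" by (auto simp: cbox_Pair_eq abs_le_iff)
      then show ?thesis using supp by (simp add: p)
    qed
  qed
  also have "\<dots> = (\<integral>\<^sup>+p. ennreal ((G p)\<^sup>2) \<partial>(M \<Otimes>\<^sub>M lborel)) + (\<integral>\<^sup>+p. indicator ?B (snd p) \<partial>(M \<Otimes>\<^sub>M lborel))"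
    by (rule nn_integral_add) measurable
  also have "\<dots> < \<infinity>"
  proof -
    have "(\<integral>\<^sup>+p. ennreal ((G p)\<^sup>2) \<partial>(M \<Otimes>\<^sub>M lborel)) = (\<integral>\<^sup>+\<omega>. (\<integral>\<^sup>+z. ennreal ((G (\<omega>, z))\<^sup>2) \<partial>lborel) \<partial>M)"
      by (rule lborel.nn_integral_fst[symmetric]) measurable
    moreover have "(\<integral>\<^sup>+p. indicator ?B (snd p) \<partial>(M \<Otimes>\<^sub>M lborel)) = (\<integral>\<^sup>+\<omega>. (\<integral>\<^sup>+z. indicator ?B z \<partial>lborel) \<partial>M)"
      by (simp only: lborel.nn_integral_fst[OF ind, symmetric] snd_conv)
    moreover have "\<dots> < \<infinity>"
      by (simp add: emeasure_space_1 emeasure_lborel_cbox_finite[unfolded infinity_ennreal_def])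
    ultimately show ?thesis using sq by simp
  qed
  finally show ?thesis by (intro integrableI_bounded) auto
qed

lemma joint_kernel_integrable:
  fixes G :: "'w \<times> (real \<times> real) \<Rightarrow> real"
  assumes G: "integrable (M \<Otimes>\<^sub>M lborel) G" and h: "test_fun h"
  shows "integrable (M \<Otimes>\<^sub>M lborel) (\<lambda>(\<omega>, z). complex_of_real (G (\<omega>, z) * noise_kernel H h z) * cis (W h \<omega>))"
proof -
  obtain K where K: "\<And>z. \<bar>noise_kernel H h z\<bar> \<le> K" "0 \<le> K" using test_fun_noise_kernel[OF h] by metis
  have [measurable]: "G \<in> borel_measurable (M \<Otimes>\<^sub>M lborel)" "W h \<in> borel_measurable M"
    using G W_measurable[OF h] by auto
  have [measurable]: "noise_kernel H h \<in> borel_measurable lborel" using noise_kernel_measurable[OF h] by simp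
  show ?thesis
  proof (rule Bochner_Integration.integrable_bound[OF integrable_mult_right[OF G, of K]])
    have "norm (complex_of_real (G (\<omega>, z) * noise_kernel H h z) * cis (W h \<omega>)) \<le> norm (K * G (\<omega>, z))" for \<omega> z
      using mult_left_mono[OF K(1)[of z], of "\<bar>G (\<omega>, z)\<bar>"] K(2) by (simp add: norm_mult abs_mult mult.commute)
    then show "AE p in M \<Otimes>\<^sub>M lborel. norm (case p of (\<omega>, z) \<Rightarrow> complex_of_real (G (\<omega>, z) * noise_kernel H h z) * cis (W h \<omega>)) \<le> norm (K * G p)"
      by (auto simp del: of_real_mult)
  qed measurable
qed

text \<open>Fubini turns the expectation of a pathwise pairing into a deterministic integral of
  tested expectations, which is the form of the Volterra equation.\<close>

lemma joint_pairing:
  fixes G :: "'w \<times> (real \<times> real) \<Rightarrow> real"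
  assumes G: "integrable (M \<Otimes>\<^sub>M lborel) G" and h: "test_fun h"
  shows "integrable M (\<lambda>\<omega>. q (\<lambda>z. G (\<omega>, z)) h * cis (W h \<omega>))"
    and "(\<integral>\<omega>. q (\<lambda>z. G (\<omega>, z)) h * cis (W h \<omega>) \<partial>M)
        = (\<integral>z. noise_kernel H h z * (\<integral>\<omega>. G (\<omega>, z) * cis (W h \<omega>) \<partial>M) \<partial>lborel)"
proof -
  note i = joint_kernel_integrable[OF G h]
  have e: "(\<integral>z. complex_of_real (G (\<omega>, z) * noise_kernel H h z) * cis (W h \<omega>) \<partial>lborel) = q (\<lambda>z. G (\<omega>, z)) h * cis (W h \<omega>)" for \<omega>
    unfolding noise_pairing_def integral_mult_left_zero integral_complex_of_real ..
  show "integrable M (\<lambda>\<omega>. q (\<lambda>z. G (\<omega>, z)) h * cis (W h \<omega>))"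
    using P.integrable_fst[OF i] unfolding e .
  have "(\<integral>\<omega>. q (\<lambda>z. G (\<omega>, z)) h * cis (W h \<omega>) \<partial>M) = (\<integral>\<omega>. (\<integral>z. complex_of_real (G (\<omega>, z) * noise_kernel H h z) * cis (W h \<omega>) \<partial>lborel) \<partial>M)"
    unfolding e ..
  also have "\<dots> = (\<integral>z. (\<integral>\<omega>. complex_of_real (G (\<omega>, z) * noise_kernel H h z) * cis (W h \<omega>) \<partial>M) \<partial>lborel)"
    by (rule P.Fubini_integral[OF i, symmetric])
  also have "\<dots> = (\<integral>z. noise_kernel H h z * (\<integral>\<omega>. G (\<omega>, z) * cis (W h \<omega>) \<partial>M) \<partial>lborel)"
  proof (rule Bochner_Integration.integral_cong[OF refl])
    fix z
    show "(\<integral>\<omega>. complex_of_real (G (\<omega>, z) * noise_kernel H h z) * cis (W h \<omega>) \<partial>M) = noise_kernel H h z * (\<integral>\<omega>. G (\<omega>, z) * cis (W h \<omega>) \<partial>M)"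
      unfolding integral_mult_right_zero[symmetric] by (simp add: mult_ac)
  qed
  finally show "(\<integral>\<omega>. q (\<lambda>z. G (\<omega>, z)) h * cis (W h \<omega>) \<partial>M)
        = (\<integral>z. noise_kernel H h z * (\<integral>\<omega>. G (\<omega>, z) * cis (W h \<omega>) \<partial>M) \<partial>lborel)" .
qed

text \<open>The definition of the Ito integral controls only the distance from \<open>X\<close> to
  simple processes. Where the expected squared norm of the difference is finite, the difference is
  jointly square integrable on a box; the simple process is bounded, and joint integrability of
  \<open>X\<close> follows. The tested formula then passes to the limit through
  \<open>noise_pairing_bound\<close>, applied path by path.\<close>

lemma ito_integral_props:
  assumes ito: "ito_integral M H W X Z"
    and JM: "(\<lambda>(\<omega>, z). X (fst z) (snd z) \<omega>) \<in> borel_measurable (M \<Otimes>\<^sub>M (borel :: (real \<times> real) measure))"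
    and supp: "\<And>s y \<omega>. \<not> (0 \<le> s \<and> s \<le> R \<and> \<bar>y\<bar> \<le> R) \<Longrightarrow> X s y \<omega> = 0"
  shows "Z \<in> borel_measurable M" "integrable M (\<lambda>\<omega>. (Z \<omega>)\<^sup>2)"
    "integrable (M \<Otimes>\<^sub>M lborel) (\<lambda>(\<omega>, z). X (fst z) (snd z) \<omega>)"
    "\<And>h. test_fun h \<Longrightarrow> (\<integral>\<omega>. Z \<omega> * cis (W h \<omega>) \<partial>M)
        = \<i> * (\<integral>z. noise_kernel H h z * (\<integral>\<omega>. X (fst z) (snd z) \<omega> * cis (W h \<omega>) \<partial>M) \<partial>lborel)"
proof -
  obtain S I where SI: "\<And>n. simple_integral M H W (S n) (I n)"
    and lim: "(\<lambda>n. \<integral>\<^sup>+\<omega>. H_norm2 H (\<lambda>(s, y). S n s y \<omega> - X s y \<omega>) \<partial>M) \<longlonglongrightarrow> 0"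
    and LI: "L2_tendsto M I Z" and slices: "AE \<omega> in M. AE s in lborel. 0 \<le> s \<longrightarrow> integrable lborel (\<lambda>y. X s y \<omega>)"
    using ito unfolding ito_integral_def by blast
  have I2: "integrable M (\<lambda>\<omega>. (I n \<omega>)\<^sup>2)" for n by (rule simple_integral_props[OF SI[of n]])
  show "Z \<in> borel_measurable M" using LI by (simp add: L2_tendsto_def)
  show "integrable M (\<lambda>\<omega>. (Z \<omega>)\<^sup>2)" by (rule L2_tendsto_square_integrable[OF LI I2])
  define x where "x = (\<lambda>(\<omega>, z). X (fst z) (snd z) \<omega>)"
  define S' where "S' n = (\<lambda>(\<omega>, z). S n (fst z) (snd z) \<omega>)" for n
  define D where "D n p = S' n p - x p" for n p
  have [measurable]: "x \<in> borel_measurable (M \<Otimes>\<^sub>M borel)" unfolding x_def by (rule JM)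
  have Sm [measurable]: "S' n \<in> borel_measurable (M \<Otimes>\<^sub>M borel)" for n
    unfolding S'_def by (rule simple_integral_props[OF SI[of n]])
  have [measurable]: "D n \<in> borel_measurable (M \<Otimes>\<^sub>M borel)" for n unfolding D_def by measurable
  define N where "N n \<omega> = H_norm2 H (\<lambda>z. D n (\<omega>, z))" for n \<omega>
  have Neq: "H_norm2 H (\<lambda>(s, y). S n s y \<omega> - X s y \<omega>) = N n \<omega>" for n \<omega>
    unfolding N_def D_def S'_def x_def by (simp add: case_prod_unfold)
  have Nlim: "(\<lambda>n. \<integral>\<^sup>+\<omega>. N n \<omega> \<partial>M) \<longlonglongrightarrow> 0" using lim unfolding Neq .
  have Nm [measurable]: "N n \<in> borel_measurable M" for n
  proof -
    have "(\<lambda>p. (fst (fst p), (snd (fst p), snd p))) \<in> measurable ((M \<Otimes>\<^sub>M borel) \<Otimes>\<^sub>M borel) (M \<Otimes>\<^sub>M (borel :: (real \<times> real) measure))"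
      unfolding borel_prod[symmetric] by measurable
    from measurable_compose[OF this \<open>D n \<in> _\<close>]
    show ?thesis unfolding N_def by (intro H_norm2_measurable) (simp add: case_prod_unfold)
  qed
  have Sprops: "\<exists>B R'. 0 \<le> B \<and> (\<forall>\<omega>\<in>space M. \<forall>z. \<bar>S' n (\<omega>, z)\<bar> \<le> B) \<and> (\<forall>\<omega> s y. \<not> (0 \<le> s \<and> s \<le> R' \<and> \<bar>y\<bar> \<le> R') \<longrightarrow> S' n (\<omega>, (s, y)) = 0)" for n
  proof -
    obtain B R' where "0 \<le> B" "\<And>\<omega> z. \<omega> \<in> space M \<Longrightarrow> \<bar>S n (fst z) (snd z) \<omega>\<bar> \<le> B"
      "\<And>\<omega> s y. \<not> (0 \<le> s \<and> s \<le> R' \<and> \<bar>y\<bar> \<le> R') \<Longrightarrow> S n s y \<omega> = 0"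
      by (rule simple_integral_props[OF SI[of n]]) (rule that)
    then show ?thesis by (intro exI[of _ B] exI[of _ R']) (simp add: S'_def)
  qed
  \<comment> \<open>The radius \<open>r\<close> depends on the support of the \<open>n\<close>-th
    simple process. This is harmless: the estimate serves integrability for single \<open>n\<close>,
    whereas convergence is measured in the norm of the noise itself.\<close>
  have Dsq: "AE \<omega> in M. (\<integral>\<^sup>+z. ennreal ((D n (\<omega>, z))\<^sup>2) \<partial>lborel) \<le> ennreal (poincare_const r / c_const H) * N n \<omega>"
    and Dsupp: "\<And>\<omega> s y. \<not> (0 \<le> s \<and> s \<le> r \<and> \<bar>y\<bar> \<le> r) \<Longrightarrow> D n (\<omega>, (s, y)) = 0"
    if B: "\<And>\<omega> z. \<omega> \<in> space M \<Longrightarrow> \<bar>S' n (\<omega>, z)\<bar> \<le> B"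
      and R': "\<And>\<omega> s y. \<not> (0 \<le> s \<and> s \<le> R' \<and> \<bar>y\<bar> \<le> R') \<Longrightarrow> S' n (\<omega>, (s, y)) = 0"
      and r: "r = max 1 (max R R')" for n B R' r
  proof -
    show Dsupp: "D n (\<omega>, (s, y)) = 0" if "\<not> (0 \<le> s \<and> s \<le> r \<and> \<bar>y\<bar> \<le> r)" for \<omega> s y
    proof -
      have "R \<le> r" "R' \<le> r" by (auto simp: r)
      with that have "\<not> (0 \<le> s \<and> s \<le> R \<and> \<bar>y\<bar> \<le> R)" "\<not> (0 \<le> s \<and> s \<le> R' \<and> \<bar>y\<bar> \<le> R')" by linarith+
      from supp[OF this(1)] R'[OF this(2)] show ?thesis by (simp add: D_def x_def)
    qed
    show "AE \<omega> in M. (\<integral>\<^sup>+z. ennreal ((D n (\<omega>, z))\<^sup>2) \<partial>lborel) \<le> ennreal (poincare_const r / c_const H) * N n \<omega>"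
      using slices AE_space
    proof eventually_elim
      case (elim \<omega>)
      have m: "(\<lambda>z. D n (\<omega>, z)) \<in> borel_measurable borel" "(\<lambda>z. S' n (\<omega>, z)) \<in> borel_measurable borel"
        using measurable_compose[OF measurable_Pair1'[OF elim(2)] \<open>D n \<in> _\<close>] measurable_compose[OF measurable_Pair1'[OF elim(2)] Sm[of n]] by auto
      have Si: "integrable lborel (\<lambda>y. S' n (\<omega>, (s, y)))" for s
        by (rule integrable_bounded_Icc[of _ B R']) (use m(2) B[OF elim(2)] R' in auto)
      show ?case
        unfolding N_def
      proof (rule L2_le_H_norm2[OF m(1)])
        show "0 < r" unfolding r by simp
        show "AE s in lborel. 0 \<le> s \<longrightarrow> integrable lborel (\<lambda>y. D n (\<omega>, (s, y)))"
          using elim(1) by eventually_elim (use Si in \<open>auto simp: D_def x_def\<close>)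
      qed (use Dsupp in auto)
    qed
  qed
  have Dint: "integrable (M \<Otimes>\<^sub>M lborel) (D n) \<and> integrable (M \<Otimes>\<^sub>M lborel) (S' n)" if fin: "(\<integral>\<^sup>+\<omega>. N n \<omega> \<partial>M) < \<infinity>" for n
  proof -
    obtain B R' where B: "0 \<le> B" "\<And>\<omega> z. \<omega> \<in> space M \<Longrightarrow> \<bar>S' n (\<omega>, z)\<bar> \<le> B"
      "\<And>\<omega> s y. \<not> (0 \<le> s \<and> s \<le> R' \<and> \<bar>y\<bar> \<le> R') \<Longrightarrow> S' n (\<omega>, (s, y)) = 0"
      using Sprops[of n] by metis
    define r where "r = max 1 (max R R')"
    note d = Dsq[OF B(2,3) r_def] Dsupp[OF B(2,3) r_def]
    have "integrable (M \<Otimes>\<^sub>M lborel) (D n)"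
    proof (rule joint_integrable[where R = r])
      have "(\<integral>\<^sup>+\<omega>. (\<integral>\<^sup>+z. ennreal ((D n (\<omega>, z))\<^sup>2) \<partial>lborel) \<partial>M) \<le> (\<integral>\<^sup>+\<omega>. ennreal (poincare_const r / c_const H) * N n \<omega> \<partial>M)"
        by (rule nn_integral_mono_AE[OF d(1)])
      also have "\<dots> = ennreal (poincare_const r / c_const H) * (\<integral>\<^sup>+\<omega>. N n \<omega> \<partial>M)"
        by (rule nn_integral_cmult) measurable
      also have "\<dots> < \<infinity>" using fin by (simp add: ennreal_mult_less_top)
      finally show "(\<integral>\<^sup>+\<omega>. (\<integral>\<^sup>+z. ennreal ((D n (\<omega>, z))\<^sup>2) \<partial>lborel) \<partial>M) < \<infinity>" .
    qed (use d(2) in auto)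
    moreover have "integrable (M \<Otimes>\<^sub>M lborel) (S' n)"
    proof (rule joint_integrable[where R = R'])
      let ?B = "cbox (- R', - R') (R', R') :: (real \<times> real) set"
      have "(\<integral>\<^sup>+\<omega>. (\<integral>\<^sup>+z. ennreal ((S' n (\<omega>, z))\<^sup>2) \<partial>lborel) \<partial>M) \<le> (\<integral>\<^sup>+\<omega>. (\<integral>\<^sup>+z. ennreal (B\<^sup>2) * indicator ?B z \<partial>lborel) \<partial>M)"
      proof (intro nn_integral_mono)
        fix \<omega> and z :: "real \<times> real" assume w: "\<omega> \<in> space M"
        show "ennreal ((S' n (\<omega>, z))\<^sup>2) \<le> ennreal (B\<^sup>2) * indicator ?B z"
        proof (cases z)
          case (Pair s y)
          show ?thesis
            using B(1) B(2)[OF w, of z] B(3)[of s y \<omega>] unfolding Pair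
            by (cases "0 \<le> s \<and> s \<le> R' \<and> \<bar>y\<bar> \<le> R'") (auto simp: cbox_Pair_eq abs_le_iff power2_le_iff_abs_le intro!: ennreal_leI)
        qed
      qed
      also have "\<dots> < \<infinity>"
        by (simp add: nn_integral_cmult_indicator emeasure_space_1 ennreal_mult_less_top emeasure_lborel_cbox_finite[unfolded infinity_ennreal_def])
      finally show "(\<integral>\<^sup>+\<omega>. (\<integral>\<^sup>+z. ennreal ((S' n (\<omega>, z))\<^sup>2) \<partial>lborel) \<partial>M) < \<infinity>" .
    qed (use B(3) in auto)
    ultimately show ?thesis by simp
  qed
  \<comment> \<open>Convergence to 0 in \<open>ennreal\<close> allows infinite initial terms; from
    \<open>n0\<close> on the expected norms are finite.\<close>
  obtain n0 where n0: "\<And>n. n0 \<le> n \<Longrightarrow> (\<integral>\<^sup>+\<omega>. N n \<omega> \<partial>M) < 1"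
    using order_tendstoD(2)[OF Nlim, of 1] by (auto simp: eventually_sequentially)
  have fin: "(\<integral>\<^sup>+\<omega>. N (n + n0) \<omega> \<partial>M) < \<infinity>" for n
    using n0[of "n + n0"] by (auto intro: less_trans)
  \<comment> \<open>A single good index recovers \<open>X\<close> as simple process minus
    error.\<close>
  have "integrable (M \<Otimes>\<^sub>M lborel) (\<lambda>p. S' (0 + n0) p - D (0 + n0) p)"
    using Dint[OF fin[of 0]] by (intro Bochner_Integration.integrable_diff) auto
  then have xi: "integrable (M \<Otimes>\<^sub>M lborel) x" by (simp add: D_def)
  then show "integrable (M \<Otimes>\<^sub>M lborel) (\<lambda>(\<omega>, z). X (fst z) (snd z) \<omega>)" by (simp add: x_def)
  fix h assume h: "test_fun h"
  have [measurable]: "W h \<in> borel_measurable M" by (rule W_measurable[OF h])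
  let ?E = "\<lambda>G. \<integral>\<omega>. q (\<lambda>z. G (\<omega>, z)) h * cis (W h \<omega>) \<partial>M"
  have "(\<lambda>n. cmod (?E (D (n + n0)))) \<longlonglongrightarrow> 0"
  proof (rule null_of_weighted_bounds[where e = "\<lambda>n. \<integral>\<^sup>+\<omega>. N (n + n0) \<omega> \<partial>M" and B = "H_norm2 H h"])
    fix \<kappa> :: real and n assume \<kappa>: "0 < \<kappa>"
    have Di: "integrable (M \<Otimes>\<^sub>M lborel) (D (n + n0))" using Dint[OF fin[of n]] by simp
    have "ennreal (cmod (?E (D (n + n0)))) \<le> (\<integral>\<^sup>+\<omega>. ennreal (cmod (q (\<lambda>z. D (n + n0) (\<omega>, z)) h * cis (W h \<omega>))) \<partial>M)"
      by (rule nn_integral_norm_bound)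
    also have "\<dots> \<le> (\<integral>\<^sup>+\<omega>. ennreal (\<kappa> / 2) * N (n + n0) \<omega> + ennreal (1 / (2 * \<kappa>)) * H_norm2 H h \<partial>M)"
    proof (rule nn_integral_mono_AE)
      show "AE \<omega> in M. ennreal (cmod (q (\<lambda>z. D (n + n0) (\<omega>, z)) h * cis (W h \<omega>))) \<le> ennreal (\<kappa> / 2) * N (n + n0) \<omega> + ennreal (1 / (2 * \<kappa>)) * H_norm2 H h"
        using P.AE_integrable_fst'[OF Di]
      proof eventually_elim
        case (elim \<omega>)
        from noise_pairing_bound[OF h elim \<kappa>] show ?case by (simp add: N_def norm_mult)
      qed
    qed
    also have "\<dots> = ennreal (\<kappa> / 2) * (\<integral>\<^sup>+\<omega>. N (n + n0) \<omega> \<partial>M) + ennreal (1 / (2 * \<kappa>)) * H_norm2 H h"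
      by (subst nn_integral_add) (simp_all add: nn_integral_cmult emeasure_space_1)
    finally show "ennreal \<bar>cmod (?E (D (n + n0)))\<bar> \<le> ennreal (\<kappa> / 2) * (\<integral>\<^sup>+\<omega>. N (n + n0) \<omega> \<partial>M) + ennreal (1 / (2 * \<kappa>)) * H_norm2 H h"
      by simp
  next
    show "(\<lambda>n. \<integral>\<^sup>+\<omega>. N (n + n0) \<omega> \<partial>M) \<longlonglongrightarrow> 0" using Nlim by (rule LIMSEQ_ignore_initial_segment)
    show "H_norm2 H h < \<infinity>" by (rule H_norm2_test_fun_finite[OF h])
  qed
  then have "(\<lambda>n. ?E (D (n + n0))) \<longlonglongrightarrow> 0" by (rule tendsto_norm_zero_cancel)
  moreover have "?E (D (n + n0)) = ?E (S' (n + n0)) - ?E x" for n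
  proof -
    have Si: "integrable (M \<Otimes>\<^sub>M lborel) (S' (n + n0))" using Dint[OF fin[of n]] by simp
    \<comment> \<open>The pairing is additive only on integrable paths, that is, for almost every
      \<omega>.\<close>
    have "?E (D (n + n0)) = (\<integral>\<omega>. q (\<lambda>z. S' (n + n0) (\<omega>, z)) h * cis (W h \<omega>) - q (\<lambda>z. x (\<omega>, z)) h * cis (W h \<omega>) \<partial>M)"
    proof (rule integral_cong_AE)
      show "(\<lambda>\<omega>. complex_of_real (q (\<lambda>z. D (n + n0) (\<omega>, z)) h) * cis (W h \<omega>)) \<in> borel_measurable M"
        using joint_pairing(1)[OF _ h, of "D (n + n0)"] Dint[OF fin[of n]] by auto
      show "(\<lambda>\<omega>. complex_of_real (q (\<lambda>z. S' (n + n0) (\<omega>, z)) h) * cis (W h \<omega>) - complex_of_real (q (\<lambda>z. x (\<omega>, z)) h) * cis (W h \<omega>)) \<in> borel_measurable M"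
        using joint_pairing(1)[OF Si h] joint_pairing(1)[OF xi h] by (intro borel_measurable_diff) auto
      show "AE \<omega> in M. complex_of_real (q (\<lambda>z. D (n + n0) (\<omega>, z)) h) * cis (W h \<omega>) =
          complex_of_real (q (\<lambda>z. S' (n + n0) (\<omega>, z)) h) * cis (W h \<omega>) - complex_of_real (q (\<lambda>z. x (\<omega>, z)) h) * cis (W h \<omega>)"
        using P.AE_integrable_fst'[OF Si] P.AE_integrable_fst'[OF xi]
      proof eventually_elim
        case (elim \<omega>)
        from noise_pairing_lincomb[OF h elim, of 1 "-1"]
        show ?case by (simp add: D_def left_diff_distrib)
      qed
    qed
    also have "\<dots> = ?E (S' (n + n0)) - ?E x"
      by (rule Bochner_Integration.integral_diff[OF joint_pairing(1)[OF Si h] joint_pairing(1)[OF xi h]])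
    finally show ?thesis .
  qed
  ultimately have "(\<lambda>n. ?E (S' (n + n0))) \<longlonglongrightarrow> ?E x" by (simp add: LIM_zero_cancel)
  then have 1: "(\<lambda>n. \<i> * ?E (S' (n + n0))) \<longlonglongrightarrow> \<i> * ?E x" by (rule tendsto_mult_left)
  have 2: "\<i> * ?E (S' (n + n0)) = (\<integral>\<omega>. I (n + n0) \<omega> * cis (W h \<omega>) \<partial>M)" for n
    by (rule simple_integral_props[OF SI[of "n + n0"]]) (use h in \<open>simp add: S'_def\<close>)
  have "(\<lambda>n. \<integral>\<omega>. I n \<omega> * cis (W h \<omega>) \<partial>M) \<longlonglongrightarrow> (\<integral>\<omega>. Z \<omega> * cis (W h \<omega>) \<partial>M)"
    by (rule L2_tendsto_expectation_mult[OF LI I2]) auto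
  then have "(\<lambda>n. \<integral>\<omega>. I (n + n0) \<omega> * cis (W h \<omega>) \<partial>M) \<longlonglongrightarrow> (\<integral>\<omega>. Z \<omega> * cis (W h \<omega>) \<partial>M)"
    by (rule LIMSEQ_ignore_initial_segment)
  with 1 have "(\<integral>\<omega>. Z \<omega> * cis (W h \<omega>) \<partial>M) = \<i> * ?E x" unfolding 2 by (rule LIMSEQ_unique[symmetric])
  then show "(\<integral>\<omega>. Z \<omega> * cis (W h \<omega>) \<partial>M)
        = \<i> * (\<integral>z. noise_kernel H h z * (\<integral>\<omega>. X (fst z) (snd z) \<omega> * cis (W h \<omega>) \<partial>M) \<partial>lborel)"
    using joint_pairing(2)[OF xi h] by (simp add: x_def)
qed

end

section \<open>Uniqueness for the transformed equation\<close>

text \<open>Half the indicator of the backward light cone with vertex \<open>(t, x)\<close>, cut off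
  at time 0.\<close>

definition wave_cone :: "real \<Rightarrow> real \<Rightarrow> real \<times> real \<Rightarrow> real" where
  "wave_cone t x z = indicator {0..t} (fst z) * wave_kernel (t - fst z) (x - snd z)"

lemma wave_cone_measurable [measurable]: "wave_cone t x \<in> borel_measurable borel"
  unfolding wave_cone_def wave_kernel_def borel_prod[symmetric] by measurable

lemma wave_cone_nonneg: "0 \<le> wave_cone t x z"
  by (simp add: wave_cone_def wave_kernel_def)

lemma wave_cone_translate: "wave_cone t (x + a) ((0, a) + z) = wave_cone t x z"
  by (simp add: wave_cone_def)

lemma wave_cone_support: "\<not> (0 \<le> s \<and> s \<le> \<bar>t\<bar> + \<bar>x\<bar> \<and> \<bar>y\<bar> \<le> \<bar>t\<bar> + \<bar>x\<bar>) \<Longrightarrow> wave_cone t x (s, y) = 0"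
  by (auto simp: wave_cone_def wave_kernel_def indicator_def abs_real_def split: if_splits)

text \<open>The backward cone of a point inside the cone of \<open>(T, X)\<close> lies in the
  latter, so the iteration never leaves one fixed cone.\<close>

lemma wave_cone_subset:
  assumes "\<bar>X - y\<bar> \<le> T - s" shows "wave_cone s y z \<le> wave_cone T X z"
    "wave_cone s y z \<noteq> 0 \<Longrightarrow> 0 \<le> fst z \<and> \<bar>X - snd z\<bar> \<le> T - fst z"
  using assms by (auto simp: wave_cone_def wave_kernel_def indicator_def abs_real_def split: if_splits)

text \<open>Iterating the equation on a backward cone bounds the solution by a multiple of \<open>C\<^sup>n / n!\<close> for every \<open>n\<close>.\<close>

lemma volterra_unique:
  fixes V :: "real \<times> real \<Rightarrow> complex"
  assumes K: "\<And>z. \<bar>k z\<bar> \<le> K"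
    and int: "\<And>t x. 0 \<le> t \<Longrightarrow> integrable lborel (\<lambda>z. wave_cone t x z * V z)"
    and eq: "\<And>t x. 0 \<le> t \<Longrightarrow> V (t, x) = \<i> * (\<integral>z. complex_of_real (k z) * (wave_cone t x z * V z) \<partial>lborel)"
    and T: "0 \<le> T"
  shows "V (T, X) = 0"
proof -
  have K0: "0 \<le> K" using K abs_ge_zero order_trans by blast
  \<comment> \<open>The starting bound: by inclusion of cones, the integral over the cone of
    \<open>(T, X)\<close> dominates \<open>V\<close> at every point of it.\<close>
  define B where "B = K * (\<integral>z. norm (complex_of_real (wave_cone T X z) * V z) \<partial>lborel)"
  have B0: "0 \<le> B" unfolding B_def using K0 by (intro mult_nonneg_nonneg Bochner_Integration.integral_nonneg) auto
  \<comment> \<open>Each step of the iteration gains a factor \<open>K\<close>, half the width of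
    the cone, which is at most \<open>T\<close>, and an integration of \<open>s ^ n / fact n\<close>
    over time.\<close>
  define E where "E n s = B * (K * T) ^ n * s ^ n / fact n" for n :: nat and s :: real
  have E0: "0 \<le> s \<Longrightarrow> 0 \<le> E n s" for n s unfolding E_def using B0 K0 T by simp
  have nb: "ennreal (cmod (V (s, y))) \<le> (\<integral>\<^sup>+z. ennreal (K * (wave_cone s y z * cmod (V z))) \<partial>lborel)" if "0 \<le> s" for s y
  proof -
    have "ennreal (cmod (V (s, y))) \<le> (\<integral>\<^sup>+z. ennreal (cmod (complex_of_real (k z) * (wave_cone s y z * V z))) \<partial>lborel)"
      using nn_integral_norm_bound[of lborel "\<lambda>z. complex_of_real (k z) * (wave_cone s y z * V z)"]
      unfolding eq[OF that] norm_mult by simp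
    also have "\<dots> \<le> (\<integral>\<^sup>+z. ennreal (K * (wave_cone s y z * cmod (V z))) \<partial>lborel)"
      using K by (intro nn_integral_mono ennreal_leI) (auto simp: norm_mult wave_cone_nonneg intro!: mult_right_mono)
    finally show ?thesis .
  qed
  have base: "cmod (V (s, y)) \<le> B" if "0 \<le> s" "\<bar>X - y\<bar> \<le> T - s" for s y
  proof -
    have i: "integrable lborel (\<lambda>z. K * norm (complex_of_real (wave_cone T X z) * V z))"
      using int[OF T] by (intro integrable_mult_right integrable_norm)
    have "ennreal (cmod (V (s, y))) \<le> (\<integral>\<^sup>+z. ennreal (K * (wave_cone s y z * cmod (V z))) \<partial>lborel)"
      by (rule nb[OF that(1)])
    also have "\<dots> \<le> (\<integral>\<^sup>+z. ennreal (K * norm (complex_of_real (wave_cone T X z) * V z)) \<partial>lborel)"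
      using wave_cone_subset(1)[OF that(2)] K0
      by (intro nn_integral_mono ennreal_leI mult_left_mono) (auto simp: norm_mult wave_cone_nonneg intro!: mult_right_mono)
    also have "\<dots> = ennreal B"
      unfolding B_def integral_mult_right_zero[symmetric] using K0 by (intro nn_integral_eq_integral i) auto
    finally show ?thesis using B0 by simp
  qed
  have "cmod (V (s, y)) \<le> E n s" if "0 \<le> s" "\<bar>X - y\<bar> \<le> T - s" for n s y
    using that
  proof (induction n arbitrary: s y)
    case 0
    then show ?case using base by (simp add: E_def)
  next
    case (Suc n)
    have sT: "s \<le> T" using Suc.prems by linarith
    have inner: "(\<integral>\<^sup>+y'. ennreal (K * (wave_cone s y (s', y') * E n s')) \<partial>lborel) \<le> ennreal (K * T * E n s') * indicator {0..s} s'" for s'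
    proof (cases "s' \<in> {0..s}")
      case True
      have e: "K * (wave_cone s y (s', y') * E n s') = K * E n s' / 2 * indicator {y - (s - s')<..<y + (s - s')} y'" for y'
        using True by (auto simp: wave_cone_def wave_kernel_def indicator_def)
      have "(\<integral>\<^sup>+y'. ennreal (K * (wave_cone s y (s', y') * E n s')) \<partial>lborel)
          = (\<integral>\<^sup>+y'. ennreal (K * E n s' / 2) * indicator {y - (s - s')<..<y + (s - s')} y' \<partial>lborel)"
        unfolding e by (intro nn_integral_cong) (auto simp: indicator_def)
      also have "\<dots> = ennreal (K * E n s' / 2) * ennreal (2 * (s - s'))"
        using True by (subst nn_integral_cmult_indicator) auto
      also have "\<dots> = ennreal (K * E n s' * (s - s'))"
        using True K0 E0[of s' n] by (subst ennreal_mult[symmetric]) auto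
      also have "\<dots> \<le> ennreal (K * E n s' * T)"
        using True K0 E0[of s' n] sT by (intro ennreal_leI mult_left_mono) auto
      finally show ?thesis using True by (simp add: mult_ac)
    next
      case False
      then have "wave_cone s y (s', y') = 0" for y' by (auto simp: wave_cone_def indicator_def)
      then show ?thesis by simp
    qed
    have "ennreal (cmod (V (s, y))) \<le> (\<integral>\<^sup>+z. ennreal (K * (wave_cone s y z * cmod (V z))) \<partial>lborel)"
      by (rule nb[OF Suc.prems(1)])
    also have "\<dots> \<le> (\<integral>\<^sup>+z. ennreal (K * (wave_cone s y z * E n (fst z))) \<partial>lborel)"
    proof (rule nn_integral_mono, rule ennreal_leI, rule mult_left_mono[OF _ K0])
      fix z :: "real \<times> real"
      show "wave_cone s y z * cmod (V z) \<le> wave_cone s y z * E n (fst z)"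
      proof (cases "wave_cone s y z = 0")
        case False
        from wave_cone_subset(2)[OF Suc.prems(2) this] Suc.IH[of "fst z" "snd z"]
        show ?thesis by (intro mult_left_mono wave_cone_nonneg) auto
      qed simp
    qed
    also have "\<dots> = (\<integral>\<^sup>+s'. (\<integral>\<^sup>+y'. ennreal (K * (wave_cone s y (s', y') * E n s')) \<partial>lborel) \<partial>lborel)"
    proof -
      have "(\<lambda>z. ennreal (K * (wave_cone s y z * E n (fst z)))) \<in> borel_measurable borel"
        unfolding E_def wave_cone_def wave_kernel_def borel_prod[symmetric] by measurable
      from lborel_nn_integral_prod[OF this] show ?thesis by simp
    qed
    also have "\<dots> \<le> (\<integral>\<^sup>+s'. ennreal (K * T * E n s') * indicator {0..s} s' \<partial>lborel)"
      by (intro nn_integral_mono inner)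
    also have "\<dots> = ennreal (E (Suc n) s - E (Suc n) 0)"
    proof (rule nn_integral_FTC_Icc)
      show "(E (Suc n) has_real_derivative K * T * E n x) (at x)" for x
      proof -
        have p: "((\<lambda>s. s ^ Suc n) has_real_derivative real (Suc n) * x ^ n) (at x)"
          using DERIV_pow[of "Suc n" x UNIV] by (simp del: of_nat_Suc power_Suc)
        have "E (Suc n) = (\<lambda>s. B * (K * T) ^ Suc n / fact (Suc n) * s ^ Suc n)"
          unfolding E_def by (simp only: times_divide_eq_left)
        moreover have "B * (K * T) ^ Suc n / fact (Suc n) * (real (Suc n) * x ^ n) = K * T * E n x"
          unfolding E_def by (simp add: field_simps del: of_nat_Suc)
        ultimately show ?thesis using DERIV_cmult[OF p, of "B * (K * T) ^ Suc n / fact (Suc n)"] by (simp only:)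
      qed
      show "(\<lambda>s'. K * T * E n s') \<in> borel_measurable borel" unfolding E_def by measurable
    qed (use Suc.prems K0 T E0 in auto)
    also have "E (Suc n) s - E (Suc n) 0 = E (Suc n) s" by (simp add: E_def)
    finally show ?case using E0[OF Suc.prems(1)] by simp
  qed
  then have le: "cmod (V (T, X)) \<le> B * ((K * T * T) ^ n / fact n)" for n
    using T by (force simp: E_def power_mult_distrib mult_ac)
  have "(\<lambda>n. (K * T * T) ^ n / fact n) \<longlonglongrightarrow> 0"
    using summable_LIMSEQ_zero[OF summable_exp[of "K * T * T"]] by (simp add: divide_inverse mult.commute)
  then have "(\<lambda>n. B * ((K * T * T) ^ n / fact n)) \<longlonglongrightarrow> 0" by (rule tendsto_mult_right_zero)
  then have "cmod (V (T, X)) \<le> 0" using le by (intro LIMSEQ_le_const) auto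
  then show ?thesis by simp
qed

lemma lborel_integrable_translate:
  fixes f :: "'a::euclidean_space \<Rightarrow> 'b::{banach, second_countable_topology}"
  assumes "integrable lborel f" shows "integrable lborel (\<lambda>z. f (c + z))"
proof -
  have "integrable (distr lborel borel ((+) c)) f" using assms by (simp add: lborel_distr_plus)
  then show ?thesis using assms by (subst (asm) integrable_distr_eq) auto
qed

section \<open>The transform of the solution and its behaviour under shifts\<close>

context noise
begin

definition noise_transform :: "(real \<Rightarrow> real \<Rightarrow> 'w \<Rightarrow> real) \<Rightarrow> (real \<times> real \<Rightarrow> real) \<Rightarrow> real \<times> real \<Rightarrow> complex" where
  "noise_transform u h z = (\<integral>\<omega>. u (fst z) (snd z) \<omega> * cis (W h \<omega>) \<partial>M)"

lemma solution_props:
  assumes sol: "hyperbolic_anderson_solution M H W u" and t: "0 \<le> t"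
  shows "u t x \<in> borel_measurable (noise_sigma M W tests)" "u t x \<in> borel_measurable M"
    "integrable M (\<lambda>\<omega>. (u t x \<omega>)\<^sup>2)"
    "\<And>h. test_fun h \<Longrightarrow> integrable lborel (\<lambda>z. wave_cone t x z * noise_transform u h z)"
    "\<And>h. test_fun h \<Longrightarrow> noise_transform u h (t, x) = exp (- q h h / 2) +
       \<i> * (\<integral>z. complex_of_real (noise_kernel H h z) * (wave_cone t x z * noise_transform u h z) \<partial>lborel)"
proof -
  have pred: "predictable M W u" using sol by (simp add: hyperbolic_anderson_solution_def)
  let ?X = "\<lambda>s y \<omega>. indicator {0..t} s * wave_kernel (t - s) (x - y) * u s y \<omega>"
  obtain Z where Z: "ito_integral M H W ?X Z" and uZ: "AE \<omega> in M. u t x \<omega> = 1 + Z \<omega>"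
    using sol t unfolding hyperbolic_anderson_solution_def by blast
  have X: "?X s y \<omega> = wave_cone t x (s, y) * u s y \<omega>" for s y \<omega> by (simp add: wave_cone_def)
  have m0: "(\<lambda>(\<omega>, z). u (max 0 (fst z)) (snd z) \<omega>) \<in> borel_measurable (M \<Otimes>\<^sub>M (borel :: (real \<times> real) measure))"
    using pred by (rule predictable_joint)
  have "(\<lambda>p. wave_cone t x (snd p) * (case p of (\<omega>, z) \<Rightarrow> u (max 0 (fst z)) (snd z) \<omega>)) \<in> borel_measurable (M \<Otimes>\<^sub>M (borel :: (real \<times> real) measure))"
    using m0 by measurable
  \<comment> \<open>The cone vanishes at negative times, so the fold by \<open>max 0\<close> is
    invisible after multiplication.\<close>
  also have "(\<lambda>p. wave_cone t x (snd p) * (case p of (\<omega>, z) \<Rightarrow> u (max 0 (fst z)) (snd z) \<omega>)) = (\<lambda>(\<omega>, z). ?X (fst z) (snd z) \<omega>)"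
    by (auto simp: fun_eq_iff wave_cone_def indicator_def max_def)
  finally have JM: "(\<lambda>(\<omega>, z). ?X (fst z) (snd z) \<omega>) \<in> borel_measurable (M \<Otimes>\<^sub>M (borel :: (real \<times> real) measure))" .
  \<comment> \<open>The box of half-width \<open>|t| + |x|\<close> contains the backward
    cone.\<close>
  have supp: "?X s y \<omega> = 0" if "\<not> (0 \<le> s \<and> s \<le> \<bar>t\<bar> + \<bar>x\<bar> \<and> \<bar>y\<bar> \<le> \<bar>t\<bar> + \<bar>x\<bar>)" for s y \<omega>
    using wave_cone_support[OF that] by (simp add: X)
  note ito_props = ito_integral_props[where R = "\<bar>t\<bar> + \<bar>x\<bar>", OF Z JM]
  have ito: "Z \<in> borel_measurable M" "integrable M (\<lambda>\<omega>. (Z \<omega>)\<^sup>2)"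
    "integrable (M \<Otimes>\<^sub>M lborel) (\<lambda>(\<omega>, z). ?X (fst z) (snd z) \<omega>)"
    by (rule ito_props(1), rule supp, assumption) (rule ito_props(2), rule supp, assumption, rule ito_props(3), rule supp, assumption)
  have ito4: "(\<integral>\<omega>. Z \<omega> * cis (W h \<omega>) \<partial>M)
        = \<i> * (\<integral>z. noise_kernel H h z * (\<integral>\<omega>. ?X (fst z) (snd z) \<omega> * cis (W h \<omega>) \<partial>M) \<partial>lborel)" if "test_fun h" for h
    by (rule ito_props(4), rule supp, assumption, rule that)
  have um: "u t x \<in> borel_measurable (noise_sigma M W tests)" by (rule predictable_slice[OF pred t])
  then show "u t x \<in> borel_measurable (noise_sigma M W tests)" .
  show uM [measurable]: "u t x \<in> borel_measurable M"
  proof (rule measurableI)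
    fix A :: "real set" assume "A \<in> sets borel"
    from measurable_sets[OF um this] show "u t x -` A \<inter> space M \<in> sets M"
      using sets_noise_sigma_subset[of tests] by auto
  qed simp
  note [measurable] = ito(1)
  show "integrable M (\<lambda>\<omega>. (u t x \<omega>)\<^sup>2)"
  proof -
    have "integrable M (\<lambda>\<omega>. (1 + Z \<omega>)\<^sup>2)"
      using ito(2) integrable_of_square[OF ito(1,2)] by (simp add: power2_sum)
    then show ?thesis
      by (rule Bochner_Integration.integrable_bound) (use uZ in \<open>auto elim: eventually_mono\<close>)
  qed
  fix h assume h: "test_fun h"
  have [measurable]: "W h \<in> borel_measurable M" by (rule W_measurable[OF h])
  have ptU: "(\<integral>\<omega>. ?X (fst z) (snd z) \<omega> * cis (W h \<omega>) \<partial>M) = wave_cone t x z * noise_transform u h z" for z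
    unfolding noise_transform_def X integral_mult_right_zero[symmetric] by (simp add: mult.assoc)
  show "integrable lborel (\<lambda>z. wave_cone t x z * noise_transform u h z)"
  proof -
    have "integrable (M \<Otimes>\<^sub>M lborel) (\<lambda>(\<omega>, z). complex_of_real (?X (fst z) (snd z) \<omega>) * cis (W h \<omega>))"
    proof (rule Bochner_Integration.integrable_bound[OF ito(3)])
      have [measurable]: "(\<lambda>(\<omega>, z). ?X (fst z) (snd z) \<omega>) \<in> borel_measurable (M \<Otimes>\<^sub>M lborel)" using ito(3) by auto
      have "(\<lambda>p. complex_of_real ((\<lambda>(\<omega>, z). ?X (fst z) (snd z) \<omega>) p) * cis (W h (fst p))) \<in> borel_measurable (M \<Otimes>\<^sub>M (lborel :: (real \<times> real) measure))"
        by measurable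
      then show "(\<lambda>(\<omega>, z). complex_of_real (?X (fst z) (snd z) \<omega>) * cis (W h \<omega>)) \<in> borel_measurable (M \<Otimes>\<^sub>M (lborel :: (real \<times> real) measure))"
        by (simp add: case_prod_unfold)
    qed (auto simp: norm_mult)
    from P.integrable_snd[OF this] show ?thesis unfolding ptU .
  qed
  have iZ: "integrable M Z" by (rule integrable_of_square[OF ito(1,2)])
  have "noise_transform u h (t, x) = (\<integral>\<omega>. cis (W h \<omega>) + Z \<omega> * cis (W h \<omega>) \<partial>M)"
    unfolding noise_transform_def
  proof (rule integral_cong_AE)
    show "AE \<omega> in M. complex_of_real (u (fst (t, x)) (snd (t, x)) \<omega>) * cis (W h \<omega>) = cis (W h \<omega>) + complex_of_real (Z \<omega>) * cis (W h \<omega>)"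
      using uZ by eventually_elim (simp add: distrib_right)
  qed (auto intro: uM)
  also have "\<dots> = (\<integral>\<omega>. cis (W h \<omega>) \<partial>M) + (\<integral>\<omega>. Z \<omega> * cis (W h \<omega>) \<partial>M)"
    by (rule Bochner_Integration.integral_add) (auto intro!: integrable_const_bound[of _ 1] cis_integrable_mult iZ)
  also have "\<dots> = exp (- q h h / 2) + \<i> * (\<integral>z. complex_of_real (noise_kernel H h z) * (wave_cone t x z * noise_transform u h z) \<partial>lborel)"
    unfolding W_cis[OF h] ito4[OF h] ptU ..
  finally show "noise_transform u h (t, x) = exp (- q h h / 2) +
       \<i> * (\<integral>z. complex_of_real (noise_kernel H h z) * (wave_cone t x z * noise_transform u h z) \<partial>lborel)" .
qed

text \<open>Moved back by \<open>a\<close>, the transform for the shifted \<open>h\<close> has the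
  kernel and the inhomogeneity of the transform for \<open>h\<close>: the kernel translates with
  \<open>h\<close>, and the variance in the inhomogeneity is invariant.\<close>

lemma solution_shift:
  assumes sol: "hyperbolic_anderson_solution M H W u" and t: "0 \<le> t" and h: "test_fun h"
  shows "noise_transform u (space_shift a h) (t, x + a) = noise_transform u h (t, x)"
proof -
  have ta: "test_fun (space_shift a h)" using h by (rule test_fun_shift)
  note sp = solution_props[OF sol]
  obtain K where K: "\<And>z. \<bar>noise_kernel H h z\<bar> \<le> K" using test_fun_noise_kernel[OF h] by metis
  define U' where "U' z = noise_transform u (space_shift a h) ((0, a) + z)" for z
  have kern: "noise_kernel H (space_shift a h) ((0, a) + z) = noise_kernel H h z" for z
    using noise_kernel_shift[OF h, of a "fst z" "a + snd z"] by (cases z) simp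
  have int': "integrable lborel (\<lambda>z. wave_cone t x z * U' z)" if "0 \<le> t" for t x
    using lborel_integrable_translate[OF sp(4)[OF that ta, of "x + a"], of "(0, a)"]
    unfolding wave_cone_translate U'_def .
  have eq': "U' (t, x) = exp (- q h h / 2) + \<i> * (\<integral>z. complex_of_real (noise_kernel H h z) * (wave_cone t x z * U' z) \<partial>lborel)"
    if t: "0 \<le> t" for t x
  proof -
    let ?f = "\<lambda>z. complex_of_real (noise_kernel H (space_shift a h) z) * (wave_cone t (x + a) z * noise_transform u (space_shift a h) z)"
    have m: "?f \<in> borel_measurable borel"
    proof (rule borel_measurable_times)
      show "(\<lambda>z. complex_of_real (noise_kernel H (space_shift a h) z)) \<in> borel_measurable borel"
        using noise_kernel_measurable[OF ta] by measurable
      show "(\<lambda>z. complex_of_real (wave_cone t (x + a) z) * noise_transform u (space_shift a h) z) \<in> borel_measurable borel"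
        using sp(4)[OF t ta, of "x + a"] by auto
    qed
    have "U' (t, x) = exp (- q (space_shift a h) (space_shift a h) / 2) + \<i> * (\<integral>z. ?f z \<partial>lborel)"
      unfolding U'_def using sp(5)[OF t ta, of "x + a"] by (simp add: add.commute)
    also have "(\<integral>z. ?f z \<partial>lborel) = (\<integral>z. ?f ((0, a) + z) \<partial>lborel)"
      by (rule lborel_integral_translate[symmetric, OF m])
    also have "\<dots> = (\<integral>z. complex_of_real (noise_kernel H h z) * (wave_cone t x z * U' z) \<partial>lborel)"
      unfolding wave_cone_translate kern U'_def ..
    finally show ?thesis unfolding noise_pairing_shift[OF h h] .
  qed
  \<comment> \<open>The inhomogeneities cancel in the difference, which therefore satisfies the
    homogeneous equation.\<close>
  have "U' (t, x) - noise_transform u h (t, x) = 0"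
  proof (rule volterra_unique[OF K, where V = "\<lambda>z. U' z - noise_transform u h z"])
    fix t x :: real assume t: "0 \<le> t"
    have e: "complex_of_real (wave_cone t x z) * (U' z - noise_transform u h z) = wave_cone t x z * U' z - wave_cone t x z * noise_transform u h z" for z
      by (rule right_diff_distrib)
    show "integrable lborel (\<lambda>z. complex_of_real (wave_cone t x z) * (U' z - noise_transform u h z))"
      unfolding e by (rule Bochner_Integration.integrable_diff[OF int'[OF t] sp(4)[OF t h]])
    have ik: "integrable lborel (\<lambda>z. complex_of_real (noise_kernel H h z) * g z)" if g: "integrable lborel g" for g :: "real \<times> real \<Rightarrow> complex"
    proof (rule Bochner_Integration.integrable_bound[OF integrable_mult_right[OF g, of "complex_of_real K"]])
      show "(\<lambda>z. complex_of_real (noise_kernel H h z) * g z) \<in> borel_measurable lborel"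
        using g noise_kernel_measurable[OF h] by (intro borel_measurable_times) auto
      show "AE z in lborel. norm (complex_of_real (noise_kernel H h z) * g z) \<le> norm (complex_of_real K * g z)"
        using K by (auto simp: norm_mult intro!: mult_right_mono order_trans[OF K])
    qed
    have "U' (t, x) - noise_transform u h (t, x) = \<i> * ((\<integral>z. complex_of_real (noise_kernel H h z) * (wave_cone t x z * U' z) \<partial>lborel)
       - (\<integral>z. complex_of_real (noise_kernel H h z) * (wave_cone t x z * noise_transform u h z) \<partial>lborel))"
      unfolding eq'[OF t] sp(5)[OF t h] by (simp add: right_diff_distrib)
    also have "(\<integral>z. complex_of_real (noise_kernel H h z) * (wave_cone t x z * U' z) \<partial>lborel)
       - (\<integral>z. complex_of_real (noise_kernel H h z) * (wave_cone t x z * noise_transform u h z) \<partial>lborel)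
       = (\<integral>z. complex_of_real (noise_kernel H h z) * (complex_of_real (wave_cone t x z) * (U' z - noise_transform u h z)) \<partial>lborel)"
      unfolding e right_diff_distrib
      by (rule Bochner_Integration.integral_diff[symmetric, OF ik[OF int'[OF t]] ik[OF sp(4)[OF t h]]])
    finally show "U' (t, x) - noise_transform u h (t, x) = \<i> * (\<integral>z. complex_of_real (noise_kernel H h z) * (complex_of_real (wave_cone t x z) * (U' z - noise_transform u h z)) \<partial>lborel)" .
  qed (rule t)
  then show ?thesis by (simp add: U'_def add.commute)
qed

lemma expectation_Re_cis:
  fixes Y :: "'w \<Rightarrow> real"
  assumes "integrable M Y" "test_fun h"
  shows "(\<integral>\<omega>. Y \<omega> * Re (c * cis (W h \<omega>)) \<partial>M) = Re (c * (\<integral>\<omega>. Y \<omega> * cis (W h \<omega>) \<partial>M))"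
    and "integrable M (\<lambda>\<omega>. Y \<omega> * Re (c * cis (W h \<omega>)))"
proof -
  have i: "integrable M (\<lambda>\<omega>. c * (Y \<omega> * cis (W h \<omega>)))"
    by (intro integrable_mult_right cis_integrable_mult assms W_measurable)
  have e: "Re (c * (Y \<omega> * cis (W h \<omega>))) = Y \<omega> * Re (c * cis (W h \<omega>))" for \<omega>
    by (simp add: algebra_simps)
  show "integrable M (\<lambda>\<omega>. Y \<omega> * Re (c * cis (W h \<omega>)))"
    using integrable_Re[OF i] unfolding e .
  show "(\<integral>\<omega>. Y \<omega> * Re (c * cis (W h \<omega>)) \<partial>M) = Re (c * (\<integral>\<omega>. Y \<omega> * cis (W h \<omega>) \<partial>M))"
    using integral_Re[OF i] unfolding e integral_mult_right_zero .
qed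

text \<open>Equal transforms extend by linearity to equal inner products with polynomials;
  integrability is carried along for the additivity in the induction step.\<close>

lemma expectation_trig_shift:
  fixes Y Y' :: "'w \<Rightarrow> real"
  assumes Y: "integrable M Y" "integrable M Y'"
    and eq: "\<And>h. test_fun h \<Longrightarrow> (\<integral>\<omega>. Y' \<omega> * cis (W (space_shift a h) \<omega>) \<partial>M) = (\<integral>\<omega>. Y \<omega> * cis (W h \<omega>) \<partial>M)"
    and L: "trig_over tests L"
  shows "(\<integral>\<omega>. Y' \<omega> * trig (trig_shift a L) \<omega> \<partial>M) = (\<integral>\<omega>. Y \<omega> * trig L \<omega> \<partial>M) \<and>
    integrable M (\<lambda>\<omega>. Y' \<omega> * trig (trig_shift a L) \<omega>) \<and> integrable M (\<lambda>\<omega>. Y \<omega> * trig L \<omega>)"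
  using L
proof (induction L)
  case (Cons x L)
  obtain c h where x: "x = (c, h)" by (cases x)
  have h: "test_fun h" and L: "trig_over tests L" using Cons.prems by (auto simp: x)
  note IH = Cons.IH[OF L]
  show ?case
    unfolding x trig_shift_simps trig_simps distrib_left
    using IH expectation_Re_cis[OF Y(1) h, of c] expectation_Re_cis[OF Y(2) test_fun_shift[OF h, of a], of c] eq[OF h]
    by (simp add: Bochner_Integration.integral_add del: times_complex.sel)
qed simp

lemma trig_expectation_shift:
  assumes L: "trig_over tests L"
  shows "(\<integral>\<omega>. trig (trig_shift a L) \<omega> \<partial>M) = (\<integral>\<omega>. trig L \<omega> \<partial>M)"
proof -
  have "(\<integral>\<omega>. complex_of_real 1 * cis (W (space_shift a h) \<omega>) \<partial>M) = (\<integral>\<omega>. complex_of_real 1 * cis (W h \<omega>) \<partial>M)" if h: "test_fun h" for h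
    using W_cis[OF h] W_cis[OF test_fun_shift[OF h, of a]] noise_pairing_shift[OF h h, of a] by simp
  from expectation_trig_shift[OF _ _ this L] show ?thesis by simp
qed

lemma trig_square_integrable: "trig_over tests L \<Longrightarrow> integrable M (\<lambda>\<omega>. (trig L \<omega>)\<^sup>2)"
  by (rule integrable_const_bound[of _ "(trig_bound L)\<^sup>2"])
    (auto intro: borel_measurable_power trig_measurable simp: power2_le_iff_abs_le trig_bound_nonneg trig_bounded)

text \<open>The square of a polynomial is almost surely again a polynomial, and forming it commutes
  with the shift; the shift is thus an isometry on polynomials.\<close>

lemma trig_square_shift:
  assumes L: "trig_over tests L"
  shows "(\<integral>\<omega>. (trig (trig_shift a L) \<omega>)\<^sup>2 \<partial>M) = (\<integral>\<omega>. (trig L \<omega>)\<^sup>2 \<partial>M)"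
proof -
  have sq: "(\<integral>\<omega>. (trig K \<omega>)\<^sup>2 \<partial>M) = (\<integral>\<omega>. trig (trig_mult K K) \<omega> \<partial>M)" if K: "trig_over tests K" for K
  proof (rule integral_cong_AE)
    show "AE \<omega> in M. (trig K \<omega>)\<^sup>2 = trig (trig_mult K K) \<omega>"
      using trig_mult_AE[OF K K] by eventually_elim (simp add: power2_eq_square)
    show "trig (trig_mult K K) \<in> borel_measurable M"
      by (rule trig_measurable[OF trig_over_mult[OF test_space_tests K K]])
    show "(\<lambda>\<omega>. (trig K \<omega>)\<^sup>2) \<in> borel_measurable M"
      using trig_measurable[OF K] by measurable
  qed
  show ?thesis
    unfolding sq[OF L] sq[OF trig_over_test_fun_shift[OF L]] trig_shift_mult[symmetric]
    by (rule trig_expectation_shift[OF trig_over_mult[OF test_space_tests L L]])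
qed

text \<open>The shift preserves the norm of a polynomial and, by the transform, its inner product
  with the solution. The squared distances to \<open>u t x\<close> and \<open>u t (x + a)\<close>
  can then differ only by the difference of second moments, which is shown to vanish.\<close>

lemma solution_approx:
  assumes sol: "hyperbolic_anderson_solution M H W u" and t: "0 \<le> t"
  shows "approx tests a (u t x) (u t (x + a))"
proof -
  note sp = solution_props[OF sol t]
  note [measurable] = sp(2)
  have ui: "integrable M (u t x)" for x by (rule integrable_of_square[OF sp(2,3)])
  define e where "e x L = (\<integral>\<omega>. (trig L \<omega> - u t x \<omega>)\<^sup>2 \<partial>M)" for x L
  define m where "m x = (\<integral>\<omega>. (u t x \<omega>)\<^sup>2 \<partial>M)" for x
  have isq: "integrable M (\<lambda>\<omega>. (trig L \<omega> - u t x \<omega>)\<^sup>2)"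
    and esq: "e x L = (\<integral>\<omega>. (trig L \<omega>)\<^sup>2 \<partial>M) + m x - 2 * (\<integral>\<omega>. u t x \<omega> * trig L \<omega> \<partial>M)"
    if L: "trig_over tests L" for x L
  proof -
    have [measurable]: "trig L \<in> borel_measurable M" by (rule trig_measurable[OF L])
    have i: "integrable M (\<lambda>\<omega>. u t x \<omega> * trig L \<omega>)"
      by (rule integrable_mult_square[OF _ _ sp(3) trig_square_integrable[OF L]]) measurable
    have ex: "(trig L \<omega> - u t x \<omega>)\<^sup>2 = (trig L \<omega>)\<^sup>2 + (u t x \<omega>)\<^sup>2 - 2 * (u t x \<omega> * trig L \<omega>)" for \<omega>
      by (simp add: power2_diff mult_ac)
    show "integrable M (\<lambda>\<omega>. (trig L \<omega> - u t x \<omega>)\<^sup>2)"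
      unfolding ex using i sp(3) trig_square_integrable[OF L] by auto
    show "e x L = (\<integral>\<omega>. (trig L \<omega>)\<^sup>2 \<partial>M) + m x - 2 * (\<integral>\<omega>. u t x \<omega> * trig L \<omega> \<partial>M)"
      unfolding e_def m_def ex using i sp(3) trig_square_integrable[OF L]
      by (simp add: Bochner_Integration.integral_add Bochner_Integration.integral_diff)
  qed
  have shift_e: "e (x + a) (trig_shift a L) = e x L + m (x + a) - m x" if L: "trig_over tests L" for x a L
  proof -
    have "(\<integral>\<omega>. u t (x + a) \<omega> * trig (trig_shift a L) \<omega> \<partial>M) = (\<integral>\<omega>. u t x \<omega> * trig L \<omega> \<partial>M)"
      using expectation_trig_shift[where a = a and Y = "u t x" and Y' = "u t (x + a)", OF ui ui _ L] solution_shift[OF sol t, of _ a x] by (simp add: noise_transform_def)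
    then show ?thesis
      unfolding esq[OF L] esq[OF trig_over_test_fun_shift[OF L]] trig_square_shift[OF L] by simp
  qed
  have ap: "\<exists>L. (\<forall>n. trig_over tests (L n)) \<and> (\<lambda>n. e x (L n)) \<longlonglongrightarrow> 0" for x
  proof -
    have "approx tests 0 (u t x) (u t x)"
      by (rule approx_noise_sigma_measurable[OF test_space_tests sp(1,2,3)])
    then obtain L where L: "\<And>n. trig_over tests (L n)" "(\<lambda>n. l2 M (\<lambda>\<omega>. trig (L n) \<omega> - u t x \<omega>)) \<longlonglongrightarrow> 0"
      by (rule approx_seq) (rule that)
    have "(\<lambda>n. ennreal (e x (L n))) \<longlonglongrightarrow> ennreal 0"
      using L(2) l2_eq_integral[OF isq[OF L(1)]] by (simp add: e_def)
    then have "(\<lambda>n. e x (L n)) \<longlonglongrightarrow> 0"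
      by (subst (asm) tendsto_ennreal_iff) (auto simp: e_def)
    with L(1) show ?thesis by blast
  qed
  \<comment> \<open>A list approximating \<open>u t x\<close> makes the first squared distance tend
    to 0, while the shifted one stays nonnegative; this gives one inequality of second moments.
    Applied at \<open>x + a\<close> with \<open>-a\<close> it gives the other.\<close>
  have mono: "m x \<le> m (x + a)" for x a
  proof -
    obtain L where L: "\<And>n. trig_over tests (L n)" "(\<lambda>n. e x (L n)) \<longlonglongrightarrow> 0" using ap[of x] by blast
    have "0 \<le> e x (L n) + m (x + a) - m x" for n
      unfolding shift_e[OF L(1), symmetric] by (simp add: e_def)
    then have "m x - m (x + a) \<le> e x (L n)" for n by (simp add: algebra_simps)
    with L(2) have "m x - m (x + a) \<le> 0" by (intro LIMSEQ_le_const) auto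
    then show ?thesis by simp
  qed
  have meq: "m (x + a) = m x" using mono[of x a] mono[of "x + a" "- a"] by simp
  obtain L where L: "\<And>n. trig_over tests (L n)" "(\<lambda>n. e x (L n)) \<longlonglongrightarrow> 0" using ap[of x] by blast
  have lim: "(\<lambda>n. ennreal (e x (L n))) \<longlonglongrightarrow> 0" using tendsto_ennrealI[OF L(2)] by simp
  show ?thesis
  proof (rule approx_limit[OF test_space_tests approx_trig[OF test_space_tests L(1)]])
    show "(\<lambda>n. l2 M (\<lambda>\<omega>. trig (L n) \<omega> - u t x \<omega>)) \<longlonglongrightarrow> 0"
      unfolding l2_eq_integral[OF isq[OF L(1)]] using lim by (simp add: e_def)
    have "e (x + a) (trig_shift a (L n)) = e x (L n)" for n unfolding shift_e[OF L(1)] meq by simp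
    then show "(\<lambda>n. l2 M (\<lambda>\<omega>. trig (trig_shift a (L n)) \<omega> - u t (x + a) \<omega>)) \<longlonglongrightarrow> 0"
      unfolding l2_eq_integral[OF isq[OF trig_over_test_fun_shift[OF L(1)]]] using lim by (simp add: e_def)
  qed measurable
qed

end

section \<open>Stationarity and ergodicity\<close>

context noise
begin

text \<open>Expectations of polynomials are invariant under the shift and pass to \<open>L^2\<close>
  limits; applied to indicators, this is stationarity.\<close>

lemma approx_expectation:
  assumes T: "test_space T" and A: "approx T a F F'"
  shows "(\<integral>\<omega>. F \<omega> \<partial>M) = (\<integral>\<omega>. F' \<omega> \<partial>M)"
proof -
  obtain L where L: "\<And>n. trig_over T (L n)" "(\<lambda>n. l2 M (\<lambda>\<omega>. trig (L n) \<omega> - F \<omega>)) \<longlonglongrightarrow> 0"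
    "(\<lambda>n. l2 M (\<lambda>\<omega>. trig (trig_shift a (L n)) \<omega> - F' \<omega>)) \<longlonglongrightarrow> 0"
    by (rule approx_seq[OF A]) (rule that)
  have t: "trig_over tests (trig_shift b (L n))" for b n
    by (rule trig_over_test_fun_shift[OF trig_over_test_fun[OF T L(1)]])
  have [measurable]: "F \<in> borel_measurable M" "F' \<in> borel_measurable M" using A by (auto simp: approx_def)
  have lim: "(\<lambda>n. \<integral>\<omega>. complex_of_real (trig (trig_shift b (L n)) \<omega>) * 1 \<partial>M) \<longlonglongrightarrow> (\<integral>\<omega>. complex_of_real (G \<omega>) * 1 \<partial>M)"
    if "(\<lambda>n. l2 M (\<lambda>\<omega>. trig (trig_shift b (L n)) \<omega> - G \<omega>)) \<longlonglongrightarrow> 0" "G \<in> borel_measurable M" for b G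
    using that trig_measurable[OF t] trig_square_integrable[OF t]
    by (intro L2_tendsto_expectation_mult) (auto simp: L2_tendsto_def l2_def)
  have "(\<lambda>n. (\<integral>\<omega>. trig (L n) \<omega> \<partial>M)) \<longlonglongrightarrow> (\<integral>\<omega>. F \<omega> \<partial>M)"
    using lim[of 0 F] L(2) by (simp add: tendsto_of_real_iff)
  moreover have "(\<lambda>n. (\<integral>\<omega>. trig (L n) \<omega> \<partial>M)) \<longlonglongrightarrow> (\<integral>\<omega>. F' \<omega> \<partial>M)"
    using lim[of a F'] L(3) trig_expectation_shift[OF t[of 0], of a] by (simp add: tendsto_of_real_iff)
  ultimately show ?thesis by (rule LIMSEQ_unique)
qed

lemma solution_measurable_PiM:
  assumes sol: "hyperbolic_anderson_solution M H W u" and t: "0 \<le> t"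
  shows "(\<lambda>\<omega>. \<lambda>x\<in>I. u t (x + a) \<omega>) \<in> measurable M (Pi\<^sub>M I (\<lambda>_. borel))"
  using solution_props(2)[OF sol t] by (intro measurable_restrict) auto

text \<open>The index set is arbitrary, so that the same statement serves the finite-dimensional
  laws and, with \<open>I = UNIV\<close>, the events of the whole path.\<close>

lemma solution_event_approx:
  assumes sol: "hyperbolic_anderson_solution M H W u" and t: "0 \<le> t"
    and A: "A \<in> sets (Pi\<^sub>M I (\<lambda>_. borel))"
  shows "approx tests a (\<lambda>\<omega>. indicator A (\<lambda>x\<in>I. u t x \<omega>)) (\<lambda>\<omega>. indicator A (\<lambda>x\<in>I. u t (x + a) \<omega>))"
proof (rule approx_sigma_sets[OF test_space_tests])
  show "A \<in> sigma_sets (\<Pi>\<^sub>E i\<in>I. space borel) {{f \<in> \<Pi>\<^sub>E i\<in>I. space borel. f i \<in> B} | i B. i \<in> I \<and> B \<in> sets borel}"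
    using A unfolding sets_PiM_single .
  fix B assume "B \<in> {{f \<in> \<Pi>\<^sub>E i\<in>I. space (borel :: real measure). f i \<in> B} | i B. i \<in> I \<and> B \<in> sets borel}"
  then obtain i C where B: "B = {f \<in> \<Pi>\<^sub>E i\<in>I. space (borel :: real measure). f i \<in> C}" "i \<in> I" "C \<in> sets borel" by blast
  show "approx tests a (\<lambda>\<omega>. indicator B (\<lambda>x\<in>I. u t x \<omega>)) (\<lambda>\<omega>. indicator B (\<lambda>x\<in>I. u t (x + a) \<omega>))"
    by (rule approx_cong[OF approx_borel[OF test_space_tests solution_approx[OF sol t, where x = i and a = a] B(3)]])
       (use B in \<open>auto simp: indicator_def\<close>)
qed auto

theorem solution_stationary:
  assumes sol: "hyperbolic_anderson_solution M H W u" and t: "0 \<le> t"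
  shows "strictly_stationary M (u t)"
  unfolding strictly_stationary_def
proof (intro conjI allI impI)
  show "u t x \<in> borel_measurable M" for x by (rule solution_props(2)[OF sol t])
  fix J :: "real set" and h :: real
  have m0: "(\<lambda>\<omega>. \<lambda>x\<in>J. u t x \<omega>) \<in> measurable M (Pi\<^sub>M J (\<lambda>_. borel))"
    using solution_measurable_PiM[OF sol t, where I = J and a = 0] by simp
  note mh = solution_measurable_PiM[OF sol t, where I = J and a = h]
  show "distr M (Pi\<^sub>M J (\<lambda>_. borel)) (\<lambda>\<omega>. \<lambda>x\<in>J. u t (x + h) \<omega>) = distr M (Pi\<^sub>M J (\<lambda>_. borel)) (\<lambda>\<omega>. \<lambda>x\<in>J. u t x \<omega>)"
  proof (rule measure_eqI)
    fix A assume "A \<in> sets (distr M (Pi\<^sub>M J (\<lambda>_. borel)) (\<lambda>\<omega>. \<lambda>x\<in>J. u t (x + h) \<omega>))"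
    then have A: "A \<in> sets (Pi\<^sub>M J (\<lambda>_. borel))" by simp
    have ind: "(\<integral>\<omega>. indicator A (f \<omega>) \<partial>M) = (measure M (f -` A \<inter> space M) :: real)"
      if f: "f \<in> measurable M (Pi\<^sub>M J (\<lambda>_. borel))" for f
    proof -
      have "(\<integral>\<omega>. indicator A (f \<omega>) \<partial>M) = (\<integral>\<omega>. (indicator (f -` A \<inter> space M) \<omega> :: real) \<partial>M)"
        by (intro Bochner_Integration.integral_cong) (auto simp: indicator_def)
      then show ?thesis using measurable_sets[OF f A] by simp
    qed
    have "measure M ((\<lambda>\<omega>. \<lambda>x\<in>J. u t (x + h) \<omega>) -` A \<inter> space M) = measure M ((\<lambda>\<omega>. \<lambda>x\<in>J. u t x \<omega>) -` A \<inter> space M)"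
      using approx_expectation[OF test_space_tests solution_event_approx[OF sol t A, where a = h]]
      unfolding ind[OF m0] ind[OF mh] by simp
    then show "emeasure (distr M (Pi\<^sub>M J (\<lambda>_. borel)) (\<lambda>\<omega>. \<lambda>x\<in>J. u t (x + h) \<omega>)) A
        = emeasure (distr M (Pi\<^sub>M J (\<lambda>_. borel)) (\<lambda>\<omega>. \<lambda>x\<in>J. u t x \<omega>)) A"
      unfolding emeasure_distr[OF mh A] emeasure_distr[OF m0 A] emeasure_eq_measure by simp
  qed simp
qed

section \<open>Decorrelation under large shifts and ergodicity\<close>

lemma trig_integrable: "trig_over tests L \<Longrightarrow> integrable M (trig L)"
  by (rule integrable_of_square[OF trig_measurable trig_square_integrable])

lemma Re_cis_expectation: "test_fun h \<Longrightarrow> (\<integral>\<omega>. Re (c * cis (W h \<omega>)) \<partial>M) = Re c * exp (- q h h / 2)"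
  using expectation_Re_cis(1)[of "\<lambda>_. 1" h c] W_cis[of h] by simp

text \<open>The product is a sum of two exponentials of the noise, at the sum and at the difference
  of \<open>h\<close> and the shifted \<open>k\<close>. Their expectations depend on the covariance
  of the two only through the cross term, which tends to 0.\<close>

lemma trig_mixing_one:
  assumes h: "test_fun h" and k: "test_fun k"
  shows "(\<lambda>n. \<integral>\<omega>. Re (c * cis (W h \<omega>)) * Re (d * cis (W (space_shift (real n) k) \<omega>)) \<partial>M)
     \<longlonglongrightarrow> (\<integral>\<omega>. Re (c * cis (W h \<omega>)) \<partial>M) * (\<integral>\<omega>. Re (d * cis (W k \<omega>)) \<partial>M)"
proof -
  have tk: "test_fun (space_shift (real n) k)" for n using k by (rule test_fun_shift)
  have tl: "test_fun (\<lambda>z. 1 * h z + s * space_shift (real n) k z)" for n s by (rule test_fun_lincomb[OF h tk])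
  \<comment> \<open>The variance of the noise at \<open>h + s * k\<close> with \<open>k\<close>
    shifted by \<open>n\<close>; the values used are \<open>s = 1\<close> and
    \<open>s = -1\<close>.\<close>
  define Q where "Q s n = q h h + 2 * s * q h (space_shift (real n) k) + s * s * q k k" for s n
  have qq: "q (\<lambda>z. 1 * h z + s * space_shift (real n) k z) (\<lambda>z. 1 * h z + s * space_shift (real n) k z) = Q s n" for s n
    unfolding q_lincomb_left[OF h tk tl] q_lincomb_right[OF h tk h] q_lincomb_right[OF h tk tk] q_sym[OF tk h] noise_pairing_shift[OF k k] Q_def
    by (simp add: algebra_simps)
  have val: "(\<integral>\<omega>. Re (c * cis (W h \<omega>)) * Re (d * cis (W (space_shift (real n) k) \<omega>)) \<partial>M)
      = Re (c * d / 2) * exp (- Q 1 n / 2) + Re (c * cnj d / 2) * exp (- Q (- 1) n / 2)" for n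
  proof -
    let ?k = "space_shift (real n) k"
    let ?L = "trig_mult [(c, h)] [(d, ?k)]"
    have o: "trig_over tests [(c, h)]" "trig_over tests [(d, ?k)]" using h tk by auto
    have L: "?L = [(c * d / 2, \<lambda>z. 1 * h z + 1 * ?k z), (c * cnj d / 2, \<lambda>z. 1 * h z + (-1) * ?k z)]"
      by (simp add: trig_mult_def)
    have m: "trig [(c, h)] \<in> borel_measurable M" "trig [(d, ?k)] \<in> borel_measurable M" "trig ?L \<in> borel_measurable M"
      by (rule trig_measurable[OF o(1)] trig_measurable[OF o(2)] trig_measurable[OF trig_over_mult[OF test_space_tests o]])+
    have "(\<integral>\<omega>. trig [(c, h)] \<omega> * trig [(d, ?k)] \<omega> \<partial>M) = (\<integral>\<omega>. trig ?L \<omega> \<partial>M)"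
    proof (rule integral_cong_AE)
      show "AE \<omega> in M. trig [(c, h)] \<omega> * trig [(d, ?k)] \<omega> = trig ?L \<omega>"
        using trig_mult_AE[OF o] by eventually_elim (simp only:)
      show "(\<lambda>\<omega>. trig [(c, h)] \<omega> * trig [(d, ?k)] \<omega>) \<in> borel_measurable M"
        by (rule borel_measurable_times[OF m(1,2)])
    qed (rule m(3))
    also have "\<dots> = (\<integral>\<omega>. Re (c * d / 2 * cis (W (\<lambda>z. 1 * h z + 1 * ?k z) \<omega>)) + Re (c * cnj d / 2 * cis (W (\<lambda>z. 1 * h z + (-1) * ?k z) \<omega>)) \<partial>M)"
      unfolding L trig_simps add_0_right ..
    also have "\<dots> = (\<integral>\<omega>. Re (c * d / 2 * cis (W (\<lambda>z. 1 * h z + 1 * ?k z) \<omega>)) \<partial>M) + (\<integral>\<omega>. Re (c * cnj d / 2 * cis (W (\<lambda>z. 1 * h z + (-1) * ?k z) \<omega>)) \<partial>M)"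
      using expectation_Re_cis(2)[of "\<lambda>_. 1", OF _ tl[of 1 n], of "c * d / 2"] expectation_Re_cis(2)[of "\<lambda>_. 1", OF _ tl[of "-1" n], of "c * cnj d / 2"]
      by (intro Bochner_Integration.integral_add) (simp_all del: times_complex.sel)
    also have "\<dots> = Re (c * d / 2) * exp (- Q 1 n / 2) + Re (c * cnj d / 2) * exp (- Q (- 1) n / 2)"
      unfolding Re_cis_expectation[OF tl[of 1 n]] Re_cis_expectation[OF tl[of "-1" n]] qq ..
    finally show ?thesis unfolding trig_simps add_0_right .
  qed
  have Ql: "Q s \<longlonglongrightarrow> q h h + 2 * s * 0 + s * s * q k k" for s
    unfolding Q_def by (intro tendsto_intros noise_pairing_mixing h k)
  have "(\<lambda>n. Re (c * d / 2) * exp (- Q 1 n / 2) + Re (c * cnj d / 2) * exp (- Q (- 1) n / 2))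
      \<longlonglongrightarrow> Re (c * d / 2) * exp (- (q h h + 2 * 1 * 0 + 1 * 1 * q k k) / 2) + Re (c * cnj d / 2) * exp (- (q h h + 2 * (- 1) * 0 + (- 1) * (- 1) * q k k) / 2)"
    by (intro tendsto_intros Ql) auto
  also have "Re (c * d / 2) * exp (- (q h h + 2 * 1 * 0 + 1 * 1 * q k k) / 2) + Re (c * cnj d / 2) * exp (- (q h h + 2 * (- 1) * 0 + (- 1) * (- 1) * q k k) / 2)
      = (Re (c * d / 2) + Re (c * cnj d / 2)) * exp (- q h h / 2 + - q k k / 2)"
    by (simp add: distrib_right add_divide_distrib diff_divide_distrib del: times_complex.sel)
  \<comment> \<open>The coefficients recombine as
    \<open>Re (c * d / 2) + Re (c * cnj d / 2) = Re c * Re d\<close>.\<close>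
  also have "\<dots> = (Re c * exp (- q h h / 2)) * (Re d * exp (- q k k / 2))"
    unfolding exp_add by (simp add: field_simps)
  finally show ?thesis unfolding val Re_cis_expectation[OF h] Re_cis_expectation[OF k] .
qed

lemma trig_mixing:
  assumes "trig_over tests L" "trig_over tests L'"
  shows "(\<lambda>n. \<integral>\<omega>. trig L \<omega> * trig (trig_shift (real n) L') \<omega> \<partial>M) \<longlonglongrightarrow> (\<integral>\<omega>. trig L \<omega> \<partial>M) * (\<integral>\<omega>. trig L' \<omega> \<partial>M)"
  using assms(1)
proof (induction L)
  case Nil
  show ?case by simp
next
  case (Cons x L)
  obtain c h where x: "x = (c, h)" by (cases x)
  have h: "test_fun h" and L: "trig_over tests L" using Cons.prems by (auto simp: x)
  let ?g = "\<lambda>\<omega>. Re (c * cis (W h \<omega>))"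
  have gi: "integrable M ?g" using expectation_Re_cis(2)[of "\<lambda>_. 1" h c] h by simp
  have ii: "integrable M (\<lambda>\<omega>. Re (a * cis (W l \<omega>)) * trig K \<omega>)" if "test_fun l" "trig_over tests K" for a l K
    using that(2)
  proof (induction K)
    case (Cons y K)
    obtain d k where y: "y = (d, k)" by (cases y)
    have "integrable M (\<lambda>\<omega>. Re (a * cis (W l \<omega>)) * Re (d * cis (W k \<omega>)))"
      by (rule expectation_Re_cis(2)) (use expectation_Re_cis(2)[of "\<lambda>_. 1" l a] that(1) Cons.prems y in auto)
    then show ?case using Cons by (simp add: y distrib_left del: times_complex.sel)
  qed simp
  have head: "(\<lambda>n. \<integral>\<omega>. ?g \<omega> * trig (trig_shift (real n) K) \<omega> \<partial>M) \<longlonglongrightarrow> (\<integral>\<omega>. ?g \<omega> \<partial>M) * (\<integral>\<omega>. trig K \<omega> \<partial>M)"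
    if "trig_over tests K" for K
    using that
  proof (induction K)
    case Nil
    show ?case by simp
  next
    case (Cons y K)
    obtain d k where y: "y = (d, k)" by (cases y)
    have k: "test_fun k" and K: "trig_over tests K" using Cons.prems by (auto simp: y)
    have ki: "integrable M (\<lambda>\<omega>. Re (d * cis (W k \<omega>)))" using expectation_Re_cis(2)[of "\<lambda>_. 1" k d] k by simp
    have kn: "integrable M (\<lambda>\<omega>. ?g \<omega> * Re (d * cis (W (space_shift (real n) k) \<omega>)))" for n
      by (rule expectation_Re_cis(2)[OF gi test_fun_shift[OF k]])
    have "(\<integral>\<omega>. ?g \<omega> * trig (trig_shift (real n) (y # K)) \<omega> \<partial>M)
       = (\<integral>\<omega>. ?g \<omega> * Re (d * cis (W (space_shift (real n) k) \<omega>)) \<partial>M) + (\<integral>\<omega>. ?g \<omega> * trig (trig_shift (real n) K) \<omega> \<partial>M)" for n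
      unfolding y trig_shift_simps trig_simps distrib_left
      by (rule Bochner_Integration.integral_add[OF kn ii[OF h trig_over_test_fun_shift[OF K]]])
    moreover have "(\<integral>\<omega>. trig (y # K) \<omega> \<partial>M) = (\<integral>\<omega>. Re (d * cis (W k \<omega>)) \<partial>M) + (\<integral>\<omega>. trig K \<omega> \<partial>M)"
      unfolding y trig_simps by (rule Bochner_Integration.integral_add[OF ki trig_integrable[OF K]])
    ultimately show ?case
      using tendsto_add[OF trig_mixing_one[OF h k, of c d] Cons.IH[OF K]] by (simp only: distrib_left)
  qed
  have "(\<integral>\<omega>. trig (x # L) \<omega> * trig (trig_shift (real n) L') \<omega> \<partial>M)
     = (\<integral>\<omega>. ?g \<omega> * trig (trig_shift (real n) L') \<omega> \<partial>M) + (\<integral>\<omega>. trig L \<omega> * trig (trig_shift (real n) L') \<omega> \<partial>M)" for n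
    unfolding x trig_simps distrib_right
    by (rule Bochner_Integration.integral_add[OF ii[OF h trig_over_test_fun_shift[OF assms(2)]]
          integrable_mult_square[OF trig_measurable[OF L] trig_measurable[OF trig_over_test_fun_shift[OF assms(2)]]
            trig_square_integrable[OF L] trig_square_integrable[OF trig_over_test_fun_shift[OF assms(2)]]]])
  moreover have "(\<integral>\<omega>. trig (x # L) \<omega> \<partial>M) = (\<integral>\<omega>. ?g \<omega> \<partial>M) + (\<integral>\<omega>. trig L \<omega> \<partial>M)"
    unfolding x trig_simps by (rule Bochner_Integration.integral_add[OF gi trig_integrable[OF L]])
  ultimately show ?case
    using tendsto_add[OF head[OF assms(2)] Cons.IH[OF L]] by (simp only: distrib_right)
qed

text \<open>The approximating lists of \<open>F\<close> are compared with \<open>L\<close> before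
  and after the shift, which is an isometry between them. The factor 4 comes from two uses of
  \<open>l2_triangle\<close>; the bound is uniform in \<open>a\<close>.\<close>

lemma approx_distance:
  assumes A: "approx tests a F F'" and L: "trig_over tests L"
  shows "l2 M (\<lambda>\<omega>. trig (trig_shift a L) \<omega> - F' \<omega>) \<le> 4 * l2 M (\<lambda>\<omega>. trig L \<omega> - F \<omega>)"
proof -
  obtain K where K: "\<And>n. trig_over tests (K n)" "(\<lambda>n. l2 M (\<lambda>\<omega>. trig (K n) \<omega> - F \<omega>)) \<longlonglongrightarrow> 0"
    "(\<lambda>n. l2 M (\<lambda>\<omega>. trig (trig_shift a (K n)) \<omega> - F' \<omega>)) \<longlonglongrightarrow> 0"
    by (rule approx_seq[OF A]) (rule that)
  have [measurable]: "F \<in> borel_measurable M" "F' \<in> borel_measurable M" using A by (auto simp: approx_def)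
  have [measurable]: "trig L \<in> borel_measurable M" "trig (trig_shift a L) \<in> borel_measurable M"
    "trig (K n) \<in> borel_measurable M" "trig (trig_shift a (K n)) \<in> borel_measurable M" for n
    using L K(1) trig_over_test_fun_shift trig_measurable by blast+
  have iso: "l2 M (\<lambda>\<omega>. trig (trig_shift a L) \<omega> - trig (trig_shift a (K n)) \<omega>) = l2 M (\<lambda>\<omega>. trig L \<omega> - trig (K n) \<omega>)" for n
  proof -
    let ?D = "L @ trig_scale (-1) (K n)"
    have D: "trig_over tests ?D" using L K(1) by simp
    have "l2 M (trig (trig_shift a ?D)) = l2 M (trig ?D)"
      unfolding l2_eq_integral[OF trig_square_integrable[OF D]] l2_eq_integral[OF trig_square_integrable[OF trig_over_test_fun_shift[OF D]]]
        trig_square_shift[OF D] ..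
    then show ?thesis by (simp add: l2_def trig_shift_scale)
  qed
  have b: "l2 M (\<lambda>\<omega>. trig (trig_shift a L) \<omega> - F' \<omega>) \<le> 4 * l2 M (\<lambda>\<omega>. trig L \<omega> - F \<omega>) +
      (4 * l2 M (\<lambda>\<omega>. trig (K n) \<omega> - F \<omega>) + 2 * l2 M (\<lambda>\<omega>. trig (trig_shift a (K n)) \<omega> - F' \<omega>))" for n
  proof -
    have "l2 M (\<lambda>\<omega>. trig (trig_shift a L) \<omega> - F' \<omega>) \<le> 2 * l2 M (\<lambda>\<omega>. trig L \<omega> - trig (K n) \<omega>) + 2 * l2 M (\<lambda>\<omega>. trig (trig_shift a (K n)) \<omega> - F' \<omega>)"
      unfolding iso[symmetric] by (rule l2_triangle) measurable
    also have "\<dots> \<le> 2 * (2 * l2 M (\<lambda>\<omega>. trig L \<omega> - F \<omega>) + 2 * l2 M (\<lambda>\<omega>. F \<omega> - trig (K n) \<omega>)) + 2 * l2 M (\<lambda>\<omega>. trig (trig_shift a (K n)) \<omega> - F' \<omega>)"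
      by (intro add_mono mult_left_mono l2_triangle order_refl) measurable
    also have "\<dots> = 4 * l2 M (\<lambda>\<omega>. trig L \<omega> - F \<omega>) +
      (4 * l2 M (\<lambda>\<omega>. trig (K n) \<omega> - F \<omega>) + 2 * l2 M (\<lambda>\<omega>. trig (trig_shift a (K n)) \<omega> - F' \<omega>))"
      unfolding l2_minus_commute[of M F] by (simp add: distrib_left mult.assoc[symmetric] add.assoc)
    finally show ?thesis .
  qed
  have "(\<lambda>n. 4 * l2 M (\<lambda>\<omega>. trig (K n) \<omega> - F \<omega>) + 2 * l2 M (\<lambda>\<omega>. trig (trig_shift a (K n)) \<omega> - F' \<omega>)) \<longlonglongrightarrow> 0"
    using K(2,3) by (intro ennreal_tendsto_0_add ennreal_tendsto_0_cmult) auto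
  from tendsto_add[OF tendsto_const this] have "(\<lambda>n. 4 * l2 M (\<lambda>\<omega>. trig L \<omega> - F \<omega>) +
      (4 * l2 M (\<lambda>\<omega>. trig (K n) \<omega> - F \<omega>) + 2 * l2 M (\<lambda>\<omega>. trig (trig_shift a (K n)) \<omega> - F' \<omega>))) \<longlonglongrightarrow> 4 * l2 M (\<lambda>\<omega>. trig L \<omega> - F \<omega>)" by simp
  then show ?thesis using b by (intro LIMSEQ_le_const) auto
qed

text \<open>Shifting decorrelates the trigonometric polynomials that approximate the functional.\<close>

lemma invariant_functional_variance:
  assumes A: "\<And>n::nat. approx tests (real n) F F" and F2: "integrable M (\<lambda>\<omega>. (F \<omega>)\<^sup>2)"
  shows "variance F = 0"
proof -
  have [measurable]: "F \<in> borel_measurable M" using A[of 0] by (auto simp: approx_def)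
  have iF: "integrable M F" by (rule integrable_of_square[OF _ F2]) measurable
  obtain L where L: "\<And>n. trig_over tests (L n)" "(\<lambda>n. l2 M (\<lambda>\<omega>. trig (L n) \<omega> - F \<omega>)) \<longlonglongrightarrow> 0"
    by (rule approx_seq[OF A[of 0]]) (rule that)
  have tm [measurable]: "trig (L n) \<in> borel_measurable M" for n by (rule trig_measurable[OF L(1)])
  have D2: "integrable M (\<lambda>\<omega>. (trig (L n) \<omega> - F \<omega>)\<^sup>2)" for n
    using trig_square_integrable[OF L(1)[of n]] F2 integrable_mult_square[OF _ _ trig_square_integrable[OF L(1)[of n]] F2]
    by (simp add: power2_diff mult.assoc)
  define e where "e n = (\<integral>\<omega>. (trig (L n) \<omega> - F \<omega>)\<^sup>2 \<partial>M)" for n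
  have e0: "0 \<le> e n" for n unfolding e_def by simp
  have le: "l2 M (\<lambda>\<omega>. trig (L n) \<omega> - F \<omega>) = ennreal (e n)" for n unfolding e_def by (rule l2_eq_integral[OF D2])
  have "(\<lambda>n. ennreal (e n)) \<longlonglongrightarrow> ennreal 0" using L(2) unfolding le by simp
  then have elim: "e \<longlonglongrightarrow> 0" by (subst (asm) tendsto_ennreal_iff) (auto simp: e0)
  \<comment> \<open>The factor 5 is half of \<open>2 + 2 * 4\<close>: a triangle inequality through
    \<open>F\<close>, whose second distance is bounded by \<open>approx_distance\<close>.\<close>
  have tv: "variance (trig (L m)) \<le> 5 * e m" for m
  proof -
    let ?P = "trig (L m)" and ?Pn = "\<lambda>n. trig (trig_shift (real n) (L m))"
    have [measurable]: "?Pn n \<in> borel_measurable M" for n by (rule trig_measurable[OF trig_over_test_fun_shift[OF L(1)]])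
    \<comment> \<open>The shift preserves second moments, so the left side is the squared distance
      between the polynomial and its shift; by mixing it tends to twice the variance of the
      polynomial.\<close>
    have dist: "2 * (\<integral>\<omega>. (?P \<omega>)\<^sup>2 \<partial>M) - 2 * (\<integral>\<omega>. ?P \<omega> * ?Pn n \<omega> \<partial>M) \<le> 10 * e m" for n
    proof -
      note sq = trig_square_integrable[OF L(1)[of m]] trig_square_integrable[OF trig_over_test_fun_shift[OF L(1)[of m], of "real n"]]
      have pi: "integrable M (\<lambda>\<omega>. ?P \<omega> * ?Pn n \<omega>)" by (rule integrable_mult_square[OF _ _ sq]) measurable
      have ex: "(?P \<omega> - ?Pn n \<omega>)\<^sup>2 = (?P \<omega>)\<^sup>2 + (?Pn n \<omega>)\<^sup>2 - 2 * (?P \<omega> * ?Pn n \<omega>)" for \<omega>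
        by (simp add: power2_diff)
      have i: "integrable M (\<lambda>\<omega>. (?P \<omega> - ?Pn n \<omega>)\<^sup>2)" unfolding ex using sq pi by auto
      have val: "(\<integral>\<omega>. (?P \<omega> - ?Pn n \<omega>)\<^sup>2 \<partial>M) = 2 * (\<integral>\<omega>. (?P \<omega>)\<^sup>2 \<partial>M) - 2 * (\<integral>\<omega>. ?P \<omega> * ?Pn n \<omega> \<partial>M)"
        unfolding ex using sq pi trig_square_shift[OF L(1)[of m], of "real n"]
        by (simp add: Bochner_Integration.integral_add Bochner_Integration.integral_diff)
      have "l2 M (\<lambda>\<omega>. ?P \<omega> - ?Pn n \<omega>) \<le> 2 * l2 M (\<lambda>\<omega>. ?P \<omega> - F \<omega>) + 2 * l2 M (\<lambda>\<omega>. F \<omega> - ?Pn n \<omega>)"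
        by (rule l2_triangle) measurable
      also have "\<dots> \<le> 2 * l2 M (\<lambda>\<omega>. ?P \<omega> - F \<omega>) + 2 * (4 * l2 M (\<lambda>\<omega>. ?P \<omega> - F \<omega>))"
        unfolding l2_minus_commute[of M F] by (intro add_mono mult_left_mono approx_distance[OF A L(1)] order_refl) simp
      also have "\<dots> = ennreal (10 * e m)"
        unfolding le using e0 by (simp add: ennreal_mult' mult.assoc[symmetric] distrib_right[symmetric])
      finally show ?thesis unfolding l2_eq_integral[OF i] val[symmetric] using e0[of m] by simp
    qed
    have "(\<lambda>n. 2 * (\<integral>\<omega>. (?P \<omega>)\<^sup>2 \<partial>M) - 2 * (\<integral>\<omega>. ?P \<omega> * ?Pn n \<omega> \<partial>M)) \<longlonglongrightarrow> 2 * (\<integral>\<omega>. (?P \<omega>)\<^sup>2 \<partial>M) - 2 * ((\<integral>\<omega>. ?P \<omega> \<partial>M) * (\<integral>\<omega>. ?P \<omega> \<partial>M))"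
      by (intro tendsto_intros trig_mixing L(1))
    then have "2 * (\<integral>\<omega>. (?P \<omega>)\<^sup>2 \<partial>M) - 2 * ((\<integral>\<omega>. ?P \<omega> \<partial>M) * (\<integral>\<omega>. ?P \<omega> \<partial>M)) \<le> 10 * e m"
      using dist by (intro LIMSEQ_le_const2) auto
    then show ?thesis
      unfolding variance_eq[OF trig_integrable[OF L(1)] trig_square_integrable[OF L(1)]] by (simp add: power2_eq_square)
  qed
  have fv: "variance F \<le> 12 * e m" for m
  proof -
    let ?P = "trig (L m)" and ?c = "expectation (trig (L m))"
    have iP: "integrable M ?P" by (rule trig_integrable[OF L(1)])
    have Fc: "integrable M (\<lambda>\<omega>. (F \<omega> - ?c)\<^sup>2)" using F2 iF by (simp add: power2_diff)
    have Pc: "integrable M (\<lambda>\<omega>. (?P \<omega> - ?c)\<^sup>2)" using trig_square_integrable[OF L(1)[of m]] iP by (simp add: power2_diff)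
    \<comment> \<open>The mean minimizes the expected squared deviation, so the mean of the
      polynomial may replace that of \<open>F\<close>.\<close>
    have "variance F \<le> (\<integral>\<omega>. (F \<omega> - ?c)\<^sup>2 \<partial>M)"
    proof -
      have "(\<integral>\<omega>. (F \<omega> - ?c)\<^sup>2 \<partial>M) = (\<integral>\<omega>. (F \<omega>)\<^sup>2 \<partial>M) + ?c\<^sup>2 - 2 * expectation F * ?c"
        using F2 iF by (simp add: power2_diff prob_space)
      moreover have "0 \<le> (expectation F - ?c)\<^sup>2" by simp
      ultimately show ?thesis unfolding variance_eq[OF iF F2] by (simp add: power2_diff)
    qed
    also have "\<dots> \<le> (\<integral>\<omega>. 2 * (?P \<omega> - F \<omega>)\<^sup>2 + 2 * (?P \<omega> - ?c)\<^sup>2 \<partial>M)"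
    proof (rule integral_mono[OF Fc])
      show "integrable M (\<lambda>\<omega>. 2 * (?P \<omega> - F \<omega>)\<^sup>2 + 2 * (?P \<omega> - ?c)\<^sup>2)" using D2 Pc by simp
      show "(F \<omega> - ?c)\<^sup>2 \<le> 2 * (?P \<omega> - F \<omega>)\<^sup>2 + 2 * (?P \<omega> - ?c)\<^sup>2" for \<omega>
      proof -
        have "0 \<le> ((?P \<omega> - F \<omega>) + (?P \<omega> - ?c))\<^sup>2" by simp
        moreover have "2 * (?P \<omega> - F \<omega>)\<^sup>2 + 2 * (?P \<omega> - ?c)\<^sup>2 - (F \<omega> - ?c)\<^sup>2 = ((?P \<omega> - F \<omega>) + (?P \<omega> - ?c))\<^sup>2"
          by (simp add: power2_eq_square algebra_simps)
        ultimately show ?thesis by linarith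
      qed
    qed
    also have "\<dots> = 2 * e m + 2 * variance ?P" unfolding e_def using D2 Pc by simp
    \<comment> \<open>\<open>12 = 2 + 2 * 5\<close>, with the 5 from \<open>tv\<close>.\<close>
    also have "\<dots> \<le> 12 * e m" using tv[of m] by simp
    finally show ?thesis .
  qed
  have "(\<lambda>m. 12 * e m) \<longlonglongrightarrow> 0" using elim by (rule tendsto_mult_right_zero)
  from LIMSEQ_le_const[OF this] fv have "variance F \<le> 0" by blast
  then show ?thesis using variance_positive[of F] by simp
qed

theorem solution_ergodic:
  assumes sol: "hyperbolic_anderson_solution M H W u" and t: "0 \<le> t"
  shows "ergodic_process M (u t)"
  unfolding ergodic_process_def
proof (intro ballI impI)
  fix A assume A: "A \<in> sets (Pi\<^sub>M UNIV (\<lambda>_. borel :: real measure))"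
    and inv: "\<forall>h. AE w in path_law M (u t). ((\<lambda>x. w (x + h)) \<in> A) = (w \<in> A)"
  have fm: "(\<lambda>\<omega> x. u t (x + a) \<omega>) \<in> measurable M (Pi\<^sub>M UNIV (\<lambda>_. borel))" for a
    using solution_measurable_PiM[OF sol t, where I = UNIV and a = a] by (simp add: restrict_UNIV)
  have f0: "(\<lambda>\<omega> x. u t x \<omega>) \<in> measurable M (Pi\<^sub>M UNIV (\<lambda>_. borel))" using fm[of 0] by simp
  define F where "F \<omega> = (indicator A (\<lambda>x. u t x \<omega>) :: real)" for \<omega>
  have ap: "approx tests a F (\<lambda>\<omega>. indicator A (\<lambda>x. u t (x + a) \<omega>))" for a
    using solution_event_approx[OF sol t A, where a = a] unfolding F_def by (simp add: restrict_UNIV)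
  have Fm: "F \<in> borel_measurable M" using ap[of 0] by (simp add: approx_def)
  \<comment> \<open>Invariance up to null sets, for this particular shift, identifies the shifted
    functional with \<open>F\<close> itself.\<close>
  have "approx tests a F F" for a
  proof (rule approx_cong_AE[OF ap[of a] Fm Fm])
    have "AE \<omega> in M. ((\<lambda>x. u t (x + a) \<omega>) \<in> A) = ((\<lambda>x. u t x \<omega>) \<in> A)"
      using AE_distrD[OF f0 inv[rule_format, of a, unfolded path_law_def]] .
    then show "AE \<omega> in M. indicator A (\<lambda>x. u t (x + a) \<omega>) = F \<omega>"
      by eventually_elim (simp add: F_def indicator_def)
  qed simp
  \<comment> \<open>An indicator equals its square, so the variance is \<open>p - p^2\<close> with
    \<open>p\<close> the probability of the event.\<close>
  moreover have Fsq: "(F \<omega>)\<^sup>2 = F \<omega>" for \<omega> by (simp add: F_def indicator_def)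
  have iF: "integrable M F"
    by (rule integrable_const_bound[of _ 1]) (use Fm in \<open>auto simp: F_def\<close>)
  ultimately have "variance F = 0" by (intro invariant_functional_variance) (auto simp: Fsq)
  then have "expectation F - (expectation F)\<^sup>2 = 0"
    using variance_eq[OF iF] iF by (simp add: Fsq)
  moreover have "expectation F = measure (path_law M (u t)) A"
  proof -
    have "expectation F = (\<integral>\<omega>. indicator ((\<lambda>\<omega> x. u t x \<omega>) -` A \<inter> space M) \<omega> \<partial>M)"
      unfolding F_def by (intro Bochner_Integration.integral_cong) (auto simp: indicator_def)
    also have "\<dots> = measure M ((\<lambda>\<omega> x. u t x \<omega>) -` A \<inter> space M)" using measurable_sets[OF f0 A] by simp
    finally show ?thesis unfolding path_law_def using measure_distr[OF f0 A] by simp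
  qed
  ultimately have "measure (path_law M (u t)) A * (1 - measure (path_law M (u t)) A) = 0"
    by (simp add: power2_eq_square right_diff_distrib)
  then show "measure (path_law M (u t)) A = 0 \<or> measure (path_law M (u t)) A = 1" by simp
qed

end

theorem theorem1p1:
  fixes M :: "'w measure" and H :: real
    and W :: "(real \<times> real \<Rightarrow> real) \<Rightarrow> 'w \<Rightarrow> real"
    and u :: "real \<Rightarrow> real \<Rightarrow> 'w \<Rightarrow> real"
  assumes "1 / 4 < H" and "H < 1 / 2"
    and "fractional_noise M H W"
    and "hyperbolic_anderson_solution M H W u"
  shows "\<forall>t>0. strictly_stationary M (u t) \<and> ergodic_process M (u t)"
proof -
  interpret noise H M W
    using assms by unfold_locales auto
  show ?thesis
    using solution_stationary[OF assms(4)] solution_ergodic[OF assms(4)] by simp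
qed

end
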